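(* To every monic hyperbolic polynomial $p$ of degree $d\ge2$ with connected Julia set and only simple critical points one can assign $\epsilon(p)>0$ such that the following holds. Let $f(x,y)=(p_f(x)-a_fy,x)$ and $g(x,y)=(p_g(x)-a_gy,x)$ be two Hénon maps, where $p_f,p_g$ are such polynomials of degree $d$ and $0<|a_f|<\epsilon(p_f)$, $0<|a_g|<\epsilon(p_g)$. Let $h\colon U_f^+\cup U_f^-\to U_g^+\cup U_g^-$ be a conjugacy between $f$ and $g$ (a homeomorphism with $h\circ f=g\circ h$) which maps the leaves of $\mathcal F_f^+$ and $\mathcal F_f^-$ to the leaves of $\mathcal F_g^+$ and $\mathcal F_g^-$ respectively. Assume that coordinates are chosen so that $h$ maps $H_f$ to $H_g$ for a pair of primary horizontal components $H_f$ and $H_g$ of the critical loci of $f$ and $g$. Finally, assume that $h\colon H_f\to H_g$ is orientation reversing and that $h$ maps small neighborhoods of the puncture of $H_f$ at infinity to neighborhoods of the puncture of $H_g$ at infinity. Then, with $\mathfrak c(x,y)=(\overline x,\overline y)$, the map $\mathfrak c\circ h\colon U_f^+\cap U_f^-\to \mathfrak c(U_g^+\cap U_g^-)$ is a biholomorphism. Also, there are constants $\beta,\gamma\in\mathbb C^*$ such that $\overline{\psi_{g+}\circ h}=\frac1\beta\psi_{f+}$ and $\overline{\psi_{g-}\circ h}=\frac1\gamma\psi_{f-}$ on a neighborhood of infinity in $H_f$, and $\beta^{d-1}$ and $\gamma^{d-1}$ must lie in $\mathscr S=\{\omega\in\mathbb C:\ \omega^{d^n}=1\text{ for some }n\ge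0\}$.
   Context: "Coordinates are chosen so that $h$ maps $H_f$ to $H_g$" means that $h$ has, if necessary, been replaced by $g^{k}\circ h\circ f^{\ell}$ for suitable integers $k,\ell$. The following is for $f=f_a$, $f_a(x,y)=(p(x)-ay,x)$, and applies also to $g$ (objects for $f$, $g$ carry that subscript). $\mathbb D_\rho=\{|z|<\rho\}$. Let $p(x)=x^d+q(x)$, $\deg q<d$. Fix $R>0$, $0<r<1$ and $\alpha>0$ such that $|q(y)/y^d|+(R+1)/|y|^{d-1}<r$ and $|p(y)|>(2R+1)|y|$ whenever $|y|\ge\alpha$. Put $V_+=\{|x|>|y|,\ |x|>\alpha\}$, $V_-=\{|y|>|x|,\ |y|>\alpha\}$. Let $0<|a|<R$; then $f(V_+)\subset V_+$ and $f^{-1}(V_-)\subset V_-$. Write $(x_n,y_n)=f^{n}(x,y)$. (The thresholds $\epsilon(p)$ are at most $R$.) With principal logarithms, $\varphi_{+}(x,y)=x\exp\big(\sum_{k\ge1}d^{-k}\log(x_k/x_{k-1}^d)\big)$ on $V_+$, and $\varphi_{-}(x,y)=y\exp\big(\sum_{k\ge1}d^{-k}\log(a\,y_{-k}/y_{-(k-1)}^d)\big)$ on $V_-$; they are holomorphic, $\varphi_{+}\circ f=\varphi_{+}^d$ and $a\,\varphi_{-}\circ f^{-1}=\varphi_{-}^d$. $K^{\pm}$ is the set of points with bounded forward ($+$), resp. backward ($-$), orbit, and $U^\pm=\mathbb C^2\setminus K^\pm$. By the functional equations $\varphi_{\pm}$ extend to $U^\pm$ up to multiplication by $d^n$-th roots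 of unity. $\mathcal F^\pm$ is the holomorphic foliation of $U^\pm$ whose leaves are locally the level sets of $\varphi_{\pm}$. The critical locus $\mathscr C\subset U^+\cap U^-$ is the zero variety of $w$, where $d\log\varphi_{+}\wedge d\log\varphi_{-}=w\,dx\wedge dy$ (the tangency locus of $\mathcal F^\pm$). With $u=1/x$, $\varphi_{+}^{-1}$ and $\varphi_{-}^{-d}$ extend holomorphically across $\{u=0\}$, with $d\varphi_{+}^{-1}\wedge d\varphi_{-}^{-d}=u^2\,\tilde w\,du\wedge dy$, and $\mathscr C$ is extended across $u=0$ as the zero variety of $\tilde w$; the extension is smooth at $(x,y)=(\infty,c)$ for each simple critical point $c$ of $p$. The primary horizontal component corresponding to $c$ is the component of $\mathscr C$ asymptotic to $y=c$ as $|x|\to\infty$, i.e. whose extension contains $(\infty,c)$; for $a$ small it is a punctured disk with puncture "at infinity" $(\infty,c)$. $\psi_+=\varphi_{+}$ and $\psi_-=\eta\,\varphi_{-}\circ f^{-1}$ on $f(V_-)$, where $\eta$ is a fixed number with $\eta^{d-1}=1/a$; thus $\psi_+\circ f=\psi_+^d$, $\psi_-\circ f^{-1}=\psi_-^d$. Both are defined and holomorphic on a neighborhood of infinity in each primary horizontal component. *)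

theory Defs
  imports "HOL-Complex_Analysis.Complex_Analysis" "HOL-Computational_Algebra.Computational_Algebra"
begin

definition filled_julia :: "complex poly \<Rightarrow> complex set" where
  "filled_julia p = {z. bounded (range (\<lambda>n. (poly p ^^ n) z))}"

definition julia :: "complex poly \<Rightarrow> complex set" where
  "julia p = frontier (filled_julia p)"

text \<open>Hyperbolicity is uniform expansion on the Julia set.\<close>
definition hyperbolic_poly :: "complex poly \<Rightarrow> bool" where
  "hyperbolic_poly p \<longleftrightarrow>
     (\<exists>C>0. \<exists>l>1. \<forall>n. \<forall>z\<in>julia p. cmod (deriv (poly p ^^ n) z) \<ge> C * l ^ n)"

definition simple_critical_points :: "complex poly \<Rightarrow> bool" where
  "simple_critical_points p \<longleftrightarrow> (\<forall>c. poly (pderiv p) c = 0 \<longrightarrow> order c (pderiv p) = 1)"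

definition admissible_poly :: "complex poly \<Rightarrow> bool" where
  "admissible_poly p \<longleftrightarrow> degree p \<ge> 2 \<and> lead_coeff p = 1 \<and> hyperbolic_poly p \<and>
     connected (julia p) \<and> simple_critical_points p"

text \<open>Here \<open>q = p - monom 1 d\<close> is the non-leading part of the monic polynomial \<open>p\<close>.\<close>
definition escape_constants :: "complex poly \<Rightarrow> real \<Rightarrow> real \<Rightarrow> real \<Rightarrow> bool" where
  "escape_constants p R r \<alpha> \<longleftrightarrow> 0 < R \<and> 0 < r \<and> r < 1 \<and> 0 < \<alpha> \<and>
     (\<forall>y. cmod y \<ge> \<alpha> \<longrightarrow>
        cmod (poly (p - monom 1 (degree p)) y / y ^ degree p) + (R + 1) / cmod y ^ (degree p - 1) < r \<and>
        cmod (poly p y) > (2 * R + 1) * cmod y)"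

text \<open>Real differentiability with complex linear derivative; used on open sets only.\<close>
definition holomorphic2_on :: "(complex \<times> complex \<Rightarrow> complex) \<Rightarrow> (complex \<times> complex) set \<Rightarrow> bool" where
  "holomorphic2_on \<phi> S \<longleftrightarrow>
     (\<forall>z\<in>S. \<exists>A B. (\<phi> has_derivative (\<lambda>v. A * fst v + B * snd v)) (at z))"

definition biholomorphism ::
    "(complex \<times> complex \<Rightarrow> complex \<times> complex) \<Rightarrow> (complex \<times> complex) set \<Rightarrow> (complex \<times> complex) set \<Rightarrow> bool" where
  "biholomorphism F S T \<longleftrightarrow> open S \<and> open T \<and> bij_betw F S T \<and>
     holomorphic2_on (fst \<circ> F) S \<and> holomorphic2_on (snd \<circ> F) S \<and>
     holomorphic2_on (fst \<circ> inv_into S F) T \<and> holomorphic2_on (snd \<circ> inv_into S F) T"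

text \<open>The coefficient of \<open>d\<phi> \<and> d\<psi>\<close> with respect to the product of the two coordinate differentials.\<close>
definition wedge_coeff ::
    "(complex \<times> complex \<Rightarrow> complex) \<Rightarrow> (complex \<times> complex \<Rightarrow> complex) \<Rightarrow> complex \<times> complex \<Rightarrow> complex" where
  "wedge_coeff \<phi> \<psi> z =
     deriv (\<lambda>s. \<phi> (s, snd z)) (fst z) * deriv (\<lambda>t. \<psi> (fst z, t)) (snd z) -
     deriv (\<lambda>t. \<phi> (fst z, t)) (snd z) * deriv (\<lambda>s. \<psi> (s, snd z)) (fst z)"

definition conj2 :: "complex \<times> complex \<Rightarrow> complex \<times> complex" where
  "conj2 z = (cnj (fst z), cnj (snd z))"

definition henon :: "complex poly \<Rightarrow> complex \<Rightarrow> complex \<times> complex \<Rightarrow> complex \<times> complex" where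
  "henon p a z = (poly p (fst z) - a * snd z, fst z)"

definition henon_inv :: "complex poly \<Rightarrow> complex \<Rightarrow> complex \<times> complex \<Rightarrow> complex \<times> complex" where
  "henon_inv p a z = (snd z, (poly p (snd z) - fst z) / a)"

lemma henon_henon_inv: "a \<noteq> 0 \<Longrightarrow> henon p a (henon_inv p a z) = z"
  by (simp add: henon_def henon_inv_def)

lemma henon_inv_henon: "a \<noteq> 0 \<Longrightarrow> henon_inv p a (henon p a z) = z"
  by (simp add: henon_def henon_inv_def)

definition U_plus :: "complex poly \<Rightarrow> complex \<Rightarrow> (complex \<times> complex) set" where
  "U_plus p a = - {z. bounded (range (\<lambda>n. (henon p a ^^ n) z))}"

definition U_minus :: "complex poly \<Rightarrow> complex \<Rightarrow> (complex \<times> complex) set" where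
  "U_minus p a = - {z. bounded (range (\<lambda>n. (henon_inv p a ^^ n) z))}"

definition V_plus :: "real \<Rightarrow> (complex \<times> complex) set" where
  "V_plus \<alpha> = {(x, y). cmod x > cmod y \<and> cmod x > \<alpha>}"

definition V_minus :: "real \<Rightarrow> (complex \<times> complex) set" where
  "V_minus \<alpha> = {(x, y). cmod y > cmod x \<and> cmod y > \<alpha>}"

text \<open>The next two functions are meaningful on \<open>V_plus \<alpha>\<close> and \<open>V_minus \<alpha>\<close> only; the summation
  index is shifted so that it starts at 0.\<close>
definition phi_plus :: "complex poly \<Rightarrow> complex \<Rightarrow> complex \<times> complex \<Rightarrow> complex" where
  "phi_plus p a z = fst z * exp (\<Sum>k.
     Ln (fst ((henon p a ^^ Suc k) z) / fst ((henon p a ^^ k) z) ^ degree p)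
       / of_nat (degree p) ^ Suc k)"

definition phi_minus :: "complex poly \<Rightarrow> complex \<Rightarrow> complex \<times> complex \<Rightarrow> complex" where
  "phi_minus p a z = snd z * exp (\<Sum>k.
     Ln (a * snd ((henon_inv p a ^^ Suc k) z) / snd ((henon_inv p a ^^ k) z) ^ degree p)
       / of_nat (degree p) ^ Suc k)"

text \<open>Local branches of the extensions of \<open>phi_plus\<close> and \<open>phi_minus\<close> to \<open>U_plus\<close> and \<open>U_minus\<close>.
  Iterating \<open>\<phi>\<^sub>+ \<circ> f = \<phi>\<^sub>+ ^ d\<close> and \<open>a \<cdot> \<phi>\<^sub>- \<circ> f\<^sup>-\<^sup>1 = \<phi>\<^sub>- ^ d\<close> gives
  \<open>\<phi>\<^sub>+ \<circ> f ^ n = \<phi>\<^sub>+ ^ (d ^ n)\<close> and \<open>a ^ (1 + d + \<dots> + d ^ (n-1)) \<cdot> \<phi>\<^sub>- \<circ> f\<^sup>-\<^sup>1 ^ n = \<phi>\<^sub>- ^ (d ^ n)\<close>.\<close>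
definition branch_plus ::
    "complex poly \<Rightarrow> complex \<Rightarrow> real \<Rightarrow> (complex \<times> complex \<Rightarrow> complex) \<Rightarrow> (complex \<times> complex) set \<Rightarrow> bool" where
  "branch_plus p a \<alpha> \<phi> N \<longleftrightarrow> open N \<and> holomorphic2_on \<phi> N \<and>
     (\<exists>n. \<forall>z\<in>N. (henon p a ^^ n) z \<in> V_plus \<alpha> \<and>
        \<phi> z ^ (degree p ^ n) = phi_plus p a ((henon p a ^^ n) z))"

definition branch_minus ::
    "complex poly \<Rightarrow> complex \<Rightarrow> real \<Rightarrow> (complex \<times> complex \<Rightarrow> complex) \<Rightarrow> (complex \<times> complex) set \<Rightarrow> bool" where
  "branch_minus p a \<alpha> \<phi> N \<longleftrightarrow> open N \<and> holomorphic2_on \<phi> N \<and>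
     (\<exists>n. \<forall>z\<in>N. (henon_inv p a ^^ n) z \<in> V_minus \<alpha> \<and>
        \<phi> z ^ (degree p ^ n) = a ^ (\<Sum>j<n. degree p ^ j) * phi_minus p a ((henon_inv p a ^^ n) z))"

text \<open>A plaque is a connected component of a level set of a local branch; a leaf is an equivalence
  class of points joined by finite chains of plaques.\<close>
definition same_plaque ::
    "((complex \<times> complex \<Rightarrow> complex) \<Rightarrow> (complex \<times> complex) set \<Rightarrow> bool) \<Rightarrow>
     complex \<times> complex \<Rightarrow> complex \<times> complex \<Rightarrow> bool" where
  "same_plaque branch z w \<longleftrightarrow>
     (\<exists>\<phi> N. branch \<phi> N \<and> connected_component {v \<in> N. \<phi> v = \<phi> z} z w)"

definition leaves_plus :: "complex poly \<Rightarrow> complex \<Rightarrow> real \<Rightarrow> (complex \<times> complex) set set" where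
  "leaves_plus p a \<alpha> = (\<lambda>z. {w. (same_plaque (branch_plus p a \<alpha>))\<^sup>*\<^sup>* z w}) ` U_plus p a"

definition leaves_minus :: "complex poly \<Rightarrow> complex \<Rightarrow> real \<Rightarrow> (complex \<times> complex) set set" where
  "leaves_minus p a \<alpha> = (\<lambda>z. {w. (same_plaque (branch_minus p a \<alpha>))\<^sup>*\<^sup>* z w}) ` U_minus p a"

text \<open>The quotient below is the coefficient \<open>w\<close> of \<open>d log \<phi> \<and> d log \<psi>\<close>. It does not depend on the
  branches, because two branches near \<open>z\<close> differ locally by a constant root of unity.\<close>
definition critical_locus :: "complex poly \<Rightarrow> complex \<Rightarrow> real \<Rightarrow> (complex \<times> complex) set" where
  "critical_locus p a \<alpha> = {z \<in> U_plus p a \<inter> U_minus p a.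
     \<exists>\<phi> \<psi> N. branch_plus p a \<alpha> \<phi> N \<and> branch_minus p a \<alpha> \<psi> N \<and> z \<in> N \<and>
       wedge_coeff \<phi> \<psi> z / (\<phi> z * \<psi> z) = 0}"

text \<open>The coefficient in \<open>d\<phi>\<^sub>+ ^ (-1) \<and> d\<phi>\<^sub>- ^ (-d) = u\<^sup>2 w du \<and> dy\<close>, in the coordinates \<open>(u, y)\<close>, \<open>u = 1/x\<close>, near \<open>u = 0\<close>. The second form is
  \<open>\<phi>\<^sub>- ^ (-d) = 1 / (a \<cdot> \<phi>\<^sub>- \<circ> f\<^sup>-\<^sup>1)\<close>, which is single valued on \<open>f (V_minus \<alpha>)\<close>.
  At \<open>u = 0\<close> the value is that of the continuous extension.\<close>
definition w_tilde :: "complex poly \<Rightarrow> complex \<Rightarrow> complex \<times> complex \<Rightarrow> complex" where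
  "w_tilde p a v =
     (let W = (\<lambda>v. wedge_coeff
                 (\<lambda>(u, y). 1 / phi_plus p a (1 / u, y))
                 (\<lambda>(u, y). 1 / (a * phi_minus p a (henon_inv p a (1 / u, y)))) v / fst v ^ 2)
      in if fst v \<noteq> 0 then W v else Lim (at v within {v. fst v \<noteq> 0}) W)"

text \<open>The trace on \<open>H\<close> of the neighbourhood filter of the point \<open>(\<infinity>, c)\<close>.\<close>
definition puncture_filter :: "(complex \<times> complex) set \<Rightarrow> complex \<Rightarrow> (complex \<times> complex) filter" where
  "puncture_filter H c = inf (at_infinity \<times>\<^sub>F nhds c) (principal H)"

definition puncture_nhd :: "(complex \<times> complex) set \<Rightarrow> complex \<Rightarrow> (complex \<times> complex) set \<Rightarrow> bool" where
  "puncture_nhd H c N \<longleftrightarrow> N \<subseteq> H \<and> eventually (\<lambda>z. z \<in> N) (puncture_filter H c)"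

text \<open>The extension of a component \<open>H\<close> consists of \<open>H\<close> and of the points \<open>(\<infinity>, y)\<close> with
  \<open>w_tilde p a (0, y) = 0\<close> to which \<open>H\<close> is adherent. As the extended locus is a smooth disk
  near \<open>(\<infinity>, c)\<close>, it is there the extension of a single component.\<close>
definition primary_component ::
    "complex poly \<Rightarrow> complex \<Rightarrow> real \<Rightarrow> complex \<Rightarrow> (complex \<times> complex) set \<Rightarrow> bool" where
  "primary_component p a \<alpha> c H \<longleftrightarrow> poly (pderiv p) c = 0 \<and> H \<in> components (critical_locus p a \<alpha>) \<and>
     w_tilde p a (0, c) = 0 \<and> puncture_filter H c \<noteq> bot"

definition psi_plus :: "complex poly \<Rightarrow> complex \<Rightarrow> complex \<times> complex \<Rightarrow> complex" where
  "psi_plus p a z = phi_plus p a z"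

definition psi_minus :: "complex poly \<Rightarrow> complex \<Rightarrow> complex \<Rightarrow> complex \<times> complex \<Rightarrow> complex" where
  "psi_minus p a \<eta> z = \<eta> * phi_minus p a (henon_inv p a z)"

text \<open>\<open>\<sigma>\<close> is the inverse of a holomorphic chart of the complex curve \<open>C\<close>.\<close>
definition curve_param ::
    "(complex \<times> complex) set \<Rightarrow> complex set \<Rightarrow> (complex \<Rightarrow> complex \<times> complex) \<Rightarrow> bool" where
  "curve_param C D \<sigma> \<longleftrightarrow> open D \<and> (fst \<circ> \<sigma>) holomorphic_on D \<and> (snd \<circ> \<sigma>) holomorphic_on D \<and>
     openin (top_of_set C) (\<sigma> ` D) \<and> (\<exists>\<kappa>. homeomorphism D (\<sigma> ` D) \<sigma> \<kappa>)"

text \<open>In holomorphic charts, the homeomorphism \<open>h\<close> has local degree \<open>-1\<close> everywhere.\<close>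
definition orientation_reversing ::
    "(complex \<times> complex \<Rightarrow> complex \<times> complex) \<Rightarrow> (complex \<times> complex) set \<Rightarrow> (complex \<times> complex) set \<Rightarrow> bool" where
  "orientation_reversing h C C' \<longleftrightarrow>
     (\<forall>D \<sigma> E \<tau> z s. curve_param C D \<sigma> \<and> curve_param C' E \<tau> \<and> h ` \<sigma> ` D \<subseteq> \<tau> ` E \<and> 0 < s \<and> cball z s \<subseteq> D \<longrightarrow>
        winding_number ((inv_into E \<tau> \<circ> h \<circ> \<sigma>) \<circ> circlepath z s) ((inv_into E \<tau> \<circ> h \<circ> \<sigma>) z) = -1)"

end

theory Submission
  imports Defs
begin

text \<open>The proof takes place near the punctures. There \<open>v = 1/\<psi>\<^sub>+\<close> is a coordinate on the critical
  component, and \<open>1/\<psi>\<^sub>-\<close> is the function \<open>m(v) = -(a/\<eta>) v exp(G(v))\<close> of \<open>v\<close>, where \<open>G\<close> is holomorphic,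
  \<open>G 0 = 0\<close>, and \<open>G\<close> does not vanish identically. Two points of the domain of \<open>\<psi>\<^sub>+\<close> lie on the same
  leaf if and only if the quotient of the values of \<open>\<psi>\<^sub>+\<close> is a \<open>d\<^sup>n\<close>-th root of unity. So \<open>h\<^sup>-\<^sup>1\<close>, written in either
  coordinate, commutes with \<open>v \<mapsto> v\<^sup>d\<close> and with the dense group of rotations by these
  roots, up to such roots, and therefore has the form \<open>r e\<^bsup>i\<theta>\<^esup> \<mapsto> k(r) e\<^bsup>\<plusminus>i\<theta>\<^esup>\<close>. Comparing the two
  coordinates through \<open>m\<close> forces \<open>v \<mapsto> C v\<close> or \<open>v \<mapsto> C \<cdot> cnj v\<close>, and orientation reversal
  leaves the second case.

  Every leaf passes through the ends, so \<open>\<psi>\<^sub>\<plusminus> \<circ> h\<close> equals a constant times the conjugate of \<open>\<psi>\<^sub>\<plusminus>\<close> locally. As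
  \<open>\<psi>\<^sub>+\<close> and \<open>\<psi>\<^sub>-\<close> are local coordinates off a set that is discrete in each leaf, \<open>cnj \<circ> h\<close> is holomorphic;
  the exceptional points are removable.\<close>

definition D1 :: "(complex \<times> complex \<Rightarrow> complex) \<Rightarrow> complex \<times> complex \<Rightarrow> complex" where
  "D1 \<phi> z = deriv (\<lambda>s. \<phi> (s, snd z)) (fst z)"

definition D2 :: "(complex \<times> complex \<Rightarrow> complex) \<Rightarrow> complex \<times> complex \<Rightarrow> complex" where
  "D2 \<phi> z = deriv (\<lambda>t. \<phi> (fst z, t)) (snd z)"

lemma has_derivative_slices:
  fixes \<phi> :: "complex \<times> complex \<Rightarrow> complex"
  assumes "(\<phi> has_derivative (\<lambda>v. A * fst v + B * snd v)) (at (x, y))"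
  shows "((\<lambda>s. \<phi> (s, y)) has_field_derivative A) (at x)"
    and "((\<lambda>t. \<phi> (x, t)) has_field_derivative B) (at y)"
proof -
  have "((\<phi> \<circ> (\<lambda>s. (s, y))) has_derivative (\<lambda>v. A * fst v + B * snd v) \<circ> (\<lambda>v. (v, 0))) (at x)"
    by (rule diff_chain_at) (use assms in \<open>auto intro!: derivative_eq_intros\<close>)
  then show "((\<lambda>s. \<phi> (s, y)) has_field_derivative A) (at x)" by (simp add: o_def has_field_derivative_def)
  have "((\<phi> \<circ> (\<lambda>t. (x, t))) has_derivative (\<lambda>v. A * fst v + B * snd v) \<circ> (\<lambda>v. (0, v))) (at y)"
    by (rule diff_chain_at) (use assms in \<open>auto intro!: derivative_eq_intros\<close>)
  then show "((\<lambda>t. \<phi> (x, t)) has_field_derivative B) (at y)" by (simp add: o_def has_field_derivative_def)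
qed

lemma holomorphic2_on_has_derivative:
  assumes "holomorphic2_on \<phi> S" "z \<in> S"
  shows "(\<phi> has_derivative (\<lambda>v. D1 \<phi> z * fst v + D2 \<phi> z * snd v)) (at z)"
proof -
  obtain A B where AB: "(\<phi> has_derivative (\<lambda>v. A * fst v + B * snd v)) (at z)" using assms unfolding holomorphic2_on_def by blast
  obtain x y where z: "z = (x, y)" by (cases z)
  have "D1 \<phi> z = A" "D2 \<phi> z = B" using has_derivative_slices[OF AB[unfolded z]] by (simp_all add: z D1_def D2_def DERIV_imp_deriv)
  with AB show ?thesis by simp
qed

lemma holomorphic2_on_slice1:
  assumes "holomorphic2_on \<phi> S" "(x, y) \<in> S"
  shows "((\<lambda>s. \<phi> (s, y)) has_field_derivative D1 \<phi> (x, y)) (at x)"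
  using has_derivative_slices(1)[OF holomorphic2_on_has_derivative[OF assms]] .

lemma holomorphic2_on_slice2:
  assumes "holomorphic2_on \<phi> S" "(x, y) \<in> S"
  shows "((\<lambda>t. \<phi> (x, t)) has_field_derivative D2 \<phi> (x, y)) (at y)"
  using has_derivative_slices(2)[OF holomorphic2_on_has_derivative[OF assms]] .

lemma holomorphic2_on_slice1_holomorphic:
  assumes "holomorphic2_on \<phi> S" "\<And>s. s \<in> A \<Longrightarrow> (s, y) \<in> S"
  shows "(\<lambda>s. \<phi> (s, y)) holomorphic_on A" unfolding holomorphic_on_def field_differentiable_def
  using holomorphic2_on_slice1[OF assms(1)] assms(2) has_field_derivative_at_within by blast

lemma holomorphic2_on_slice2_holomorphic:
  assumes "holomorphic2_on \<phi> S" "\<And>t. t \<in> A \<Longrightarrow> (x, t) \<in> S"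
  shows "(\<lambda>t. \<phi> (x, t)) holomorphic_on A" unfolding holomorphic_on_def field_differentiable_def
  using holomorphic2_on_slice2[OF assms(1)] assms(2) has_field_derivative_at_within by blast

lemma holomorphic2_on_imp_continuous_on:
  "holomorphic2_on \<phi> S \<Longrightarrow> continuous_on S \<phi>"
  by (meson continuous_at_imp_continuous_on has_derivative_continuous holomorphic2_on_has_derivative)

lemma holomorphic2_on_isCont: "holomorphic2_on \<phi> S \<Longrightarrow> z \<in> S \<Longrightarrow> isCont \<phi> z"
  using has_derivative_continuous holomorphic2_on_has_derivative by blast

lemma holomorphic2_on_subset: "holomorphic2_on \<phi> S \<Longrightarrow> T \<subseteq> S \<Longrightarrow> holomorphic2_on \<phi> T" unfolding holomorphic2_on_def by blast

lemma holomorphic2_on_cong: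
  assumes "open S" "\<And>z. z \<in> S \<Longrightarrow> \<phi> z = \<psi> z"
  shows "holomorphic2_on \<phi> S \<longleftrightarrow> holomorphic2_on \<psi> S"
proof -
  have "(\<phi> has_derivative D) (at z) \<longleftrightarrow> (\<psi> has_derivative D) (at z)" if "z \<in> S" for z D
    using has_derivative_transform_within_open[OF _ assms(1) that] assms(2) by metis
  then show ?thesis unfolding holomorphic2_on_def by blast
qed

lemma holomorphic2_on_const [intro, simp]: "holomorphic2_on (\<lambda>_. c) S" unfolding holomorphic2_on_def by (intro ballI exI[of _ 0]) (auto)

lemma holomorphic2_on_fst [intro, simp]: "holomorphic2_on fst S" unfolding holomorphic2_on_def
  by (intro ballI exI[of _ 1] exI[of _ 0]) (auto intro!: derivative_eq_intros)

lemma holomorphic2_on_snd [intro, simp]: "holomorphic2_on snd S" unfolding holomorphic2_on_def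
  by (intro ballI exI[of _ 0] exI[of _ 1]) (auto intro!: derivative_eq_intros)

lemma holomorphic2_on_add:
  assumes "holomorphic2_on f S" "holomorphic2_on g S"
  shows "holomorphic2_on (\<lambda>z. f z + g z) S" unfolding holomorphic2_on_def
proof
  fix z assume z: "z \<in> S"
  show "\<exists>A B. ((\<lambda>z. f z + g z) has_derivative (\<lambda>v. A * fst v + B * snd v)) (at z)"
    by (intro exI[of _ "D1 f z + D1 g z"] exI[of _ "D2 f z + D2 g z"]
        has_derivative_eq_rhs[OF has_derivative_add[OF assms[THEN holomorphic2_on_has_derivative, OF z]]])
      (auto simp: algebra_simps)
qed

lemma holomorphic2_on_mult:
  assumes "holomorphic2_on f S" "holomorphic2_on g S"
  shows "holomorphic2_on (\<lambda>z. f z * g z) S" unfolding holomorphic2_on_def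
proof
  fix z assume z: "z \<in> S"
  show "\<exists>A B. ((\<lambda>z. f z * g z) has_derivative (\<lambda>v. A * fst v + B * snd v)) (at z)"
    by (intro exI[of _ "f z * D1 g z + D1 f z * g z"] exI[of _ "f z * D2 g z + D2 f z * g z"]
        has_derivative_eq_rhs[OF has_derivative_mult[OF assms[THEN holomorphic2_on_has_derivative, OF z]]])
      (auto simp: algebra_simps)
qed

lemma holomorphic2_on_compose:
  assumes "holomorphic2_on \<phi> T" "holomorphic2_on f S" "holomorphic2_on g S"
    "\<And>z. z \<in> S \<Longrightarrow> (f z, g z) \<in> T"
  shows "holomorphic2_on (\<lambda>z. \<phi> (f z, g z)) S" unfolding holomorphic2_on_def
proof
  fix z assume z: "z \<in> S"
  let ?p = "(f z, g z)"
  have T: "?p \<in> T" using assms(4)[OF z] .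
  have "((\<phi> \<circ> (\<lambda>z. (f z, g z))) has_derivative (\<lambda>v. D1 \<phi> ?p * fst v + D2 \<phi> ?p * snd v) \<circ>
     (\<lambda>v. (D1 f z * fst v + D2 f z * snd v, D1 g z * fst v + D2 g z * snd v))) (at z)" by (rule diff_chain_at)
      (use assms(1-3) T z in \<open>auto intro!: has_derivative_Pair holomorphic2_on_has_derivative\<close>)
  then show "\<exists>A B. ((\<lambda>z. \<phi> (f z, g z)) has_derivative (\<lambda>v. A * fst v + B * snd v)) (at z)"
    by (intro exI[of _ "D1 \<phi> ?p * D1 f z + D2 \<phi> ?p * D1 g z"] exI[of _ "D1 \<phi> ?p * D2 f z + D2 \<phi> ?p * D2 g z"])
      (auto simp: o_def algebra_simps elim!: has_derivative_eq_rhs)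
qed

lemma holomorphic2_on_compose1:
  assumes "f holomorphic_on T" "open T" "holomorphic2_on g S" "\<And>z. z \<in> S \<Longrightarrow> g z \<in> T"
  shows "holomorphic2_on (\<lambda>z. f (g z)) S" unfolding holomorphic2_on_def
proof
  fix z assume z: "z \<in> S"
  have "((f \<circ> g) has_derivative (\<lambda>v. deriv f (g z) * v) \<circ> (\<lambda>v. D1 g z * fst v + D2 g z * snd v)) (at z)" by (rule diff_chain_at)
      (use assms z in \<open>auto intro!: holomorphic2_on_has_derivative
         simp: has_field_derivative_def[symmetric] holomorphic_derivI\<close>)
  then show "\<exists>A B. ((\<lambda>z. f (g z)) has_derivative (\<lambda>v. A * fst v + B * snd v)) (at z)"
    by (intro exI[of _ "deriv f (g z) * D1 g z"] exI[of _ "deriv f (g z) * D2 g z"])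
      (auto simp: o_def algebra_simps elim!: has_derivative_eq_rhs)
qed

lemma holomorphic2_on_compose_curve_at:
  assumes "holomorphic2_on \<phi> T" "f field_differentiable (at z)" "g field_differentiable (at z)"
    "(f z, g z) \<in> T"
  shows "(\<lambda>z. \<phi> (f z, g z)) field_differentiable (at z)"
proof -
  let ?p = "(f z, g z)"
  have fg: "(f has_derivative (\<lambda>v. deriv f z * v)) (at z)" "(g has_derivative (\<lambda>v. deriv g z * v)) (at z)"
    using assms(2,3) by (simp_all add: field_differentiable_derivI has_field_derivative_imp_has_derivative)
  have "((\<phi> \<circ> (\<lambda>z. (f z, g z))) has_derivative (\<lambda>v. D1 \<phi> ?p * fst v + D2 \<phi> ?p * snd v) \<circ>
     (\<lambda>v. (deriv f z * v, deriv g z * v))) (at z)" by (rule diff_chain_at)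
      (use assms fg in \<open>auto intro!: has_derivative_Pair holomorphic2_on_has_derivative\<close>)
  then have "((\<lambda>z. \<phi> (f z, g z)) has_field_derivative (D1 \<phi> ?p * deriv f z + D2 \<phi> ?p * deriv g z)) (at z)"
    by (auto simp: o_def has_field_derivative_def algebra_simps intro!: ext elim!: has_derivative_eq_rhs)
  then show ?thesis using field_differentiable_def by blast
qed

lemma holomorphic2_on_compose_curve:
  assumes "holomorphic2_on \<phi> T" "f holomorphic_on S" "g holomorphic_on S" "open S"
    "\<And>z. z \<in> S \<Longrightarrow> (f z, g z) \<in> T"
  shows "(\<lambda>z. \<phi> (f z, g z)) holomorphic_on S" using assms holomorphic2_on_compose_curve_at[OF assms(1)]
  by (auto simp: holomorphic_on_open field_differentiable_def)

lemma holomorphic2_on_uminus: "holomorphic2_on f S \<Longrightarrow> holomorphic2_on (\<lambda>z. - f z) S"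
  by (rule holomorphic2_on_compose1[where T = UNIV]) (auto intro!: holomorphic_intros)

lemma holomorphic2_on_diff:
  "holomorphic2_on f S \<Longrightarrow> holomorphic2_on g S \<Longrightarrow> holomorphic2_on (\<lambda>z. f z - g z) S"
  using holomorphic2_on_add[of f S "\<lambda>z. - g z"] holomorphic2_on_uminus[of g S] by simp

lemma holomorphic2_on_inverse:
  "holomorphic2_on f S \<Longrightarrow> (\<And>z. z \<in> S \<Longrightarrow> f z \<noteq> 0) \<Longrightarrow> holomorphic2_on (\<lambda>z. inverse (f z)) S"
  by (rule holomorphic2_on_compose1[where T = "- {0}"]) (auto intro!: holomorphic_intros)

lemma holomorphic2_on_divide:
  "holomorphic2_on f S \<Longrightarrow> holomorphic2_on g S \<Longrightarrow> (\<And>z. z \<in> S \<Longrightarrow> g z \<noteq> 0)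
    \<Longrightarrow> holomorphic2_on (\<lambda>z. f z / g z) S" unfolding divide_inverse by (intro holomorphic2_on_mult holomorphic2_on_inverse)

lemma holomorphic2_on_power: "holomorphic2_on f S \<Longrightarrow> holomorphic2_on (\<lambda>z. f z ^ n) S"
  by (rule holomorphic2_on_compose1[where T = UNIV and f = "\<lambda>w. w ^ n"]) (auto intro!: holomorphic_intros)

lemma holomorphic2_on_exp: "holomorphic2_on f S \<Longrightarrow> holomorphic2_on (\<lambda>z. exp (f z)) S"
  by (rule holomorphic2_on_compose1[where T = UNIV]) (auto intro!: holomorphic_intros)

lemma holomorphic2_on_poly: "holomorphic2_on f S \<Longrightarrow> holomorphic2_on (\<lambda>z. poly p (f z)) S"
  by (rule holomorphic2_on_compose1[where T = UNIV]) (auto intro!: holomorphic_intros)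

lemma holomorphic2_on_sum:
  "finite I \<Longrightarrow> (\<And>i. i \<in> I \<Longrightarrow> holomorphic2_on (f i) S) \<Longrightarrow> holomorphic2_on (\<lambda>z. \<Sum>i\<in>I. f i z) S"
  by (induction I rule: finite_induct) (auto intro: holomorphic2_on_add)

lemmas holomorphic2_intros = holomorphic2_on_add holomorphic2_on_mult holomorphic2_on_diff
  holomorphic2_on_uminus holomorphic2_on_divide holomorphic2_on_power holomorphic2_on_exp
  holomorphic2_on_poly holomorphic2_on_const holomorphic2_on_fst holomorphic2_on_snd

lemma contour_integral_circlepath_param:
  "contour_integral (circlepath z r) f =
    integral (cbox 0 1) (\<lambda>x::real. f (z + r * exp (2 * of_real pi * \<i> * of_real x)) * (2 * pi * \<i> * r * exp (2 * of_real pi * \<i> * of_real x)))"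
  unfolding contour_integral_integral by (simp add: vector_derivative_circlepath) (simp add: circlepath)

lemma continuous_on_times_local:
  fixes f :: "'a::metric_space \<times> 'b::metric_space \<Rightarrow> 'c::topological_space"
  assumes "open U" "\<And>w. w \<in> U \<Longrightarrow> \<exists>r>0. continuous_on (ball w r \<times> T) f"
  shows "continuous_on (U \<times> T) f" unfolding continuous_on_eq_continuous_within
proof
  fix z assume z: "z \<in> U \<times> T"
  then obtain w t where wt: "z = (w, t)" "w \<in> U" "t \<in> T" by auto
  obtain r where r: "r > 0" "continuous_on (ball w r \<times> T) f" using assms(2)[OF wt(2)] by blast
  obtain s where s: "s > 0" "ball w s \<subseteq> U" using assms(1) wt(2) openE by blast
  have "at z within U \<times> T = at z within ball w r \<times> T" by (rule at_within_nhd[where S = "ball w (min r s) \<times> UNIV"])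
      (use wt r s in \<open>auto simp: open_Times\<close>)
  then show "continuous (at z within U \<times> T) f" using r wt by (simp add: continuous_on_eq_continuous_within)
qed

lemma continuous_on_deriv_param:
  fixes g :: "complex \<Rightarrow> 'a::metric_space \<Rightarrow> complex"
  assumes U: "open U" and cont: "continuous_on (U \<times> T) (\<lambda>(w, t). g w t)"
    and hol: "\<And>t. t \<in> T \<Longrightarrow> (\<lambda>w. g w t) holomorphic_on U"
  shows "continuous_on (U \<times> T) (\<lambda>(w, t). deriv (\<lambda>w. g w t) w)"
proof (rule continuous_on_times_local[OF U])
  fix w0 assume "w0 \<in> U"
  then obtain r where r: "r > 0" "cball w0 r \<subseteq> U" using U open_contains_cball by blast
  let ?e = "\<lambda>x. w0 + r * exp (2 * of_real pi * \<i> * of_real x)"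
  have e: "?e x \<in> sphere w0 r" for x using r by (simp add: dist_norm norm_mult)
  have eq: "deriv (\<lambda>w. g w t) w = 1 / (2 * of_real pi * \<i>) *
      integral (cbox 0 1) (\<lambda>x. g (?e x) t / (?e x - w)\<^sup>2 * (2 * pi * \<i> * r * exp (2 * of_real pi * \<i> * x)))"
    if "w \<in> ball w0 r" "t \<in> T" for w t
  proof -
    have "((\<lambda>w. g w t) has_field_derivative (1 / (2 * of_real pi * \<i>) *
        contour_integral (circlepath w0 r) (\<lambda>u. g u t / (u-w)^2))) (at w)"
    proof (rule Cauchy_derivative_integral_circlepath(2))
      show "continuous_on (cball w0 r) (\<lambda>w. g w t)" "(\<lambda>w. g w t) holomorphic_on ball w0 r"
        using hol[OF that(2)] r holomorphic_on_imp_continuous_on holomorphic_on_subset by (meson ball_subset_cball subset_trans)+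
    qed (use that in auto)
    then show ?thesis unfolding contour_integral_circlepath_param by (rule DERIV_imp_deriv)
  qed
  have "continuous_on ((ball w0 r \<times> T) \<times> cbox 0 1) (\<lambda>(z, x). case z of (w, t) \<Rightarrow>
     g (?e x) t / (?e x - w)\<^sup>2 * (2 * pi * \<i> * r * exp (2 * of_real pi * \<i> * of_real x)))" unfolding split_beta
  proof (intro continuous_intros)
    have c1: "continuous_on ((ball w0 r \<times> T) \<times> cbox 0 1) (\<lambda>z. (?e (snd z), snd (fst z)))" by (intro continuous_intros)
    have i1: "(\<lambda>z. (?e (snd z), snd (fst z))) ` ((ball w0 r \<times> T) \<times> cbox 0 1) \<subseteq> U \<times> T" using e r sphere_cball[of w0 r] by fastforce
    show "continuous_on ((ball w0 r \<times> T) \<times> cbox 0 1) (\<lambda>z. g (?e (snd z)) (snd (fst z)))" using continuous_on_compose2[OF cont c1 i1] by simp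
    show "\<forall>z\<in>(ball w0 r \<times> T) \<times> cbox 0 1. (?e (snd z) - fst (fst z))\<^sup>2 \<noteq> 0"
    proof
      fix z assume z: "z \<in> (ball w0 r \<times> T) \<times> cbox (0::real) 1"
      have "?e (snd z) \<noteq> fst (fst z)" using z e[of "snd z"] by auto
      then show "(?e (snd z) - fst (fst z))\<^sup>2 \<noteq> 0" by simp
    qed
  qed
  then have "continuous_on (ball w0 r \<times> T) (\<lambda>z. integral (cbox 0 1) (\<lambda>x. case z of (w, t) \<Rightarrow>
     g (?e x) t / (?e x - w)\<^sup>2 * (2 * pi * \<i> * r * exp (2 * of_real pi * \<i> * of_real x))))" by (intro integral_continuous_on_param)
  then have "continuous_on (ball w0 r \<times> T) (\<lambda>z. 1 / (2 * of_real pi * \<i>) * integral (cbox 0 1) (\<lambda>x. case z of (w, t) \<Rightarrow>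
     g (?e x) t / (?e x - w)\<^sup>2 * (2 * pi * \<i> * r * exp (2 * of_real pi * \<i> * of_real x))))" by (intro continuous_intros)
  then have "continuous_on (ball w0 r \<times> T) (\<lambda>(w, t). deriv (\<lambda>w. g w t) w)" by (rule continuous_on_eq) (auto simp: eq)
  then show "\<exists>r>0. continuous_on (ball w0 r \<times> T) (\<lambda>(w, t). deriv (\<lambda>w. g w t) w)" using r by blast
qed

lemma holomorphic_on_circle_integral:
  fixes K :: "complex \<Rightarrow> complex \<Rightarrow> complex"
  assumes U: "open U" and r: "0 < r"
    and cont: "continuous_on (U \<times> sphere z r) (\<lambda>(w, u). K w u)"
    and hol: "\<And>u. u \<in> sphere z r \<Longrightarrow> (\<lambda>w. K w u) holomorphic_on U"
  shows "(\<lambda>w. contour_integral (circlepath z r) (K w)) holomorphic_on U"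
proof -
  let ?e = "\<lambda>x. z + r * exp (2 * of_real pi * \<i> * of_real x)"
  let ?v = "\<lambda>x. 2 * pi * \<i> * r * exp (2 * of_real pi * \<i> * of_real x)"
  have e: "?e x \<in> sphere z r" for x using r by (simp add: dist_norm norm_mult)
  have "(\<lambda>w. integral (cbox 0 1) (\<lambda>x. K w (?e x) * ?v x)) holomorphic_on U"
  proof (rule analytic_imp_holomorphic, unfold analytic_on_def, intro ballI)
    fix w assume "w \<in> U"
    then obtain s where s: "s > 0" "ball w s \<subseteq> U" using U openE by blast
    have cG: "continuous_on (ball w s \<times> cbox 0 1) (\<lambda>z. g (fst z) (?e (snd z)))"
      if g: "continuous_on (U \<times> sphere z r) (\<lambda>(w, u). g w u)" for g :: "complex \<Rightarrow> complex \<Rightarrow> complex"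
    proof -
      have c1: "continuous_on (ball w s \<times> cbox 0 1) (\<lambda>z. (fst z, ?e (snd z)))" by (intro continuous_intros)
      have i1: "(\<lambda>z. (fst z, ?e (snd z))) ` (ball w s \<times> cbox 0 1) \<subseteq> U \<times> sphere z r" using e s by fastforce
      show ?thesis using continuous_on_compose2[OF g c1 i1] by simp
    qed
    note ceK = cG[OF cont] and cdK = cG[OF continuous_on_deriv_param[OF U cont hol]]
    have "(\<lambda>w. integral (cbox 0 1) (\<lambda>x. K w (?e x) * ?v x)) holomorphic_on ball w s"
    proof (rule leibniz_rule_holomorphic[where fx = "\<lambda>w x. deriv (\<lambda>w. K w (?e x)) w * ?v x"])
      fix w' x assume "w' \<in> ball w s" "x \<in> cbox (0::real) 1"
      then have "((\<lambda>w. K w (?e x)) has_field_derivative deriv (\<lambda>w. K w (?e x)) w') (at w')"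
        using hol[OF e] U s by (meson holomorphic_derivI subsetD)
      then show "((\<lambda>w'. K w' (?e x) * ?v x) has_field_derivative deriv (\<lambda>w. K w (?e x)) w' * ?v x) (at w' within ball w s)"
        by (rule DERIV_cmult_right[OF has_field_derivative_at_within])
    next
      fix w' assume w': "w' \<in> ball w s"
      have "continuous_on (cbox 0 1) (\<lambda>x. K w' (?e x))"
        by (rule continuous_on_compose2[OF ceK, of _ "\<lambda>x. (w', x)", simplified]) (use w' in \<open>auto intro!: continuous_intros\<close>)
      then show "(\<lambda>x. K w' (?e x) * ?v x) integrable_on cbox 0 1" by (intro integrable_continuous continuous_intros)
    next
      show "continuous_on (ball w s \<times> cbox 0 1) (\<lambda>(w', x). deriv (\<lambda>w. K w (?e x)) w' * ?v x)"
        unfolding split_beta by (intro continuous_intros cdK)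
    qed auto
    then show "\<exists>s>0. (\<lambda>w. integral (cbox 0 1) (\<lambda>x. K w (?e x) * ?v x)) holomorphic_on ball w s" using s by blast
  qed
  then show ?thesis unfolding contour_integral_circlepath_param .
qed

definition sep_holomorphic_on where
  "sep_holomorphic_on \<phi> S \<longleftrightarrow> continuous_on S \<phi> \<and>
     (\<forall>x y. (x, y) \<in> S \<longrightarrow> (\<lambda>s. \<phi> (s, y)) field_differentiable (at x) \<and> (\<lambda>t. \<phi> (x, t)) field_differentiable (at y))"

lemma sep_holomorphic_box:
  assumes "open S" "(x, y) \<in> S"
  obtains r where "r > 0" "cball x r \<times> cball y r \<subseteq> S"
proof -
  obtain A B where AB: "open A" "open B" "x \<in> A" "y \<in> B" "A \<times> B \<subseteq> S" using open_prod_elim[OF assms] by (metis mem_Sigma_iff)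
  obtain r where r: "r > 0" "cball x r \<subseteq> A" using AB open_contains_cball by blast
  obtain s where s: "s > 0" "cball y s \<subseteq> B" using AB open_contains_cball by blast
  show ?thesis by (rule that[of "min r s"]) (use r s AB in force)+
qed

lemma sep_holomorphic_on_D:
  assumes S: "open S" and sep: "sep_holomorphic_on \<phi> S"
  shows "continuous_on S (D1 \<phi>)" "continuous_on S (D2 \<phi>)"
proof -
  have *: "isCont (D1 \<phi>) (x, y) \<and> isCont (D2 \<phi>) (x, y)" if xy: "(x, y) \<in> S" for x y
  proof -
    obtain r where r: "r > 0" "cball x r \<times> cball y r \<subseteq> S" using sep_holomorphic_box[OF S xy] .
    have h1: "(\<lambda>s. \<phi> (s, t)) holomorphic_on ball x r" if "t \<in> ball y r" for t unfolding holomorphic_on_def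
    proof
      fix s assume "s \<in> ball x r"
      then have "(s, t) \<in> S" using r that by auto
      then show "(\<lambda>s. \<phi> (s, t)) field_differentiable at s within ball x r"
        using sep field_differentiable_at_within unfolding sep_holomorphic_on_def by blast
    qed
    have h2: "(\<lambda>t. \<phi> (s, t)) holomorphic_on ball y r" if "s \<in> ball x r" for s unfolding holomorphic_on_def
    proof
      fix t assume "t \<in> ball y r"
      then have "(s, t) \<in> S" using r that by auto
      then show "(\<lambda>t. \<phi> (s, t)) field_differentiable at t within ball y r"
        using sep field_differentiable_at_within unfolding sep_holomorphic_on_def by blast
    qed
    have c: "continuous_on (ball x r \<times> ball y r) \<phi>" using sep r unfolding sep_holomorphic_on_def by (elim conjE continuous_on_subset) force
    have "continuous_on (ball x r \<times> ball y r) (\<lambda>(s, t). deriv (\<lambda>s. \<phi> (s, t)) s)" by (rule continuous_on_deriv_param) (use c h1 in auto)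
    then have "continuous_on (ball x r \<times> ball y r) (D1 \<phi>)" by (simp add: D1_def[abs_def] split_beta)
    moreover have "continuous_on (ball y r \<times> ball x r) (\<lambda>(t, s). deriv (\<lambda>t. \<phi> (s, t)) t)"
    proof (rule continuous_on_deriv_param)
      have "continuous_on (ball y r \<times> ball x r) (\<lambda>z. (snd z, fst z))" by (intro continuous_intros)
      then show "continuous_on (ball y r \<times> ball x r) (\<lambda>(t, s). \<phi> (s, t))" unfolding split_beta by (rule continuous_on_compose2[OF c]) auto
    qed (use h2 in auto)
    then have "continuous_on (ball x r \<times> ball y r) (\<lambda>z. (\<lambda>(t, s). deriv (\<lambda>t. \<phi> (s, t)) t) (snd z, fst z))"
      by (rule continuous_on_compose2) (auto intro!: continuous_intros)
    then have "continuous_on (ball x r \<times> ball y r) (D2 \<phi>)" by (simp add: D2_def[abs_def] split_beta)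
    ultimately show ?thesis using r continuous_on_eq_continuous_at[of "ball x r \<times> ball y r"]
      by (metis SigmaI centre_in_ball open_Times open_ball)
  qed
  show "continuous_on S (D1 \<phi>)" "continuous_on S (D2 \<phi>)" using * by (auto intro!: continuous_at_imp_continuous_on)
qed

text \<open>Osgood's lemma.\<close>
lemma holomorphic2_on_iff:
  assumes S: "open S"
  shows "holomorphic2_on \<phi> S \<longleftrightarrow> sep_holomorphic_on \<phi> S"
proof
  assume "holomorphic2_on \<phi> S"
  then show "sep_holomorphic_on \<phi> S" unfolding sep_holomorphic_on_def field_differentiable_def
    using holomorphic2_on_imp_continuous_on holomorphic2_on_slice1 holomorphic2_on_slice2 by blast
next
  assume sep: "sep_holomorphic_on \<phi> S"
  show "holomorphic2_on \<phi> S" unfolding holomorphic2_on_def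
  proof
    fix z assume z: "z \<in> S"
    obtain x y where xy: "z = (x, y)" by (cases z)
    obtain r where r: "r > 0" "cball x r \<times> cball y r \<subseteq> S" using sep_holomorphic_box[OF S] z xy by metis
    have d: "((\<lambda>s. \<phi> (s, t)) has_field_derivative D1 \<phi> (s, t)) (at s)"
      "((\<lambda>t. \<phi> (s, t)) has_field_derivative D2 \<phi> (s, t)) (at t)" if "(s, t) \<in> S" for s t
      using sep that unfolding sep_holomorphic_on_def D1_def D2_def by (auto intro: field_differentiable_derivI)
    have "((\<lambda>(s, t). \<phi> (s, t)) has_derivative
       (\<lambda>(tx, ty). D1 \<phi> (x, y) * tx + blinfun_apply (blinfun_mult_right (D2 \<phi> (x, y))) ty)) (at (x, y) within ball x r \<times> ball y r)"
    proof (rule has_derivative_partialsI[where fy = "\<lambda>s t. blinfun_mult_right (D2 \<phi> (s, t))"])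
      show "((\<lambda>s. \<phi> (s, y)) has_derivative (*) (D1 \<phi> (x, y))) (at x within ball x r)"
        using d(1)[of x y] z xy by (auto simp: has_field_derivative_def has_derivative_at_withinI)
      show "((\<lambda>t. \<phi> (s, t)) has_derivative blinfun_apply (blinfun_mult_right (D2 \<phi> (s, t)))) (at t within ball y r)"
        if "s \<in> ball x r" "t \<in> ball y r" for s t
      proof -
        have "(s, t) \<in> S" using r that by auto
        from d(2)[OF this] show ?thesis unfolding has_field_derivative_def by (simp add: has_derivative_at_withinI)
      qed
      have "isCont (D2 \<phi>) (x, y)" using sep_holomorphic_on_D(2)[OF S sep] z xy S by (simp add: continuous_on_eq_continuous_at)
      then have "isCont (\<lambda>z. blinfun_mult_right (D2 \<phi> z)) (x, y)" by (intro continuous_intros)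
      then have "continuous (at (x, y) within ball x r \<times> ball y r) (\<lambda>z. blinfun_mult_right (D2 \<phi> z))"
        by (rule continuous_at_imp_continuous_at_within)
      then show "continuous (at (x, y) within ball x r \<times> ball y r) (\<lambda>(s, t). blinfun_mult_right (D2 \<phi> (s, t)))"
        by (simp add: case_prod_unfold)
    qed (use r in auto)
    then have "(\<phi> has_derivative (\<lambda>v. D1 \<phi> (x, y) * fst v + D2 \<phi> (x, y) * snd v)) (at (x, y) within ball x r \<times> ball y r)"
      by (simp add: case_prod_unfold)
    then show "\<exists>A B. (\<phi> has_derivative (\<lambda>v. A * fst v + B * snd v)) (at z)"
      using at_within_open[of "(x, y)" "ball x r \<times> ball y r"] r xy by (auto simp: open_Times)
  qed
qed

lemma open_swap_image:
  fixes S :: "('a::topological_space \<times> 'b::topological_space) set"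
  assumes "open S"
  shows "open (prod.swap ` S)"
proof -
  have "prod.swap ` S = prod.swap -` S" by (force simp: image_iff)
  moreover have "open (prod.swap -` S)" using assms by (intro open_vimage) (auto simp: prod.swap_def intro!: continuous_intros)
  ultimately show ?thesis by simp
qed

lemma holomorphic2_on_swap:
  assumes "holomorphic2_on \<phi> S"
  shows "holomorphic2_on (\<lambda>z. \<phi> (prod.swap z)) (prod.swap ` S)"
proof -
  have "holomorphic2_on (\<lambda>z. \<phi> (snd z, fst z)) (prod.swap ` S)" by (rule holomorphic2_on_compose[OF assms]) auto
  then show ?thesis by (simp add: prod.swap_def)
qed

lemma holomorphic2_on_D1:
  assumes S: "open S" and h: "holomorphic2_on \<phi> S"
  shows "holomorphic2_on (D1 \<phi>) S" unfolding holomorphic2_on_iff[OF S] sep_holomorphic_on_def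
proof (intro conjI allI impI)
  have sep: "sep_holomorphic_on \<phi> S" using h holomorphic2_on_iff[OF S] by blast
  show "continuous_on S (D1 \<phi>)" by (rule sep_holomorphic_on_D[OF S sep])
  fix x y assume xy: "(x, y) \<in> S"
  obtain r where r: "r > 0" "cball x r \<times> cball y r \<subseteq> S" using sep_holomorphic_box[OF S xy] .
  have h1: "(\<lambda>s. \<phi> (s, t)) holomorphic_on cball x r" if "t \<in> cball y r" for t
    by (rule holomorphic2_on_slice1_holomorphic[OF h]) (use r that in auto)
  have h2: "(\<lambda>t. \<phi> (s, t)) holomorphic_on ball y r" if "s \<in> cball x r" for s
    by (rule holomorphic2_on_slice2_holomorphic[OF h]) (use r that in auto)
  have "(\<lambda>s. \<phi> (s, y)) holomorphic_on ball x r"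
    using h1[of y] r by (meson ball_subset_cball centre_in_cball holomorphic_on_subset less_imp_le)
  then have "deriv (\<lambda>s. \<phi> (s, y)) holomorphic_on ball x r" by (intro holomorphic_deriv) auto
  then have "(\<lambda>s. D1 \<phi> (s, y)) holomorphic_on ball x r" by (simp add: D1_def[abs_def])
  then show "(\<lambda>s. D1 \<phi> (s, y)) field_differentiable at x" using r by (simp add: holomorphic_on_imp_differentiable_at)
  have eq: "D1 \<phi> (x, t) = 1 / (2 * of_real pi * \<i>) * contour_integral (circlepath x r) (\<lambda>u. \<phi> (u, t) / (u - x)^2)"
    if "t \<in> ball y r" for t
  proof -
    have "((\<lambda>s. \<phi> (s, t)) has_field_derivative (1 / (2 * of_real pi * \<i>) *
        contour_integral (circlepath x r) (\<lambda>u. \<phi> (u, t) / (u - x)^2))) (at x)" by (rule Cauchy_derivative_integral_circlepath(2))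
       (use h1[of t] that r in \<open>auto intro: holomorphic_on_imp_continuous_on holomorphic_on_subset[OF _ ball_subset_cball]\<close>)
    then show ?thesis by (auto simp: D1_def DERIV_imp_deriv)
  qed
  have "(\<lambda>t. contour_integral (circlepath x r) (\<lambda>u. \<phi> (u, t) / (u - x)^2)) holomorphic_on ball y r"
  proof (rule holomorphic_on_circle_integral)
    have "continuous_on (ball y r \<times> sphere x r) (\<lambda>z. \<phi> (snd z, fst z))"
      by (rule continuous_on_compose2[OF holomorphic2_on_imp_continuous_on[OF h]])
        (use r in \<open>auto intro!: continuous_intros\<close>)
    then show "continuous_on (ball y r \<times> sphere x r) (\<lambda>(t, u). \<phi> (u, t) / (u - x)\<^sup>2)"
      unfolding split_beta using r by (intro continuous_intros) auto
    show "(\<lambda>t. \<phi> (u, t) / (u - x)\<^sup>2) holomorphic_on ball y r" if "u \<in> sphere x r" for u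
      using h2[of u] that r by (intro holomorphic_intros) (auto)
  qed (use r in auto)
  then have "(\<lambda>t. 1 / (2 * of_real pi * \<i>) * contour_integral (circlepath x r) (\<lambda>u. \<phi> (u, t) / (u - x)^2)) holomorphic_on ball y r"
    by (intro holomorphic_intros)
  then have "(\<lambda>t. D1 \<phi> (x, t)) holomorphic_on ball y r" by (rule holomorphic_transform) (use eq in auto)
  then show "(\<lambda>t. D1 \<phi> (x, t)) field_differentiable at y" using r by (simp add: holomorphic_on_imp_differentiable_at)
qed

lemma holomorphic2_on_D2:
  assumes S: "open S" and h: "holomorphic2_on \<phi> S"
  shows "holomorphic2_on (D2 \<phi>) S"
proof -
  have o: "open (prod.swap ` S)" using S by (rule open_swap_image)
  have "holomorphic2_on (\<lambda>z. D1 (\<lambda>z. \<phi> (prod.swap z)) (prod.swap z)) (prod.swap ` prod.swap ` S)"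
    by (intro holomorphic2_on_swap holomorphic2_on_D1 o h)
  then show ?thesis by (simp add: D1_def[abs_def] D2_def[abs_def] image_image)
qed

lemma holomorphic2_uniform_limit:
  assumes S: "open S" and h: "\<And>n. holomorphic2_on (f n) S" and lim: "uniform_limit S f g sequentially"
  shows "holomorphic2_on g S" unfolding holomorphic2_on_iff[OF S] sep_holomorphic_on_def
proof (intro conjI allI impI)
  show "continuous_on S g"
    by (rule uniform_limit_theorem[OF _ lim]) (use h in \<open>auto intro!: always_eventually holomorphic2_on_imp_continuous_on\<close>)
  fix x y assume xy: "(x, y) \<in> S"
  obtain r where r: "r > 0" "cball x r \<times> cball y r \<subseteq> S" using sep_holomorphic_box[OF S xy] .
  have *: "uniform_limit A (\<lambda>n a. f n (h a)) (\<lambda>a. g (h a)) sequentially" if "h ` A \<subseteq> S" for h :: "complex \<Rightarrow> _" and A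
    using lim that unfolding uniform_limit_iff by (smt (verit, ccfv_SIG) eventually_mono image_subset_iff)
  have "(\<lambda>s. g (s, y)) holomorphic_on ball x r"
  proof (rule holomorphic_uniform_limit)
    show "uniform_limit (cball x r) (\<lambda>n s. f n (s, y)) (\<lambda>s. g (s, y)) sequentially" by (rule *) (use r in auto)
    have "(\<lambda>s. f n (s, y)) holomorphic_on cball x r" for n by (rule holomorphic2_on_slice1_holomorphic[OF h]) (use r in auto)
    then show "\<forall>\<^sub>F n in sequentially. continuous_on (cball x r) (\<lambda>s. f n (s, y)) \<and> (\<lambda>s. f n (s, y)) holomorphic_on ball x r"
      by (intro always_eventually allI conjI holomorphic_on_imp_continuous_on) (meson ball_subset_cball holomorphic_on_subset)+
  qed auto
  then show "(\<lambda>s. g (s, y)) field_differentiable at x" using r by (simp add: holomorphic_on_imp_differentiable_at)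
  have "(\<lambda>t. g (x, t)) holomorphic_on ball y r"
  proof (rule holomorphic_uniform_limit)
    show "uniform_limit (cball y r) (\<lambda>n t. f n (x, t)) (\<lambda>t. g (x, t)) sequentially" by (rule *) (use r in auto)
    have "(\<lambda>t. f n (x, t)) holomorphic_on cball y r" for n by (rule holomorphic2_on_slice2_holomorphic[OF h]) (use r in auto)
    then show "\<forall>\<^sub>F n in sequentially. continuous_on (cball y r) (\<lambda>t. f n (x, t)) \<and> (\<lambda>t. f n (x, t)) holomorphic_on ball y r"
      by (intro always_eventually allI conjI holomorphic_on_imp_continuous_on) (meson ball_subset_cball holomorphic_on_subset)+
  qed auto
  then show "(\<lambda>t. g (x, t)) field_differentiable at y" using r by (simp add: holomorphic_on_imp_differentiable_at)
qed

text \<open>Splitting the remainder of \<open>N\<close> as \<open>e1 * fst + e2 * snd\<close> with \<open>e1, e2 \<longlonglongrightarrow> 0\<close> allows one to solve for the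
  difference quotient of \<open>Y\<close>.\<close>
lemma implicit_field_differentiable:
  fixes Y A :: "complex \<Rightarrow> complex"
  assumes "A field_differentiable (at z)" and Y: "isCont Y z" and "holomorphic2_on N T" "(A z, Y z) \<in> T"
    and n2: "D2 N (A z, Y z) \<noteq> 0" and "(\<lambda>w. N (A w, Y w)) field_differentiable (at z)"
  shows "Y field_differentiable (at z)"
proof -
  define q where "q = (\<lambda>w. (A w, Y w))"
  define n1 where "n1 = D1 N (q z)"
  define n2 where "n2 = D2 N (q z)"
  obtain A' M' where A': "(A has_field_derivative A') (at z)" and M': "((\<lambda>w. N (q w)) has_field_derivative M') (at z)"
    using assms by (auto simp: field_differentiable_def q_def)
  define E where "E = (\<lambda>v. (N v - N (q z) - (n1 * fst (v - q z) + n2 * snd (v - q z))) /\<^sub>R norm (v - q z))"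
  have "(N has_derivative (\<lambda>v. n1 * fst v + n2 * snd v)) (at (q z))"
    using assms holomorphic2_on_has_derivative by (auto simp: q_def n1_def n2_def)
  then have "isCont E (q z)" unfolding has_derivative_at_within isCont_def by (simp add: E_def)
  moreover have "isCont q z" unfolding q_def using Y DERIV_isCont[OF A'] by (intro continuous_intros)
  ultimately have "isCont (\<lambda>w. E (q w)) z" by (rule isCont_o2[rotated])
  then have E0: "((\<lambda>w. E (q w)) \<longlongrightarrow> 0) (at z)" by (simp add: isCont_def E_def)
  define e1 where "e1 = (\<lambda>w. E (q w) * (cnj (A w - A z) / norm (q w - q z)))"
  define e2 where "e2 = (\<lambda>w. E (q w) * (cnj (Y w - Y z) / norm (q w - q z)))"
  have le: "norm (E (q w) * (cnj u / norm (q w - q z))) \<le> norm (E (q w))" if "norm u \<le> norm (q w - q z)" for u w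
  proof -
    have "norm u / norm (q w - q z) \<le> 1" using that by (simp add: divide_le_eq_1)
    then have "norm (E (q w)) * (norm u / norm (q w - q z)) \<le> norm (E (q w))" by (intro mult_left_le) auto
    then show ?thesis by (simp add: norm_mult norm_divide)
  qed
  have nq: "norm (A w - A z) \<le> norm (q w - q z)" "norm (Y w - Y z) \<le> norm (q w - q z)" for w
    using norm_fst_le[of "A w - A z" "Y w - Y z"] norm_snd_le[of "Y w - Y z" "A w - A z"] by (simp_all add: q_def)
  have e: "(e1 \<longlongrightarrow> 0) (at z)" "(e2 \<longlongrightarrow> 0) (at z)" unfolding e1_def e2_def
    by (rule Lim_null_comparison[OF _ tendsto_norm_zero[OF E0]]; intro always_eventually allI le nq)+
  have N: "N (q w) - N (q z) = (n1 + e1 w) * (A w - A z) + (n2 + e2 w) * (Y w - Y z)" for w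
  proof (cases "q w = q z")
    case False
    let ?r = "complex_of_real (norm (q w - q z))"
    have r: "?r \<noteq> 0" using False by simp
    have "?r\<^sup>2 = of_real ((norm (A w - A z))\<^sup>2 + (norm (Y w - Y z))\<^sup>2)" by (simp add: q_def norm_Pair flip: of_real_power)
    also have "\<dots> = (A w - A z) * cnj (A w - A z) + (Y w - Y z) * cnj (Y w - Y z)" by (simp only: of_real_add complex_norm_square)
    finally have r2: "?r\<^sup>2 = (A w - A z) * cnj (A w - A z) + (Y w - Y z) * cnj (Y w - Y z)" .
    have "x * (a' / r) * a + x * (b' / r) * b = x * ((a * a' + b * b') / r)" for x a a' b b' r :: complex
      by (simp add: add_divide_distrib algebra_simps)
    then have "e1 w * (A w - A z) + e2 w * (Y w - Y z) = E (q w) * (?r\<^sup>2 / ?r)" unfolding e1_def e2_def r2 by blast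
    also have "\<dots> = N (q w) - N (q z) - (n1 * (A w - A z) + n2 * (Y w - Y z))"
      using r by (simp add: E_def power2_eq_square scaleR_conv_of_real q_def divide_inverse)
    finally show ?thesis by (simp add: algebra_simps)
  qed (auto simp: q_def)
  have n20: "n2 + 0 \<noteq> 0" using n2 by (simp add: n2_def q_def)
  have "((\<lambda>w. ((N (q w) - N (q z)) / (w - z) - (n1 + e1 w) * ((A w - A z) / (w - z))) / (n2 + e2 w))
      \<longlongrightarrow> (M' - (n1 + 0) * A') / (n2 + 0)) (at z)" using n20 A' M' unfolding has_field_derivative_iff by (intro tendsto_intros e)
  moreover have "\<forall>\<^sub>F w in at z. ((N (q w) - N (q z)) / (w - z) - (n1 + e1 w) * ((A w - A z) / (w - z))) / (n2 + e2 w)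
      = (Y w - Y z) / (w - z)" using tendsto_imp_eventually_ne[OF tendsto_add[OF tendsto_const e(2)] n20]
    by eventually_elim (simp add: N add_divide_distrib)
  ultimately have "((\<lambda>w. (Y w - Y z) / (w - z)) \<longlongrightarrow> (M' - (n1 + 0) * A') / (n2 + 0)) (at z)" by (rule Lim_transform_eventually)
  then show ?thesis unfolding field_differentiable_def has_field_derivative_iff by blast
qed


abbreviation pdisc :: "real \<Rightarrow> complex set" where
  "pdisc r \<equiv> ball 0 r - {0}"

definition root_group :: "nat \<Rightarrow> complex set" where
  "root_group d = {\<omega>. \<exists>n. \<omega> ^ (d ^ n) = 1}"

lemma root_groupI: "\<omega> ^ (d ^ n) = 1 \<Longrightarrow> \<omega> \<in> root_group d" by (auto simp: root_group_def)

lemma root_group_power_eq_1_mono: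
  fixes \<omega> :: complex
  assumes "\<omega> ^ (d ^ n) = 1" "n \<le> m"
  shows "\<omega> ^ (d ^ m) = 1"
proof -
  have "\<omega> ^ (d ^ m) = (\<omega> ^ (d ^ n)) ^ (d ^ (m - n))" using assms(2) by (simp flip: power_mult power_add)
  with assms(1) show ?thesis by simp
qed

lemma root_group_mult: "a \<in> root_group d \<Longrightarrow> b \<in> root_group d \<Longrightarrow> a * b \<in> root_group d"
proof -
  assume "a \<in> root_group d" "b \<in> root_group d"
  then obtain n m where "a ^ (d ^ n) = 1" "b ^ (d ^ m) = 1" by (auto simp: root_group_def)
  then have "a ^ (d ^ max n m) = 1" "b ^ (d ^ max n m) = 1" by (auto intro: root_group_power_eq_1_mono)
  then show ?thesis by (intro root_groupI[of _ _ "max n m"]) (simp add: power_mult_distrib)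
qed

lemma root_group_inverse: "a \<in> root_group d \<Longrightarrow> inverse a \<in> root_group d" by (auto simp: root_group_def power_inverse)

lemma root_group_cnj: "a \<in> root_group d \<Longrightarrow> cnj a \<in> root_group d" by (auto simp: root_group_def simp flip: complex_cnj_power)

lemma root_group_1 [simp]: "1 \<in> root_group d" by (auto simp: root_group_def)

lemma root_group_norm:
  assumes "0 < d" "a \<in> root_group d"
  shows "cmod a = 1"
proof -
  obtain n where "a ^ (d ^ n) = 1" using assms by (auto simp: root_group_def)
  then show ?thesis using power_eq_1_iff[of a "d ^ n"] assms(1) by auto
qed

lemma countable_root_group: "0 < d \<Longrightarrow> countable (root_group d)"
proof -
  assume d: "0 < d"
  have "root_group d = (\<Union>n. {\<omega>. \<omega> ^ (d ^ n) = 1})" by (auto simp: root_group_def)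
  moreover have "finite {\<omega>::complex. \<omega> ^ (d ^ n) = 1}" for n using d by (intro finite_roots_unity) (simp add: Suc_le_eq)
  ultimately show ?thesis by (simp add: countable_finite)
qed

lemma countable_exp_vimage:
  assumes "countable A"
  shows "countable {v::complex. exp v \<in> A}"
proof (rule countable_subset)
  show "{v. exp v \<in> A} \<subseteq> (\<lambda>(a, n::int). Ln a + (of_int (2 * n) * pi) * \<i>) ` (A \<times> UNIV)"
  proof
    fix v assume "v \<in> {v. exp v \<in> A}"
    then have "exp v \<in> A" by simp
    moreover have "exp v = exp (Ln (exp v))" by simp
    then obtain n :: int where "v = Ln (exp v) + (of_int (2 * n) * pi) * \<i>" by (subst (asm) exp_eq) blast
    ultimately show "v \<in> (\<lambda>(a, n::int). Ln a + (of_int (2 * n) * pi) * \<i>) ` (A \<times> UNIV)" by (intro rev_image_eqI[of "(exp v, n)"]) auto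
  qed
  show "countable ((\<lambda>(a, n::int). Ln a + (of_int (2 * n) * pi) * \<i>) ` (A \<times> UNIV))" using assms by auto
qed

lemma constant_if_countable_range:
  fixes f :: "'a::topological_space \<Rightarrow> complex"
  assumes "connected A" "continuous_on A f" "countable C" "\<And>x. x \<in> A \<Longrightarrow> f x \<in> C" "x \<in> A" "y \<in> A"
  shows "f x = f y"
proof (rule ccontr)
  assume "f x \<noteq> f y"
  moreover have "connected (f ` A)" using assms(1,2) by (rule connected_continuous_image[rotated])
  ultimately have "uncountable (f ` A)" using connected_uncountable assms(5,6) by blast
  then show False using assms(3,4) by (meson countable_subset image_subsetI)
qed

lemma equivariant_lift:
  fixes k :: "complex \<Rightarrow> complex" and d :: nat
  assumes d: "d \<ge> 2" and \<rho>: "0 < \<rho>" "\<rho> \<le> 1"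
    and cont: "continuous_on (pdisc \<rho>) k" and inj: "inj_on k (pdisc \<rho>)"
    and nz: "\<And>v. v \<in> pdisc \<rho> \<Longrightarrow> k v \<noteq> 0"
    and rot: "\<And>v \<omega>. v \<in> pdisc \<rho> \<Longrightarrow> \<omega> \<in> root_group d \<Longrightarrow> k (\<omega> * v) / k v \<in> root_group d"
    and pow: "\<And>v. v \<in> pdisc \<rho> \<Longrightarrow> k (v ^ d) / k v ^ d \<in> root_group d"
  obtains \<sigma> :: real and \<mu> :: "real \<Rightarrow> complex" and c :: complex
  where "\<sigma> = 1 \<or> \<sigma> = -1" "continuous_on {- ln \<rho><..} \<mu>"
    "\<And>\<xi> \<theta>. \<xi> > - ln \<rho> \<Longrightarrow> k (exp (- Complex \<xi> \<theta>)) = exp (- (\<mu> \<xi> + \<i> * \<sigma> * \<theta>))"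
    "\<And>\<xi>. \<xi> > - ln \<rho> \<Longrightarrow> \<mu> (real d * \<xi>) = d * \<mu> \<xi> + c"
proof -
  define x0 where "x0 = - ln \<rho>"
  have x0: "x0 \<ge> 0" using \<rho> by (simp add: x0_def)
  define H where "H = {\<zeta>. Re \<zeta> > x0}"
  have convH: "convex H" unfolding H_def by (rule convex_halfspace_Re_gt)
  have eH: "exp (- \<zeta>) \<in> pdisc \<rho>" if "\<zeta> \<in> H" for \<zeta>
  proof -
    have "exp (- Re \<zeta>) < exp (ln \<rho>)" using that unfolding H_def x0_def by (simp only: exp_less_cancel_iff) simp
    then show ?thesis using \<rho> by simp
  qed
  have "continuous_on H (\<lambda>\<zeta>. k (exp (- \<zeta>)))" by (rule continuous_on_compose2[OF cont]) (use eH in \<open>auto intro!: continuous_intros\<close>)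
  moreover have "k (exp (- \<zeta>)) \<noteq> 0" if "\<zeta> \<in> H" for \<zeta> using nz[OF eH[OF that]] .
  ultimately obtain g where g: "continuous_on H g" "\<And>\<zeta>. \<zeta> \<in> H \<Longrightarrow> k (exp (- \<zeta>)) = exp (g \<zeta>)"
    using continuous_logarithm_on_contractible[OF _ convex_imp_contractible[OF convH], of "\<lambda>\<zeta>. k (exp (- \<zeta>))"] by blast
  define M where "M = (\<lambda>\<zeta>. - g \<zeta>)"
  have M: "continuous_on H M" "\<And>\<zeta>. \<zeta> \<in> H \<Longrightarrow> k (exp (- \<zeta>)) = exp (- M \<zeta>)" using g by (auto simp: M_def intro!: continuous_intros)
  have shift: "\<zeta> + \<i> * of_real t \<in> H \<longleftrightarrow> \<zeta> \<in> H" for \<zeta> t by (simp add: H_def)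
  define \<tau> where "\<tau> = (\<lambda>n. 2 * pi / d ^ n)"
  have d0: "real d > 0" "real d \<ge> 1" using d by auto
  have H0: "of_real (x0 + 1) \<in> H" by (simp add: H_def)
  have ctbl: "countable {v. exp v \<in> root_group d}" using d by (intro countable_exp_vimage countable_root_group) auto
  define \<Delta> where "\<Delta> = (\<lambda>n. M (of_real (x0 + 1) + \<i> * \<tau> n) - M (of_real (x0 + 1)))"
  have step: "M (\<zeta> + \<i> * \<tau> n) = M \<zeta> + \<Delta> n" if \<zeta>: "\<zeta> \<in> H" for \<zeta> n
  proof -
    have "M (\<zeta> + \<i> * \<tau> n) - M \<zeta> = M (of_real (x0 + 1) + \<i> * \<tau> n) - M (of_real (x0 + 1))"
    proof (rule constant_if_countable_range[where A = H and f = "\<lambda>\<zeta>. M (\<zeta> + \<i> * \<tau> n) - M \<zeta>", OF convex_connected[OF convH] _ ctbl])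
      have "continuous_on H (\<lambda>\<zeta>. M (\<zeta> + \<i> * \<tau> n))" by (rule continuous_on_compose2[OF M(1), of H "\<lambda>\<zeta>. \<zeta> + \<i> * \<tau> n"])
          (simp_all add: shift image_subset_iff continuous_on_add)
      then show "continuous_on H (\<lambda>\<zeta>. M (\<zeta> + \<i> * \<tau> n) - M \<zeta>)" by (intro continuous_on_diff M(1))
      fix z assume z: "z \<in> H"
      have om: "exp (- (\<i> * \<tau> n)) \<in> root_group d"
      proof (rule root_groupI[of _ _ n])
        have "exp (- (\<i> * \<tau> n)) ^ (d ^ n) = exp (of_nat (d ^ n) * (- (\<i> * \<tau> n)))" by (simp only: exp_of_nat_mult)
        also have "of_nat (d ^ n) * (- (\<i> * complex_of_real (\<tau> n))) = - (2 * of_real pi * \<i>)" using d0 by (simp add: \<tau>_def field_simps)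
        also have "exp (- (2 * of_real pi * \<i>)) = 1" by (simp add: exp_minus)
        finally show "exp (- (\<i> * \<tau> n)) ^ (d ^ n) = 1" .
      qed
      have e1: "exp (- (z + \<i> * \<tau> n)) = exp (- (\<i> * \<tau> n)) * exp (- z)" by (simp add: algebra_simps flip: exp_add)
      have "z + \<i> * \<tau> n \<in> H" using z shift by blast
      then have e2: "exp (- M (z + \<i> * \<tau> n)) = k (exp (- (\<i> * \<tau> n)) * exp (- z))" using M(2)[of "z + \<i> * \<tau> n"] unfolding e1 by simp
      have e3: "exp (- M z) = k (exp (- z))" using M(2)[OF z] by simp
      have "exp (- (M (z + \<i> * \<tau> n) - M z)) = exp (- M (z + \<i> * \<tau> n)) / exp (- M z)" by (simp flip: exp_diff)
      then have "exp (- (M (z + \<i> * \<tau> n) - M z)) \<in> root_group d" using rot[OF eH[OF z] om] unfolding e2 e3 by simp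
      then have "inverse (exp (- (M (z + \<i> * \<tau> n) - M z))) \<in> root_group d" by (rule root_group_inverse)
      then show "M (z + \<i> * \<tau> n) - M z \<in> {v. exp v \<in> root_group d}" by (simp flip: exp_minus)
    qed (use \<zeta> H0 in auto)
    then show ?thesis by (simp add: \<Delta>_def algebra_simps)
  qed
  have steps: "M (\<zeta> + \<i> * of_real (real j * \<tau> n)) = M \<zeta> + of_nat j * \<Delta> n" if \<zeta>: "\<zeta> \<in> H" for \<zeta> n j
  proof (induction j)
    case (Suc j)
    have "M (\<zeta> + \<i> * of_real (real (Suc j) * \<tau> n)) = M ((\<zeta> + \<i> * of_real (real j * \<tau> n)) + \<i> * \<tau> n)" by (simp add: algebra_simps)
    also have "\<dots> = M (\<zeta> + \<i> * of_real (real j * \<tau> n)) + \<Delta> n" by (rule step) (use shift \<zeta> in blast)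
    finally show ?case using Suc by (simp add: algebra_simps)
  qed simp
  have t0: "\<tau> 0 = 2 * pi" by (simp add: \<tau>_def)
  have "exp (\<Delta> 0) = 1"
  proof -
    let ?z = "complex_of_real (x0 + 1)"
    have "- (?z + \<i> * \<tau> 0) = - ?z - 2 * of_real pi * \<i>" by (simp add: t0)
    then have e1: "exp (- (?z + \<i> * \<tau> 0)) = exp (- ?z)" by (simp only: exp_diff) simp
    have "?z + \<i> * \<tau> 0 \<in> H" using H0 shift by blast
    then have "exp (- M (?z + \<i> * \<tau> 0)) = k (exp (- ?z))" using M(2)[of "?z + \<i> * \<tau> 0"] unfolding e1 by simp
    then have "exp (- M (?z + \<i> * \<tau> 0)) = exp (- M ?z)" using M(2)[OF H0] by simp
    then have "exp (M (?z + \<i> * \<tau> 0)) = exp (M ?z)" by (simp add: exp_minus)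
    then show ?thesis by (simp add: \<Delta>_def exp_diff)
  qed
  then obtain N :: int where "Re (\<Delta> 0) = 0" "Im (\<Delta> 0) = of_int (2 * N) * pi" using exp_eq_1 by blast
  then have N: "\<Delta> 0 = \<i> * (of_int N * of_real (2 * pi))" by (simp add: complex_eq_iff)
  have \<Delta>: "\<Delta> n = \<i> * of_int N * \<tau> n" for n
  proof -
    have e: "real (d ^ n) * \<tau> n = \<tau> 0" using d0 by (simp add: \<tau>_def)
    have "of_nat (d ^ n) * \<Delta> n = \<Delta> 0" using steps[OF H0, of "d ^ n" n] unfolding e by (simp add: \<Delta>_def)
    then have "\<Delta> n = \<Delta> 0 / of_nat (d ^ n)" using d0 by (simp add: field_simps)
    then show ?thesis by (simp add: N \<tau>_def)
  qed
  have rotp: "M (\<zeta> + \<i> * of_real t) = M \<zeta> + \<i> * of_int N * of_real t" if \<zeta>: "\<zeta> \<in> H" and t: "t \<ge> 0" for \<zeta> t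
  proof -
    define j where "j = (\<lambda>n. nat \<lfloor>t / \<tau> n\<rfloor>)"
    define s where "s = (\<lambda>n. real (j n) * \<tau> n)"
    have \<tau>p: "\<tau> n > 0" for n using d0 by (simp add: \<tau>_def)
    have b: "\<bar>s n - t\<bar> \<le> \<tau> n" for n
    proof -
      have "real (j n) = of_int \<lfloor>t / \<tau> n\<rfloor>" using t \<tau>p[of n] by (simp add: j_def)
      then have "real (j n) \<le> t / \<tau> n" "t / \<tau> n < real (j n) + 1" by linarith+
      then have "s n \<le> t" "t < s n + \<tau> n" using \<tau>p[of n] by (auto simp: s_def field_simps)
      then show ?thesis by linarith
    qed
    have "(\<lambda>n. 2 * pi * (1 / real d) ^ n) \<longlonglongrightarrow> 2 * pi * 0" using d by (intro tendsto_intros LIMSEQ_realpow_zero) auto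
    then have "\<tau> \<longlonglongrightarrow> 0" by (simp add: \<tau>_def[abs_def] power_divide)
    have "(\<lambda>n. s n - t) \<longlonglongrightarrow> 0" by (rule Lim_null_comparison[OF _ \<open>\<tau> \<longlonglongrightarrow> 0\<close>]) (simp add: b)
    then have s: "s \<longlonglongrightarrow> t" by (rule LIM_zero_cancel)
    have "(\<lambda>n. M (\<zeta> + \<i> * of_real (s n))) \<longlonglongrightarrow> M (\<zeta> + \<i> * of_real t)"
    proof (rule continuous_on_tendsto_compose[OF M(1)])
      show "(\<lambda>n. \<zeta> + \<i> * of_real (s n)) \<longlonglongrightarrow> \<zeta> + \<i> * of_real t" by (intro tendsto_intros s)
    qed (use \<zeta> shift in auto)
    moreover have "(\<lambda>n. M \<zeta> + \<i> * of_int N * of_real (s n)) \<longlonglongrightarrow> M \<zeta> + \<i> * of_int N * of_real t" by (intro tendsto_intros s)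
    moreover have "M (\<zeta> + \<i> * of_real (s n)) = M \<zeta> + \<i> * of_int N * of_real (s n)" for n
      using steps[OF \<zeta>, of "j n" n] by (simp add: s_def \<Delta> algebra_simps)
    ultimately show ?thesis using LIMSEQ_unique by auto
  qed
  have rotM: "M (\<zeta> + \<i> * of_real t) = M \<zeta> + \<i> * of_int N * of_real t" if \<zeta>: "\<zeta> \<in> H" for \<zeta> t
  proof (cases "t \<ge> 0")
    case False
    have "M ((\<zeta> + \<i> * of_real t) + \<i> * of_real (- t)) = M (\<zeta> + \<i> * of_real t) + \<i> * of_int N * of_real (- t)"
      by (rule rotp) (use False \<zeta> shift in auto)
    then show ?thesis by (simp add: algebra_simps)
  qed (use rotp \<zeta> in auto)
  define \<mu> where "\<mu> = (\<lambda>\<xi>. M (complex_of_real \<xi>))"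
  have form: "k (exp (- Complex \<xi> \<theta>)) = exp (- (\<mu> \<xi> + \<i> * of_int N * of_real \<theta>))" if "\<xi> > x0" for \<xi> \<theta>
  proof -
    have H: "complex_of_real \<xi> \<in> H" using that by (simp add: H_def)
    have "Complex \<xi> \<theta> = of_real \<xi> + \<i> * of_real \<theta>" by (simp add: complex_eq_iff)
    then show ?thesis using M(2)[of "of_real \<xi> + \<i> * of_real \<theta>"] rotM[OF H, of \<theta>] H shift[of "of_real \<xi>" \<theta>] by (simp add: \<mu>_def)
  qed
  have N1: "\<bar>N\<bar> = 1"
  proof (rule ccontr)
    assume N': "\<bar>N\<bar> \<noteq> 1"
    define t where "t = (if N = 0 then pi else 2 * pi / of_int N)"
    have "exp (\<i> * (2 * complex_of_real pi)) = 1" using exp_two_pi_i by (simp add: mult_ac)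
    then have "exp (- (\<i> * of_int N * of_real t)) = 1" by (simp add: t_def exp_minus)
    then have e1: "exp (- (\<mu> (x0 + 1) + \<i> * of_int N * of_real t)) = exp (- \<mu> (x0 + 1))" by (simp only: minus_add_distrib exp_add) simp
    have "k (exp (- Complex (x0 + 1) t)) = k (exp (- Complex (x0 + 1) 0))"
      using form[of "x0 + 1" t] form[of "x0 + 1" 0] unfolding e1 by simp
    moreover have "exp (- Complex (x0 + 1) t) \<in> pdisc \<rho>" "exp (- Complex (x0 + 1) 0) \<in> pdisc \<rho>" by (intro eH; simp add: H_def)+
    ultimately have "exp (- Complex (x0 + 1) t) = exp (- Complex (x0 + 1) 0)" using inj unfolding inj_on_def by blast
    then obtain n :: int where "- Complex (x0 + 1) t = - Complex (x0 + 1) 0 + (of_int (2 * n) * pi) * \<i>" unfolding exp_eq by blast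
    then have tn: "t = - 2 * of_int n * pi" by (simp add: complex_eq_iff)
    show False
    proof (cases "N = 0")
      case True
      then have "pi * of_int (1 + 2 * n) = 0" using tn by (simp add: t_def algebra_simps)
      then have "of_int (1 + 2 * n) = (0::real)" by (simp only: mult_eq_0_iff pi_neq_zero simp_thms)
      then have "1 + 2 * n = 0" by (simp only: of_int_eq_0_iff)
      then show False by presburger
    next
      case False
      then have "pi * of_int (n * N + 1) = 0" using tn by (simp add: t_def field_simps)
      then have "of_int (n * N + 1) = (0::real)" by (simp only: mult_eq_0_iff pi_neq_zero simp_thms)
      then have "n * N + 1 = 0" by (simp only: of_int_eq_0_iff)
      then have "n * N = -1" by simp
      then have "\<bar>N\<bar> = 1" by (metis abs_minus abs_mult abs_1 zmult_eq_1_iff abs_ge_zero mult.commute abs_zmult_eq_1)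
      with N' show False by simp
    qed
  qed
  have cont\<mu>: "continuous_on {x0<..} \<mu>"
    unfolding \<mu>_def by (rule continuous_on_compose2[OF M(1)]) (auto intro!: continuous_intros simp: H_def)
  have bigd: "real d * \<xi> > x0" if "\<xi> > x0" for \<xi>
  proof -
    have "1 * \<xi> \<le> real d * \<xi>" using that x0 d0 by (intro mult_right_mono) auto
    then show ?thesis using that by simp
  qed
  define c where "c = \<mu> (real d * (x0 + 1)) - d * \<mu> (x0 + 1)"
  have hom: "\<mu> (real d * \<xi>) = d * \<mu> \<xi> + c" if \<xi>: "\<xi> > x0" for \<xi>
  proof -
    have "\<mu> (real d * \<xi>) - d * \<mu> \<xi> = \<mu> (real d * (x0 + 1)) - d * \<mu> (x0 + 1)"
    proof (rule constant_if_countable_range[where A = "{x0<..}" and f = "\<lambda>\<xi>. \<mu> (real d * \<xi>) - d * \<mu> \<xi>", OF _ _ ctbl])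
      show "continuous_on {x0<..} (\<lambda>\<xi>. \<mu> (real d * \<xi>) - d * \<mu> \<xi>)"
        by (intro continuous_intros cont\<mu> continuous_on_compose2[OF cont\<mu>]) (use bigd in auto)
      fix x assume "x \<in> {x0<..}"
      then have x: "x > x0" by simp
      have "k (exp (- Complex x 0) ^ d) / k (exp (- Complex x 0)) ^ d \<in> root_group d" by (intro pow eH) (use x in \<open>simp add: H_def\<close>)
      moreover have "exp (- Complex x 0) ^ d = exp (- Complex (real d * x) 0)"
        by (simp add: complex_eq_iff flip: exp_of_nat_mult) (simp add: complex_of_real_def[symmetric] Complex_eq exp_minus)
      ultimately have "exp (- \<mu> (real d * x)) / exp (- \<mu> x) ^ d \<in> root_group d"
        using form[of x 0] form[of "real d * x" 0] bigd[OF x] x by simp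
      then have "exp (- (\<mu> (real d * x) - d * \<mu> x)) \<in> root_group d" by (simp add: exp_diff exp_minus field_simps flip: exp_of_nat_mult)
      then have "inverse (exp (- (\<mu> (real d * x) - d * \<mu> x))) \<in> root_group d" by (rule root_group_inverse)
      then show "\<mu> (real d * x) - d * \<mu> x \<in> {v. exp v \<in> root_group d}" by (simp flip: exp_minus)
    qed (use \<xi> in auto)
    then show ?thesis by (simp add: c_def algebra_simps)
  qed
  show ?thesis
  proof (rule that[of "of_int N" \<mu> c])
    show "real_of_int N = 1 \<or> real_of_int N = -1" using N1 by linarith
    show "continuous_on {- ln \<rho><..} \<mu>" using cont\<mu> by (simp add: x0_def)
  qed (use form hom in \<open>auto simp: x0_def\<close>)
qed

lemma affine_if_asymptotically_translation:
  fixes \<mu> :: "real \<Rightarrow> complex" and d :: nat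
  assumes d: "d \<ge> 2" and X0: "X0 \<ge> 0" and cont: "continuous_on {X0<..} \<mu>"
    and hom: "\<And>x. x > X0 \<Longrightarrow> \<mu> (real d * x) = d * \<mu> x + c"
    and K: "K > 0" and lim: "((\<lambda>X. \<mu> (X + K) - \<mu> X) \<longlongrightarrow> C) at_top"
  obtains \<kappa> m where "\<And>x. x > X0 \<Longrightarrow> \<mu> x = \<kappa> * of_real x + m"
proof -
  have d1: "real d \<ge> 1" using d by simp
  have dn: "real d ^ n \<ge> 1" for n using d1 by simp
  have big: "real (d ^ n) * x > X0" if "x > X0" for n and x :: real
  proof -
    have "1 * x \<le> real (d ^ n) * x" using dn[of n] that X0 by (intro mult_right_mono) auto
    then show ?thesis using that by simp
  qed
  define cn where "cn = rec_nat 0 (\<lambda>n a. of_nat d * a + c)"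
  have homn: "\<mu> (real (d ^ n) * x) = d ^ n * \<mu> x + cn n" if "x > X0" for n and x :: real
  proof (induction n)
    case (Suc n)
    have "\<mu> (real (d ^ Suc n) * x) = \<mu> (real d * (real (d ^ n) * x))" by (simp add: mult_ac)
    also have "\<dots> = d * \<mu> (real (d ^ n) * x) + c" using hom[of "real (d ^ n) * x"] big[OF that, of n] by simp
    finally show ?case using Suc by (simp add: cn_def algebra_simps)
  qed (simp add: cn_def)
  have main: "\<mu> (x + y) - \<mu> x = of_real y * C / of_real K" if x: "x > X0" and y: "y \<ge> 0" for x y
  proof -
    define J where "J = (\<lambda>n. nat \<lfloor>d ^ n * y / K\<rfloor>)"
    define t where "t = (\<lambda>n. real (J n) * K / d ^ n)"
    have JK: "real (J n) \<le> d ^ n * y / K" "d ^ n * y / K < real (J n) + 1" for n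
    proof -
      have "d ^ n * y / K \<ge> 0" using y K by simp
      then have "real (J n) = of_int \<lfloor>d ^ n * y / K\<rfloor>" by (simp add: J_def)
      then show "real (J n) \<le> d ^ n * y / K" "d ^ n * y / K < real (J n) + 1" by linarith+
    qed
    have tb: "\<bar>t n - y\<bar> \<le> K * (1 / d) ^ n" and ty: "t n \<ge> 0" "t n \<le> y" for n
    proof -
      have "t n \<le> y" "y < t n + K / d ^ n" using JK[of n] K d1 by (auto simp: t_def field_simps)
      then show "\<bar>t n - y\<bar> \<le> K * (1 / d) ^ n" "t n \<le> y" by (auto simp: power_divide)
      show "t n \<ge> 0" using K by (simp add: t_def)
    qed
    have t0: "(\<lambda>n. K * (1 / real d) ^ n) \<longlonglongrightarrow> 0" using d by (intro tendsto_mult_right_zero LIMSEQ_realpow_zero) auto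
    have "(\<lambda>n. t n - y) \<longlonglongrightarrow> 0" by (rule Lim_null_comparison[OF _ t0]) (simp add: tb)
    then have t: "t \<longlonglongrightarrow> y" by (rule LIM_zero_cancel)
    have l1: "(\<lambda>n. \<mu> (x + t n) - \<mu> x) \<longlonglongrightarrow> \<mu> (x + y) - \<mu> x"
    proof (intro tendsto_intros continuous_on_tendsto_compose[OF cont] t)
      show "x + y \<in> {X0<..}" using x y by auto
      have "x + t n > X0" for n using x ty(1)[of n] by linarith
      then show "\<forall>\<^sub>F n in sequentially. x + t n \<in> {X0<..}" by auto
    qed
    have "(\<lambda>n. \<mu> (x + t n) - \<mu> x - of_real (t n) * C / of_real K) \<longlonglongrightarrow> 0"
    proof (rule tendstoI)
      fix e :: real assume e: "e > 0"
      define e' where "e' = e / (y / K + 1)"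
      have e': "e' > 0" "e' * (y / K) < e" using e y K by (auto simp: e'_def field_simps intro!: divide_pos_pos add_nonneg_pos)
      from tendstoD[OF lim e'(1)] obtain B where B: "\<And>X. X \<ge> B \<Longrightarrow> dist (\<mu> (X + K) - \<mu> X) C < e'"
        unfolding eventually_at_top_linorder by blast
      have "x > 0" using x X0 by simp
      have "filterlim (\<lambda>n. real d ^ n * x) at_top sequentially"
        using filterlim_at_top_mult_tendsto_pos[OF tendsto_const \<open>x > 0\<close> filterlim_at_infinity_imp_norm_at_top[OF filterlim_realpow_sequentially_gt1[of "real d"], unfolded norm_power real_norm_def abs_of_nat]] d
        by simp
      then have "\<forall>\<^sub>F n in sequentially. real d ^ n * x \<ge> B" unfolding filterlim_at_top by blast
      then show "\<forall>\<^sub>F n in sequentially. dist (\<mu> (x + t n) - \<mu> x - of_real (t n) * C / of_real K) 0 < e"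
      proof eventually_elim
        case (elim n)
        define Z where "Z = real d ^ n * x"
        have dnz: "(of_nat d :: complex) ^ n \<noteq> 0" using d by simp
        have "x + t n > X0" using x ty(1)[of n] by linarith
        have eq: "\<mu> (real (d ^ n) * (x + t n)) - \<mu> (real (d ^ n) * x) = of_nat d ^ n * (\<mu> (x + t n) - \<mu> x)"
          using homn[OF \<open>x + t n > X0\<close>, of n] homn[OF x, of n] by (simp add: algebra_simps)
        have a: "real (d ^ n) * (x + t n) = Z + real (J n) * K" using d1 by (simp add: Z_def t_def field_simps)
        have "\<mu> (Z + real (J n) * K) - \<mu> Z - of_nat (J n) * C = (\<Sum>i<J n. \<mu> (Z + real i * K + K) - \<mu> (Z + real i * K) - C)"
        proof -
          have "(\<Sum>i<J. \<mu> (Z + real i * K + K) - \<mu> (Z + real i * K) - C) = \<mu> (Z + real J * K) - \<mu> Z - of_nat J * C" for J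
            by (induction J) (auto simp: algebra_simps)
          then show ?thesis by simp
        qed
        also have "cmod \<dots> \<le> (\<Sum>i<J n. e')"
        proof (rule sum_norm_le)
          fix i
          have "Z + real i * K \<ge> B" using elim K by (simp add: Z_def add_increasing2)
          from B[OF this] show "cmod (\<mu> (Z + real i * K + K) - \<mu> (Z + real i * K) - C) \<le> e'" by (simp add: dist_norm less_imp_le)
        qed
        finally have "cmod (\<mu> (Z + real (J n) * K) - \<mu> Z - of_nat (J n) * C) \<le> real (J n) * e'" by simp
        moreover have "\<mu> (Z + real (J n) * K) - \<mu> Z - of_nat (J n) * C =
            of_nat d ^ n * (\<mu> (x + t n) - \<mu> x - of_real (t n) * C / of_real K)"
        proof -
          have "of_nat d ^ n * (of_real (t n) * C / of_real K) = of_nat (J n) * C" using dnz K by (simp add: t_def)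
          then show ?thesis using eq a by (simp add: Z_def algebra_simps)
        qed
        ultimately have "real d ^ n * cmod (\<mu> (x + t n) - \<mu> x - of_real (t n) * C / of_real K) \<le> real (J n) * e'"
          by (simp add: norm_mult norm_power)
        also have "\<dots> \<le> (d ^ n * y / K) * e'" using JK[of n] e' by (intro mult_right_mono) auto
        also have "\<dots> = real d ^ n * (e' * (y / K))" by simp
        finally have "cmod (\<mu> (x + t n) - \<mu> x - of_real (t n) * C / of_real K) \<le> e' * (y / K)" by (rule mult_left_le_imp_le) (use d in simp)
        with e'(2) show ?case by simp
      qed
    qed
    moreover have "(\<lambda>n. \<mu> (x + t n) - \<mu> x - of_real (t n) * C / of_real K) \<longlonglongrightarrow> \<mu> (x + y) - \<mu> x - of_real y * C / of_real K"
      using K by (intro tendsto_diff l1 tendsto_intros t) auto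
    ultimately have "\<mu> (x + y) - \<mu> x - of_real y * C / of_real K = 0" by (rule LIMSEQ_unique[rotated])
    then show ?thesis by simp
  qed
  show ?thesis
  proof (rule that[of "C / of_real K" "\<mu> (X0 + 1) - of_real (X0 + 1) * C / of_real K"])
    fix x assume x: "x > X0"
    show "\<mu> x = C / of_real K * of_real x + (\<mu> (X0 + 1) - of_real (X0 + 1) * C / of_real K)"
    proof (cases "x \<ge> X0 + 1")
      case True
      then show ?thesis using main[of "X0 + 1" "x - (X0 + 1)"] by (simp add: algebra_simps diff_divide_distrib add_divide_distrib)
    next
      case False
      then show ?thesis using main[of x "X0 + 1 - x"] x by (simp add: algebra_simps diff_divide_distrib add_divide_distrib)
    qed
  qed
qed

lemma imaginary_on_sphere_constant:
  assumes r: "0 < r" and cont: "continuous_on (cball 0 r) f" and hol: "f holomorphic_on ball 0 r"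
    and im: "\<And>u. cmod u = r \<Longrightarrow> Re (f u) = 0" and z: "z \<in> ball 0 r"
  shows "f z = f 0"
proof -
  have fr: "frontier (ball 0 r) = {u::complex. cmod u = r}" using r by (simp add: frontier_ball sphere_def)
  have "Re (f z) = 0" if z: "z \<in> ball 0 r" for z
  proof -
    have "cmod (exp (f z)) \<le> 1" by (rule maximum_modulus_frontier[where S = "ball 0 r"])
        (use z r cont hol im fr in \<open>auto intro!: holomorphic_intros continuous_intros\<close>)
    moreover have "cmod (exp (- f z)) \<le> 1" by (rule maximum_modulus_frontier[where S = "ball 0 r"])
        (use z r cont hol im fr in \<open>auto intro!: holomorphic_intros continuous_intros\<close>)
    ultimately show ?thesis by simp
  qed
  then have *: "f ` ball 0 r \<subseteq> {w. Re w = 0}" by auto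
  have "f constant_on ball 0 r"
  proof (rule ccontr)
    assume "\<not> f constant_on ball 0 r"
    then have "open (f ` ball 0 r)" using open_mapping_thm[OF hol _ _ _ subset_refl] by auto
    moreover have "f 0 \<in> f ` ball 0 r" using r by auto
    ultimately obtain e where e: "e > 0" "ball (f 0) e \<subseteq> f ` ball 0 r" by (meson openE)
    have "f 0 + of_real (e / 2) \<in> ball (f 0) e" using e by (simp add: dist_norm)
    then have "f 0 + of_real (e / 2) \<in> {w. Re w = 0}" using e(2) * by blast
    moreover have "f 0 \<in> {w. Re w = 0}" using subsetD[OF *, of "f 0"] r by simp
    ultimately show False using e by simp
  qed
  then show ?thesis using z r by (metis centre_in_ball constant_on_def)
qed

lemma Re_zero_on_sphere:
  fixes r \<rho> :: real
  assumes r: "0 < r" and hol: "G holomorphic_on ball 0 \<rho>" and r': "r < \<rho>" and G0: "G 0 = 0"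
  obtains \<theta> where "Re (G (r * exp (- (\<i> * of_real \<theta>)))) = 0"
proof -
  have sub: "cball 0 r \<subseteq> ball (0::complex) \<rho>" using r' by auto
  have c: "continuous_on (cball 0 r) G" using hol sub holomorphic_on_imp_continuous_on continuous_on_subset by blast
  have h: "G holomorphic_on ball 0 r" using hol r' by (auto elim!: holomorphic_on_subset)
  have "\<exists>u. cmod u = r \<and> Re (G u) = 0"
  proof (rule ccontr)
    assume "\<not> ?thesis"
    then have nz: "Re (G u) \<noteq> 0" if "cmod u = r" for u using that by blast
    have cs: "continuous_on (sphere 0 r) (\<lambda>u. Re (G u))" by (intro continuous_intros continuous_on_subset[OF c]) auto
    have comp: "compact (sphere (0::complex) r)" "sphere (0::complex) r \<noteq> {}" using r by auto
    have conn: "connected (sphere (0::complex) r)" by (rule connected_sphere) simp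
    have key: False if f: "continuous_on (cball 0 r) f" "f holomorphic_on ball 0 r" "f 0 = 0"
      "\<And>u. u \<in> sphere 0 r \<Longrightarrow> Re (f u) < 0" for f
    proof -
      have "continuous_on (sphere 0 r) (\<lambda>u. Re (f u))" by (intro continuous_intros continuous_on_subset[OF f(1)]) auto
      then obtain u0 where u0: "u0 \<in> sphere 0 r" "\<And>u. u \<in> sphere 0 r \<Longrightarrow> Re (f u) \<le> Re (f u0)" using continuous_attains_sup[OF comp] by blast
      have "cmod (exp (f 0)) \<le> exp (Re (f u0))" by (rule maximum_modulus_frontier[where S = "ball 0 r"])
          (use r u0 f in \<open>auto intro!: holomorphic_intros continuous_intros simp: frontier_ball\<close>)
      then show False using f(3) f(4)[OF u0(1)] by simp
    qed
    show False
    proof (cases "Re (G (of_real r)) < 0")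
      case True
      have "Re (G u) < 0" if u: "u \<in> sphere 0 r" for u
      proof (rule ccontr)
        assume "\<not> ?thesis"
        then have "0 \<in> closed_segment (Re (G (of_real r))) (Re (G u))" using True by (auto simp: closed_segment_eq_real_ivl)
        also have "\<dots> \<subseteq> (\<lambda>u. Re (G u)) ` sphere 0 r"
          by (rule closed_segment_subset) (use connected_continuous_image[OF cs conn] u r in \<open>auto simp: is_interval_connected_1 is_interval_convex\<close>)
        finally show False using nz by auto
      qed
      then show False using key[OF c h G0] by blast
    next
      case False
      have "Re (- G u) < 0" if u: "u \<in> sphere 0 r" for u
      proof (rule ccontr)
        assume "\<not> ?thesis"
        then have "0 \<in> closed_segment (Re (G (of_real r))) (Re (G u))" using False by (auto simp: closed_segment_eq_real_ivl)
        also have "\<dots> \<subseteq> (\<lambda>u. Re (G u)) ` sphere 0 r"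
          by (rule closed_segment_subset) (use connected_continuous_image[OF cs conn] u r in \<open>auto simp: is_interval_connected_1 is_interval_convex\<close>)
        finally show False using nz by auto
      qed
      then show False using key[of "\<lambda>u. - G u"] c h G0 by (auto intro!: continuous_intros holomorphic_intros)
    qed
  qed
  then obtain u where u: "cmod u = r" "Re (G u) = 0" by blast
  have "u = r * exp (- (\<i> * of_real (- Arg u)))" using Arg_eq[of u] u r by force
  then show ?thesis using that[of "- Arg u"] u by simp
qed

lemma real_linear_boundary_values:
  fixes \<kappa> :: complex
  assumes hol: "G holomorphic_on ball 0 \<rho>" and r: "0 < r" "r < \<rho>" and G0: "G 0 = 0"
    and H: "H holomorphic_on ball 0 r" "continuous_on (cball 0 r) H"
    and eq: "\<And>u. cmod u = r \<Longrightarrow> \<kappa> * Re (G u) + \<i> * Im (G u) = H u"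
    and \<kappa>: "\<kappa> \<noteq> 1" and z: "z \<in> ball 0 r"
  shows "G z = 0"
proof -
  have c: "continuous_on (cball 0 r) G" using hol r holomorphic_on_imp_continuous_on[OF hol] by (auto elim!: continuous_on_subset)
  have h: "G holomorphic_on ball 0 r" using hol r by (auto elim!: holomorphic_on_subset)
  define J where "J = (\<lambda>u. (2 * H u - (\<kappa> + 1) * G u) / (\<kappa> - 1))"
  have J: "J u = cnj (G u)" if "cmod u = r" for u
  proof -
    have "2 * H u = \<kappa> * (G u + cnj (G u)) + (G u - cnj (G u))"
      unfolding eq[OF that, symmetric] by (simp add: complex_add_cnj complex_diff_cnj algebra_simps)
    then have "2 * H u - (\<kappa> + 1) * G u = (\<kappa> - 1) * cnj (G u)" by (simp add: algebra_simps)
    then show ?thesis using \<kappa> by (simp add: J_def)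
  qed
  have cJ: "continuous_on (cball 0 r) J" unfolding J_def using \<kappa> by (intro continuous_intros c H) auto
  have hJ: "J holomorphic_on ball 0 r" unfolding J_def using \<kappa> by (intro holomorphic_intros h H) auto
  have "G z - J z = G 0 - J 0" by (rule imaginary_on_sphere_constant[OF r(1) _ _ _ z, of "\<lambda>u. G u - J u"])
      (auto intro!: continuous_intros holomorphic_intros c h cJ hJ simp: J)
  moreover have "\<i> * (G z + J z) = \<i> * (G 0 + J 0)" by (rule imaginary_on_sphere_constant[OF r(1) _ _ _ z, of "\<lambda>u. \<i> * (G u + J u)"])
      (auto intro!: continuous_intros holomorphic_intros c h cJ hJ simp: J)
  then have "G z + J z = G 0 + J 0" by (simp only: mult_cancel_left complex_i_not_zero simp_thms)
  ultimately have "(G z - J z) + (G z + J z) = (G 0 - J 0) + (G 0 + J 0)" by simp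
  then show ?thesis using G0 by simp
qed


text \<open>The functions \<open>k\<close> and \<open>l\<close> commute with a dense group of rotations in two different
  coordinates, \<open>v\<close> and \<open>K v exp (G v)\<close>. Lifted to logarithms they are determined by functions of
  one real variable; iteration of \<open>v \<mapsto> v ^ d\<close> forces those to be affine, because \<open>K\<close> has
  modulus different from 1, and \<open>G \<noteq> 0\<close> forces the slope to be 1.\<close>
lemma two_coordinate_rigidity:
  fixes k l G G' :: "complex \<Rightarrow> complex" and d :: nat and \<rho> \<rho>' :: real
  assumes d: "d \<ge> 2" and \<rho>: "0 < \<rho>" "\<rho> \<le> 1"
    and k: "continuous_on (pdisc \<rho>) k" "inj_on k (pdisc \<rho>)"
      "\<And>v. v \<in> pdisc \<rho> \<Longrightarrow> k v \<noteq> 0"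
      "\<And>v \<omega>. v \<in> pdisc \<rho> \<Longrightarrow> \<omega> \<in> root_group d \<Longrightarrow> k (\<omega> * v) / k v \<in> root_group d"
      "\<And>v. v \<in> pdisc \<rho> \<Longrightarrow> k (v ^ d) / k v ^ d \<in> root_group d"
    and l: "continuous_on (pdisc \<rho>) l" "inj_on l (pdisc \<rho>)"
      "\<And>v. v \<in> pdisc \<rho> \<Longrightarrow> l v \<noteq> 0"
      "\<And>v \<omega>. v \<in> pdisc \<rho> \<Longrightarrow> \<omega> \<in> root_group d \<Longrightarrow> l (\<omega> * v) / l v \<in> root_group d"
      "\<And>v. v \<in> pdisc \<rho> \<Longrightarrow> l (v ^ d) / l v ^ d \<in> root_group d"
    and klim: "(k \<longlongrightarrow> 0) (at 0)"
    and G: "G holomorphic_on ball 0 \<rho>" "G 0 = 0"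
    and G': "G' holomorphic_on ball 0 \<rho>'" "G' 0 = 0" "0 < \<rho>'"
    and K: "K \<noteq> 0" "cmod K < 1" "K' \<noteq> 0"
    and rel: "\<forall>\<^sub>F v in at 0. l (K * v * exp (G v)) = K' * k v * exp (G' (k v))"
    and nontriv: "\<And>r. r > 0 \<Longrightarrow> \<exists>v \<in> ball 0 r. G v \<noteq> 0"
  obtains C D where "C \<noteq> 0" "D \<noteq> 0"
    "(\<forall>v \<in> pdisc \<rho>. k v = C * v \<and> l v = D * v) \<or> (\<forall>v \<in> pdisc \<rho>. k v = C * cnj v \<and> l v = D * cnj v)"
proof -
  define x0 where "x0 = - ln \<rho>"
  have x0: "x0 \<ge> 0" using \<rho> by (simp add: x0_def)
  obtain \<sigma> :: real and \<mu> :: "real \<Rightarrow> complex" and c :: complex where \<sigma>: "\<sigma> = 1 \<or> \<sigma> = -1" and c\<mu>: "continuous_on {x0<..} \<mu>"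
    and kf: "\<And>\<xi> \<theta>. \<xi> > x0 \<Longrightarrow> k (exp (- Complex \<xi> \<theta>)) = exp (- (\<mu> \<xi> + \<i> * \<sigma> * of_real \<theta>))"
    and \<mu>d: "\<And>\<xi>. \<xi> > x0 \<Longrightarrow> \<mu> (real d * \<xi>) = d * \<mu> \<xi> + c" by (rule equivariant_lift[OF d \<rho> k, folded x0_def]; (rule that)?; assumption)
  obtain \<sigma>' :: real and \<nu> :: "real \<Rightarrow> complex" and c' :: complex where \<sigma>': "\<sigma>' = 1 \<or> \<sigma>' = -1" and c\<nu>: "continuous_on {x0<..} \<nu>"
    and lf: "\<And>\<xi> \<theta>. \<xi> > x0 \<Longrightarrow> l (exp (- Complex \<xi> \<theta>)) = exp (- (\<nu> \<xi> + \<i> * \<sigma>' * \<theta>))"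
    and \<nu>d: "\<And>\<xi>. \<xi> > x0 \<Longrightarrow> \<nu> (real d * \<xi>) = d * \<nu> \<xi> + c'" by (rule equivariant_lift[OF d \<rho> l, folded x0_def]; (rule that)?; assumption)
  define \<alpha> where "\<alpha> = - Ln K"
  have \<alpha>K: "exp (- \<alpha>) = K" using K by (simp add: \<alpha>_def)
  define a where "a = Re \<alpha>" define b where "b = Im \<alpha>"
  have \<alpha>ab: "\<alpha> = Complex a b" by (simp add: a_def b_def)
  have a: "a > 0" using K by (simp add: a_def \<alpha>_def)
  define \<beta> where "\<beta> = - Ln K'"
  have \<beta>K: "exp (- \<beta>) = K'" using K by (simp add: \<beta>_def)
  have "isCont G 0" by (rule field_differentiable_imp_continuous_at, rule holomorphic_on_imp_differentiable_at[OF G(1)]) (use \<rho> in auto)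
  then have G_lim: "(G \<longlongrightarrow> 0) (at 0)" using G(2) by (simp add: isCont_def)
  have "isCont G' 0" by (rule field_differentiable_imp_continuous_at, rule holomorphic_on_imp_differentiable_at[OF G'(1)]) (use G' in auto)
  then have G'_lim: "((\<lambda>v. G' (k v)) \<longlongrightarrow> 0) (at 0)" using isCont_tendsto_compose[OF _ klim] G'(2) by metis
  have "\<forall>\<^sub>F v in at 0. cmod (k v) < \<rho>'" using tendstoD[OF klim G'(3)] by simp
  then have "\<forall>\<^sub>F v in at 0. l (K * v * exp (G v)) = K' * k v * exp (G' (k v)) \<and> cmod (k v) < \<rho>' \<and> cmod (G v) < 1 \<and> v \<in> ball 0 \<rho>"
    using rel tendstoD[OF G_lim zero_less_one] eventually_at_ball[OF \<rho>(1), of 0 UNIV] by eventually_elim auto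
  then obtain \<delta> where \<delta>: "\<delta> > 0" "\<And>v. v \<noteq> 0 \<Longrightarrow> cmod v < \<delta> \<Longrightarrow>
     l (K * v * exp (G v)) = K' * k v * exp (G' (k v)) \<and> cmod (k v) < \<rho>' \<and> cmod (G v) < 1 \<and> v \<in> ball 0 \<rho>"
    unfolding eventually_at by (auto simp: dist_norm)
  define x1 where "x1 = max (x0 + 1) (- ln \<delta>)"
  define V where "V = (\<lambda>\<xi> \<theta>. exp (- Complex \<xi> \<theta>))"
  have V: "V \<xi> \<theta> \<noteq> 0" "cmod (V \<xi> \<theta>) = exp (- \<xi>)" for \<xi> \<theta> by (auto simp: V_def)
  have Vs: "cmod (V \<xi> \<theta>) < \<delta>" if "\<xi> > x1" for \<xi> \<theta>
  proof -
    have "exp (- \<xi>) < exp (ln \<delta>)" using that by (simp only: exp_less_cancel_iff) (simp add: x1_def)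
    then show ?thesis using \<delta> V by simp
  qed
  note V\<delta> = \<delta>(2)[OF V(1) Vs]
  define S where "S = (\<lambda>\<zeta>. \<zeta> + \<alpha> - G (exp (- \<zeta>)))"
  define H where "H = {\<zeta>. Re \<zeta> > x1}"
  have convH: "convex H" unfolding H_def by (rule convex_halfspace_Re_gt)
  have VC: "exp (- \<zeta>) = V (Re \<zeta>) (Im \<zeta>)" for \<zeta> by (simp add: V_def)
  have inB: "exp (- \<zeta>) \<in> pdisc \<rho>" "k (exp (- \<zeta>)) \<in> ball 0 \<rho>'" if "\<zeta> \<in> H" for \<zeta>
    using V\<delta>[of "Re \<zeta>" "Im \<zeta>"] V(1) that unfolding VC H_def by simp_all
  have ReS: "Re (S \<zeta>) > x0" if "\<zeta> \<in> H" for \<zeta>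
  proof -
    have "cmod (G (exp (- \<zeta>))) < 1" using V\<delta>[of "Re \<zeta>" "Im \<zeta>"] that unfolding VC H_def by blast
    then have "Re (G (exp (- \<zeta>))) < 1" using complex_Re_le_cmod[of "G (exp (- \<zeta>))"] by linarith
    then show ?thesis using that a by (simp add: S_def H_def x1_def a_def)
  qed
  have cG: "continuous_on H (\<lambda>\<zeta>. G (exp (- \<zeta>)))"
  proof (rule continuous_on_compose2[OF holomorphic_on_imp_continuous_on[OF G(1)]])
    show "(\<lambda>\<zeta>. exp (- \<zeta>)) ` H \<subseteq> ball 0 \<rho>" using inB(1) by (intro image_subsetI) (metis DiffD1)
  qed (intro continuous_intros)
  have cS: "continuous_on H S" unfolding S_def by (intro continuous_intros cG)
  have cG': "continuous_on H (\<lambda>\<zeta>. G' (k (exp (- \<zeta>))))"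
  proof (rule continuous_on_compose2[OF holomorphic_on_imp_continuous_on[OF G'(1)]])
    show "(\<lambda>\<zeta>. k (exp (- \<zeta>))) ` H \<subseteq> ball 0 \<rho>'" by (intro image_subsetI inB(2))
    show "continuous_on H (\<lambda>\<zeta>. k (exp (- \<zeta>)))"
    proof (rule continuous_on_compose2[OF k(1)])
      show "(\<lambda>\<zeta>. exp (- \<zeta>)) ` H \<subseteq> pdisc \<rho>" by (intro image_subsetI inB(1))
    qed (intro continuous_intros)
  qed
  define E where "E = (\<lambda>\<zeta>. \<nu> (Re (S \<zeta>)) + \<i> * \<sigma>' * (Im (S \<zeta>))
     - (\<beta> + \<mu> (Re \<zeta>) + \<i> * \<sigma> * (Im \<zeta>) - G' (k (exp (- \<zeta>)))))"
  have E1: "exp (E \<zeta>) = 1" if \<zeta>: "\<zeta> \<in> H" for \<zeta>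
  proof -
    have \<xi>: "Re \<zeta> > x1" "Re \<zeta> > x0" using \<zeta> by (auto simp: H_def x1_def)
    have "K * exp (- \<zeta>) * exp (G (exp (- \<zeta>))) = exp (- S \<zeta>)"
    proof -
      have "- S \<zeta> = - \<alpha> + - \<zeta> + G (exp (- \<zeta>))" by (simp add: S_def)
      then show ?thesis by (simp only: exp_add \<alpha>K)
    qed
    also have "- S \<zeta> = - Complex (Re (S \<zeta>)) (Im (S \<zeta>))" by simp
    finally have "l (K * exp (- \<zeta>) * exp (G (exp (- \<zeta>)))) = exp (- (\<nu> (Re (S \<zeta>)) + \<i> * \<sigma>' * (Im (S \<zeta>))))"
      using lf[OF ReS[OF \<zeta>], of "Im (S \<zeta>)"] by simp
    moreover have "l (K * exp (- \<zeta>) * exp (G (exp (- \<zeta>)))) = K' * k (exp (- \<zeta>)) * exp (G' (k (exp (- \<zeta>))))"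
      using V\<delta>[OF \<xi>(1), of "Im \<zeta>"] unfolding VC by blast
    moreover have "k (exp (- \<zeta>)) = exp (- (\<mu> (Re \<zeta>) + \<i> * \<sigma> * (Im \<zeta>)))" using kf[OF \<xi>(2), of "Im \<zeta>"] by simp
    ultimately have eq: "exp (- (\<nu> (Re (S \<zeta>)) + \<i> * \<sigma>' * (Im (S \<zeta>)))) =
       exp (- \<beta>) * exp (- (\<mu> (Re \<zeta>) + \<i> * \<sigma> * (Im \<zeta>))) * exp (G' (k (exp (- \<zeta>))))" unfolding \<beta>K by simp
    have "exp (E \<zeta>) = exp (- \<beta>) * exp (- (\<mu> (Re \<zeta>) + \<i> * \<sigma> * (Im \<zeta>))) * exp (G' (k (exp (- \<zeta>))))
       / exp (- (\<nu> (Re (S \<zeta>)) + \<i> * \<sigma>' * (Im (S \<zeta>))))"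
    proof -
      have "E \<zeta> = - \<beta> + - (\<mu> (Re \<zeta>) + \<i> * \<sigma> * (Im \<zeta>)) + G' (k (exp (- \<zeta>)))
        - - (\<nu> (Re (S \<zeta>)) + \<i> * \<sigma>' * (Im (S \<zeta>)))" by (simp add: E_def)
      then show ?thesis by (simp only: exp_add exp_diff)
    qed
    then show ?thesis unfolding eq by simp
  qed
  have cE: "continuous_on H E" unfolding E_def
  proof (intro continuous_intros cG' cS)
    show "continuous_on H (\<lambda>\<zeta>. \<nu> (Re (S \<zeta>)))" by (rule continuous_on_compose2[OF c\<nu>]) (use ReS in \<open>auto intro!: continuous_intros cS\<close>)
    show "continuous_on H (\<lambda>\<zeta>. \<mu> (Re \<zeta>))" by (rule continuous_on_compose2[OF c\<mu>]) (auto intro!: continuous_intros simp: H_def x1_def)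
  qed
  define e0 where "e0 = E (of_real (x1 + 1))"
  have E0: "E \<zeta> = e0" if "\<zeta> \<in> H" for \<zeta> unfolding e0_def
    by (rule constant_if_countable_range[where A = H and C = "{v. exp v \<in> {1}}", OF convex_connected[OF convH] cE])
      (use E1 that in \<open>auto simp: H_def intro: countable_exp_vimage[of "{1}", simplified]\<close>)
  define \<beta>' where "\<beta>' = \<beta> + e0"
  have star: "\<nu> (\<xi> + a - Re (G (V \<xi> \<theta>))) + \<i> * \<sigma>' * of_real (\<theta> + b - Im (G (V \<xi> \<theta>)))
     = \<beta>' + \<mu> \<xi> + \<i> * \<sigma> * of_real \<theta> - G' (k (V \<xi> \<theta>))" if "\<xi> > x1" for \<xi> \<theta>
  proof -
    have "Complex \<xi> \<theta> \<in> H" using that by (simp add: H_def)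
    from E0[OF this] show ?thesis by (simp add: E_def S_def \<beta>'_def V_def a_def b_def algebra_simps)
  qed
  have \<sigma>\<sigma>: "\<sigma>' = \<sigma>"
  proof -
    have Veq: "V (x1 + 1) (2 * pi) = V (x1 + 1) 0"
    proof -
      have "- Complex (x1 + 1) (2 * pi) = - Complex (x1 + 1) 0 - 2 * of_real pi * \<i>" by (simp add: complex_eq_iff)
      then show ?thesis unfolding V_def by (simp only: exp_diff) simp
    qed
    have aux: "A - A0 = C - C0" if "N + A = B + C - g" "N + A0 = B + C0 - g" for N A A0 B C C0 g :: complex using that by algebra
    have "x1 + 1 > x1" by simp
    from aux[OF star[OF this, of "2 * pi", unfolded Veq] star[OF this, of 0]]
    have "\<i> * \<sigma>' * of_real (2 * pi) = \<i> * \<sigma> * of_real (2 * pi)" by (simp add: algebra_simps)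
    then show ?thesis by simp
  qed
  have limG: "((\<lambda>v. \<i> * \<sigma> * (Im (G v)) - G' (k v)) \<longlongrightarrow> \<i> * \<sigma> * (Im 0) - 0) (at 0)" by (intro tendsto_intros G_lim G'_lim)
  define C where "C = \<beta>' - \<i> * \<sigma> * of_real b"
  have lim1: "((\<lambda>\<xi>. \<nu> (\<xi> + a) - \<mu> \<xi>) \<longlongrightarrow> C) at_top"
  proof (rule tendstoI)
    fix e :: real assume "e > 0"
    from tendstoD[OF limG this] obtain t where t: "t > 0"
      "\<And>v. v \<noteq> 0 \<Longrightarrow> cmod v < t \<Longrightarrow> cmod (\<i> * \<sigma> * (Im (G v)) - G' (k v)) < e" unfolding eventually_at by (auto simp: dist_norm)
    show "\<forall>\<^sub>F \<xi> in at_top. dist (\<nu> (\<xi> + a) - \<mu> \<xi>) C < e" using eventually_gt_at_top[of x1] eventually_gt_at_top[of "- ln t"]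
    proof eventually_elim
      case (elim \<xi>)
      have \<xi>\<rho>: "exp (- \<xi>) < \<rho>" using V\<delta>[OF elim(1), of 0] V(2)[of \<xi> 0] by simp
      obtain \<theta> where \<theta>: "Re (G (exp (- \<xi>) * exp (- (\<i> * of_real \<theta>)))) = 0" using Re_zero_on_sphere[OF _ G(1) \<xi>\<rho> G(2)] by (metis exp_gt_zero)
      have Veq: "V \<xi> \<theta> = exp (- \<xi>) * exp (- (\<i> * of_real \<theta>))" by (simp add: V_def Complex_eq exp_of_real[symmetric] flip: exp_add)
      have "exp (- \<xi>) < exp (ln t)" using elim(2) by (simp only: exp_less_cancel_iff)
      then have small: "cmod (V \<xi> \<theta>) < t" using t V by simp
      have "\<nu> (\<xi> + a) - \<mu> \<xi> - C = \<i> * \<sigma> * (Im (G (V \<xi> \<theta>))) - G' (k (V \<xi> \<theta>))"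
        using star[OF elim(1), of \<theta>] \<theta> unfolding Veq[symmetric] by (simp add: C_def \<sigma>\<sigma> algebra_simps)
      then show ?case using t(2)[OF V(1) small] by (simp add: dist_norm)
    qed
  qed
  have d1: "real d > 1" "real d - 1 > 0" using d by auto
  define Kr where "Kr = (real d - 1) * a"
  have Kr: "Kr > 0" using d1 a by (simp add: Kr_def)
  have lim2: "((\<lambda>X. \<nu> (X + Kr) - \<nu> X) \<longlongrightarrow> (d * C + c' - c) - C) at_top"
  proof -
    have f1: "filterlim (\<lambda>X. (X - a) / d) at_top at_top"
    proof -
      have "filterlim (\<lambda>X. (1 / real d) * (- a + X)) at_top at_top"
        by (rule filterlim_tendsto_pos_mult_at_top[OF tendsto_const _ filterlim_tendsto_add_at_top[OF tendsto_const filterlim_ident]])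
          (use d1 in auto)
      then show ?thesis by (simp add: field_simps)
    qed
    have f2: "filterlim (\<lambda>X. X - a) at_top at_top" using filterlim_tendsto_add_at_top[OF tendsto_const[of "- a"] filterlim_ident] by simp
    have "((\<lambda>X. (d * (\<nu> ((X - a) / d + a) - \<mu> ((X - a) / d)) + c' - c) - (\<nu> ((X - a) + a) - \<mu> (X - a)))
       \<longlongrightarrow> (d * C + c' - c) - C) at_top" by (intro tendsto_intros filterlim_compose[OF lim1 f1] filterlim_compose[OF lim1 f2])
    moreover have "\<forall>\<^sub>F X in at_top. (d * (\<nu> ((X - a) / d + a) - \<mu> ((X - a) / d)) + c' - c) - (\<nu> ((X - a) + a) - \<mu> (X - a))
      = \<nu> (X + Kr) - \<nu> X" using filterlim_at_top_dense[THEN iffD1, OF f1, rule_format, of x0]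
    proof eventually_elim
      case (elim X)
      define \<xi> where "\<xi> = (X - a) / d"
      have X: "X - a = real d * \<xi>" using d1 by (simp add: \<xi>_def)
      have 1: "\<xi> > x0" "\<xi> + a > x0" using elim a by (auto simp: \<xi>_def)
      have "X + Kr = real d * (\<xi> + a)" using X by (simp add: Kr_def algebra_simps)
      then have 2: "\<nu> (X + Kr) = d * \<nu> (\<xi> + a) + c'" using \<nu>d[OF 1(2)] by simp
      have 3: "\<mu> (X - a) = d * \<mu> \<xi> + c" using \<mu>d[OF 1(1)] X by simp
      show ?case unfolding 2 3 \<xi>_def[symmetric] by (simp add: algebra_simps)
    qed
    ultimately show ?thesis by (rule Lim_transform_eventually)
  qed
  obtain \<kappa> m where \<nu>: "\<And>x. x > x0 \<Longrightarrow> \<nu> x = \<kappa> * of_real x + m" using affine_if_asymptotically_translation[OF d x0 c\<nu> \<nu>d Kr lim2] by blast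
  have shift_at_top: "filterlim (\<lambda>x::real. x + t) at_top at_top" for t
    using filterlim_tendsto_add_at_top[OF tendsto_const[of t] filterlim_ident] by (simp add: add.commute)
  have lim3: "((\<lambda>X. (\<nu> (X + t + a) - \<mu> (X + t)) - (\<nu> (X + a) - \<mu> X)) \<longlongrightarrow> C - C) at_top" for t
    by (intro tendsto_diff lim1 filterlim_compose[OF lim1 shift_at_top])
  have \<nu>t: "\<nu> (X + t + a) - \<nu> (X + a) = \<kappa> * of_real t" if "X > x0" "t > 0" for X t using that a by (simp add: \<nu> algebra_simps)
  have lim4: "((\<lambda>X. \<mu> (X + t) - \<mu> X) \<longlongrightarrow> \<kappa> * of_real t - (C - C)) at_top" if t: "t > 0" for t
  proof (rule Lim_transform_eventually[OF tendsto_diff[OF tendsto_const lim3[of t]]])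
    show "\<forall>\<^sub>F X in at_top. \<kappa> * of_real t - ((\<nu> (X + t + a) - \<mu> (X + t)) - (\<nu> (X + a) - \<mu> X)) = \<mu> (X + t) - \<mu> X"
      using eventually_gt_at_top[of x0]
    proof eventually_elim
      case (elim X)
      show ?case unfolding \<nu>t[OF elim t, symmetric] by algebra
    qed
  qed
  obtain \<kappa>' L where \<mu>': "\<And>x. x > x0 \<Longrightarrow> \<mu> x = \<kappa>' * of_real x + L"
    using affine_if_asymptotically_translation[OF d x0 c\<mu> \<mu>d Kr lim4[OF Kr]] by blast
  have "((\<lambda>X::real. \<kappa>') \<longlongrightarrow> \<kappa> * of_real 1 - (C - C)) at_top"
  proof (rule Lim_transform_eventually[OF lim4])
    show "\<forall>\<^sub>F X in at_top. \<mu> (X + 1) - \<mu> X = \<kappa>'" using eventually_gt_at_top[of x0] by eventually_elim (simp add: \<mu>' algebra_simps)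
  qed simp
  from tendsto_unique[OF trivial_limit_at_top_linorder tendsto_const this] have \<kappa>': "\<kappa>' = \<kappa>" by simp
  then have \<mu>: "\<And>x. x > x0 \<Longrightarrow> \<mu> x = \<kappa> * of_real x + L" using \<mu>' by simp
  have "((\<lambda>X::real. \<kappa> * of_real a + m - L) \<longlongrightarrow> C) at_top"
  proof (rule Lim_transform_eventually[OF lim1])
    show "\<forall>\<^sub>F X in at_top. \<nu> (X + a) - \<mu> X = \<kappa> * of_real a + m - L"
      using eventually_gt_at_top[of x0] by eventually_elim (use a in \<open>simp add: \<nu> \<mu> algebra_simps\<close>)
  qed
  from tendsto_unique[OF trivial_limit_at_top_linorder tendsto_const this]
  have L_def: "L = \<kappa> * of_real a + m - C" by (simp add: algebra_simps)
  define q where "q = exp (- (x1 + 1))"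
  have q: "0 < q" "q < \<rho>" using V\<delta>[of "x1 + 1" 0] V(2)[of "x1 + 1" 0] by (auto simp: q_def)
  have key: "\<kappa> * of_real (Re (G (V (x1 + 1) \<theta>))) + \<i> * of_real \<sigma> * of_real (Im (G (V (x1 + 1) \<theta>))) = G' (k (V (x1 + 1) \<theta>))" for \<theta>
  proof -
    have gr: "x1 + 1 + a - Re (G (V (x1 + 1) \<theta>)) > x0" using ReS[of "Complex (x1 + 1) \<theta>"] by (simp add: H_def S_def V_def a_def)
    have "x1 + 1 > x0" by (simp add: x1_def)
    then show ?thesis using star[of "x1 + 1" \<theta>] unfolding \<nu>[OF gr] \<mu>[OF \<open>x1 + 1 > x0\<close>] \<sigma>\<sigma> by (simp add: L_def C_def algebra_simps)
  qed
  have kV: "k (V (x1 + 1) \<theta>) = exp (- (\<kappa> * of_real (x1 + 1) + L)) * exp (- (\<i> * of_real \<sigma> * of_real \<theta>))" for \<theta>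
  proof -
    have g: "x1 + 1 > x0" by (simp add: x1_def)
    show ?thesis by (simp only: V_def kf[OF g] \<mu>[OF g] minus_add_distrib exp_add)
  qed
  have cmk: "cmod (exp (- (\<kappa> * of_real (x1 + 1) + L))) < \<rho>'" using V\<delta>[of "x1 + 1" 0] unfolding kV by simp
  define \<Lambda> where "\<Lambda> = exp (- (\<kappa> * of_real (x1 + 1) + L)) / of_real q"
  have \<Lambda>: "\<Lambda> * u \<in> ball 0 \<rho>'" if "cmod u \<le> q" for u
  proof -
    have "cmod (\<Lambda> * u) = cmod (exp (- (\<kappa> * of_real (x1 + 1) + L))) * (cmod u / q)" using q by (simp add: \<Lambda>_def norm_mult norm_divide)
    also have "\<dots> \<le> cmod (exp (- (\<kappa> * of_real (x1 + 1) + L))) * 1" using that q by (intro mult_left_mono) auto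
    finally show ?thesis using cmk by simp
  qed
  have polar: "\<exists>\<theta>. u = of_real q * exp (- (\<i> * of_real \<theta>))" if "cmod u = q" for u
    using Arg_eq[of u] that q by (intro exI[of _ "- Arg u"]) force
  have Vq: "V (x1 + 1) \<theta> = of_real q * exp (- (\<i> * of_real \<theta>))" for \<theta>
    by (simp add: V_def q_def Complex_eq exp_of_real[symmetric] flip: exp_add)
  have hH: "(\<lambda>u. G' (\<Lambda> * u)) holomorphic_on ball 0 q"
    by (rule holomorphic_on_compose_gen[of "\<lambda>u. \<Lambda> * u" _ G', unfolded o_def, OF _ G'(1)]) (use \<Lambda> in \<open>auto intro!: holomorphic_intros\<close>)
  have cH: "continuous_on (cball 0 q) (\<lambda>u. G' (\<Lambda> * u))"
    by (rule continuous_on_compose2[OF holomorphic_on_imp_continuous_on[OF G'(1)]]) (use \<Lambda> in \<open>auto intro!: continuous_intros\<close>)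
  have \<kappa>1: "\<kappa> = 1"
  proof (rule ccontr)
    assume \<kappa>: "\<kappa> \<noteq> 1"
    obtain v where v: "v \<in> ball 0 q" "G v \<noteq> 0" using nontriv[OF q(1)] by blast
    from \<sigma> show False
    proof
      assume s: "\<sigma> = 1"
      have "G v = 0"
      proof (rule real_linear_boundary_values[OF G(1) q G(2) hH cH _ \<kappa> v(1)])
        fix u :: complex assume "cmod u = q"
        then obtain \<theta> where \<theta>: "u = V (x1 + 1) \<theta>" using polar Vq by metis
        have "\<Lambda> * u = k u" unfolding \<theta> kV s using q by (simp add: Vq \<Lambda>_def)
        then show "\<kappa> * of_real (Re (G u)) + \<i> * of_real (Im (G u)) = G' (\<Lambda> * u)" using key[of \<theta>] s unfolding \<theta>[symmetric] by simp
      qed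
      with v show False by simp
    next
      assume s: "\<sigma> = -1"
      have hc: "(\<lambda>u. cnj (G (cnj u))) holomorphic_on ball 0 \<rho>"
      proof -
        have "cnj ` ball 0 \<rho> = ball 0 \<rho>" by (auto simp: image_iff intro!: bexI[of _ "cnj _"])
        then have "(cnj \<circ> G \<circ> cnj) holomorphic_on ball 0 \<rho>" by (intro holomorphic_on_compose_cnj_cnj) (use G(1) in auto)
        then show ?thesis by (simp add: o_def)
      qed
      have "cnj (G (cnj (cnj v))) = 0"
      proof (rule real_linear_boundary_values[OF hc q _ hH cH _ \<kappa>])
        fix u :: complex assume "cmod u = q"
        then obtain \<theta> where "u = of_real q * exp (- (\<i> * of_real \<theta>))" using polar by metis
        then have u: "u = of_real q * exp (- (\<i> * of_real \<theta>))" "cnj u = V (x1 + 1) (- \<theta>)" by (simp_all add: Vq exp_cnj)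
        have "\<Lambda> * u = k (cnj u)" unfolding u(2) kV s using q by (simp add: u \<Lambda>_def)
        then show "\<kappa> * of_real (Re (cnj (G (cnj u)))) + \<i> * of_real (Im (cnj (G (cnj u)))) = G' (\<Lambda> * u)"
          using key[of "- \<theta>"] s unfolding u(2)[symmetric] by simp
      qed (use v G in auto)
      with v show False by simp
    qed
  qed
  have inH: "\<exists>\<xi> \<theta>. \<xi> > x0 \<and> v = V \<xi> \<theta>" if v: "v \<in> pdisc \<rho>" for v
  proof (intro exI conjI)
    have "ln (cmod v) < ln \<rho>" using v \<rho> by (subst ln_less_cancel_iff) auto
    then show "- ln (cmod v) > x0" by (simp add: x0_def)
    have "- Complex (- ln (cmod v)) (- Im (Ln v)) = Ln v" using v by (simp add: complex_eq_iff)
    then have "V (- ln (cmod v)) (- Im (Ln v)) = exp (Ln v)" unfolding V_def by (rule arg_cong)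
    then show "v = V (- ln (cmod v)) (- Im (Ln v))" using v by simp
  qed
  have "(\<forall>v \<in> pdisc \<rho>. k v = exp (- L) * v \<and> l v = exp (- m) * v) \<or>
     (\<forall>v \<in> pdisc \<rho>. k v = exp (- L) * cnj v \<and> l v = exp (- m) * cnj v)" using \<sigma>
  proof
    assume s: "\<sigma> = 1"
    have "k v = exp (- L) * v \<and> l v = exp (- m) * v" if v: "v \<in> pdisc \<rho>" for v
    proof -
      obtain \<xi> \<theta> where 1: "\<xi> > x0" "v = V \<xi> \<theta>" using inH[OF v] by blast
      show ?thesis using kf[OF 1(1), of \<theta>] lf[OF 1(1), of \<theta>] \<mu>[OF 1(1)] \<nu>[OF 1(1)] \<sigma>\<sigma> s \<kappa>1
        unfolding 1(2) V_def by (simp add: Complex_eq algebra_simps exp_add exp_diff exp_minus divide_simps)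
    qed
    then show ?thesis by blast
  next
    assume s: "\<sigma> = -1"
    have "k v = exp (- L) * cnj v \<and> l v = exp (- m) * cnj v" if v: "v \<in> pdisc \<rho>" for v
    proof -
      obtain \<xi> \<theta> where 1: "\<xi> > x0" "v = V \<xi> \<theta>" using inH[OF v] by blast
      show ?thesis using kf[OF 1(1), of \<theta>] lf[OF 1(1), of \<theta>] \<mu>[OF 1(1)] \<nu>[OF 1(1)] \<sigma>\<sigma> s \<kappa>1
        unfolding 1(2) V_def by (simp add: Complex_eq exp_cnj algebra_simps exp_add exp_diff exp_minus divide_simps)
    qed
    then show ?thesis by blast
  qed
  then show ?thesis using that[of "exp (- L)" "exp (- m)"] by simp
qed


lemma norm_Ln_one_plus_le:
  fixes w :: complex
  assumes "cmod w < r" "r < 1"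
  shows "cmod (Ln (1 + w)) \<le> cmod w / (1 - r)"
proof -
  have r: "0 \<le> cmod w" "0 < 1 - r" using assms by auto
  have re: "Re (1 + z) > 0" if "z \<in> ball 0 r" for z using that assms abs_Re_le_cmod[of z] by auto
  have "cmod (Ln (1 + w) - Ln (1 + 0)) \<le> 1 / (1 - r) * cmod (w - 0)"
  proof (rule field_differentiable_bound[where S = "ball 0 r" and f' = "\<lambda>z. inverse (1 + z)"])
    fix z :: complex assume z: "z \<in> ball 0 r"
    then have "1 + z \<notin> \<real>\<^sub>\<le>\<^sub>0" using re[OF z] complex_nonpos_Reals_iff by force
    then have "((\<lambda>w. Ln (1 + w)) has_field_derivative inverse (1 + z)) (at z)" by (auto intro!: derivative_eq_intros)
    then show "((\<lambda>w. Ln (1 + w)) has_field_derivative inverse (1 + z)) (at z within ball 0 r)" by (rule has_field_derivative_at_within)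
    have "1 - r \<le> cmod (1 + z)" using z norm_triangle_ineq2[of 1 "- z"] by (simp add: dist_norm)
    then have "inverse (cmod (1 + z)) \<le> inverse (1 - r)" using r by (intro le_imp_inverse_le)
    then show "cmod (inverse (1 + z)) \<le> 1 / (1 - r)" unfolding norm_inverse by (simp only: inverse_eq_divide)
  qed (use assms r le_less_trans[OF r(1) assms(1)] in auto)
  then show ?thesis by simp
qed

lemma norm_exp_diff_one_le:
  fixes w :: complex
  assumes "cmod w \<le> C"
  shows "cmod (exp w - 1) \<le> exp C * cmod w"
proof -
  have "cmod (exp w - exp 0) \<le> exp C * cmod (w - 0)"
  proof (rule field_differentiable_bound[where S = "cball 0 C" and f' = exp])
    fix z :: complex assume "z \<in> cball 0 C"
    then have "Re z \<le> C" using complex_Re_le_cmod[of z] by simp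
    then show "cmod (exp z) \<le> exp C" by simp
  qed (use assms order_trans[OF norm_ge_zero assms] in \<open>auto intro: DERIV_exp[THEN has_field_derivative_at_within]\<close>)
  then show ?thesis by simp
qed

lemma tendsto_mult_Ln_one_plus:
  fixes Q A :: "'a \<Rightarrow> complex"
  assumes Q: "(Q \<longlongrightarrow> 0) Fl" and A: "((\<lambda>t. A t * Q t) \<longlongrightarrow> L) Fl"
  shows "((\<lambda>t. A t * Ln (1 + Q t)) \<longlongrightarrow> L) Fl"
proof -
  define h where "h = (\<lambda>w::complex. if w = 0 then 1 else Ln (1 + w) / w)"
  have "((\<lambda>w. Ln (1 + w)) has_field_derivative 1) (at (0::complex))" by (auto intro!: derivative_eq_intros)
  then have "((\<lambda>w. (Ln (1 + w) - Ln (1 + 0)) / (w - 0)) \<longlongrightarrow> 1) (at (0::complex))" unfolding has_field_derivative_iff by simp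
  then have "(h \<longlongrightarrow> 1) (at 0)" by (rule Lim_transform_eventually) (auto simp: h_def eventually_at_filter)
  then have "isCont h 0" by (simp add: isCont_def h_def)
  from isCont_tendsto_compose[OF this Q] have "((\<lambda>t. h (Q t)) \<longlongrightarrow> 1) Fl" by (simp add: h_def)
  with A have "((\<lambda>t. (A t * Q t) * h (Q t)) \<longlongrightarrow> L * 1) Fl" by (rule tendsto_mult)
  moreover have "(A t * Q t) * h (Q t) = A t * Ln (1 + Q t)" for t by (simp add: h_def)
  ultimately show ?thesis by simp
qed

lemma poly_lower_terms_bound:
  fixes q :: "complex poly"
  assumes "degree q \<le> n"
  obtains C where "C \<ge> 0" "\<And>x. cmod x \<ge> 1 \<Longrightarrow> cmod (poly q x) \<le> C * cmod x ^ n"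
proof (rule that[of "\<Sum>i\<le>degree q. cmod (coeff q i)"])
  show "0 \<le> (\<Sum>i\<le>degree q. cmod (coeff q i))" by (intro sum_nonneg) auto
  fix x :: complex assume x: "cmod x \<ge> 1"
  have "cmod (poly q x) \<le> (\<Sum>i\<le>degree q. cmod (coeff q i * x ^ i))" unfolding poly_altdef by (rule norm_sum)
  also have "\<dots> \<le> (\<Sum>i\<le>degree q. cmod (coeff q i) * cmod x ^ n)"
  proof (rule sum_mono)
    fix i assume "i \<in> {..degree q}"
    then have "cmod x ^ i \<le> cmod x ^ n" using assms x by (intro power_increasing) auto
    then show "cmod (coeff q i * x ^ i) \<le> cmod (coeff q i) * cmod x ^ n" by (simp add: norm_mult norm_power mult_left_mono)
  qed
  finally show "cmod (poly q x) \<le> (\<Sum>i\<le>degree q. cmod (coeff q i)) * cmod x ^ n" by (simp add: sum_distrib_right)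
qed

lemma deriv_bound_from_cball:
  assumes "f holomorphic_on cball z \<rho>" "0 < \<rho>" "\<And>w. w \<in> cball z \<rho> \<Longrightarrow> cmod (f w) \<le> B"
  shows "cmod (deriv f z) \<le> B / \<rho>"
proof -
  have "cmod ((deriv ^^ 1) f z) \<le> fact 1 * B / \<rho> ^ 1" by (rule Cauchy_inequality)
      (use assms holomorphic_on_subset[OF assms(1) ball_subset_cball] in \<open>auto intro!: holomorphic_on_imp_continuous_on simp: dist_norm\<close>)
  then show ?thesis by simp
qed

text \<open>The map \<open>F\<close> specialises to the Henon map (\<open>b = a\<close>, \<open>e = 1\<close>) and, up to exchanging the
  coordinates, to its inverse (\<open>b = 1\<close>, \<open>e = a\<close>); \<open>\<eta>\<close> normalises the Boettcher coordinate.\<close>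
locale bott =
  fixes p :: "complex poly" and b e \<eta> :: complex and R r \<alpha> :: real
  assumes deg: "degree p \<ge> 2" and monic: "lead_coeff p = 1" and esc: "escape_constants p R r \<alpha>"
    and b0: "b \<noteq> 0" and e0: "e \<noteq> 0" and be: "cmod b + cmod e \<le> R + 1"
    and eta: "\<eta> ^ (degree p - 1) = 1 / e"
begin

abbreviation "d \<equiv> degree p"
abbreviation "V \<equiv> V_plus \<alpha>"

definition F :: "complex \<times> complex \<Rightarrow> complex \<times> complex" where
  "F z = ((poly p (fst z) - b * snd z) / e, fst z)"

definition Fi :: "complex \<times> complex \<Rightarrow> complex \<times> complex" where
  "Fi z = (snd z, (poly p (snd z) - e * fst z) / b)"

definition Q :: "complex \<times> complex \<Rightarrow> complex" where
  "Q z = (poly p (fst z) - b * snd z) / fst z ^ d - 1"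

definition E :: "complex \<times> complex \<Rightarrow> complex" where
  "E z = (\<Sum>k. Ln (1 + Q ((F ^^ k) z)) / of_nat d ^ Suc k)"

definition \<Phi> :: "complex \<times> complex \<Rightarrow> complex" where
  "\<Phi> z = fst z * exp (E z)"

definition \<psi> :: "complex \<times> complex \<Rightarrow> complex" where
  "\<psi> z = \<eta> * \<Phi> z"

definition U :: "(complex \<times> complex) set" where
  "U = {z. \<exists>n. (F ^^ n) z \<in> V}"

definition eqv :: "complex \<times> complex \<Rightarrow> complex \<times> complex \<Rightarrow> bool" where
  "eqv z w \<longleftrightarrow> (\<exists>n. (F ^^ n) z \<in> V \<and> (F ^^ n) w \<in> V \<and> \<psi> ((F ^^ n) z) = \<psi> ((F ^^ n) w))"

definition branch :: "(complex \<times> complex \<Rightarrow> complex) \<Rightarrow> (complex \<times> complex) set \<Rightarrow> bool" where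
  "branch \<phi> N \<longleftrightarrow> open N \<and> holomorphic2_on \<phi> N \<and>
     (\<exists>n. \<forall>z\<in>N. (F ^^ n) z \<in> V \<and> \<phi> z ^ (d ^ n) = e ^ (\<Sum>j<n. d ^ j) * \<Phi> ((F ^^ n) z))"

lemma Rr: "0 < R" "0 < r" "r < 1" "0 < \<alpha>" using esc by (auto simp: escape_constants_def)

lemma d_pos: "real d > 1" "real d > 0" "d > 0" "of_nat d \<noteq> (0::complex)" using deg by auto

lemma eta0: "\<eta> \<noteq> 0"
  using eta e0 d_pos deg by (metis divide_eq_0_iff diff_is_0_eq not_less_eq_eq numeral_2_eq_2 one_neq_zero zero_power zero_less_iff_neq_zero One_nat_def)

lemma b_le: "cmod b \<le> R + 1" and e_le: "cmod e \<le> R + 1" using be norm_ge_zero[of e] norm_ge_zero[of b] by linarith+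

lemma alpha_gt_1: "\<alpha> > 1"
proof (rule ccontr)
  assume "\<not> \<alpha> > 1"
  then have "\<alpha> \<le> 1" by simp
  have "cmod (of_real \<alpha>) \<ge> \<alpha>" using Rr by simp
  then have "cmod (poly (p - monom 1 d) (of_real \<alpha>) / of_real \<alpha> ^ d) + (R + 1) / cmod (of_real \<alpha>) ^ (d - 1) < r"
    using esc unfolding escape_constants_def by blast
  then have "(R + 1) / cmod (of_real \<alpha>) ^ (d - 1) < r" using norm_ge_zero[of "poly (p - monom 1 d) (of_real \<alpha>) / of_real \<alpha> ^ d"] by linarith
  then have 1: "(R + 1) / \<alpha> ^ (d - 1) < r" using Rr by simp
  have "\<alpha> ^ (d - 1) \<le> 1" using Rr \<open>\<alpha> \<le> 1\<close> by (simp add: power_le_one)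
  then have "R + 1 \<le> (R + 1) / \<alpha> ^ (d - 1)" using Rr by (simp add: le_divide_eq mult_left_le)
  also note 1
  finally show False using Rr by linarith
qed

lemma V_D:
  assumes "z \<in> V"
  shows "cmod (snd z) < cmod (fst z)" "\<alpha> < cmod (fst z)" "1 < cmod (fst z)" "fst z \<noteq> 0" using assms alpha_gt_1 by (auto simp: V_plus_def)

lemma V_I: "cmod y < cmod x \<Longrightarrow> \<alpha> < cmod x \<Longrightarrow> (x, y) \<in> V" by (simp add: V_plus_def)

lemma not_V: "z \<notin> V \<Longrightarrow> cmod (fst z) \<le> max (cmod (snd z)) \<alpha>" by (cases z) (auto simp: V_plus_def)

lemma open_V: "open V"
proof -
  have "V = {z. cmod (snd z) < cmod (fst z)} \<inter> {z. \<alpha> < cmod (fst z)}" by (auto simp: V_plus_def)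
  moreover have "open {z::complex \<times> complex. cmod (snd z) < cmod (fst z)}" "open {z::complex \<times> complex. \<alpha> < cmod (fst z)}"
    by (intro open_Collect_less continuous_intros)+
  ultimately show ?thesis by auto
qed

lemma Q_eq:
  assumes "fst z \<noteq> 0"
  shows "Q z = (poly (p - monom 1 d) (fst z) - b * snd z) / fst z ^ d" using assms by (simp add: Q_def poly_monom field_simps)

lemma Q_less_r:
  assumes z: "z \<in> V"
  shows "cmod (Q z) < r"
proof -
  note zd = V_D[OF z]
  have d1: "cmod (fst z) ^ d = cmod (fst z) * cmod (fst z) ^ (d - 1)" using deg by (metis One_nat_def Suc_pred d_pos(3) power_Suc)
  have "cmod (b * snd z / fst z ^ d) = cmod b * cmod (snd z) / cmod (fst z) ^ d" by (simp add: norm_mult norm_divide norm_power)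
  also have "\<dots> \<le> (R + 1) * cmod (fst z) / cmod (fst z) ^ d" using zd b_le Rr by (intro divide_right_mono mult_mono) auto
  also have "\<dots> = (R + 1) / cmod (fst z) ^ (d - 1)" using zd unfolding d1 by simp
  finally have 1: "cmod (b * snd z / fst z ^ d) \<le> (R + 1) / cmod (fst z) ^ (d - 1)" .
  have "Q z = poly (p - monom 1 d) (fst z) / fst z ^ d - b * snd z / fst z ^ d" using zd by (simp add: Q_eq diff_divide_distrib)
  then have "cmod (Q z) \<le> cmod (poly (p - monom 1 d) (fst z) / fst z ^ d) + cmod (b * snd z / fst z ^ d)" by (metis norm_triangle_ineq4)
  also have "\<dots> \<le> cmod (poly (p - monom 1 d) (fst z) / fst z ^ d) + (R + 1) / cmod (fst z) ^ (d - 1)" using 1 by simp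
  also have "\<dots> < r" using esc zd(2) unfolding escape_constants_def by (auto simp: less_imp_le)
  finally show ?thesis .
qed

lemma one_plus_Q:
  assumes z: "z \<in> V"
  shows "Re (1 + Q z) > 0" "1 + Q z \<noteq> 0" "1 + Q z \<notin> \<real>\<^sub>\<le>\<^sub>0" "cmod (1 + Q z) \<ge> 1 - r"
proof -
  have "\<bar>Re (Q z)\<bar> < 1" using abs_Re_le_cmod[of "Q z"] Q_less_r[OF z] Rr by linarith
  then show 1: "Re (1 + Q z) > 0" by simp
  then show "1 + Q z \<noteq> 0" by (metis less_irrefl zero_complex.simps(1))
  show "1 + Q z \<notin> \<real>\<^sub>\<le>\<^sub>0" using 1 complex_nonpos_Reals_iff by force
  show "cmod (1 + Q z) \<ge> 1 - r" using norm_triangle_ineq2[of 1 "- Q z"] Q_less_r[OF z] by simp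
qed

lemma fst_F: "fst z \<noteq> 0 \<Longrightarrow> e * fst (F z) = fst z ^ d * (1 + Q z)" using e0 by (simp add: F_def Q_def)

lemma snd_F [simp]: "snd (F z) = fst z" by (simp add: F_def)

definition lam :: real where "lam = 1 + R / (R + 1)"

lemma lam_gt_1: "lam > 1" using Rr by (simp add: lam_def)

lemma fst_F_ge:
  assumes z: "z \<in> V"
  shows "cmod (fst (F z)) \<ge> lam * cmod (fst z)"
proof -
  note zd = V_D[OF z]
  have ep: "cmod e > 0" using e0 by simp
  have "cmod (poly p (fst z)) > (2 * R + 1) * cmod (fst z)" using esc zd(2) unfolding escape_constants_def by (auto simp: less_imp_le)
  moreover have "cmod (b * snd z) \<le> cmod b * cmod (fst z)" using zd by (simp add: norm_mult mult_left_mono)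
  moreover have "cmod b * cmod (fst z) \<le> (R + 1 - cmod e) * cmod (fst z)" using be by (intro mult_right_mono) auto
  ultimately have "cmod (poly p (fst z) - b * snd z) \<ge> (2 * R + 1) * cmod (fst z) - (R + 1 - cmod e) * cmod (fst z)"
    using norm_triangle_ineq2[of "poly p (fst z)" "b * snd z"] by linarith
  then have "cmod (poly p (fst z) - b * snd z) \<ge> (R + cmod e) * cmod (fst z)" by (simp add: algebra_simps)
  moreover have "lam * cmod e \<le> R + cmod e"
  proof -
    have "R * cmod e / (R + 1) \<le> R * (R + 1) / (R + 1)" using e_le Rr by (intro divide_right_mono mult_left_mono) auto
    also have "\<dots> = R" using Rr by simp
    finally show ?thesis by (simp add: lam_def distrib_right)
  qed
  then have "(lam * cmod e) * cmod (fst z) \<le> (R + cmod e) * cmod (fst z)" by (intro mult_right_mono) auto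
  ultimately have "lam * cmod (fst z) * cmod e \<le> cmod (poly p (fst z) - b * snd z)" by (simp add: mult_ac)
  then show ?thesis using ep by (simp add: F_def norm_divide field_simps)
qed

lemma F_V:
  assumes z: "z \<in> V"
  shows "F z \<in> V" "cmod (fst (F z)) \<ge> cmod (fst z)"
proof -
  note zd = V_D[OF z]
  have "lam * cmod (fst z) > 1 * cmod (fst z)" using lam_gt_1 zd by (intro mult_strict_right_mono) auto
  then have "cmod (fst (F z)) > cmod (fst z)" using fst_F_ge[OF z] by linarith
  then show "F z \<in> V" "cmod (fst (F z)) \<ge> cmod (fst z)" using zd by (auto simp: V_plus_def F_def)
qed

lemma Fn_V:
  assumes z: "z \<in> V"
  shows "(F ^^ n) z \<in> V \<and> cmod (fst ((F ^^ n) z)) \<ge> lam ^ n * cmod (fst z)"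
proof (induction n)
  case (Suc n)
  then have 1: "(F ^^ n) z \<in> V" and 2: "cmod (fst ((F ^^ n) z)) \<ge> lam ^ n * cmod (fst z)" by auto
  have "lam * (lam ^ n * cmod (fst z)) \<le> lam * cmod (fst ((F ^^ n) z))" using 2 lam_gt_1 by (intro mult_left_mono) auto
  then have "cmod (fst (F ((F ^^ n) z))) \<ge> lam ^ Suc n * cmod (fst z)" using fst_F_ge[OF 1] by simp
  then show ?case using F_V(1)[OF 1] by simp
qed (use z in simp)

lemma Fn_split: "n \<le> m \<Longrightarrow> (F ^^ m) z = (F ^^ (m - n)) ((F ^^ n) z)" by (metis comp_apply funpow_add le_add_diff_inverse2)

lemma Fn_V_mono: "(F ^^ n) z \<in> V \<Longrightarrow> n \<le> m \<Longrightarrow> (F ^^ m) z \<in> V" using Fn_V[of "(F ^^ n) z" "m - n"] by (simp add: Fn_split[of n m])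

lemma Fn_ge:
  assumes z: "z \<in> V"
  shows "cmod (fst ((F ^^ n) z)) \<ge> cmod (fst z)"
proof -
  have "1 * cmod (fst z) \<le> lam ^ n * cmod (fst z)" using lam_gt_1 by (intro mult_right_mono) auto
  then show ?thesis using Fn_V[OF z, of n] by linarith
qed

definition C0 :: real where
  "C0 = (SOME C. C \<ge> 0 \<and> (\<forall>z\<in>V. cmod (Q z) \<le> C / cmod (fst z)))"

lemma C0: "C0 \<ge> 0" "z \<in> V \<Longrightarrow> cmod (Q z) \<le> C0 / cmod (fst z)"
proof -
  have "degree (p - monom 1 d) \<le> d - 1"
  proof (rule degree_le, intro allI impI)
    fix i assume "d - 1 < i"
    then consider "i = d" | "i > d" by linarith
    then show "coeff (p - monom 1 d) i = 0" by cases (use monic in \<open>auto simp: coeff_eq_0\<close>)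
  qed
  then obtain C where C: "C \<ge> 0" "\<And>x. cmod x \<ge> 1 \<Longrightarrow> cmod (poly (p - monom 1 d) x) \<le> C * cmod x ^ (d - 1)"
    using poly_lower_terms_bound by blast
  have "\<forall>z\<in>V. cmod (Q z) \<le> (C + cmod b) / cmod (fst z)"
  proof
    fix z assume z: "z \<in> V"
    note zd = V_D[OF z]
    have d1: "cmod (fst z) ^ d = cmod (fst z) * cmod (fst z) ^ (d - 1)" using deg by (metis One_nat_def Suc_pred d_pos(3) power_Suc)
    have "cmod (fst z) ^ 1 \<le> cmod (fst z) ^ (d - 1)" using zd deg by (intro power_increasing) auto
    then have "cmod b * cmod (snd z) \<le> cmod b * cmod (fst z) ^ (d - 1)" using zd by (intro mult_left_mono) auto
    then have "cmod (poly (p - monom 1 d) (fst z) - b * snd z) \<le> (C + cmod b) * cmod (fst z) ^ (d - 1)"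
      using C(2)[of "fst z"] zd norm_triangle_ineq4[of "poly (p - monom 1 d) (fst z)" "b * snd z"] by (simp add: norm_mult algebra_simps)
    then have "cmod (Q z) \<le> (C + cmod b) * cmod (fst z) ^ (d - 1) / cmod (fst z) ^ d"
      using zd by (simp only: Q_eq not_False_eq_True norm_divide norm_power) (intro divide_right_mono, auto)
    also have "\<dots> = (C + cmod b) / cmod (fst z)" using zd unfolding d1 by simp
    finally show "cmod (Q z) \<le> (C + cmod b) / cmod (fst z)" .
  qed
  then have "\<exists>C. C \<ge> 0 \<and> (\<forall>z\<in>V. cmod (Q z) \<le> C / cmod (fst z))" using C(1) by (intro exI[of _ "C + cmod b"]) auto
  then have *: "C0 \<ge> 0 \<and> (\<forall>z\<in>V. cmod (Q z) \<le> C0 / cmod (fst z))" unfolding C0_def by (rule someI_ex)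
  then show "C0 \<ge> 0" "z \<in> V \<Longrightarrow> cmod (Q z) \<le> C0 / cmod (fst z)" by auto
qed

definition C1 :: real where "C1 = C0 / (1 - r)"

lemma C1_nonneg: "C1 \<ge> 0" using C0(1) Rr by (simp add: C1_def)

lemma Ln_Q_bound:
  assumes z: "z \<in> V"
  shows "cmod (Ln (1 + Q z)) \<le> C1 / cmod (fst z)"
proof -
  have "cmod (Ln (1 + Q z)) \<le> cmod (Q z) / (1 - r)" using Q_less_r[OF z] Rr by (intro norm_Ln_one_plus_le)
  also have "\<dots> \<le> (C0 / cmod (fst z)) / (1 - r)" using C0(2)[OF z] Rr by (intro divide_right_mono) auto
  finally show ?thesis by (simp add: C1_def mult.commute)
qed

lemma term_bound:
  assumes z: "z \<in> V"
  shows "cmod (Ln (1 + Q ((F ^^ k) z)) / of_nat d ^ Suc k) \<le> C1 / cmod (fst z) * (1 / 2) ^ Suc k"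
proof -
  have "cmod (Ln (1 + Q ((F ^^ k) z))) \<le> C1 / cmod (fst ((F ^^ k) z))" using Fn_V[OF z] by (intro Ln_Q_bound) auto
  also have "\<dots> \<le> C1 / cmod (fst z)" using Fn_ge[OF z, of k] C1_nonneg V_D[OF z] by (intro divide_left_mono) (auto intro!: mult_pos_pos)
  finally have "cmod (Ln (1 + Q ((F ^^ k) z))) \<le> C1 / cmod (fst z)" .
  moreover have "1 / real d ^ Suc k \<le> (1 / 2) ^ Suc k"
    unfolding power_divide using deg by (auto intro!: divide_left_mono power_mono mult_pos_pos simp del: power_Suc)
  ultimately have "cmod (Ln (1 + Q ((F ^^ k) z))) * (1 / real d ^ Suc k) \<le> C1 / cmod (fst z) * (1 / 2) ^ Suc k"
    using C1_nonneg by (intro mult_mono) auto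
  then show ?thesis by (simp add: norm_divide norm_power del: power_Suc)
qed

lemma summable_half: "summable (\<lambda>k. C * (1 / 2 :: real) ^ Suc k)"
  by (intro summable_mult summable_Suc_iff[THEN iffD2] summable_geometric) auto

lemma suminf_half: "(\<Sum>k. C * (1 / 2 :: real) ^ Suc k) = C"
  using power_half_series sums_mult[of "\<lambda>k. (1 / 2) ^ Suc k" 1 C] by (simp add: sums_iff)

lemma summable_terms:
  assumes z: "z \<in> V"
  shows "summable (\<lambda>k. Ln (1 + Q ((F ^^ k) z)) / of_nat d ^ Suc k)"
  by (rule summable_comparison_test'[OF summable_half, of 0]) (rule term_bound[OF z])

lemma E_bound:
  assumes z: "z \<in> V"
  shows "cmod (E z) \<le> C1 / cmod (fst z)"
proof -
  have "cmod (E z) \<le> (\<Sum>k. C1 / cmod (fst z) * (1 / 2) ^ Suc k)" unfolding E_def by (rule norm_suminf_le[OF term_bound[OF z] summable_half])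
  then show ?thesis unfolding suminf_half .
qed

lemma E_rec:
  assumes z: "z \<in> V"
  shows "E z = (Ln (1 + Q z) + E (F z)) / of_nat d"
proof -
  have "E z = (\<Sum>k. Ln (1 + Q ((F ^^ Suc k) z)) / of_nat d ^ Suc (Suc k)) + Ln (1 + Q z) / of_nat d"
    unfolding E_def using suminf_split_head[OF summable_terms[OF z]] by simp
  also have "(\<Sum>k. Ln (1 + Q ((F ^^ Suc k) z)) / of_nat d ^ Suc (Suc k)) = E (F z) / of_nat d"
    unfolding E_def using suminf_divide[OF summable_terms[OF F_V(1)[OF z]], of "of_nat d"] by (simp add: funpow_swap1 mult.commute)
  finally show ?thesis by (simp add: add_divide_distrib)
qed

lemma Phi_F:
  assumes z: "z \<in> V"
  shows "e * \<Phi> (F z) = \<Phi> z ^ d"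
proof -
  have "\<Phi> z ^ d = fst z ^ d * exp (of_nat d * E z)" by (simp add: \<Phi>_def power_mult_distrib exp_of_nat_mult)
  also have "of_nat d * E z = Ln (1 + Q z) + E (F z)" using E_rec[OF z] d_pos by simp
  also have "exp \<dots> = (1 + Q z) * exp (E (F z))" using one_plus_Q[OF z] by (simp add: exp_add)
  also have "fst z ^ d * \<dots> = e * \<Phi> (F z)" using fst_F[of z] V_D[OF z] by (simp add: \<Phi>_def mult.assoc[symmetric])
  finally show ?thesis by simp
qed

lemma Phi_nonzero: "z \<in> V \<Longrightarrow> \<Phi> z \<noteq> 0" using V_D(4) by (simp add: \<Phi>_def)

lemma psi_nonzero: "z \<in> V \<Longrightarrow> \<psi> z \<noteq> 0" using Phi_nonzero eta0 by (simp add: \<psi>_def)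

lemma psi_F:
  assumes z: "z \<in> V"
  shows "\<psi> (F z) = \<psi> z ^ d"
proof -
  have "\<eta> ^ d = \<eta> * \<eta> ^ (d - 1)" using deg by (metis One_nat_def Suc_pred d_pos(3) power_Suc)
  then have "\<eta> ^ d * e = \<eta>" using eta e0 by simp
  then have "\<psi> z ^ d * e = \<eta> * \<Phi> z ^ d" by (simp add: \<psi>_def power_mult_distrib mult_ac)
  also have "\<dots> = \<psi> (F z) * e" unfolding Phi_F[OF z, symmetric] by (simp add: \<psi>_def mult_ac)
  finally show ?thesis using e0 by simp
qed

lemma psi_Fn:
  assumes z: "z \<in> V"
  shows "\<psi> ((F ^^ n) z) = \<psi> z ^ (d ^ n)"
proof (induction n)
  case (Suc n)
  then show ?case using psi_F[of "(F ^^ n) z"] Fn_V[OF z, of n] by (simp add: power_mult[symmetric] mult.commute)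
qed simp

lemma Phi_diff_bound:
  assumes z: "z \<in> V"
  shows "cmod (\<Phi> z - fst z) \<le> C1 * exp C1"
proof -
  note zd = V_D[OF z]
  have "C1 / cmod (fst z) \<le> C1 / 1" using C1_nonneg zd by (intro divide_left_mono) auto
  then have "cmod (E z) \<le> C1" using E_bound[OF z] by simp
  then have "cmod (exp (E z) - 1) \<le> exp C1 * cmod (E z)" by (rule norm_exp_diff_one_le)
  also have "\<dots> \<le> exp C1 * (C1 / cmod (fst z))" using E_bound[OF z] by (intro mult_left_mono) auto
  finally have "cmod (fst z) * cmod (exp (E z) - 1) \<le> cmod (fst z) * (exp C1 * (C1 / cmod (fst z)))" by (intro mult_left_mono) auto
  moreover have "\<Phi> z - fst z = fst z * (exp (E z) - 1)" by (simp add: \<Phi>_def algebra_simps)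
  ultimately show ?thesis using zd by (simp add: norm_mult mult_ac)
qed

lemma F_Fi [simp]: "F (Fi z) = z" and Fi_F [simp]: "Fi (F z) = z" using b0 e0 by (auto simp: F_def Fi_def prod_eq_iff)

lemma Fn_Fin [simp]: "(F ^^ n) ((Fi ^^ n) z) = z" by (induction n arbitrary: z) (simp_all add: funpow_swap1)

lemma Fin_Fn [simp]: "(Fi ^^ n) ((F ^^ n) z) = z" by (induction n arbitrary: z) (simp_all add: funpow_swap1)

lemma holomorphic2_Fn: "holomorphic2_on (\<lambda>z. fst ((F ^^ n) z)) S" "holomorphic2_on (\<lambda>z. snd ((F ^^ n) z)) S"
proof (induction n)
  case (Suc n)
  { case 1 show ?case using Suc e0 by (auto simp: F_def intro!: holomorphic2_intros) }
  { case 2 show ?case using Suc by (simp add: F_def) }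
qed auto

lemma holomorphic2_Fin: "holomorphic2_on (\<lambda>z. fst ((Fi ^^ n) z)) S" "holomorphic2_on (\<lambda>z. snd ((Fi ^^ n) z)) S"
proof (induction n)
  case (Suc n)
  { case 1 show ?case using Suc by (simp add: Fi_def) }
  { case 2 show ?case using Suc b0 by (auto simp: Fi_def intro!: holomorphic2_intros) }
qed auto

lemma continuous_Fn: "continuous_on S (F ^^ n)"
proof -
  have "continuous_on S (\<lambda>z. (fst ((F ^^ n) z), snd ((F ^^ n) z)))"
    by (intro continuous_on_Pair holomorphic2_on_imp_continuous_on holomorphic2_Fn)
  then show ?thesis by simp
qed

lemma continuous_Fin: "continuous_on S (Fi ^^ n)"
proof -
  have "continuous_on S (\<lambda>z. (fst ((Fi ^^ n) z), snd ((Fi ^^ n) z)))"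
    by (intro continuous_on_Pair holomorphic2_on_imp_continuous_on holomorphic2_Fin)
  then show ?thesis by simp
qed

lemma holomorphic2_compose_Fn:
  assumes "holomorphic2_on \<phi> T" "\<And>z. z \<in> S \<Longrightarrow> (F ^^ n) z \<in> T"
  shows "holomorphic2_on (\<lambda>z. \<phi> ((F ^^ n) z)) S" using holomorphic2_on_compose[OF assms(1) holomorphic2_Fn[of n S]] assms(2) by simp

lemma holomorphic2_Q: "holomorphic2_on Q V" unfolding Q_def[abs_def] using V_D(4) by (intro holomorphic2_intros) auto

lemma holomorphic2_E: "holomorphic2_on E V"
proof (rule holomorphic2_uniform_limit[OF open_V])
  fix n
  show "holomorphic2_on (\<lambda>z. \<Sum>k<n. Ln (1 + Q ((F ^^ k) z)) / of_nat d ^ Suc k) V"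
  proof (rule holomorphic2_on_sum)
    fix k
    have "holomorphic2_on (\<lambda>z. Q ((F ^^ k) z)) V" by (rule holomorphic2_compose_Fn[OF holomorphic2_Q]) (use Fn_V in auto)
    then have "holomorphic2_on (\<lambda>z. 1 + Q ((F ^^ k) z)) V" by (intro holomorphic2_intros)
    then have "holomorphic2_on (\<lambda>z. Ln (1 + Q ((F ^^ k) z))) V" by (rule holomorphic2_on_compose1[where T = "- \<real>\<^sub>\<le>\<^sub>0", rotated 2])
        (use one_plus_Q(3) Fn_V in \<open>auto intro!: holomorphic_intros simp: closed_nonpos_Reals_complex open_Compl\<close>)
    then show "holomorphic2_on (\<lambda>z. Ln (1 + Q ((F ^^ k) z)) / of_nat d ^ Suc k) V" using d_pos by (intro holomorphic2_intros) auto
  qed simp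
next
  show "uniform_limit V (\<lambda>n z. \<Sum>k<n. Ln (1 + Q ((F ^^ k) z)) / of_nat d ^ Suc k) E sequentially" unfolding E_def[abs_def]
  proof (rule Weierstrass_m_test)
    fix k z assume z: "z \<in> V"
    have "C1 / cmod (fst z) \<le> C1 / 1" using C1_nonneg V_D[OF z] by (intro divide_left_mono) auto
    then have "C1 / cmod (fst z) * (1 / 2) ^ Suc k \<le> C1 * (1 / 2) ^ Suc k" by (intro mult_right_mono) auto
    then show "cmod (Ln (1 + Q ((F ^^ k) z)) / of_nat d ^ Suc k) \<le> C1 * (1 / 2) ^ Suc k" using term_bound[OF z, of k] by linarith
  qed (rule summable_half)
qed

lemma holomorphic2_Phi: "holomorphic2_on \<Phi> V" unfolding \<Phi>_def[abs_def] by (intro holomorphic2_intros holomorphic2_E)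

lemma holomorphic2_psi: "holomorphic2_on \<psi> V" unfolding \<psi>_def[abs_def] by (intro holomorphic2_intros holomorphic2_Phi)

lemma U_iff_unbounded: "z \<in> U \<longleftrightarrow> \<not> bounded (range (\<lambda>n. (F ^^ n) z))"
proof
  assume "z \<in> U"
  then obtain n where n: "(F ^^ n) z \<in> V" by (auto simp: U_def)
  show "\<not> bounded (range (\<lambda>n. (F ^^ n) z))"
  proof
    assume "bounded (range (\<lambda>n. (F ^^ n) z))"
    then obtain B where B: "\<And>n. norm ((F ^^ n) z) \<le> B" by (auto simp: bounded_iff)
    obtain m where m: "B < lam ^ m" using lam_gt_1 real_arch_pow by blast
    have "(F ^^ (m + n)) z = (F ^^ m) ((F ^^ n) z)" by (simp add: funpow_add)
    moreover have "lam ^ m * 1 \<le> lam ^ m * cmod (fst ((F ^^ n) z))" using V_D[OF n] lam_gt_1 by (intro mult_left_mono) auto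
    ultimately have "lam ^ m \<le> cmod (fst ((F ^^ (m + n)) z))" using Fn_V[OF n, of m] by simp
    also have "\<dots> \<le> norm ((F ^^ (m + n)) z)" by (metis norm_fst_le prod.collapse)
    finally show False using B[of "m + n"] m by linarith
  qed
next
  assume unb: "\<not> bounded (range (\<lambda>n. (F ^^ n) z))"
  show "z \<in> U"
  proof (rule ccontr)
    assume "z \<notin> U"
    then have nV: "(F ^^ n) z \<notin> V" for n by (auto simp: U_def)
    define B where "B = max (cmod (snd z)) \<alpha>"
    have "cmod (fst ((F ^^ n) z)) \<le> B \<and> cmod (snd ((F ^^ n) z)) \<le> B" for n
    proof (induction n)
      case 0
      show ?case using not_V[OF nV[of 0]] by (simp add: B_def)
    next
      case (Suc n)
      then have "cmod (snd ((F ^^ Suc n) z)) \<le> B" by simp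
      moreover have "\<alpha> \<le> B" by (simp add: B_def)
      ultimately show ?case using not_V[OF nV[of "Suc n"]] by linarith
    qed
    then have "norm ((F ^^ n) z) \<le> B + B" for n using norm_Pair_le[of "fst ((F ^^ n) z)" "snd ((F ^^ n) z)"] by (smt (verit) prod.collapse)
    then show False using unb by (auto simp: bounded_iff)
  qed
qed

lemma V_subset_U: "V \<subseteq> U"
proof
  fix z assume "z \<in> V"
  then have "(F ^^ 0) z \<in> V" by simp
  then show "z \<in> U" unfolding U_def by blast
qed

lemma U_F: "F z \<in> U \<longleftrightarrow> z \<in> U"
proof
  assume "F z \<in> U"
  then obtain n where "(F ^^ n) (F z) \<in> V" by (auto simp: U_def)
  then have "(F ^^ Suc n) z \<in> V" by (simp add: funpow_swap1)
  then show "z \<in> U" unfolding U_def by blast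
next
  assume "z \<in> U"
  then obtain n where n: "(F ^^ n) z \<in> V" by (auto simp: U_def)
  then have "(F ^^ n) (F z) \<in> V" using F_V(1)[OF n] by (simp add: funpow_swap1)
  then show "F z \<in> U" unfolding U_def by blast
qed

lemma U_Fn: "(F ^^ n) z \<in> U \<longleftrightarrow> z \<in> U" by (induction n) (auto simp: U_F)

lemma open_U: "open U"
proof -
  have "U = (\<Union>n. (F ^^ n) -` V)" unfolding U_def by blast
  moreover have "open ((F ^^ n) -` V)" for n by (rule open_vimage[OF open_V continuous_Fn])
  ultimately show ?thesis by auto
qed

lemma fst_F_ge_power:
  assumes z: "z \<in> V"
  shows "cmod (fst (F z)) \<ge> (1 - r) / cmod e * cmod (fst z) ^ d"
proof -
  have "cmod e * cmod (fst (F z)) = cmod (fst z) ^ d * cmod (1 + Q z)"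
    using arg_cong[OF fst_F[of z], of cmod] V_D[OF z] by (simp add: norm_mult norm_power)
  moreover have "cmod (fst z) ^ d * cmod (1 + Q z) \<ge> cmod (fst z) ^ d * (1 - r)" using one_plus_Q(4)[OF z] by (intro mult_left_mono) auto
  ultimately have "cmod e * cmod (fst (F z)) \<ge> cmod (fst z) ^ d * (1 - r)" by simp
  then show ?thesis using e0 by (simp add: field_simps)
qed

definition deep :: "real \<Rightarrow> complex \<times> complex \<Rightarrow> bool" where
  "deep M z \<longleftrightarrow> z \<in> V \<and> cmod (fst z) > M \<and> cmod (snd z) < cmod (fst z) / 4"

lemma eventually_deep:
  assumes "z \<in> U"
  shows "\<forall>\<^sub>F n in sequentially. deep M ((F ^^ n) z)"
proof -
  obtain k where k: "(F ^^ k) z \<in> V" using assms by (auto simp: U_def)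
  define T where "T = max M (4 * cmod e / (1 - r))"
  obtain m where m: "T < lam ^ m" using lam_gt_1 real_arch_pow by blast
  have "deep M ((F ^^ n) z)" if n: "n \<ge> Suc (k + m)" for n
  proof -
    obtain j where j: "n = Suc (j + k)" "j \<ge> m" using n by (metis add.commute le_Suc_ex Suc_le_D add_Suc_right add_leE add_le_cancel_right Suc_le_mono le_add_diff_inverse)
    define w where "w = (F ^^ j) ((F ^^ k) z)"
    have wV: "w \<in> V" using Fn_V[OF k] by (simp add: w_def)
    have nw: "(F ^^ n) z = F w" by (simp add: j w_def funpow_add)
    have "lam ^ m * 1 \<le> lam ^ j * cmod (fst ((F ^^ k) z))" using lam_gt_1 j V_D[OF k] by (intro mult_mono power_increasing) auto
    then have wT: "cmod (fst w) > T" using Fn_V[OF k, of j] m by (simp add: w_def)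
    have wM: "cmod (fst (F w)) > M" using wT F_V(2)[OF wV] by (simp add: T_def)
    have "4 * cmod e / (1 - r) < cmod (fst w)" using wT by (simp add: T_def)
    then have "4 * cmod e < (1 - r) * cmod (fst w)" using Rr by (simp add: field_simps)
    then have "4 < (1 - r) / cmod e * cmod (fst w)" using e0 by (simp add: field_simps)
    then have "4 * cmod (fst w) < ((1 - r) / cmod e * cmod (fst w)) * cmod (fst w)" using V_D[OF wV] by (intro mult_strict_right_mono) auto
    also have "\<dots> = (1 - r) / cmod e * cmod (fst w) ^ 2" by (simp add: power2_eq_square)
    also have "\<dots> \<le> (1 - r) / cmod e * cmod (fst w) ^ d" using V_D[OF wV] deg Rr by (intro mult_left_mono power_increasing) auto
    also have "\<dots> \<le> cmod (fst (F w))" by (rule fst_F_ge_power[OF wV])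
    finally show ?thesis using F_V(1)[OF wV] wM by (simp add: deep_def nw)
  qed
  then show ?thesis unfolding eventually_sequentially by blast
qed

end


lemma has_field_derivative_iff_diff:
  fixes f :: "complex \<Rightarrow> complex"
  shows "((\<lambda>x. f x - x) has_field_derivative D) (at z) \<longleftrightarrow> (f has_field_derivative D + 1) (at z)"
proof
  assume "((\<lambda>x. f x - x) has_field_derivative D) (at z)"
  then have "((\<lambda>x. (f x - x) + x) has_field_derivative D + 1) (at z)" by (intro derivative_intros)
  then show "(f has_field_derivative D + 1) (at z)" by simp
next
  assume "(f has_field_derivative D + 1) (at z)"
  then have "((\<lambda>x. f x - x) has_field_derivative (D + 1) - 1) (at z)" by (intro derivative_intros)
  then show "((\<lambda>x. f x - x) has_field_derivative D) (at z)" by simp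
qed

context bott
begin

definition C2 :: real where "C2 = C1 * exp C1"

lemma C2_nonneg: "C2 \<ge> 0" using C1_nonneg by (simp add: C2_def)

lemma Phi_diff: "z \<in> V \<Longrightarrow> cmod (\<Phi> z - fst z) \<le> C2" using Phi_diff_bound by (simp add: C2_def)

definition M0 :: real where "M0 = 16 * C2 + 2 * \<alpha> + 1"

lemma M0: "M0 > 0" "M0 > 2 * \<alpha>" "M0 > 16 * C2" "M0 > 1" using C2_nonneg Rr alpha_gt_1 by (auto simp: M0_def)

lemma cball_subset_V:
  assumes "cmod s > M0" "cmod y \<le> cmod s / 2" "x \<in> cball s (cmod s / 4)"
  shows "(x, y) \<in> V"
proof -
  have "cmod s - cmod (s - x) \<le> cmod x" using norm_triangle_ineq2[of s "s - x"] by simp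
  then have "cmod x \<ge> 3 / 4 * cmod s" using assms(3) by (simp add: dist_norm)
  then show ?thesis using assms(1,2) M0 Rr by (intro V_I) linarith+
qed

lemma Phi_deriv_near:
  assumes s: "cmod s > M0" "cmod y \<le> cmod s / 2" and x: "x \<in> cball s (cmod s / 8)"
  shows "((\<lambda>x. \<Phi> (x, y) - x) has_field_derivative (D1 \<Phi> (x, y) - 1)) (at x)"
    "cmod (D1 \<Phi> (x, y) - 1) \<le> 1 / 2"
proof -
  have sp: "cmod s > 0" using s M0 by linarith
  have sub: "(w, y) \<in> V" if "w \<in> cball x (cmod s / 8)" for w
  proof (rule cball_subset_V[OF s])
    have "dist s w \<le> dist s x + dist x w" by (rule dist_triangle)
    then show "w \<in> cball s (cmod s / 4)" using that x by simp
  qed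
  have xV: "(x, y) \<in> V" by (rule sub) (use sp in simp)
  show der: "((\<lambda>x. \<Phi> (x, y) - x) has_field_derivative (D1 \<Phi> (x, y) - 1)) (at x)"
    using holomorphic2_on_slice1[OF holomorphic2_Phi xV] by (simp add: has_field_derivative_iff_diff)
  have "cmod (deriv (\<lambda>x. \<Phi> (x, y) - x) x) \<le> C2 / (cmod s / 8)"
  proof (rule deriv_bound_from_cball)
    show "(\<lambda>x. \<Phi> (x, y) - x) holomorphic_on cball x (cmod s / 8)"
      by (intro holomorphic_intros holomorphic2_on_slice1_holomorphic[OF holomorphic2_Phi] sub)
    show "cmod (\<Phi> (w, y) - w) \<le> C2" if "w \<in> cball x (cmod s / 8)" for w using Phi_diff[OF sub[OF that]] by simp
  qed (use sp in simp)
  also have "C2 / (cmod s / 8) \<le> 1 / 2" using s M0 sp by (simp add: field_simps)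
  finally show "cmod (D1 \<Phi> (x, y) - 1) \<le> 1 / 2" using DERIV_imp_deriv[OF der] by simp
qed

lemma Phi_lipschitz:
  assumes s: "cmod s > M0" "cmod y \<le> cmod s / 2"
    and x: "x \<in> cball s (cmod s / 8)" "x' \<in> cball s (cmod s / 8)"
  shows "cmod ((\<Phi> (x, y) - x) - (\<Phi> (x', y) - x')) \<le> 1 / 2 * cmod (x - x')"
proof (rule field_differentiable_bound[where S = "cball s (cmod s / 8)" and f' = "\<lambda>x. D1 \<Phi> (x, y) - 1"])
  fix z assume z: "z \<in> cball s (cmod s / 8)"
  show "((\<lambda>x. \<Phi> (x, y) - x) has_field_derivative D1 \<Phi> (z, y) - 1) (at z within cball s (cmod s / 8))"
    by (rule has_field_derivative_at_within[OF Phi_deriv_near(1)[OF s z]])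
  show "cmod (D1 \<Phi> (z, y) - 1) \<le> 1 / 2" by (rule Phi_deriv_near(2)[OF s z])
qed (use x in auto)

lemma level_unique:
  assumes s: "cmod s > M0" "cmod y \<le> cmod s / 2"
  shows "\<exists>!x. (x, y) \<in> V \<and> \<Phi> (x, y) = s"
proof -
  have sp: "cmod s > 0" using s M0 by linarith
  have C2s: "C2 \<le> cmod s / 16" using s M0 by linarith
  have C2s': "C2 \<le> cmod s / 8" "C2 \<le> cmod s / 4" using C2s sp by linarith+
  have sub: "cball s C2 \<subseteq> cball s (cmod s / 8)" by (rule subset_cball[OF C2s'(1)])
  have V: "(x, y) \<in> V" if "x \<in> cball s C2" for x by (rule cball_subset_V[OF s]) (use that subset_cball[OF C2s'(2), of s] in blast)
  have dd: "dist (s - u) (s - v) = dist u v" for u v by (simp add: dist_norm norm_minus_commute)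
  have "\<exists>!x\<in>cball s C2. s - (\<Phi> (x, y) - x) = x"
  proof (rule Banach_fix[where c = "1 / 2"])
    show "(\<lambda>x. s - (\<Phi> (x, y) - x)) ` cball s C2 \<subseteq> cball s C2" using Phi_diff[OF V] by (auto simp: dist_norm)
    fix x x' assume "x \<in> cball s C2" "x' \<in> cball s C2"
    then have "cmod ((\<Phi> (x, y) - x) - (\<Phi> (x', y) - x')) \<le> 1 / 2 * cmod (x - x')" using sub by (intro Phi_lipschitz[OF s]) auto
    then show "dist (s - (\<Phi> (x, y) - x)) (s - (\<Phi> (x', y) - x')) \<le> 1 / 2 * dist x x'" unfolding dd unfolding dist_norm .
  qed (use C2_nonneg in \<open>auto simp: complete_eq_closed\<close>)
  then obtain x where x: "x \<in> cball s C2" "s - (\<Phi> (x, y) - x) = x"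
    and uniq: "\<And>x'. x' \<in> cball s C2 \<Longrightarrow> s - (\<Phi> (x', y) - x') = x' \<Longrightarrow> x' = x" by blast
  show ?thesis
  proof (rule ex1I[of _ x])
    show "(x, y) \<in> V \<and> \<Phi> (x, y) = s" using V[OF x(1)] x(2) by (simp add: algebra_simps)
    fix x' assume x': "(x', y) \<in> V \<and> \<Phi> (x', y) = s"
    then have "x' \<in> cball s C2" using Phi_diff[of "(x', y)"] by (simp add: dist_norm)
    then show "x' = x" using x' uniq by simp
  qed
qed

definition X :: "complex \<Rightarrow> complex \<Rightarrow> complex" where
  "X s y = (THE x. (x, y) \<in> V \<and> \<Phi> (x, y) = s)"

lemma X:
  assumes "cmod s > M0" "cmod y \<le> cmod s / 2"
  shows "(X s y, y) \<in> V" "\<Phi> (X s y, y) = s" using theI'[OF level_unique[OF assms]] by (auto simp: X_def)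

lemma X_eq:
  assumes "cmod s > M0" "cmod y \<le> cmod s / 2" "(x, y) \<in> V" "\<Phi> (x, y) = s"
  shows "X s y = x" using the1_equality[OF level_unique[OF assms(1,2)]] assms(3,4) by (simp add: X_def)

lemma X_diff:
  assumes "cmod s > M0" "cmod y \<le> cmod s / 2"
  shows "cmod (X s y - s) \<le> C2" using Phi_diff[OF X(1)[OF assms]] X(2)[OF assms] by (simp add: norm_minus_commute)

definition box :: "(complex \<times> complex) set" where
  "box = {z. cmod (fst z) > M0 \<and> cmod (snd z) < cmod (fst z) / 2}"

lemma open_box: "open box" unfolding box_def by (intro open_Collect_conj open_Collect_less continuous_intros) auto

lemma D1_Phi_X:
  assumes "cmod s > M0" "cmod y \<le> cmod s / 2"
  shows "D1 \<Phi> (X s y, y) \<noteq> 0"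
proof -
  have "C2 \<le> cmod s / 8" using assms M0 by linarith
  then have "X s y \<in> cball s (cmod s / 8)" using X_diff[OF assms] by (simp add: dist_norm norm_minus_commute)
  then have "cmod (D1 \<Phi> (X s y, y) - 1) \<le> 1 / 2" by (rule Phi_deriv_near[OF assms])
  then show ?thesis by auto
qed

lemma isCont_X:
  assumes z: "z \<in> box"
  shows "isCont (\<lambda>z. X (fst z) (snd z)) z"
proof -
  obtain s y where sy: "z = (s, y)" by (cases z)
  have s: "cmod s > M0" "cmod y < cmod s / 2" using z by (auto simp: sy box_def)
  let ?x = "X s y"
  have xV: "(?x, y) \<in> V" "\<Phi> (?x, y) = s" using X s by auto
  have sp: "cmod s > 0" using s M0 by linarith
  have C2s: "C2 < cmod s / 16" using s M0 by linarith
  have xs: "cmod (?x - s) \<le> C2" using X_diff s by auto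
  have "isCont (\<lambda>z'. \<Phi> (?x, snd z')) z"
  proof (rule isCont_o2[of _ "\<lambda>z'. (?x, snd z')"])
    show "isCont \<Phi> (?x, snd z)" using holomorphic2_on_isCont[OF holomorphic2_Phi xV(1)] sy by simp
  qed (intro continuous_intros)
  then have c1: "((\<lambda>z'. \<Phi> (?x, snd z')) \<longlongrightarrow> s) (at z)" using xV by (simp add: isCont_def sy)
  have c2: "((\<lambda>z'. fst z') \<longlongrightarrow> s) (at z)" by (rule tendsto_eq_intros) (auto simp: sy intro!: tendsto_eq_intros)
  have "((\<lambda>z'. 2 * (cmod (fst z' - s) + cmod (\<Phi> (?x, snd z') - s))) \<longlongrightarrow> 2 * (cmod (s - s) + cmod (s - s))) (at z)"
    by (intro tendsto_intros c1 c2)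
  then have lim0: "((\<lambda>z'. 2 * (cmod (fst z' - s) + cmod (\<Phi> (?x, snd z') - s))) \<longlongrightarrow> 0) (at z)" by simp
  have "((\<lambda>z'. X (fst z') (snd z') - ?x) \<longlongrightarrow> 0) (at z)"
  proof (rule Lim_null_comparison[OF _ lim0])
    have "\<forall>\<^sub>F z' in at z. z' \<in> box" using z open_box by (simp add: eventually_at_topological) blast
    moreover have "\<forall>\<^sub>F z' in at z. cmod (fst z' - s) < cmod s / 32" using tendstoD[OF c2, of "cmod s / 32"] sp by (simp add: dist_norm)
    ultimately show "\<forall>\<^sub>F z' in at z. norm (X (fst z') (snd z') - ?x) \<le> 2 * (cmod (fst z' - s) + cmod (\<Phi> (?x, snd z') - s))"
    proof eventually_elim
      case (elim z')
      define s' where "s' = fst z'" define y' where "y' = snd z'"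
      have s': "cmod s' > M0" "cmod y' \<le> cmod s' / 2" using elim(1) by (auto simp: box_def s'_def y'_def)
      have ds: "cmod (s' - s) < cmod s / 32" using elim(2) by (simp add: s'_def)
      have ns: "cmod s' \<ge> 31 / 32 * cmod s" using norm_triangle_ineq2[of s "s - s'"] ds by (simp add: norm_minus_commute)
      let ?x' = "X s' y'"
      have C2s': "C2 < cmod s' / 16" using s' M0 by linarith
      have "cmod (s' - ?x') \<le> C2" using X_diff[OF s'] by (simp only: norm_minus_commute)
      then have "cmod (s' - ?x') \<le> cmod s' / 8" using C2s' norm_ge_zero[of s'] by linarith
      then have x': "?x' \<in> cball s' (cmod s' / 8)" by (simp add: dist_norm)
      have "cmod (s' - ?x) \<le> cmod (s' - s) + cmod (?x - s)" using norm_triangle_ineq4[of "s' - s" "?x - s"] by simp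
      also have "\<dots> \<le> cmod s' / 8" using ds xs C2s ns sp by linarith
      finally have x: "?x \<in> cball s' (cmod s' / 8)" by (simp add: dist_norm)
      have l: "cmod ((\<Phi> (?x', y') - ?x') - (\<Phi> (?x, y') - ?x)) \<le> 1 / 2 * cmod (?x' - ?x)" by (rule Phi_lipschitz[OF s' x' x])
      have "?x' - ?x = (s' - s) - (\<Phi> (?x, y') - s) - ((\<Phi> (?x', y') - ?x') - (\<Phi> (?x, y') - ?x))" using X(2)[OF s'] by simp
      then have tri: "cmod (?x' - ?x) \<le> cmod (s' - s) + cmod (\<Phi> (?x, y') - s) + cmod ((\<Phi> (?x', y') - ?x') - (\<Phi> (?x, y') - ?x))"
        by (smt (verit) norm_triangle_ineq4)
      have aux: "n \<le> 2 * (a + c)" if "n \<le> a + c + m" "m \<le> 1 / 2 * n" for n a c m :: real using that by argo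
      have "cmod (?x' - ?x) \<le> 2 * (cmod (s' - s) + cmod (\<Phi> (?x, y') - s))" by (rule aux[OF tri l])
      then show ?case by (simp add: s'_def y'_def)
    qed
  qed
  then show ?thesis by (simp add: isCont_def LIM_zero_iff sy)
qed

lemma holomorphic2_X: "holomorphic2_on (\<lambda>z. X (fst z) (snd z)) box"
  unfolding holomorphic2_on_iff[OF open_box] sep_holomorphic_on_def fst_conv snd_conv
proof (intro conjI allI impI)
  show "continuous_on box (\<lambda>z. X (fst z) (snd z))" using isCont_X by (intro continuous_at_imp_continuous_on) blast
  fix s y assume z: "(s, y) \<in> box"
  have sw: "prod.swap ` V = {w. (snd w, fst w) \<in> V}" by (force simp: image_iff)
  have h: "holomorphic2_on (\<lambda>w. \<Phi> (prod.swap w)) (prod.swap ` V)" by (rule holomorphic2_on_swap[OF holomorphic2_Phi])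
  have o: "open ((\<lambda>s. (s, y)) -` box)" "open ((\<lambda>t. (s, t)) -` box)" by (intro open_vimage open_box continuous_intros)+
  have Xbox: "(X s y, y) \<in> V" "\<Phi> (X s y, y) = s" "D1 \<Phi> (X s y, y) \<noteq> 0" if "(s, y) \<in> box" for s y
    using X[of s y] D1_Phi_X[of s y] that by (auto simp: box_def)
  have m: "(y, X s y) \<in> prod.swap ` V" using Xbox(1)[OF z] by (simp add: sw)
  have d: "D2 (\<lambda>w. \<Phi> (prod.swap w)) (y, X s y) \<noteq> 0" using Xbox(3)[OF z] by (simp add: D1_def D2_def)
  have c: "isCont (\<lambda>s. X s y) s" "isCont (\<lambda>t. X s t) y"
    using isCont_o2[of s "\<lambda>s. (s, y)" "\<lambda>z. X (fst z) (snd z)"] isCont_o2[of y "\<lambda>t. (s, t)" "\<lambda>z. X (fst z) (snd z)"] isCont_X[OF z]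
    by (simp_all add: continuous_intros)
  have "((\<lambda>s. \<Phi> (X s y, y)) has_field_derivative 1) (at s)"
    by (rule has_field_derivative_transform_within_open[OF DERIV_ident o(1)]) (use z Xbox(2) in auto)
  then show "(\<lambda>s. X s y) field_differentiable at s"
    by (intro implicit_field_differentiable[OF field_differentiable_const c(1) h m d]) (auto simp: field_differentiable_def)
  have "((\<lambda>t. \<Phi> (X s t, t)) has_field_derivative 0) (at y)"
    by (rule has_field_derivative_transform_within_open[OF DERIV_const o(2)]) (use z Xbox(2) in auto)
  then show "(\<lambda>t. X s t) field_differentiable at y"
    by (intro implicit_field_differentiable[OF field_differentiable_ident c(2) h m d]) (auto simp: field_differentiable_def)
qed

lemma deep_box:
  assumes z: "deep (2 * M0) z"
  shows "cmod (\<Phi> z) > M0" "cmod (snd z) < cmod (\<Phi> z) / 2" "X (\<Phi> z) (snd z) = fst z" "(\<Phi> z, snd z) \<in> box"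
proof -
  have zV: "z \<in> V" "cmod (fst z) > 2 * M0" "cmod (snd z) < cmod (fst z) / 4" using z by (auto simp: deep_def)
  have "cmod (fst z) - cmod (\<Phi> z) \<le> C2" using Phi_diff[OF zV(1)] norm_triangle_ineq2[of "fst z" "\<Phi> z"] by (simp add: norm_minus_commute)
  then have "cmod (\<Phi> z) > cmod (fst z) / 2" using zV(2) M0 by linarith
  then show 1: "cmod (\<Phi> z) > M0" "cmod (snd z) < cmod (\<Phi> z) / 2" using zV by linarith+
  show "X (\<Phi> z) (snd z) = fst z" by (rule X_eq) (use 1 zV in auto)
  show "(\<Phi> z, snd z) \<in> box" using 1 by (simp add: box_def)
qed

lemma connected_level:
  assumes s: "cmod s > M0"
  shows "connected {z \<in> V. \<Phi> z = s \<and> cmod (snd z) < cmod s / 2}"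
proof -
  have "{z \<in> V. \<Phi> z = s \<and> cmod (snd z) < cmod s / 2} = (\<lambda>y. (X s y, y)) ` ball 0 (cmod s / 2)" (is "?L = ?R")
  proof
    show "?L \<subseteq> ?R"
    proof
      fix z assume z: "z \<in> ?L"
      then have "X s (snd z) = fst z" using s by (intro X_eq) auto
      then show "z \<in> ?R" using z by (intro image_eqI[of _ _ "snd z"]) auto
    qed
    show "?R \<subseteq> ?L" using X[OF s] by auto
  qed
  moreover have "connected ((\<lambda>y. (X s y, y)) ` ball 0 (cmod s / 2))"
  proof (rule connected_continuous_image)
    have "continuous_on (ball 0 (cmod s / 2)) (\<lambda>y. X (fst (s, y)) (snd (s, y)))"
      by (intro holomorphic_on_imp_continuous_on holomorphic2_on_slice2_holomorphic[OF holomorphic2_X])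
        (use s in \<open>auto simp: box_def\<close>)
    then show "continuous_on (ball 0 (cmod s / 2)) (\<lambda>y. (X s y, y))" by (intro continuous_intros) simp
  qed auto
  ultimately show ?thesis by simp
qed

lemma psi_eq_iff: "\<psi> z = \<psi> w \<longleftrightarrow> \<Phi> z = \<Phi> w" using eta0 by (simp add: \<psi>_def)

lemma eqv_mono:
  assumes "(F ^^ n) z \<in> V" "(F ^^ n) w \<in> V" "\<psi> ((F ^^ n) z) = \<psi> ((F ^^ n) w)" "n \<le> m"
  shows "\<psi> ((F ^^ m) z) = \<psi> ((F ^^ m) w)"
proof -
  have "(F ^^ m) x = (F ^^ (m - n)) ((F ^^ n) x)" for x by (rule Fn_split[OF assms(4)])
  then show ?thesis using psi_Fn[OF assms(1), of "m - n"] psi_Fn[OF assms(2), of "m - n"] assms(3) by simp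
qed

lemma eqv_eventually:
  assumes "eqv z w"
  shows "\<forall>\<^sub>F n in sequentially. (F ^^ n) z \<in> V \<and> (F ^^ n) w \<in> V \<and> \<psi> ((F ^^ n) z) = \<psi> ((F ^^ n) w)"
proof -
  obtain n where n: "(F ^^ n) z \<in> V" "(F ^^ n) w \<in> V" "\<psi> ((F ^^ n) z) = \<psi> ((F ^^ n) w)" using assms by (auto simp: eqv_def)
  show ?thesis using eqv_mono[OF n] Fn_V_mono[OF n(1)] Fn_V_mono[OF n(2)] unfolding eventually_sequentially by blast
qed

lemma eqv_U: "eqv z w \<Longrightarrow> z \<in> U \<and> w \<in> U" by (auto simp: eqv_def U_def)

lemma eqv_refl: "z \<in> U \<Longrightarrow> eqv z z" by (auto simp: eqv_def U_def)

lemma eqv_sym: "eqv z w \<Longrightarrow> eqv w z" unfolding eqv_def by metis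

lemma eqv_trans:
  assumes "eqv x y" "eqv y z"
  shows "eqv x z"
proof -
  have "\<forall>\<^sub>F n in sequentially. (F ^^ n) x \<in> V \<and> (F ^^ n) z \<in> V \<and> \<psi> ((F ^^ n) x) = \<psi> ((F ^^ n) z)"
    using eqv_eventually[OF assms(1)] eqv_eventually[OF assms(2)] by eventually_elim simp
  from eventually_happens'[OF sequentially_bot this] show ?thesis unfolding eqv_def .
qed

lemma eqv_V_iff:
  assumes "z \<in> V" "w \<in> V"
  shows "eqv z w \<longleftrightarrow> \<psi> w / \<psi> z \<in> root_group d"
proof
  assume "eqv z w"
  then obtain n where "\<psi> ((F ^^ n) z) = \<psi> ((F ^^ n) w)" by (auto simp: eqv_def)
  then have "(\<psi> w / \<psi> z) ^ (d ^ n) = 1"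
    using psi_Fn[OF assms(1)] psi_Fn[OF assms(2)] psi_nonzero[OF assms(1)] psi_nonzero[OF assms(2)] by (simp add: power_divide)
  then show "\<psi> w / \<psi> z \<in> root_group d" by (rule root_groupI)
next
  assume "\<psi> w / \<psi> z \<in> root_group d"
  then obtain n where "(\<psi> w / \<psi> z) ^ (d ^ n) = 1" by (auto simp: root_group_def)
  then have "\<psi> ((F ^^ n) z) = \<psi> ((F ^^ n) w)"
    using psi_Fn[OF assms(1)] psi_Fn[OF assms(2)] psi_nonzero[OF assms(1)] by (simp add: power_divide)
  then show "eqv z w" using Fn_V assms unfolding eqv_def by blast
qed

lemma eqv_F: "eqv z w \<Longrightarrow> eqv (F z) (F w)"
proof -
  assume "eqv z w"
  then obtain n where n: "(F ^^ n) z \<in> V" "(F ^^ n) w \<in> V" "\<psi> ((F ^^ n) z) = \<psi> ((F ^^ n) w)" by (auto simp: eqv_def)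
  then show ?thesis using F_V psi_F unfolding eqv_def by (intro exI[of _ n]) (simp add: funpow_swap1[symmetric])
qed

lemma same_plaque_imp_eqv:
  assumes "same_plaque branch z w"
  shows "eqv z w"
proof -
  obtain \<phi> N where 1: "branch \<phi> N" and 2: "connected_component {v \<in> N. \<phi> v = \<phi> z} z w" using assms by (auto simp: same_plaque_def)
  have in': "z \<in> N" "w \<in> N" "\<phi> w = \<phi> z" using connected_component_in[OF 2] by auto
  obtain n where n: "\<And>v. v \<in> N \<Longrightarrow> (F ^^ n) v \<in> V \<and> \<phi> v ^ (d ^ n) = e ^ (\<Sum>j<n. d ^ j) * \<Phi> ((F ^^ n) v)" using 1 unfolding branch_def by blast
  have "e ^ (\<Sum>j<n. d ^ j) * \<Phi> ((F ^^ n) z) = e ^ (\<Sum>j<n. d ^ j) * \<Phi> ((F ^^ n) w)" using n[OF in'(1)] n[OF in'(2)] in'(3) by metis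
  then have "\<Phi> ((F ^^ n) z) = \<Phi> ((F ^^ n) w)" using e0 by simp
  then show ?thesis using n in' psi_eq_iff unfolding eqv_def by blast
qed

lemma branch_exists:
  assumes s: "s \<noteq> 0"
  obtains \<phi> where "branch \<phi> {v. (F ^^ n) v \<in> V \<and> Re (\<Phi> ((F ^^ n) v) / s) > 0 \<and> cmod (snd ((F ^^ n) v)) < c}"
    "\<And>v w. \<Phi> ((F ^^ n) v) = \<Phi> ((F ^^ n) w) \<Longrightarrow> \<phi> v = \<phi> w"
proof -
  define N where "N = {v. (F ^^ n) v \<in> V \<and> Re (\<Phi> ((F ^^ n) v) / s) > 0 \<and> cmod (snd ((F ^^ n) v)) < c}"
  define K where "K = e ^ (\<Sum>j<n. d ^ j) * s"
  have K0: "K \<noteq> 0" using s e0 by (simp add: K_def)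
  have dn: "of_nat (d ^ n) \<noteq> (0::complex)" using d_pos by simp
  define \<omega> where "\<omega> = exp (Ln K / of_nat (d ^ n))"
  have \<omega>: "\<omega> ^ (d ^ n) = K" using K0 dn by (simp add: \<omega>_def flip: exp_of_nat_mult)
  define \<phi> where "\<phi> = (\<lambda>v. \<omega> * exp (Ln (\<Phi> ((F ^^ n) v) / s) / of_nat (d ^ n)))"
  have opN: "open N"
  proof -
    have "open {w \<in> V. Re (\<Phi> w / s) > 0}"
    proof -
      have "continuous_on V (\<lambda>w. Re (\<Phi> w / s))"
        by (intro continuous_intros holomorphic2_on_imp_continuous_on holomorphic2_Phi) (use s in auto)
      then have "open (V \<inter> (\<lambda>w. Re (\<Phi> w / s)) -` {0<..})" by (rule continuous_open_preimage[OF _ open_V]) simp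
      moreover have "V \<inter> (\<lambda>w. Re (\<Phi> w / s)) -` {0<..} = {w \<in> V. Re (\<Phi> w / s) > 0}" by auto
      ultimately show ?thesis by simp
    qed
    moreover have "open {w :: complex \<times> complex. cmod (snd w) < c}" by (intro open_Collect_less continuous_intros)
    ultimately have "open ((F ^^ n) -` ({w \<in> V. Re (\<Phi> w / s) > 0} \<inter> {w. cmod (snd w) < c}))" by (intro open_vimage open_Int continuous_Fn)
    moreover have "(F ^^ n) -` ({w \<in> V. Re (\<Phi> w / s) > 0} \<inter> {w. cmod (snd w) < c}) = N" by (auto simp: N_def)
    ultimately show ?thesis by simp
  qed
  have "holomorphic2_on \<phi> N"
  proof -
    have "holomorphic2_on (\<lambda>v. \<Phi> ((F ^^ n) v)) N" by (rule holomorphic2_compose_Fn[OF holomorphic2_Phi]) (simp add: N_def)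
    then have "holomorphic2_on (\<lambda>v. \<Phi> ((F ^^ n) v) / s) N" using s by (intro holomorphic2_intros)
    then have "holomorphic2_on (\<lambda>v. Ln (\<Phi> ((F ^^ n) v) / s)) N"
    proof (rule holomorphic2_on_compose1[where T = "- \<real>\<^sub>\<le>\<^sub>0", rotated 2])
      show "\<Phi> ((F ^^ n) v) / s \<in> - \<real>\<^sub>\<le>\<^sub>0" if "v \<in> N" for v using that complex_nonpos_Reals_iff by (force simp: N_def)
    qed (auto intro!: holomorphic_intros simp: closed_nonpos_Reals_complex open_Compl)
    then show ?thesis unfolding \<phi>_def using dn by (intro holomorphic2_intros) auto
  qed
  moreover have "(F ^^ n) v \<in> V \<and> \<phi> v ^ (d ^ n) = e ^ (\<Sum>j<n. d ^ j) * \<Phi> ((F ^^ n) v)" if "v \<in> N" for v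
  proof -
    have V: "(F ^^ n) v \<in> V" using that by (simp add: N_def)
    have nz: "\<Phi> ((F ^^ n) v) / s \<noteq> 0" using Phi_nonzero[OF V] s by simp
    have "exp (Ln (\<Phi> ((F ^^ n) v) / s) / of_nat (d ^ n)) ^ (d ^ n) = \<Phi> ((F ^^ n) v) / s" using nz dn by (simp flip: exp_of_nat_mult)
    then have "\<phi> v ^ (d ^ n) = K * (\<Phi> ((F ^^ n) v) / s)" by (simp add: \<phi>_def power_mult_distrib \<omega>)
    then show ?thesis using V s by (simp add: K_def)
  qed
  ultimately have "branch \<phi> N" unfolding branch_def using opN by blast
  then show ?thesis using that[of \<phi>] by (simp add: N_def \<phi>_def)
qed

lemma eqv_imp_same_plaque:
  assumes "eqv z w"
  shows "same_plaque branch z w"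
proof -
  have "\<forall>\<^sub>F n in sequentially. deep (2 * M0) ((F ^^ n) z) \<and> deep (2 * M0) ((F ^^ n) w) \<and> \<psi> ((F ^^ n) z) = \<psi> ((F ^^ n) w)"
    using eqv_eventually[OF assms] eventually_deep[OF conjunct1[OF eqv_U[OF assms]], of "2 * M0"]
      eventually_deep[OF conjunct2[OF eqv_U[OF assms]], of "2 * M0"] by eventually_elim simp
  from eventually_happens'[OF sequentially_bot this]
  obtain n where n: "deep (2 * M0) ((F ^^ n) z)" "deep (2 * M0) ((F ^^ n) w)" "\<psi> ((F ^^ n) z) = \<psi> ((F ^^ n) w)" by blast
  define s where "s = \<Phi> ((F ^^ n) z)"
  have sw: "\<Phi> ((F ^^ n) w) = s" using n(3) psi_eq_iff by (simp add: s_def)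
  have s: "cmod s > M0" using deep_box(1)[OF n(1)] by (simp add: s_def)
  have s0: "s \<noteq> 0" using s M0 by auto
  obtain \<phi> where \<phi>: "branch \<phi> {v. (F ^^ n) v \<in> V \<and> Re (\<Phi> ((F ^^ n) v) / s) > 0 \<and> cmod (snd ((F ^^ n) v)) < cmod s / 2}"
    "\<And>v w. \<Phi> ((F ^^ n) v) = \<Phi> ((F ^^ n) w) \<Longrightarrow> \<phi> v = \<phi> w" using branch_exists[OF s0] by blast
  let ?N = "{v. (F ^^ n) v \<in> V \<and> Re (\<Phi> ((F ^^ n) v) / s) > 0 \<and> cmod (snd ((F ^^ n) v)) < cmod s / 2}"
  let ?L = "{v \<in> V. \<Phi> v = s \<and> cmod (snd v) < cmod s / 2}"
  have zL: "(F ^^ n) z \<in> ?L" "(F ^^ n) w \<in> ?L" using n(1,2) deep_box(2)[OF n(1)] deep_box(2)[OF n(2)] sw by (auto simp: s_def deep_def)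
  show ?thesis unfolding same_plaque_def
  proof (intro exI conjI)
    show "branch \<phi> ?N" by (rule \<phi>(1))
    show "connected_component {v \<in> ?N. \<phi> v = \<phi> z} z w" unfolding connected_component_def
    proof (intro exI conjI)
      show "connected ((Fi ^^ n) ` ?L)" by (rule connected_continuous_image[OF continuous_Fin connected_level[OF s]])
      show "(Fi ^^ n) ` ?L \<subseteq> {v \<in> ?N. \<phi> v = \<phi> z}"
      proof
        fix v assume "v \<in> (Fi ^^ n) ` ?L"
        then obtain l where l: "l \<in> ?L" "v = (Fi ^^ n) l" by blast
        then have Fv: "(F ^^ n) v = l" by simp
        then have "\<phi> v = \<phi> z" using l by (intro \<phi>(2)) (simp add: s_def)
        then show "v \<in> {v \<in> ?N. \<phi> v = \<phi> z}" using l Fv s0 by simp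
      qed
      show "z \<in> (Fi ^^ n) ` ?L" "w \<in> (Fi ^^ n) ` ?L" using zL by (metis (no_types, lifting) Fin_Fn image_eqI)+
    qed
  qed
qed

lemma rtranclp_same_plaque:
  assumes "z \<in> U"
  shows "(same_plaque branch)\<^sup>*\<^sup>* z w \<longleftrightarrow> eqv z w"
proof
  assume "(same_plaque branch)\<^sup>*\<^sup>* z w"
  then show "eqv z w" by (induction rule: rtranclp_induct) (use assms eqv_refl eqv_trans same_plaque_imp_eqv in blast)+
next
  assume "eqv z w"
  then show "(same_plaque branch)\<^sup>*\<^sup>* z w" using eqv_imp_same_plaque by blast
qed

definition leaves :: "(complex \<times> complex) set set" where
  "leaves = (\<lambda>z. {w. (same_plaque branch)\<^sup>*\<^sup>* z w}) ` U"

lemma leaves_eq: "leaves = (\<lambda>z. {w. eqv z w}) ` U" unfolding leaves_def using rtranclp_same_plaque by (intro image_cong) auto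

lemma E_F_bound:
  assumes z: "z \<in> V"
  shows "cmod (E (F z)) \<le> C1 * (R + 1) / (1 - r) / cmod (fst z) ^ d"
proof -
  have pos: "0 < (1 - r) / cmod e * cmod (fst z) ^ d" using Rr e0 V_D[OF z] by simp
  have "cmod (E (F z)) \<le> C1 / cmod (fst (F z))" by (rule E_bound[OF F_V(1)[OF z]])
  also have "\<dots> \<le> C1 / ((1 - r) / cmod e * cmod (fst z) ^ d)" by (rule divide_left_mono[OF fst_F_ge_power[OF z] C1_nonneg])
      (rule mult_pos_pos, use V_D(3)[OF F_V(1)[OF z]] in linarith, rule pos)
  also have "\<dots> = (C1 * cmod e) / ((1 - r) * cmod (fst z) ^ d)" by simp
  also have "\<dots> \<le> (C1 * (R + 1)) / ((1 - r) * cmod (fst z) ^ d)"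
    using e_le C1_nonneg Rr V_D[OF z] by (intro divide_right_mono mult_left_mono) auto
  finally show ?thesis by simp
qed

lemma D1_E_bound:
  assumes x: "cmod x > 2 * \<alpha>" and y: "cmod y \<le> cmod x / 2"
  shows "cmod (D1 E (x, y)) \<le> 8 * C1 / cmod x ^ 2"
proof -
  have sub: "(w, y) \<in> V" "cmod w \<ge> cmod x * 3 / 4" if "w \<in> cball x (cmod x / 4)" for w
  proof -
    have "cmod x - cmod (x - w) \<le> cmod w" using norm_triangle_ineq2[of x "x - w"] by simp
    then show "cmod w \<ge> cmod x * 3 / 4" using that by (simp add: dist_norm)
    then show "(w, y) \<in> V" using x y Rr by (intro V_I) linarith+
  qed
  have xp: "cmod x > 0" using x Rr by linarith
  have "cmod (deriv (\<lambda>s. E (s, y)) x) \<le> (2 * C1 / cmod x) / (cmod x / 4)"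
  proof (rule deriv_bound_from_cball)
    show "(\<lambda>s. E (s, y)) holomorphic_on cball x (cmod x / 4)" by (rule holomorphic2_on_slice1_holomorphic[OF holomorphic2_E sub(1)])
    fix w assume w: "w \<in> cball x (cmod x / 4)"
    have "cmod (E (w, y)) \<le> C1 / cmod w" using E_bound[OF sub(1)[OF w]] by simp
    also have "\<dots> \<le> C1 / (cmod x / 2)"
    proof -
      have "cmod x / 2 \<le> cmod w" "0 < cmod w" using sub(2)[OF w] xp by linarith+
      then show ?thesis using xp C1_nonneg by (intro divide_left_mono mult_pos_pos) auto
    qed
    finally show "cmod (E (w, y)) \<le> 2 * C1 / cmod x" by (simp add: mult.commute)
  qed (use xp in simp)
  then show ?thesis by (simp add: D1_def power2_eq_square)
qed

lemma D2_E_bound: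
  obtains C where "C \<ge> 0" "\<And>x y. cmod x > 2 * \<alpha> \<Longrightarrow> cmod y \<le> cmod x / 2 \<Longrightarrow>
    cmod (D2 E (x, y) + b / (of_nat d * x ^ d)) \<le> C / cmod x ^ Suc d"
proof (rule that[of "cmod b * C0 / (1 - r) + 4 * (C1 * (R + 1) / (1 - r))"])
  show "0 \<le> cmod b * C0 / (1 - r) + 4 * (C1 * (R + 1) / (1 - r))"
    using Rr C0(1) C1_nonneg by (intro add_nonneg_nonneg mult_nonneg_nonneg divide_nonneg_nonneg) auto
  fix x y :: complex assume x: "cmod x > 2 * \<alpha>" and y: "cmod y \<le> cmod x / 2"
  let ?q = "Q (x, y)" let ?K = "C1 * (R + 1) / (1 - r)"
  have xp: "cmod x > 0" "x \<noteq> 0" using x Rr by auto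
  have sub: "(x, w) \<in> V" if "w \<in> cball y (cmod x / 4)" for w
  proof -
    have "cmod w \<le> cmod y + cmod (w - y)" using norm_triangle_ineq[of y "w - y"] by simp
    then have "cmod w \<le> cmod x * 3 / 4" using that y by (simp add: dist_norm norm_minus_commute)
    then show "(x, w) \<in> V" using x y Rr xp by (intro V_I) linarith+
  qed
  have V: "(x, y) \<in> V" by (rule sub) (use xp in simp)
  define EF where "EF = (\<lambda>w. E (F (x, w)))"
  have hEF: "EF holomorphic_on cball y (cmod x / 4)"
  proof -
    have "holomorphic2_on (\<lambda>z. E ((F ^^ 1) z)) V" by (rule holomorphic2_compose_Fn[OF holomorphic2_E]) (use F_V in simp)
    then have h: "holomorphic2_on (\<lambda>z. E (F z)) V" by simp
    show ?thesis unfolding EF_def by (rule holomorphic2_on_slice2_holomorphic[OF h sub])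
  qed
  have dEF: "(EF has_field_derivative deriv EF y) (at y)"
    by (rule holomorphic_derivI[of _ "ball y (cmod x / 4)"]) (use xp hEF in \<open>auto intro: holomorphic_on_subset[OF hEF]\<close>)
  have "cmod (deriv EF y) \<le> (?K / cmod x ^ d) / (cmod x / 4)"
    by (rule deriv_bound_from_cball[OF hEF]) (use xp E_F_bound[OF sub] in \<open>auto simp: EF_def\<close>)
  then have b2: "cmod (deriv EF y) \<le> 4 * (?K) / cmod x ^ Suc d" using xp by (simp add: field_simps)
  have nz: "1 + ?q \<noteq> 0" "1 + ?q \<notin> \<real>\<^sub>\<le>\<^sub>0" using one_plus_Q[OF V] by auto
  have dQ: "((\<lambda>w. 1 + Q (x, w)) has_field_derivative - b / x ^ d) (at y)" unfolding Q_def using xp by (auto intro!: derivative_eq_intros)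
  have "((\<lambda>w. Ln (1 + Q (x, w))) has_field_derivative inverse (1 + ?q) * (- b / x ^ d)) (at y)"
    by (rule DERIV_chain2[OF has_field_derivative_Ln[OF nz(2)] dQ])
  then have "((\<lambda>w. (Ln (1 + Q (x, w)) + EF w) / of_nat d) has_field_derivative
     (inverse (1 + ?q) * (- b / x ^ d) + deriv EF y) / of_nat d) (at y)" by (intro DERIV_cdivide DERIV_add dEF)
  then have "((\<lambda>w. E (x, w)) has_field_derivative
     (inverse (1 + ?q) * (- b / x ^ d) + deriv EF y) / of_nat d) (at y)"
  proof (rule has_field_derivative_transform_within_open[of _ _ _ "ball y (cmod x / 4)"])
    show "(Ln (1 + Q (x, w)) + EF w) / of_nat d = E (x, w)" if "w \<in> ball y (cmod x / 4)" for w
      using E_rec[OF sub, of w] that by (simp add: EF_def)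
  qed (use xp in auto)
  then have D2E: "D2 E (x, y) = (inverse (1 + ?q) * (- b / x ^ d) + deriv EF y) / of_nat d" by (simp add: D2_def DERIV_imp_deriv)
  have "D2 E (x, y) + b / (of_nat d * x ^ d) = (b / x ^ d * (?q / (1 + ?q)) + deriv EF y) / of_nat d"
  proof -
    have a: "(i * (- b / xx) + dE) / dd + b / (dd * xx) = (b / xx * (1 - i) + dE) / dd"
      if "xx \<noteq> 0" "dd \<noteq> 0" for i dE xx dd :: complex using that by (simp add: field_simps)
    have "1 - inverse (1 + ?q) = ?q / (1 + ?q)" using nz(1) by (simp add: field_simps)
    then show ?thesis unfolding D2E using a[of "x ^ d" "of_nat d"] xp d_pos by simp
  qed
  then have "cmod (D2 E (x, y) + b / (of_nat d * x ^ d)) = cmod (b / x ^ d * (?q / (1 + ?q)) + deriv EF y) / real d"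
    by (simp add: norm_divide)
  also have "\<dots> \<le> cmod (b / x ^ d * (?q / (1 + ?q)) + deriv EF y) / 1" using d_pos by (intro divide_left_mono) auto
  also have "\<dots> \<le> cmod (b / x ^ d * (?q / (1 + ?q))) + cmod (deriv EF y)" using norm_triangle_ineq by simp
  also have "cmod (b / x ^ d * (?q / (1 + ?q))) \<le> (cmod b * C0 / (1 - r)) / cmod x ^ Suc d"
  proof -
    have "cmod (?q / (1 + ?q)) \<le> (C0 / cmod x) / (1 - r)"
      unfolding norm_divide using C0(2)[OF V] C0(1) xp one_plus_Q(4)[OF V] Rr by (intro frac_le) auto
    then have "cmod (b / x ^ d) * cmod (?q / (1 + ?q)) \<le> (cmod b / cmod x ^ d) * ((C0 / cmod x) / (1 - r))"
      by (intro mult_mono) (auto simp: norm_divide norm_power)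
    also have "(cmod b / cmod x ^ d) * ((C0 / cmod x) / (1 - r)) = (cmod b * C0 / (1 - r)) / cmod x ^ Suc d" by simp
    finally show ?thesis by (simp only: norm_mult)
  qed
  finally show "cmod (D2 E (x, y) + b / (of_nat d * x ^ d)) \<le> (cmod b * C0 / (1 - r) + 4 * (?K)) / cmod x ^ Suc d"
    using b2 by (simp add: add_divide_distrib)
qed

lemma tendsto_inverse_power_0:
  fixes X :: "'a \<Rightarrow> complex"
  assumes "filterlim X at_infinity Fl" "k > 0"
  shows "((\<lambda>t. 1 / X t ^ k) \<longlongrightarrow> 0) Fl"
proof -
  have "((\<lambda>t. inverse (X t)) \<longlongrightarrow> 0) Fl" by (rule filterlim_compose[OF tendsto_inverse_0 assms(1)])
  then have "((\<lambda>t. inverse (X t) ^ k) \<longlongrightarrow> 0 ^ k) Fl" by (rule tendsto_power)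
  then show ?thesis using assms(2) by (simp add: power_inverse divide_inverse zero_power)
qed

lemma eventually_in_V:
  fixes X Y :: "'a \<Rightarrow> complex"
  assumes X: "filterlim X at_infinity Fl" and Y: "(Y \<longlongrightarrow> c) Fl"
  shows "\<forall>\<^sub>F t in Fl. (X t, Y t) \<in> V \<and> cmod (X t) > 2 * \<alpha> \<and> cmod (Y t) \<le> cmod (X t) / 2 \<and> cmod (X t) > B"
proof -
  have nX: "filterlim (\<lambda>t. cmod (X t)) at_top Fl" using filterlim_at_infinity_imp_norm_at_top[OF X] .
  have "\<forall>\<^sub>F t in Fl. cmod (Y t) < cmod c + 1"
  proof -
    have "((\<lambda>t. cmod (Y t)) \<longlongrightarrow> cmod c) Fl" using Y by (rule tendsto_norm)
    from order_tendstoD(2)[OF this] show ?thesis by simp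
  qed
  moreover have "\<forall>\<^sub>F t in Fl. cmod (X t) > max (max (2 * \<alpha>) B) (2 * (cmod c + 1))" using nX by (simp only: filterlim_at_top_dense)
  ultimately show ?thesis
  proof eventually_elim
    case (elim t)
    then have 1: "cmod (X t) > 2 * \<alpha>" "cmod (X t) > B" "cmod (X t) > 2 * (cmod c + 1)" "cmod (Y t) < cmod c + 1" by simp_all
    moreover have "cmod (Y t) \<le> cmod (X t) / 2" using 1 by argo
    moreover have "cmod (Y t) < cmod (X t)" using 1 norm_ge_zero[of c] by argo
    moreover have "\<alpha> < cmod (X t)" using 1 alpha_gt_1 by linarith
    ultimately show ?case by (simp add: V_I)
  qed
qed

lemma tendsto_D2_E:
  fixes X Y :: "'a \<Rightarrow> complex"
  assumes X: "filterlim X at_infinity Fl" and Y: "(Y \<longlongrightarrow> c) Fl"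
  shows "((\<lambda>t. X t ^ d * D2 E (X t, Y t)) \<longlongrightarrow> - b / of_nat d) Fl"
proof -
  obtain C where C: "C \<ge> 0" "\<And>x y. cmod x > 2 * \<alpha> \<Longrightarrow> cmod y \<le> cmod x / 2 \<Longrightarrow>
    cmod (D2 E (x, y) + b / (of_nat d * x ^ d)) \<le> C / cmod x ^ Suc d" using D2_E_bound by blast
  have "((\<lambda>t. C * cmod (1 / X t ^ 1)) \<longlongrightarrow> C * cmod 0) Fl" by (intro tendsto_intros tendsto_inverse_power_0 X) simp
  then have l0: "((\<lambda>t. C * cmod (1 / X t ^ 1)) \<longlongrightarrow> 0) Fl" by simp
  have "((\<lambda>t. X t ^ d * D2 E (X t, Y t) - (- b / of_nat d)) \<longlongrightarrow> 0) Fl"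
  proof (rule Lim_null_comparison[OF _ l0])
    show "\<forall>\<^sub>F t in Fl. norm (X t ^ d * D2 E (X t, Y t) - (- b / of_nat d)) \<le> C * cmod (1 / X t ^ 1)" using eventually_in_V[OF X Y, of 0]
    proof eventually_elim
      case (elim t)
      then have xp: "X t \<noteq> 0" "cmod (X t) > 0" by auto
      have "X t ^ d * D2 E (X t, Y t) - (- b / of_nat d) = X t ^ d * (D2 E (X t, Y t) + b / (of_nat d * X t ^ d))"
        using xp d_pos by (simp add: field_simps)
      also have "cmod \<dots> \<le> cmod (X t) ^ d * (C / cmod (X t) ^ Suc d)"
        unfolding norm_mult norm_power using elim by (intro mult_left_mono C(2)) auto
      also have "\<dots> = C * cmod (1 / X t ^ 1)" using xp by (simp add: norm_divide)
      finally show ?case .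
    qed
  qed
  then show ?thesis by (rule LIM_zero_cancel)
qed

lemma tendsto_D1_E:
  fixes X Y :: "'a \<Rightarrow> complex"
  assumes X: "filterlim X at_infinity Fl" and Y: "(Y \<longlongrightarrow> c) Fl"
  shows "((\<lambda>t. X t * D1 E (X t, Y t)) \<longlongrightarrow> 0) Fl"
proof -
  have "((\<lambda>t. 8 * C1 * cmod (1 / X t ^ 1)) \<longlongrightarrow> 8 * C1 * cmod 0) Fl" by (intro tendsto_intros tendsto_inverse_power_0 X) simp
  then have l0: "((\<lambda>t. 8 * C1 * cmod (1 / X t ^ 1)) \<longlongrightarrow> 0) Fl" by simp
  show ?thesis
  proof (rule Lim_null_comparison[OF _ l0])
    show "\<forall>\<^sub>F t in Fl. norm (X t * D1 E (X t, Y t)) \<le> 8 * C1 * cmod (1 / X t ^ 1)" using eventually_in_V[OF X Y, of 0]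
    proof eventually_elim
      case (elim t)
      then have xp: "X t \<noteq> 0" "cmod (X t) > 0" by auto
      have "cmod (X t * D1 E (X t, Y t)) \<le> cmod (X t) * (8 * C1 / cmod (X t) ^ 2)"
        unfolding norm_mult using elim by (intro mult_left_mono D1_E_bound) auto
      also have "\<dots> = 8 * C1 * cmod (1 / X t ^ 1)" using xp by (simp add: norm_divide power2_eq_square)
      finally show ?case .
    qed
  qed
qed

lemma tendsto_E_0:
  fixes X Y :: "'a \<Rightarrow> complex"
  assumes X: "filterlim X at_infinity Fl" and Y: "(Y \<longlongrightarrow> c) Fl"
  shows "((\<lambda>t. E (X t, Y t)) \<longlongrightarrow> 0) Fl"
proof -
  have "((\<lambda>t. C1 * cmod (1 / X t ^ 1)) \<longlongrightarrow> C1 * cmod 0) Fl" by (intro tendsto_intros tendsto_inverse_power_0 X) simp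
  then have l0: "((\<lambda>t. C1 * cmod (1 / X t ^ 1)) \<longlongrightarrow> 0) Fl" by simp
  show ?thesis
  proof (rule Lim_null_comparison[OF _ l0])
    show "\<forall>\<^sub>F t in Fl. norm (E (X t, Y t)) \<le> C1 * cmod (1 / X t ^ 1)" using eventually_in_V[OF X Y, of 0]
      by eventually_elim (use E_bound in \<open>force simp: norm_divide\<close>)
  qed
qed

lemma tendsto_E_F:
  fixes X Y :: "'a \<Rightarrow> complex"
  assumes X: "filterlim X at_infinity Fl" and Y: "(Y \<longlongrightarrow> c) Fl" and j: "j < d"
  shows "((\<lambda>t. X t ^ j * E (F (X t, Y t))) \<longlongrightarrow> 0) Fl"
proof -
  define K where "K = C1 * (R + 1) / (1 - r)"
  have "((\<lambda>t. K * cmod (1 / X t ^ (d - j))) \<longlongrightarrow> K * cmod 0) Fl" by (intro tendsto_intros tendsto_inverse_power_0 X) (use j in simp)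
  then have l0: "((\<lambda>t. K * cmod (1 / X t ^ (d - j))) \<longlongrightarrow> 0) Fl" by simp
  show ?thesis
  proof (rule Lim_null_comparison[OF _ l0])
    show "\<forall>\<^sub>F t in Fl. norm (X t ^ j * E (F (X t, Y t))) \<le> K * cmod (1 / X t ^ (d - j))" using eventually_in_V[OF X Y, of 0]
    proof eventually_elim
      case (elim t)
      then have xp: "X t \<noteq> 0" "cmod (X t) > 0" by auto
      have "cmod (X t ^ j * E (F (X t, Y t))) \<le> cmod (X t) ^ j * (K / cmod (X t) ^ d)"
        unfolding norm_mult norm_power using E_F_bound[of "(X t, Y t)"] elim by (intro mult_left_mono) (auto simp: K_def)
      also have "\<dots> = K * cmod (1 / X t ^ (d - j))" using xp j by (simp add: norm_divide norm_power power_diff field_simps)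
      finally show ?case .
    qed
  qed
qed

lemma tendsto_E_leading:
  fixes X Y :: "'a \<Rightarrow> complex"
  assumes X: "filterlim X at_infinity Fl" and Y: "(Y \<longlongrightarrow> c) Fl"
    and j: "1 \<le> j" "j < d" and low: "\<And>i. d - j < i \<Longrightarrow> i < d \<Longrightarrow> coeff p i = 0"
  shows "((\<lambda>t. X t ^ j * E (X t, Y t)) \<longlongrightarrow> coeff p (d - j) / of_nat d) Fl"
proof -
  have Xnz: "\<forall>\<^sub>F t in Fl. X t \<noteq> 0" using eventually_in_V[OF X Y, of 0] by eventually_elim auto
  have pexp: "poly p x = x ^ d + (\<Sum>i\<le>d - j. coeff p i * x ^ i)" for x
  proof -
    have "poly p x = (\<Sum>i\<le>d. coeff p i * x ^ i)" by (rule poly_altdef)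
    also have "\<dots> = (\<Sum>i\<in>insert d {..d - j}. coeff p i * x ^ i)" by (rule sum.mono_neutral_right) (use low j in \<open>auto simp: not_le\<close>)
    also have "\<dots> = coeff p d * x ^ d + (\<Sum>i\<le>d - j. coeff p i * x ^ i)" by (rule sum.insert) (use j in auto)
    finally show ?thesis using monic by simp
  qed
  have "((\<lambda>t. (\<Sum>i<d - j. coeff p i * (1 / X t ^ (d - j - i))) + coeff p (d - j) - b * Y t * (1 / X t ^ (d - j)))
      \<longlongrightarrow> (\<Sum>i<d - j. coeff p i * 0) + coeff p (d - j) - b * c * 0) Fl" by (intro tendsto_intros tendsto_inverse_power_0 X Y) (use j in auto)
  then have "((\<lambda>t. (\<Sum>i<d - j. coeff p i * (1 / X t ^ (d - j - i))) + coeff p (d - j) - b * Y t * (1 / X t ^ (d - j)))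
      \<longlongrightarrow> coeff p (d - j)) Fl" by simp
  moreover have "\<forall>\<^sub>F t in Fl. (\<Sum>i<d - j. coeff p i * (1 / X t ^ (d - j - i))) + coeff p (d - j) - b * Y t * (1 / X t ^ (d - j))
     = X t ^ j * Q (X t, Y t)" using Xnz
  proof eventually_elim
    case (elim t)
    have pw: "X t ^ j / X t ^ d = 1 / X t ^ (d - j)" using elim j by (simp add: power_diff field_simps)
    have "{..d - j} = insert (d - j) {..<d - j}" by auto
    then have "(\<Sum>i\<le>d - j. coeff p i * X t ^ i) / X t ^ (d - j)
       = coeff p (d - j) + (\<Sum>i<d - j. coeff p i * (1 / X t ^ (d - j - i)))"
    proof -
      have "(\<Sum>i<d - j. coeff p i * X t ^ i) / X t ^ (d - j) = (\<Sum>i<d - j. coeff p i * (1 / X t ^ (d - j - i)))" unfolding sum_divide_distrib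
      proof (rule sum.cong[OF refl])
        fix i assume "i \<in> {..<d - j}"
        then have "X t ^ (d - j) = X t ^ (d - j - i) * X t ^ i" by (simp flip: power_add)
        then show "coeff p i * X t ^ i / X t ^ (d - j) = coeff p i * (1 / X t ^ (d - j - i))" using elim by simp
      qed
      then show ?thesis using elim unfolding \<open>{..d - j} = insert (d - j) {..<d - j}\<close> by (simp add: add_divide_distrib)
    qed
    moreover have "X t ^ j * Q (X t, Y t) = (\<Sum>i\<le>d - j. coeff p i * X t ^ i) / X t ^ (d - j) - b * Y t * (1 / X t ^ (d - j))"
    proof -
      have "Q (X t, Y t) = ((\<Sum>i\<le>d - j. coeff p i * X t ^ i) - b * Y t) / X t ^ d" using elim by (simp add: Q_def pexp field_simps)
      then have "X t ^ j * Q (X t, Y t) = ((\<Sum>i\<le>d - j. coeff p i * X t ^ i) - b * Y t) * (X t ^ j / X t ^ d)" by simp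
      then show ?thesis unfolding pw by (simp add: diff_divide_distrib)
    qed
    ultimately show ?case by simp
  qed
  ultimately have jQ: "((\<lambda>t. X t ^ j * Q (X t, Y t)) \<longlongrightarrow> coeff p (d - j)) Fl" by (rule Lim_transform_eventually)
  have Q0: "((\<lambda>t. Q (X t, Y t)) \<longlongrightarrow> 0) Fl"
  proof -
    have "((\<lambda>t. C0 * cmod (1 / X t ^ 1)) \<longlongrightarrow> C0 * cmod 0) Fl" by (intro tendsto_intros tendsto_inverse_power_0 X) simp
    then have l0: "((\<lambda>t. C0 * cmod (1 / X t ^ 1)) \<longlongrightarrow> 0) Fl" by simp
    show ?thesis
    proof (rule Lim_null_comparison[OF _ l0])
      show "\<forall>\<^sub>F t in Fl. norm (Q (X t, Y t)) \<le> C0 * cmod (1 / X t ^ 1)" using eventually_in_V[OF X Y, of 0]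
        by eventually_elim (use C0(2) in \<open>force simp: norm_divide\<close>)
    qed
  qed
  have "((\<lambda>t. (X t ^ j * Ln (1 + Q (X t, Y t)) + X t ^ j * E (F (X t, Y t))) / of_nat d)
     \<longlongrightarrow> (coeff p (d - j) + 0) / of_nat d) Fl"
    by (intro tendsto_intros tendsto_mult_Ln_one_plus[OF Q0 jQ] tendsto_E_F[OF X Y j(2)]) (use d_pos in auto)
  moreover have "\<forall>\<^sub>F t in Fl. (X t ^ j * Ln (1 + Q (X t, Y t)) + X t ^ j * E (F (X t, Y t))) / of_nat d = X t ^ j * E (X t, Y t)"
    using eventually_in_V[OF X Y, of 0] by eventually_elim (simp add: E_rec algebra_simps)
  ultimately show ?thesis using Lim_transform_eventually by fastforce
qed

text \<open>For \<open>p = x\<^sup>2\<close> the first two terms of the expansion are needed.\<close>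
lemma tendsto_E_square:
  fixes X Y :: "'a \<Rightarrow> complex"
  assumes X: "filterlim X at_infinity Fl" and XY: "((\<lambda>t. X t * Y t) \<longlongrightarrow> y1) Fl" and p: "p = monom 1 2"
  shows "((\<lambda>t. X t ^ 3 * E (X t, Y t)) \<longlongrightarrow> - b * y1 / 2 - b * e\<^sup>2 / 4) Fl"
proof -
  let ?W = "\<lambda>t. 1 - b * (X t * Y t) * (1 / X t ^ 3)"
  have d2: "d = 2" using p by (simp add: degree_monom_eq)
  have pp: "poly p x = x\<^sup>2" for x by (simp add: p poly_monom)
  have X0: "((\<lambda>t. 1 / X t ^ k) \<longlongrightarrow> 0) Fl" if "k > 0" for k by (rule tendsto_inverse_power_0[OF X that])
  have "\<forall>\<^sub>F t in Fl. cmod (X t) > 1" using filterlim_at_infinity_imp_norm_at_top[OF X] by (simp only: filterlim_at_top_dense)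
  then have Xnz: "\<forall>\<^sub>F t in Fl. X t \<noteq> 0" by eventually_elim auto
  have "((\<lambda>t. (X t * Y t) * (1 / X t ^ 1)) \<longlongrightarrow> y1 * 0) Fl" by (intro tendsto_mult XY X0) simp
  moreover have "\<forall>\<^sub>F t in Fl. (X t * Y t) * (1 / X t ^ 1) = Y t" using Xnz by eventually_elim simp
  ultimately have Y: "(Y \<longlongrightarrow> 0) Fl" using Lim_transform_eventually by fastforce
  have ev: "\<forall>\<^sub>F t in Fl. (X t, Y t) \<in> V" using eventually_in_V[OF X Y, of 0] by eventually_elim auto
  define Q1 where "Q1 = (\<lambda>t. Q (X t, Y t))"
  define Q2 where "Q2 = (\<lambda>t. Q (F (X t, Y t)))"
  have q1: "\<forall>\<^sub>F t in Fl. Q1 t = - b * (X t * Y t) * (1 / X t ^ 3)"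
    using Xnz by eventually_elim (simp add: Q1_def Q_def d2 pp field_simps eval_nat_numeral)
  have l1: "((\<lambda>t. - b * (X t * Y t) * (1 / X t ^ 3)) \<longlongrightarrow> - b * y1 * 0) Fl" by (intro tendsto_intros XY X0) simp
  then have Q10: "(Q1 \<longlongrightarrow> 0) Fl" using Lim_transform_eventually[OF l1 eventually_mono[OF q1]] by simp
  have "((\<lambda>t. - b * (X t * Y t)) \<longlongrightarrow> - b * y1) Fl" by (intro tendsto_intros XY)
  then have Q1l: "((\<lambda>t. X t ^ 3 * Q1 t) \<longlongrightarrow> - b * y1) Fl" by (rule Lim_transform_eventually) (use q1 Xnz in eventually_elim, simp)
  have x1: "fst (F (X t, Y t)) = ((X t)\<^sup>2 - b * Y t) / e" for t by (simp add: F_def pp)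
  have r0: "((\<lambda>t. ?W t) \<longlongrightarrow> 1 - b * y1 * 0) Fl" by (intro tendsto_intros XY X0) simp
  have rnz: "\<forall>\<^sub>F t in Fl. ?W t \<noteq> 0" by (rule tendsto_imp_eventually_ne[OF r0]) simp
  have q2: "\<forall>\<^sub>F t in Fl. - b * e\<^sup>2 / (?W t)\<^sup>2 = X t ^ 3 * Q2 t" using Xnz rnz
  proof eventually_elim
    case (elim t)
    define W where "W = ?W t"
    have W: "(X t)\<^sup>2 - b * Y t = (X t)\<^sup>2 * W" using elim by (simp add: W_def field_simps eval_nat_numeral)
    have "fst (F (X t, Y t)) = (X t)\<^sup>2 * W / e" unfolding x1 W ..
    moreover have "W \<noteq> 0" using elim by (simp add: W_def)
    ultimately have "Q2 t = - b * X t / ((X t)\<^sup>2 * W / e)\<^sup>2" using elim e0 by (simp add: Q2_def Q_eq d2 p[symmetric] poly_diff pp)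
    then show ?case using elim e0 \<open>W \<noteq> 0\<close> unfolding W_def[symmetric] by (simp add: field_simps eval_nat_numeral)
  qed
  have l2: "((\<lambda>t. - b * e\<^sup>2 / (?W t)\<^sup>2) \<longlongrightarrow> - b * e\<^sup>2 / (1 - b * y1 * 0)\<^sup>2) Fl" by (intro tendsto_intros XY X0) auto
  have Q2l: "((\<lambda>t. X t ^ 3 * Q2 t) \<longlongrightarrow> - b * e\<^sup>2) Fl" using Lim_transform_eventually[OF l2 q2] by simp
  have "((\<lambda>t. X t ^ 3 * Q2 t * (1 / X t ^ 3)) \<longlongrightarrow> - b * e\<^sup>2 * 0) Fl" by (intro tendsto_intros Q2l X0) simp
  moreover have "\<forall>\<^sub>F t in Fl. X t ^ 3 * Q2 t * (1 / X t ^ 3) = Q2 t" using Xnz by eventually_elim simp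
  ultimately have Q20: "(Q2 \<longlongrightarrow> 0) Fl" using Lim_transform_eventually by fastforce
  define K where "K = C1 * (R + 1) / (1 - r) * ((R + 1) / (1 - r))\<^sup>2"
  have K0: "K \<ge> 0" using C1_nonneg Rr by (simp add: K_def)
  have E2: "((\<lambda>t. X t ^ 3 * E (F (F (X t, Y t)))) \<longlongrightarrow> 0) Fl"
  proof -
    have "((\<lambda>t. K * cmod (1 / X t ^ 1)) \<longlongrightarrow> K * cmod 0) Fl" by (intro tendsto_intros X0) simp
    then have l0: "((\<lambda>t. K * cmod (1 / X t ^ 1)) \<longlongrightarrow> 0) Fl" by simp
    show ?thesis
    proof (rule Lim_null_comparison[OF _ l0])
      show "\<forall>\<^sub>F t in Fl. norm (X t ^ 3 * E (F (F (X t, Y t)))) \<le> K * cmod (1 / X t ^ 1)" using ev Xnz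
      proof eventually_elim
        case (elim t)
        let ?z = "(X t, Y t)"
        have xp: "cmod (X t) > 0" using elim by simp
        have Re: "(1 - r) / (R + 1) \<le> (1 - r) / cmod e" using e_le e0 Rr by (intro divide_left_mono) auto
        then have "(1 - r) / (R + 1) * cmod (X t) ^ 2 \<le> (1 - r) / cmod e * cmod (X t) ^ 2" by (intro mult_right_mono) auto
        then have g1: "(1 - r) / (R + 1) * cmod (X t) ^ 2 \<le> cmod (fst (F ?z))" using fst_F_ge_power[OF elim(1)] d2 by simp
        have p1: "0 < (1 - r) / (R + 1) * cmod (X t) ^ 2" using Rr xp by simp
        have "cmod (E (F (F ?z))) \<le> C1 * (R + 1) / (1 - r) / cmod (fst (F ?z)) ^ 2" using E_F_bound[OF F_V(1)[OF elim(1)]] d2 by simp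
        also have "\<dots> \<le> C1 * (R + 1) / (1 - r) / ((1 - r) / (R + 1) * cmod (X t) ^ 2) ^ 2"
          using g1 p1 C1_nonneg Rr by (intro divide_left_mono power_mono) (auto intro!: mult_pos_pos zero_less_power)
        also have "\<dots> = K / cmod (X t) ^ 4" using Rr xp by (simp add: K_def power_mult_distrib power_divide field_simps eval_nat_numeral)
        finally have "cmod (X t) ^ 3 * cmod (E (F (F ?z))) \<le> cmod (X t) ^ 3 * (K / cmod (X t) ^ 4)" by (intro mult_left_mono) auto
        also have "\<dots> = K * cmod (1 / X t ^ 1)" using xp by (simp add: norm_divide eval_nat_numeral)
        finally show ?case by (simp add: norm_mult norm_power)
      qed
    qed
  qed
  have "((\<lambda>t. (X t ^ 3 * Ln (1 + Q1 t) + (X t ^ 3 * Ln (1 + Q2 t) + X t ^ 3 * E (F (F (X t, Y t)))) / 2) / 2)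
     \<longlongrightarrow> (- b * y1 + (- b * e\<^sup>2 + 0) / 2) / 2) Fl"
    by (intro tendsto_intros tendsto_mult_Ln_one_plus[OF Q10 Q1l] tendsto_mult_Ln_one_plus[OF Q20 Q2l] E2) auto
  moreover have "\<forall>\<^sub>F t in Fl. (X t ^ 3 * Ln (1 + Q1 t) + (X t ^ 3 * Ln (1 + Q2 t) + X t ^ 3 * E (F (F (X t, Y t)))) / 2) / 2
     = X t ^ 3 * E (X t, Y t)" using ev
  proof eventually_elim
    case (elim t)
    have "E (X t, Y t) = (Ln (1 + Q1 t) + (Ln (1 + Q2 t) + E (F (F (X t, Y t)))) / 2) / 2"
      using E_rec[OF elim] E_rec[OF F_V(1)[OF elim]] d2 by (simp add: Q1_def Q2_def)
    then show ?case by (simp only:) (simp add: field_simps)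
  qed
  ultimately have "((\<lambda>t. X t ^ 3 * E (X t, Y t)) \<longlongrightarrow> (- b * y1 + (- b * e\<^sup>2 + 0) / 2) / 2) Fl" by (rule Lim_transform_eventually)
  moreover have "(- b * y1 + (- b * e\<^sup>2 + 0) / 2) / 2 = - b * y1 / 2 - b * e\<^sup>2 / 4" by (simp add: field_simps)
  ultimately show ?thesis by (simp only:)
qed

end


lemma logarithmic_derivative_power:
  fixes f g :: "complex \<Rightarrow> complex"
  assumes f: "(f has_field_derivative f') (at x)" and g: "(g has_field_derivative g') (at x)"
    and S: "open S" "x \<in> S" and eq: "\<And>w. w \<in> S \<Longrightarrow> f w ^ m = c * g w ^ k"
    and nz: "f x \<noteq> 0" "g x \<noteq> 0" and mk: "m > 0" "k > 0"
  shows "of_nat m * (f' / f x) = of_nat k * (g' / g x)"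
proof -
  have 1: "((\<lambda>w. f w ^ m) has_field_derivative of_nat m * f x ^ (m - 1) * f') (at x)" using f by (auto intro!: derivative_eq_intros)
  have "((\<lambda>w. c * g w ^ k) has_field_derivative c * (of_nat k * g x ^ (k - 1) * g')) (at x)" using g by (auto intro!: derivative_eq_intros)
  then have "((\<lambda>w. f w ^ m) has_field_derivative c * (of_nat k * g x ^ (k - 1) * g')) (at x)"
    by (rule has_field_derivative_transform_within_open[OF _ S]) (simp add: eq)
  with 1 have e: "of_nat m * f x ^ (m - 1) * f' = c * (of_nat k * g x ^ (k - 1) * g')" by (rule DERIV_unique)
  have fm: "f x ^ m = f x * f x ^ (m - 1)" "g x ^ k = g x * g x ^ (k - 1)" using mk by (metis Suc_diff_1 power_Suc)+
  have "of_nat m * (f' / f x) = (of_nat m * f x ^ (m - 1) * f') / f x ^ m" using nz by (simp add: fm)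
  also have "\<dots> = c * (of_nat k * g x ^ (k - 1) * g') / (c * g x ^ k)" unfolding e eq[OF S(2)] ..
  also have "\<dots> = of_nat k * (g' / g x)"
  proof -
    have "c \<noteq> 0" using eq[OF S(2)] nz by (metis mult_zero_left power_not_zero)
    then show ?thesis using nz by (simp add: fm)
  qed
  finally show ?thesis .
qed

lemma holomorphic_extend_by_0:
  fixes f :: "complex \<Rightarrow> complex"
  assumes "f holomorphic_on pdisc \<rho>" "(f \<longlongrightarrow> 0) (at 0)"
  shows "(\<lambda>u. if u = 0 then 0 else f u) holomorphic_on ball 0 \<rho>" (is "?g holomorphic_on _")
proof (rule no_isolated_singularity'[where K = "{0}"])
  have "(?g \<longlongrightarrow> 0) (at 0)" by (rule Lim_transform_eventually[OF assms(2)]) (auto simp: eventually_at_filter)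
  then show "(?g \<longlongrightarrow> ?g z) (at z within ball 0 \<rho>)" if "z \<in> {0}" for z
    using that tendsto_within_subset[OF \<open>(?g \<longlongrightarrow> 0) (at 0)\<close> subset_UNIV, of "ball 0 \<rho>"] by simp
  show "?g holomorphic_on pdisc \<rho>" by (rule holomorphic_transform[OF assms(1)]) auto
qed auto

lemma local_inverse_at_0:
  fixes v :: "complex \<Rightarrow> complex"
  assumes hol: "v holomorphic_on ball 0 \<rho>" and \<rho>: "0 < \<rho>" and v0: "v 0 = 0" and dv: "deriv v 0 \<noteq> 0"
  obtains r s ui where "0 < r" "r \<le> \<rho>" "0 < s" "inj_on v (ball 0 r)" "ui holomorphic_on ball 0 s" "ui 0 = 0"
    "\<And>w. w \<in> ball 0 s \<Longrightarrow> ui w \<in> ball 0 r \<and> v (ui w) = w"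
proof -
  have 0: "0 \<in> ball (0::complex) \<rho>" using \<rho> by simp
  obtain r where r: "r > 0" "ball (0::complex) r \<subseteq> ball 0 \<rho>" "open (v ` ball 0 r)" "inj_on v (ball 0 r)"
    using has_complex_derivative_locally_invertible[OF hol 0 open_ball dv] by blast
  have hr: "v holomorphic_on ball 0 r" using hol r(2) holomorphic_on_subset by blast
  obtain g where g: "g holomorphic_on (v ` ball 0 r)" "\<And>z. z \<in> ball 0 r \<Longrightarrow> g (v z) = z"
    using holomorphic_has_inverse[OF hr open_ball r(4)] by metis
  have "0 \<in> v ` ball 0 r" using v0 r by (metis centre_in_ball imageI)
  then obtain s where s: "s > 0" "ball 0 s \<subseteq> v ` ball 0 r" using r(3) openE by blast
  show ?thesis
  proof (rule that[of r s g])
    show "r \<le> \<rho>" using r(1,2) by (simp add: ball_subset_ball_iff)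
    show "g holomorphic_on ball 0 s" using g(1) s(2) holomorphic_on_subset by blast
    show "g 0 = 0" using g(2)[of 0] v0 r by simp
    fix w :: complex assume "w \<in> ball 0 s"
    then obtain z where "z \<in> ball 0 r" "w = v z" using s(2) by blast
    then show "g w \<in> ball 0 r \<and> v (g w) = w" using g(2) by simp
  qed (use r s in auto)
qed

lemma eventually_puncture_filter:
  "eventually P (puncture_filter H c) \<longleftrightarrow>
     (\<exists>M \<rho>. \<rho> > 0 \<and> (\<forall>z\<in>H. cmod (fst z) > M \<longrightarrow> cmod (snd z - c) < \<rho> \<longrightarrow> P z))"
proof
  assume "eventually P (puncture_filter H c)"
  then have "\<forall>\<^sub>F z in at_infinity \<times>\<^sub>F nhds c. z \<in> H \<longrightarrow> P z" by (simp add: puncture_filter_def eventually_inf_principal)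
  then obtain A B where AB: "eventually A at_infinity" "eventually B (nhds c)"
    "\<And>x y. A x \<Longrightarrow> B y \<Longrightarrow> (x, y) \<in> H \<longrightarrow> P (x, y)" unfolding eventually_prod_filter by blast
  obtain M where M: "\<And>x. cmod x \<ge> M \<Longrightarrow> A x" using AB(1) unfolding eventually_at_infinity by blast
  obtain \<rho> where \<rho>: "\<rho> > 0" "\<And>y. dist y c < \<rho> \<Longrightarrow> B y" using AB(2) unfolding eventually_nhds_metric by blast
  show "\<exists>M \<rho>. \<rho> > 0 \<and> (\<forall>z\<in>H. cmod (fst z) > M \<longrightarrow> cmod (snd z - c) < \<rho> \<longrightarrow> P z)"
  proof (rule exI[of _ M], rule exI[of _ \<rho>], intro conjI \<rho>(1) ballI impI)
    fix z :: "complex \<times> complex" assume z: "z \<in> H" "M < cmod (fst z)" "cmod (snd z - c) < \<rho>"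
    then show "P z" using AB(3)[OF M \<rho>(2), of "fst z" "snd z"] by (simp add: dist_norm)
  qed
next
  assume "\<exists>M \<rho>. \<rho> > 0 \<and> (\<forall>z\<in>H. cmod (fst z) > M \<longrightarrow> cmod (snd z - c) < \<rho> \<longrightarrow> P z)"
  then obtain M \<rho> where M: "\<rho> > 0" "\<And>z. z \<in> H \<Longrightarrow> cmod (fst z) > M \<Longrightarrow> cmod (snd z - c) < \<rho> \<Longrightarrow> P z" by blast
  have 1: "\<forall>\<^sub>F x::complex in at_infinity. cmod x > M" unfolding eventually_at_infinity by (intro exI[of _ "M + 1"]) auto
  have 2: "\<forall>\<^sub>F y in nhds c. cmod (y - c) < \<rho>" unfolding eventually_nhds_metric using M(1) by (auto simp: dist_norm)
  have "\<forall>\<^sub>F z in at_infinity \<times>\<^sub>F nhds c. z \<in> H \<longrightarrow> P z" unfolding eventually_prod_filter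
    by (rule exI[of _ "\<lambda>x. cmod x > M"], rule exI[of _ "\<lambda>y. cmod (y - c) < \<rho>"]) (use 1 2 M(2) in auto)
  then show "eventually P (puncture_filter H c)" by (simp add: puncture_filter_def eventually_inf_principal)
qed

context bott
begin

definition T :: "complex \<times> complex \<Rightarrow> complex" where
  "T z = fst z * D2 E z / (1 + fst z * D1 E z)"

definition MT :: real where "MT = 2 * \<alpha> + 16 * C1 + 1"

lemma MT: "MT > 2 * \<alpha>" "MT > 16 * C1" "MT > 1" using C1_nonneg Rr alpha_gt_1 by (auto simp: MT_def)

lemma T_denominator:
  assumes "cmod x > MT" "cmod y \<le> cmod x / 2"
  shows "cmod (x * D1 E (x, y)) \<le> 1 / 2" "1 + x * D1 E (x, y) \<noteq> 0" "cmod (1 + x * D1 E (x, y)) \<ge> 1 / 2"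
    "(x, y) \<in> V"
proof -
  have x: "cmod x > 2 * \<alpha>" "cmod x > 0" "x \<noteq> 0" using assms MT Rr by auto
  have "cmod (x * D1 E (x, y)) \<le> cmod x * (8 * C1 / cmod x ^ 2)"
    unfolding norm_mult using D1_E_bound[OF x(1) assms(2)] by (intro mult_left_mono) auto
  also have "\<dots> = 8 * C1 / cmod x" using x by (simp add: power2_eq_square)
  also have "\<dots> \<le> 1 / 2" using assms MT x by (simp add: field_simps)
  finally show 1: "cmod (x * D1 E (x, y)) \<le> 1 / 2" .
  then show 3: "cmod (1 + x * D1 E (x, y)) \<ge> 1 / 2" using norm_triangle_ineq2[of 1 "- (x * D1 E (x, y))"] by simp
  show "1 + x * D1 E (x, y) \<noteq> 0" using 3 by auto
  show "(x, y) \<in> V" using x assms Rr by (intro V_I) linarith+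
qed

definition reg :: "(complex \<times> complex) set" where
  "reg = {z. cmod (fst z) > MT \<and> cmod (snd z) < cmod (fst z) / 2}"

lemma reg_V: "reg \<subseteq> V" using T_denominator(4) by (force simp: reg_def)

lemma holomorphic2_T: "holomorphic2_on T reg"
proof -
  have "holomorphic2_on (D1 E) reg" "holomorphic2_on (D2 E) reg"
    using holomorphic2_on_D1[OF open_V holomorphic2_E] holomorphic2_on_D2[OF open_V holomorphic2_E]
      holomorphic2_on_subset reg_V by blast+
  then show ?thesis unfolding T_def[abs_def]
  proof (intro holomorphic2_intros)
    fix z assume "z \<in> reg"
    then show "1 + fst z * D1 E z \<noteq> 0" using T_denominator(2)[of "fst z" "snd z"] by (simp add: reg_def)
  qed
qed

lemma T_bound:
  obtains C where "C \<ge> 0" "\<And>x y. cmod x > MT \<Longrightarrow> cmod y \<le> cmod x / 2 \<Longrightarrow> cmod (T (x, y)) \<le> C / cmod x ^ (d - 1)"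
proof -
  obtain C where C: "C \<ge> 0" "\<And>x y. cmod x > 2 * \<alpha> \<Longrightarrow> cmod y \<le> cmod x / 2 \<Longrightarrow>
    cmod (D2 E (x, y) + b / (of_nat d * x ^ d)) \<le> C / cmod x ^ Suc d" using D2_E_bound by blast
  show ?thesis
  proof (rule that[of "2 * (C + cmod b)"])
    fix x y :: complex assume xy: "cmod x > MT" "cmod y \<le> cmod x / 2"
    have x: "cmod x > 2 * \<alpha>" "cmod x > 1" "x \<noteq> 0" using xy MT Rr by auto
    have dd: "cmod x ^ d = cmod x * cmod x ^ (d - 1)" using d_pos(3) by (metis Suc_diff_1 power_Suc)
    have "cmod (D2 E (x, y)) \<le> cmod (D2 E (x, y) + b / (of_nat d * x ^ d)) + cmod (b / (of_nat d * x ^ d))"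
      using norm_triangle_ineq4[of "D2 E (x, y) + b / (of_nat d * x ^ d)" "b / (of_nat d * x ^ d)"] by simp
    also have "\<dots> \<le> C / cmod x ^ d + cmod b / cmod x ^ d"
    proof (rule add_mono)
      have "C / cmod x ^ Suc d \<le> C / cmod x ^ d" using C(1) x by (intro divide_left_mono power_increasing mult_pos_pos) auto
      then show "cmod (D2 E (x, y) + b / (of_nat d * x ^ d)) \<le> C / cmod x ^ d" using C(2)[OF x(1) xy(2)] by linarith
      have "1 * cmod x ^ d \<le> real d * cmod x ^ d" using d_pos by (intro mult_right_mono) auto
      then have "cmod b / (real d * cmod x ^ d) \<le> cmod b / cmod x ^ d" using x d_pos by (intro divide_left_mono mult_pos_pos) auto
      then show "cmod (b / (of_nat d * x ^ d)) \<le> cmod b / cmod x ^ d" by (simp add: norm_divide norm_mult norm_power)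
    qed
    finally have D: "cmod (D2 E (x, y)) \<le> (C + cmod b) / cmod x ^ d" by (simp add: add_divide_distrib)
    have "cmod (T (x, y)) = cmod x * cmod (D2 E (x, y)) / cmod (1 + x * D1 E (x, y))" by (simp add: T_def norm_divide norm_mult)
    also have "\<dots> \<le> (cmod x * ((C + cmod b) / cmod x ^ d)) / (1 / 2)"
      using D T_denominator(3)[OF xy] C(1) by (intro frac_le mult_left_mono mult_nonneg_nonneg) auto
    also have "\<dots> = 2 * (C + cmod b) / cmod x ^ (d - 1)" using x by (simp add: dd)
    finally show "cmod (T (x, y)) \<le> 2 * (C + cmod b) / cmod x ^ (d - 1)" .
  qed (use C in auto)
qed

lemma tendsto_T:
  fixes X Y :: "'a \<Rightarrow> complex"
  assumes X: "filterlim X at_infinity Fl" and Y: "(Y \<longlongrightarrow> c) Fl"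
  shows "((\<lambda>t. X t ^ (d - 1) * T (X t, Y t)) \<longlongrightarrow> - b / of_nat d) Fl"
proof -
  have "((\<lambda>t. (X t ^ d * D2 E (X t, Y t)) / (1 + X t * D1 E (X t, Y t))) \<longlongrightarrow> (- b / of_nat d) / (1 + 0)) Fl"
    by (intro tendsto_intros tendsto_D2_E[OF X Y] tendsto_D1_E[OF X Y]) simp
  moreover have "X t ^ d = X t ^ (d - 1) * X t" for t using d_pos(3) by (metis Suc_diff_1 power_Suc2)
  ultimately show ?thesis by (simp add: T_def mult_ac)
qed

lemma Phi_log_derivatives:
  assumes "(x, y) \<in> V"
  shows "D1 \<Phi> (x, y) / \<Phi> (x, y) = 1 / x + D1 E (x, y)" "D2 \<Phi> (x, y) / \<Phi> (x, y) = D2 E (x, y)"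
proof -
  have x: "x \<noteq> 0" using V_D(4)[OF assms] by simp
  have "((\<lambda>s. s * exp (E (s, y))) has_field_derivative 1 * exp (E (x, y)) + (exp (E (x, y)) * D1 E (x, y)) * x) (at x)"
    by (intro DERIV_mult DERIV_ident DERIV_chain2[OF DERIV_exp] holomorphic2_on_slice1[OF holomorphic2_E assms])
  then have "D1 \<Phi> (x, y) = exp (E (x, y)) + exp (E (x, y)) * D1 E (x, y) * x" by (simp add: D1_def \<Phi>_def DERIV_imp_deriv)
  then show "D1 \<Phi> (x, y) / \<Phi> (x, y) = 1 / x + D1 E (x, y)" using x by (simp add: \<Phi>_def field_simps)
  have "((\<lambda>t. x * exp (E (x, t))) has_field_derivative x * (exp (E (x, y)) * D2 E (x, y))) (at y)"
    by (intro DERIV_cmult DERIV_chain2[OF DERIV_exp] holomorphic2_on_slice2[OF holomorphic2_E assms])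
  then have "D2 \<Phi> (x, y) = x * (exp (E (x, y)) * D2 E (x, y))" by (simp add: D2_def \<Phi>_def DERIV_imp_deriv)
  then show "D2 \<Phi> (x, y) / \<Phi> (x, y) = D2 E (x, y)" using x by (simp add: \<Phi>_def)
qed

lemma branch_subset: "branch \<phi> N \<Longrightarrow> open N' \<Longrightarrow> N' \<subseteq> N \<Longrightarrow> branch \<phi> N'" unfolding branch_def using holomorphic2_on_subset by blast

lemma Phi_Fn:
  assumes z: "z \<in> V"
  shows "\<Phi> ((F ^^ n) z) = \<eta> ^ (d ^ n) / \<eta> * \<Phi> z ^ (d ^ n)" using psi_Fn[OF z, of n] eta0 by (simp add: \<psi>_def power_mult_distrib field_simps)

end

locale henon_map =
  fixes p :: "complex poly" and a \<eta> :: complex and R r \<alpha> :: real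
  assumes deg: "degree p \<ge> 2" and monic: "lead_coeff p = 1" and esc: "escape_constants p R r \<alpha>"
    and a0: "a \<noteq> 0" and aR: "cmod a \<le> R" and a_half: "cmod a \<le> 1 / 2"
    and eta: "\<eta> ^ (degree p - 1) = 1 / a"
begin

sublocale P: bott p a 1 1 R r \<alpha> by unfold_locales (use deg monic esc a0 aR in auto)

sublocale N: bott p 1 a \<eta> R r \<alpha> by unfold_locales (use deg monic esc a0 aR eta in auto)

abbreviation "d \<equiv> degree p"
abbreviation "V \<equiv> V_plus \<alpha>"
abbreviation "sw \<equiv> prod.swap :: complex \<times> complex \<Rightarrow> complex \<times> complex"

lemma henon_eq: "henon p a = P.F" by (simp add: fun_eq_iff henon_def P.F_def)

lemma henon_inv_eq: "henon_inv p a z = sw (N.F (sw z))" by (simp add: henon_inv_def N.F_def)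

lemma henon_inv_Fi: "henon_inv p a = P.Fi" by (simp add: fun_eq_iff henon_inv_def P.Fi_def)

lemma henon_inv_funpow: "(henon_inv p a ^^ n) z = sw ((N.F ^^ n) (sw z))" by (induction n) (simp_all add: henon_inv_eq)

lemma N_F_sw: "N.F (sw z) = sw (P.Fi z)" by (simp add: N.F_def P.Fi_def)

lemma U_plus_eq: "U_plus p a = P.U" unfolding U_plus_def henon_eq using P.U_iff_unbounded by auto

lemma bounded_sw: "bounded (range (\<lambda>n. sw (f n))) \<longleftrightarrow> bounded (range f)"
  by (simp add: bounded_iff norm_Pair prod.swap_def add.commute norm_prod_def)

lemma U_minus_iff: "z \<in> U_minus p a \<longleftrightarrow> sw z \<in> N.U" unfolding U_minus_def henon_inv_funpow[abs_def] bounded_sw using N.U_iff_unbounded by simp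

lemma phi_plus_eq: "phi_plus p a = P.\<Phi>" unfolding fun_eq_iff phi_plus_def P.\<Phi>_def P.E_def henon_eq by (simp add: P.Q_def P.F_def)

lemma phi_minus_eq: "phi_minus p a z = N.\<Phi> (sw z)"
proof -
  have "a * fst (N.F w) = poly p (fst w) - snd w" for w using a0 by (simp add: N.F_def)
  then show ?thesis unfolding phi_minus_def N.\<Phi>_def N.E_def henon_inv_funpow by (simp add: N.Q_def)
qed

lemma psi_plus_eq: "psi_plus p a z = P.\<psi> z" by (simp add: psi_plus_def phi_plus_eq P.\<psi>_def)

lemma psi_minus_eq: "psi_minus p a \<eta> z = N.\<psi> (N.F (sw z))" by (simp add: psi_minus_def phi_minus_eq henon_inv_eq N.\<psi>_def)

lemma V_minus_iff: "z \<in> V_minus \<alpha> \<longleftrightarrow> sw z \<in> V" by (cases z) (auto simp: V_minus_def V_plus_def)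

lemma branch_plus_eq: "branch_plus p a \<alpha> = P.branch" by (simp add: fun_eq_iff branch_plus_def P.branch_def henon_eq phi_plus_eq)

lemma sw_image: "sw ` A = {z. sw z \<in> A}" by (force simp: image_iff)

lemma branch_minus_iff: "branch_minus p a \<alpha> \<phi> A \<longleftrightarrow> N.branch (\<lambda>z. \<phi> (sw z)) (sw ` A)"
proof -
  have 1: "open (sw ` A) \<longleftrightarrow> open A" using open_swap_image[of A] open_swap_image[of "sw ` A"] by (auto simp: image_image)
  have 2: "holomorphic2_on (\<lambda>z. \<phi> (sw z)) (sw ` A) \<longleftrightarrow> holomorphic2_on \<phi> A"
    using holomorphic2_on_swap[of \<phi> A] holomorphic2_on_swap[of "\<lambda>z. \<phi> (sw z)" "sw ` A"] by (auto simp: image_image)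
  show ?thesis unfolding branch_minus_def N.branch_def 1 2 by (simp add: henon_inv_funpow phi_minus_eq V_minus_iff)
qed

lemma same_plaque_minus_iff:
  "same_plaque (branch_minus p a \<alpha>) z w \<longleftrightarrow> same_plaque N.branch (sw z) (sw w)"
proof
  have cc: "connected_component (sw ` S) (sw x) (sw y)" if xy: "connected_component S x y" for S x y
  proof -
    obtain C where C: "connected C" "C \<subseteq> S" "x \<in> C" "y \<in> C" using xy by (auto simp: connected_component_def)
    have "connected (sw ` C)" by (rule connected_continuous_image[OF _ C(1)]) (auto simp: prod.swap_def intro!: continuous_intros)
    then show ?thesis using C unfolding connected_component_def by blast
  qed
  { assume "same_plaque (branch_minus p a \<alpha>) z w"
    then obtain \<phi> A where A: "branch_minus p a \<alpha> \<phi> A" "connected_component {v \<in> A. \<phi> v = \<phi> z} z w" by (auto simp: same_plaque_def)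
    have e: "sw ` {v \<in> A. \<phi> v = \<phi> z} = {v \<in> sw ` A. \<phi> (sw v) = \<phi> (sw (sw z))}" by (auto simp: sw_image)
    show "same_plaque N.branch (sw z) (sw w)" unfolding same_plaque_def using A(1) cc[OF A(2), unfolded e] unfolding branch_minus_iff
      by (intro exI[of _ "\<lambda>v. \<phi> (sw v)"] exI[of _ "sw ` A"] conjI) }
  { assume "same_plaque N.branch (sw z) (sw w)"
    then obtain \<phi> A where A: "N.branch \<phi> A" "connected_component {v \<in> A. \<phi> v = \<phi> (sw z)} (sw z) (sw w)" by (auto simp: same_plaque_def)
    have "branch_minus p a \<alpha> (\<lambda>v. \<phi> (sw v)) (sw ` A)" using A(1) by (simp add: branch_minus_iff image_image)
    moreover have "sw ` {v \<in> A. \<phi> v = \<phi> (sw z)} = {v \<in> sw ` A. \<phi> (sw v) = \<phi> (sw z)}" by (auto simp: sw_image)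
    ultimately show "same_plaque (branch_minus p a \<alpha>) z w"
      using cc[OF A(2)] unfolding same_plaque_def by (intro exI[of _ "\<lambda>v. \<phi> (sw v)"] exI[of _ "sw ` A"]) simp }
qed

lemma leaves_plus_eq: "leaves_plus p a \<alpha> = (\<lambda>z. {w. P.eqv z w}) ` P.U"
  using P.leaves_eq unfolding leaves_plus_def P.leaves_def U_plus_eq branch_plus_eq by simp

lemma rtranclp_sw:
  "(same_plaque (branch_minus p a \<alpha>))\<^sup>*\<^sup>* z w \<longleftrightarrow> (same_plaque N.branch)\<^sup>*\<^sup>* (sw z) (sw w)"
proof
  assume "(same_plaque (branch_minus p a \<alpha>))\<^sup>*\<^sup>* z w"
  then show "(same_plaque N.branch)\<^sup>*\<^sup>* (sw z) (sw w)"
    by (induction rule: rtranclp_induct) (auto simp: same_plaque_minus_iff intro: rtranclp.rtrancl_into_rtrancl)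
next
  have "(same_plaque N.branch)\<^sup>*\<^sup>* z' w' \<Longrightarrow> (same_plaque (branch_minus p a \<alpha>))\<^sup>*\<^sup>* (sw z') (sw w')" for z' w'
    by (induction rule: rtranclp_induct) (auto simp: same_plaque_minus_iff intro: rtranclp.rtrancl_into_rtrancl)
  from this[of "sw z" "sw w"] show "(same_plaque N.branch)\<^sup>*\<^sup>* (sw z) (sw w) \<Longrightarrow> (same_plaque (branch_minus p a \<alpha>))\<^sup>*\<^sup>* z w" by simp
qed

lemma leaves_minus_eq: "leaves_minus p a \<alpha> = (\<lambda>z. {w. N.eqv (sw z) (sw w)}) ` U_minus p a" unfolding leaves_minus_def rtranclp_sw
  by (intro image_cong refl) (use N.rtranclp_same_plaque U_minus_iff in auto)

definition Yc :: "complex \<times> complex \<Rightarrow> complex" where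
  "Yc z = (poly p (snd z) - fst z) / a"

lemma N_F_sw_eq: "N.F (sw z) = (Yc z, snd z)" by (simp add: N.F_def Yc_def)

lemma holomorphic2_Yc: "holomorphic2_on Yc S" unfolding Yc_def[abs_def] using a0 by (intro holomorphic2_intros)

definition W :: "complex \<times> complex \<Rightarrow> complex" where
  "W z = poly (pderiv p) (snd z) + P.T z + a * N.T (Yc z, snd z)"

definition good :: "complex \<times> complex \<Rightarrow> bool" where
  "good z \<longleftrightarrow> cmod (fst z) > P.MT \<and> cmod (snd z) < cmod (fst z) / 2 \<and>
     cmod (Yc z) > N.MT \<and> cmod (snd z) < cmod (Yc z) / 2"

lemma good_reg:
  assumes "good z"
  shows "z \<in> P.reg" "(Yc z, snd z) \<in> N.reg" "z \<in> V" "(Yc z, snd z) \<in> V"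
proof -
  show 1: "z \<in> P.reg" "(Yc z, snd z) \<in> N.reg" using assms by (auto simp: good_def P.reg_def N.reg_def)
  show "z \<in> V" "(Yc z, snd z) \<in> V" using 1 P.reg_V N.reg_V by blast+
qed

lemma good_U:
  assumes "good z"
  shows "z \<in> U_plus p a" "z \<in> U_minus p a"
proof -
  show "z \<in> U_plus p a" using good_reg(3)[OF assms] P.V_subset_U U_plus_eq by blast
  have "N.F (sw z) \<in> N.U" using good_reg(4)[OF assms] N.V_subset_U N_F_sw_eq by auto
  then show "z \<in> U_minus p a" by (simp add: N.U_F U_minus_iff)
qed

lemma open_good: "open {z. good z}" unfolding good_def
  by (intro open_Collect_conj open_Collect_less continuous_intros holomorphic2_on_imp_continuous_on holomorphic2_Yc) auto

lemma holomorphic2_W: "holomorphic2_on W {z. good z}" unfolding W_def[abs_def]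
  by (intro holomorphic2_intros holomorphic2_on_subset[OF P.holomorphic2_T]
      holomorphic2_on_compose[OF N.holomorphic2_T holomorphic2_Yc])
    (use good_reg in auto)

definition \<Psi> :: "complex \<times> complex \<Rightarrow> complex" where
  "\<Psi> z = N.\<Phi> (Yc z, snd z)"

lemma Psi_derivatives:
  assumes g: "good z"
  shows "((\<lambda>s. \<Psi> (s, snd z)) has_field_derivative D1 N.\<Phi> (Yc z, snd z) * (- 1 / a)) (at (fst z))"
    "((\<lambda>t. \<Psi> (fst z, t)) has_field_derivative D1 N.\<Phi> (Yc z, snd z) * (poly (pderiv p) (snd z) / a) + D2 N.\<Phi> (Yc z, snd z)) (at (snd z))"
proof -
  let ?w = "(Yc z, snd z)"
  have V: "?w \<in> V" by (rule good_reg[OF g])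
  have D: "(N.\<Phi> has_derivative (\<lambda>v. D1 N.\<Phi> ?w * fst v + D2 N.\<Phi> ?w * snd v)) (at ?w)"
    by (rule holomorphic2_on_has_derivative[OF N.holomorphic2_Phi V])
  have "((\<lambda>s. Yc (s, snd z)) has_field_derivative (- 1 / a)) (at (fst z))" unfolding Yc_def using a0 by (auto intro!: derivative_eq_intros)
  then have 1: "((\<lambda>s. Yc (s, snd z)) has_derivative (\<lambda>v. (- 1 / a) * v)) (at (fst z))" by (simp only: has_field_derivative_def)
  have D': "(N.\<Phi> has_derivative (\<lambda>v. D1 N.\<Phi> ?w * fst v + D2 N.\<Phi> ?w * snd v)) (at (Yc (fst z, snd z), snd z))" using D by simp
  have "((N.\<Phi> \<circ> (\<lambda>s. (Yc (s, snd z), snd z))) has_derivative (\<lambda>v. D1 N.\<Phi> ?w * fst v + D2 N.\<Phi> ?w * snd v) \<circ> (\<lambda>v. ((- 1 / a) * v, 0))) (at (fst z))"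
    by (rule diff_chain_at[OF has_derivative_Pair[OF 1 has_derivative_const] D'])
  moreover have "(\<lambda>v. D1 N.\<Phi> ?w * fst v + D2 N.\<Phi> ?w * snd v) \<circ> (\<lambda>v. ((- 1 / a) * v, 0)) = (*) (D1 N.\<Phi> ?w * (- 1 / a))"
    by (auto simp: fun_eq_iff algebra_simps)
  ultimately show "((\<lambda>s. \<Psi> (s, snd z)) has_field_derivative D1 N.\<Phi> ?w * (- 1 / a)) (at (fst z))"
    unfolding has_field_derivative_def by (simp only: o_def \<Psi>_def fst_conv snd_conv)
  have "((\<lambda>t. Yc (fst z, t)) has_field_derivative (poly (pderiv p) (snd z) / a)) (at (snd z))"
    unfolding Yc_def using a0 by (auto intro!: derivative_eq_intros)
  then have 2: "((\<lambda>t. Yc (fst z, t)) has_derivative (\<lambda>v. (poly (pderiv p) (snd z) / a) * v)) (at (snd z))"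
    by (simp only: has_field_derivative_def)
  have "((N.\<Phi> \<circ> (\<lambda>t. (Yc (fst z, t), t))) has_derivative (\<lambda>v. D1 N.\<Phi> ?w * fst v + D2 N.\<Phi> ?w * snd v) \<circ> (\<lambda>v. ((poly (pderiv p) (snd z) / a) * v, v))) (at (snd z))"
    by (rule diff_chain_at[OF has_derivative_Pair[OF 2 has_derivative_ident] D'])
  moreover have "(\<lambda>v. D1 N.\<Phi> ?w * fst v + D2 N.\<Phi> ?w * snd v) \<circ> (\<lambda>v. ((poly (pderiv p) (snd z) / a) * v, v)) = (*) (D1 N.\<Phi> ?w * (poly (pderiv p) (snd z) / a) + D2 N.\<Phi> ?w)"
    by (auto simp: fun_eq_iff algebra_simps)
  ultimately show "((\<lambda>t. \<Psi> (fst z, t)) has_field_derivative D1 N.\<Phi> ?w * (poly (pderiv p) (snd z) / a) + D2 N.\<Phi> ?w) (at (snd z))"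
    unfolding has_field_derivative_def by (simp only: o_def \<Psi>_def fst_conv snd_conv)
qed

lemma Psi_nonzero: "good z \<Longrightarrow> \<Psi> z \<noteq> 0" unfolding \<Psi>_def by (rule N.Phi_nonzero[OF good_reg(4)])

text \<open>On the region \<open>good\<close> every pair of branches has the same logarithmic derivatives as
  \<open>\<Phi>\<close> and \<open>\<Psi>\<close>, up to the factor \<open>1 / d\<close>.\<close>
lemma wedge_coeff_good:
  assumes g: "good z" and br: "branch_plus p a \<alpha> \<phi> A" "branch_minus p a \<alpha> \<theta> A" "z \<in> A"
  shows "wedge_coeff \<phi> \<theta> z / (\<phi> z * \<theta> z) = 0 \<longleftrightarrow> W z = 0"
proof -
  obtain x y where z: "z = (x, y)" by (cases z)
  let ?Y = "Yc z"
  have Vz: "z \<in> V" "(?Y, y) \<in> V" using good_reg[OF g] z by auto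
  have Yx: "?Y \<noteq> 0" "x \<noteq> 0" using P.V_D(4) Vz z by fastforce+
  have dp: "d > 0" using deg by simp
  have oA: "open A" using br(1) by (simp add: branch_plus_def)
  define B where "B = A \<inter> {z. good z}"
  have oB: "open B" "z \<in> B" using oA open_good br(3) g by (auto simp: B_def)
  have slice: "open {s. (s, y) \<in> B}" "open {t. (x, t) \<in> B}"
  proof -
    have "open ((\<lambda>s. (s, y)) -` B)" "open ((\<lambda>t. (x, t)) -` B)" by (intro open_vimage[OF oB(1)] continuous_intros)+
    then show "open {s. (s, y) \<in> B}" "open {t. (x, t) \<in> B}" by (simp_all add: vimage_def)
  qed
  have xB: "x \<in> {s. (s, y) \<in> B}" "y \<in> {t. (x, t) \<in> B}" using oB(2) z by auto
  have h\<phi>: "holomorphic2_on \<phi> A" and h\<theta>: "holomorphic2_on \<theta> A" using br by (auto simp: branch_plus_def branch_minus_def)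
  have zA: "(x, y) \<in> A" using br(3) z by simp
  obtain n where n: "\<And>w. w \<in> A \<Longrightarrow> \<phi> w ^ (d ^ n) = 1 ^ (\<Sum>j<n. d ^ j) * P.\<Phi> ((P.F ^^ n) w)"
    using br(1) unfolding branch_plus_eq P.branch_def by blast
  have \<phi>eq: "\<phi> w ^ (d ^ n) = 1 * P.\<Phi> w ^ (d ^ n)" if "w \<in> B" for w
    using n[of w] P.Phi_Fn[of w n] good_reg(3)[of w] that by (simp add: B_def)
  obtain m where m: "\<And>w. w \<in> sw ` A \<Longrightarrow> (N.F ^^ m) w \<in> V \<and> \<theta> (sw w) ^ (d ^ m) = a ^ (\<Sum>j<m. d ^ j) * N.\<Phi> ((N.F ^^ m) w)"
    using br(2) unfolding branch_minus_iff N.branch_def by blast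
  have m0: "m \<noteq> 0"
  proof
    assume "m = 0"
    then have "sw z \<in> V" using m[of "sw z"] br(3) by auto
    then show False using Vz(1) by (auto simp: V_plus_def split: prod.splits)
  qed
  define k where "k = m - 1"
  define K where "K = a ^ (\<Sum>j<m. d ^ j) * (\<eta> ^ (d ^ k) / \<eta>)"
  have \<theta>eq: "\<theta> w ^ (d ^ m) = K * \<Psi> w ^ (d ^ k)" if "w \<in> B" for w
  proof -
    have w: "w \<in> A" "good w" using that by (auto simp: B_def)
    have "(N.F ^^ m) (sw w) = (N.F ^^ k) (N.F (sw w))"
      using m0 by (metis Suc_pred' comp_apply funpow_Suc_right k_def One_nat_def not_gr_zero)
    then have "N.\<Phi> ((N.F ^^ m) (sw w)) = \<eta> ^ (d ^ k) / \<eta> * \<Psi> w ^ (d ^ k)"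
      unfolding N_F_sw_eq \<Psi>_def using N.Phi_Fn[OF good_reg(4)[OF w(2)], of k] by simp
    then show ?thesis using m[of "sw w"] w(1) by (simp add: K_def)
  qed
  have K0: "K \<noteq> 0" using a0 N.eta0 by (simp add: K_def)
  have nz: "\<phi> z \<noteq> 0" "P.\<Phi> z \<noteq> 0" "\<theta> z \<noteq> 0" "\<Psi> z \<noteq> 0"
  proof -
    show P: "P.\<Phi> z \<noteq> 0" "\<Psi> z \<noteq> 0" using P.Phi_nonzero[OF Vz(1)] Psi_nonzero[OF g] by auto
    show "\<phi> z \<noteq> 0" using \<phi>eq[OF oB(2)] P dp by (metis mult_1 power_eq_0_iff zero_power zero_less_power)
    show "\<theta> z \<noteq> 0" using \<theta>eq[OF oB(2)] P K0 dp by (metis mult_eq_0_iff power_not_zero zero_power zero_less_power)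
  qed
  have L1: "of_nat (d ^ n) * (D1 \<phi> z / \<phi> z) = of_nat (d ^ n) * (D1 P.\<Phi> z / P.\<Phi> z)" unfolding z
    by (rule logarithmic_derivative_power[OF holomorphic2_on_slice1[OF h\<phi> zA]
        holomorphic2_on_slice1[OF P.holomorphic2_Phi Vz(1)[unfolded z]] slice(1) xB(1), of _ 1])
      (use \<phi>eq nz dp z in auto)
  have L2: "of_nat (d ^ n) * (D2 \<phi> z / \<phi> z) = of_nat (d ^ n) * (D2 P.\<Phi> z / P.\<Phi> z)" unfolding z
    by (rule logarithmic_derivative_power[OF holomorphic2_on_slice2[OF h\<phi> zA]
        holomorphic2_on_slice2[OF P.holomorphic2_Phi Vz(1)[unfolded z]] slice(2) xB(2), of _ 1])
      (use \<phi>eq nz dp z in auto)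
  define \<Psi>1 where "\<Psi>1 = D1 N.\<Phi> (?Y, y) * (- 1 / a)"
  define \<Psi>2 where "\<Psi>2 = D1 N.\<Phi> (?Y, y) * (poly (pderiv p) y / a) + D2 N.\<Phi> (?Y, y)"
  have dPsi: "((\<lambda>s. \<Psi> (s, y)) has_field_derivative \<Psi>1) (at x)" "((\<lambda>t. \<Psi> (x, t)) has_field_derivative \<Psi>2) (at y)"
    using Psi_derivatives[OF g] by (simp_all add: z \<Psi>1_def \<Psi>2_def)
  have L3: "of_nat (d ^ m) * (D1 \<theta> z / \<theta> z) = of_nat (d ^ k) * (\<Psi>1 / \<Psi> z)" unfolding z
    by (rule logarithmic_derivative_power[OF holomorphic2_on_slice1[OF h\<theta> zA] dPsi(1) slice(1) xB(1), of _ K])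
      (use \<theta>eq nz dp z in auto)
  have L4: "of_nat (d ^ m) * (D2 \<theta> z / \<theta> z) = of_nat (d ^ k) * (\<Psi>2 / \<Psi> z)" unfolding z
    by (rule logarithmic_derivative_power[OF holomorphic2_on_slice2[OF h\<theta> zA] dPsi(2) slice(2) xB(2), of _ K])
      (use \<theta>eq nz dp z in auto)
  have dm: "(of_nat (d ^ m) :: complex) \<noteq> 0" "(of_nat (d ^ n) :: complex) \<noteq> 0" "(of_nat (d ^ k) :: complex) \<noteq> 0" using dp by auto
  have A: "D1 \<phi> z / \<phi> z = 1 / x + D1 P.E z" "D2 \<phi> z / \<phi> z = D2 P.E z" using L1 L2 P.Phi_log_derivatives[OF Vz(1)[unfolded z]] unfolding z
    by (simp_all only: mult_left_cancel[OF dm(2)])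
  have N1: "D1 N.\<Phi> (?Y, y) / \<Psi> z = 1 / ?Y + D1 N.E (?Y, y)" "D2 N.\<Phi> (?Y, y) / \<Psi> z = D2 N.E (?Y, y)"
    using N.Phi_log_derivatives[OF Vz(2)] by (simp_all add: \<Psi>_def z)
  define q1 where "q1 = 1 / x + D1 P.E z"
  define q2 where "q2 = 1 / ?Y + D1 N.E (?Y, y)"
  have P1: "\<Psi>1 / \<Psi> z = q2 * (- 1 / a)"
  proof -
    have "\<Psi>1 / \<Psi> z = (D1 N.\<Phi> (?Y, y) / \<Psi> z) * (- 1 / a)" by (simp add: \<Psi>1_def)
    then show ?thesis unfolding N1(1) q2_def .
  qed
  have P2: "\<Psi>2 / \<Psi> z = q2 * (poly (pderiv p) y / a) + D2 N.E (?Y, y)"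
  proof -
    have "\<Psi>2 / \<Psi> z = (D1 N.\<Phi> (?Y, y) / \<Psi> z) * (poly (pderiv p) y / a) + D2 N.\<Phi> (?Y, y) / \<Psi> z" by (simp add: \<Psi>2_def add_divide_distrib)
    then show ?thesis unfolding N1 q2_def .
  qed
  define c where "c = (of_nat (d ^ k) :: complex) / of_nat (d ^ m)"
  have c0: "c \<noteq> 0" using dm by (simp add: c_def)
  have X1: "D1 \<theta> z / \<theta> z = c * (\<Psi>1 / \<Psi> z)" "D2 \<theta> z / \<theta> z = c * (\<Psi>2 / \<Psi> z)"
  proof -
    have e: "u = of_nat (d ^ k) / of_nat (d ^ m) * v" if "of_nat (d ^ m) * u = of_nat (d ^ k) * v" for u v :: complex
    proof -
      have "u = (of_nat (d ^ k) * v) / of_nat (d ^ m)" unfolding that[symmetric] using dm(1) by simp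
      then show ?thesis by simp
    qed
    show "D1 \<theta> z / \<theta> z = c * (\<Psi>1 / \<Psi> z)" "D2 \<theta> z / \<theta> z = c * (\<Psi>2 / \<Psi> z)" unfolding c_def by (rule e[OF L3], rule e[OF L4])
  qed
  have "wedge_coeff \<phi> \<theta> z / (\<phi> z * \<theta> z) = (D1 \<phi> z / \<phi> z) * (D2 \<theta> z / \<theta> z) - (D2 \<phi> z / \<phi> z) * (D1 \<theta> z / \<theta> z)"
    using nz by (simp add: wedge_coeff_def D1_def D2_def field_simps)
  also have "\<dots> = c * (q1 * (q2 * (poly (pderiv p) y / a) + D2 N.E (?Y, y)) - D2 P.E z * (q2 * (- 1 / a)))"
    unfolding X1 P1 P2 A q1_def[symmetric] by (simp add: algebra_simps)
  finally have w: "wedge_coeff \<phi> \<theta> z / (\<phi> z * \<theta> z) = c * (q1 * (q2 * (poly (pderiv p) y / a) + D2 N.E (?Y, y)) - D2 P.E z * (q2 * (- 1 / a)))" .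
  have den: "1 + x * D1 P.E z \<noteq> 0" "1 + ?Y * D1 N.E (?Y, y) \<noteq> 0"
    using P.T_denominator(2)[of x y] N.T_denominator(2)[of ?Y y] g by (auto simp: good_def z)
  have q10: "q1 = (1 + x * D1 P.E z) / x" "q2 = (1 + ?Y * D1 N.E (?Y, y)) / ?Y" using Yx by (simp_all add: q1_def q2_def field_simps)
  have q0: "q1 \<noteq> 0" "q2 \<noteq> 0" using den Yx by (simp_all add: q10)
  have TP: "P.T z = D2 P.E z / q1" "N.T (?Y, y) = D2 N.E (?Y, y) / q2" using den Yx by (simp_all add: P.T_def N.T_def q10 z)
  have "W z * (q1 * q2) = a * (q1 * (q2 * (poly (pderiv p) y / a) + D2 N.E (?Y, y)) - D2 P.E z * (q2 * (- 1 / a)))"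
  proof -
    have "W z = poly (pderiv p) y + D2 P.E z / q1 + a * (D2 N.E (?Y, y) / q2)" using TP by (simp add: W_def z)
    then show ?thesis using q0 a0 by (simp add: field_simps)
  qed
  then have "W z = 0 \<longleftrightarrow> q1 * (q2 * (poly (pderiv p) y / a) + D2 N.E (?Y, y)) - D2 P.E z * (q2 * (- 1 / a)) = 0"
    using q0 a0 by (metis mult_eq_0_iff)
  then show ?thesis unfolding w using c0 by simp
qed

lemma critical_locus_good_iff:
  assumes g: "good z"
  shows "z \<in> critical_locus p a \<alpha> \<longleftrightarrow> W z = 0"
proof
  assume "z \<in> critical_locus p a \<alpha>"
  then show "W z = 0" unfolding critical_locus_def using wedge_coeff_good[OF g] by blast
next
  assume W0: "W z = 0"
  let ?w = "(Yc z, snd z)"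
  have Vz: "z \<in> V" "?w \<in> V" using good_reg[OF g] by auto
  have s: "P.\<Phi> z \<noteq> 0" "N.\<Phi> ?w \<noteq> 0" using P.Phi_nonzero N.Phi_nonzero Vz by auto
  obtain \<phi> where \<phi>: "P.branch \<phi> {v. (P.F ^^ 0) v \<in> V \<and> Re (P.\<Phi> ((P.F ^^ 0) v) / P.\<Phi> z) > 0 \<and> cmod (snd ((P.F ^^ 0) v)) < cmod (snd z) + 1}"
    using P.branch_exists[OF s(1)] by blast
  obtain \<theta> where \<theta>: "N.branch \<theta> {v. (N.F ^^ 1) v \<in> V \<and> Re (N.\<Phi> ((N.F ^^ 1) v) / N.\<Phi> ?w) > 0 \<and> cmod (snd ((N.F ^^ 1) v)) < cmod (snd z) + 1}"
    using N.branch_exists[OF s(2)] by blast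
  define A1 where "A1 = {v. (P.F ^^ 0) v \<in> V \<and> Re (P.\<Phi> ((P.F ^^ 0) v) / P.\<Phi> z) > 0 \<and> cmod (snd ((P.F ^^ 0) v)) < cmod (snd z) + 1}"
  define A2 where "A2 = {v. (N.F ^^ 1) v \<in> V \<and> Re (N.\<Phi> ((N.F ^^ 1) v) / N.\<Phi> ?w) > 0 \<and> cmod (snd ((N.F ^^ 1) v)) < cmod (snd z) + 1}"
  have zA1: "z \<in> A1" using Vz s by (simp add: A1_def)
  have zA2: "sw z \<in> A2" using Vz s by (simp add: A2_def N_F_sw_eq)
  have o1: "open A1" using \<phi> by (simp add: A1_def P.branch_def)
  have o2: "open A2" using \<theta> by (simp add: A2_def N.branch_def)
  have o2': "open (sw ` A2)" by (rule open_swap_image[OF o2])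
  define A where "A = A1 \<inter> sw ` A2"
  have oA: "open A" using o1 o2' by (auto simp: A_def)
  have zA: "z \<in> A" using zA1 zA2 by (auto simp: A_def sw_image)
  have b1: "branch_plus p a \<alpha> \<phi> A" unfolding branch_plus_eq by (rule P.branch_subset[OF \<phi> oA]) (auto simp: A_def A1_def)
  have "sw ` A \<subseteq> A2" by (auto simp: A_def sw_image)
  then have b2: "branch_minus p a \<alpha> (\<lambda>v. \<theta> (sw v)) A"
    unfolding branch_minus_iff using N.branch_subset[OF \<theta>[folded A2_def] open_swap_image[OF oA]] by simp
  have "wedge_coeff \<phi> (\<lambda>v. \<theta> (sw v)) z / (\<phi> z * \<theta> (sw z)) = 0" using wedge_coeff_good[OF g b1 b2 zA] W0 by simp
  then show "z \<in> critical_locus p a \<alpha>" unfolding critical_locus_def using good_U[OF g] b1 b2 zA by blast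
qed

end


lemma constant_if_root_group_ratio:
  fixes \<theta> :: "complex \<Rightarrow> complex"
  assumes D: "open D" "connected D" and \<theta>: "\<theta> holomorphic_on D" and z: "z \<in> D" "\<theta> z \<noteq> 0" and \<delta>: "\<delta> > 0"
    and r: "\<And>y. y \<in> ball z \<delta> \<Longrightarrow> y \<in> D \<Longrightarrow> \<theta> y / \<theta> z \<in> root_group d" and d: "0 < d" and y: "y \<in> D"
  shows "\<theta> y = \<theta> z"
proof -
  obtain e where e: "e > 0" "ball z e \<subseteq> D" using D(1) z(1) openE by blast
  define t where "t = min e \<delta>"
  have t: "t > 0" "ball z t \<subseteq> D" "ball z t \<subseteq> ball z \<delta>" using e \<delta> by (auto simp: t_def)
  have const: "\<theta> w - \<theta> z = 0" if w: "w \<in> ball z t" for w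
  proof -
    have "\<theta> w / \<theta> z = \<theta> z / \<theta> z"
    proof (rule constant_if_countable_range[where A = "ball z t" and f = "\<lambda>w. \<theta> w / \<theta> z", OF _ _ countable_root_group[OF d]])
      show "continuous_on (ball z t) (\<lambda>w. \<theta> w / \<theta> z)"
        using z(2) t(2) by (intro continuous_intros holomorphic_on_imp_continuous_on holomorphic_on_subset[OF \<theta>]) auto
      show "\<theta> w / \<theta> z \<in> root_group d" if "w \<in> ball z t" for w using r that t by blast
    qed (use w t in auto)
    then show ?thesis using z(2) by simp
  qed
  have "\<theta> y - \<theta> z = 0"
  proof (rule analytic_continuation[of "\<lambda>w. \<theta> w - \<theta> z" D "ball z t" z])
    show "(\<lambda>w. \<theta> w - \<theta> z) holomorphic_on D" by (intro holomorphic_intros \<theta>)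
    show "z islimpt ball z t" using t(1) by (simp add: islimpt_ball)
    show "\<theta> w - \<theta> z = 0" if "w \<in> ball z t" for w by (rule const[OF that])
  qed (rule D t(2) z(1) y)+
  then show ?thesis by simp
qed

context bott
begin

lemma not_U_bound:
  assumes "z \<notin> U"
  shows "cmod (fst ((F ^^ n) z)) \<le> max (cmod (snd z)) \<alpha>"
proof -
  have nV: "(F ^^ n) z \<notin> V" for n using assms by (auto simp: U_def)
  show ?thesis
  proof (induction n)
    case 0
    show ?case using not_V[OF nV[of 0]] by simp
  next
    case (Suc n)
    have "snd ((F ^^ Suc n) z) = fst ((F ^^ n) z)" by simp
    then have "cmod (snd ((F ^^ Suc n) z)) \<le> max (cmod (snd z)) \<alpha>" using Suc by (simp only:)
    then show ?case using not_V[OF nV[of "Suc n"]] unfolding max_def by (simp split: if_splits)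
  qed
qed

lemma eqv_Fn_iff: "eqv ((F ^^ n) z) ((F ^^ n) w) \<longleftrightarrow> eqv z w"
proof
  assume "eqv ((F ^^ n) z) ((F ^^ n) w)"
  then obtain m where "(F ^^ m) ((F ^^ n) z) \<in> V" "(F ^^ m) ((F ^^ n) w) \<in> V" "\<psi> ((F ^^ m) ((F ^^ n) z)) = \<psi> ((F ^^ m) ((F ^^ n) w))"
    unfolding eqv_def by blast
  moreover have "(F ^^ m) ((F ^^ n) x) = (F ^^ (m + n)) x" for x by (simp add: funpow_add)
  ultimately show "eqv z w" unfolding eqv_def by metis
next
  show "eqv z w \<Longrightarrow> eqv ((F ^^ n) z) ((F ^^ n) w)" by (induction n) (auto intro: eqv_F)
qed

end

context henon_map
begin

lemma W_bound:
  obtains C M where "C \<ge> 0" "M > 1" "\<And>x y. cmod x > M \<Longrightarrow> y \<in> cball c 1 \<Longrightarrow> good (x, y) \<and> cmod (W (x, y) - poly (pderiv p) y) \<le> C / cmod x ^ (d - 1)"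
proof -
  obtain CP where CP: "CP \<ge> 0" "\<And>x y. cmod x > P.MT \<Longrightarrow> cmod y \<le> cmod x / 2 \<Longrightarrow> cmod (P.T (x, y)) \<le> CP / cmod x ^ (d - 1)"
    using P.T_bound by blast
  obtain CN where CN: "CN \<ge> 0" "\<And>x y. cmod x > N.MT \<Longrightarrow> cmod y \<le> cmod x / 2 \<Longrightarrow> cmod (N.T (x, y)) \<le> CN / cmod x ^ (d - 1)"
    using N.T_bound by blast
  have "bounded (poly p ` cball c 1)" by (intro compact_imp_bounded compact_continuous_image continuous_intros) auto
  then obtain B where B: "B > 0" "\<And>y. y \<in> cball c 1 \<Longrightarrow> cmod (poly p y) \<le> B" unfolding bounded_pos by auto
  define M where "M = P.MT + N.MT + 2 * B + 2 * cmod c + 3"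
  have M: "M > P.MT" "M > N.MT" "M > 2 * B" "M > 2 * cmod c + 2" "M > 1"
    using P.MT(3) N.MT(3) B(1) norm_ge_zero[of c] unfolding M_def by (simp_all add: add_nonneg_pos add_pos_nonneg)
  show ?thesis
  proof (rule that[of "CP + CN" M])
    fix x y assume x: "cmod x > M" and y: "y \<in> cball c 1"
    have "cmod y \<le> cmod c + 1" using y norm_triangle_ineq[of c "y - c"] by (simp add: dist_norm norm_minus_commute)
    then have y2: "cmod y < cmod x / 2" using x M(4) by argo
    have "cmod x - B \<le> cmod (poly p y - x)" using norm_triangle_ineq2[of x "poly p y"] B(2)[OF y] by (simp add: norm_minus_commute)
    then have "cmod (poly p y - x) \<ge> cmod x / 2" using x M by linarith
    moreover have "cmod (poly p y - x) = cmod a * cmod (Yc (x, y))" using a0 by (simp add: Yc_def norm_divide)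
    moreover have "cmod a * cmod (Yc (x, y)) \<le> 1 / 2 * cmod (Yc (x, y))" using a_half by (intro mult_right_mono) auto
    ultimately have Yx: "cmod (Yc (x, y)) \<ge> cmod x" by linarith
    have x1: "cmod x > P.MT" "cmod (Yc (x, y)) > N.MT" "cmod y < cmod (Yc (x, y)) / 2" "cmod x > 0" using x M Yx y2 by linarith+
    have "cmod (P.T (x, y)) \<le> CP / cmod x ^ (d - 1)" using x1 y2 by (intro CP(2)) auto
    moreover have "cmod (a * N.T (Yc (x, y), y)) \<le> CN / cmod x ^ (d - 1)"
    proof -
      have "cmod (a * N.T (Yc (x, y), y)) \<le> 1 * cmod (N.T (Yc (x, y), y))" unfolding norm_mult using a_half by (intro mult_right_mono) auto
      also have "\<dots> \<le> CN / cmod (Yc (x, y)) ^ (d - 1)" using CN(2)[of "Yc (x, y)" y] x1 by simp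
      also have "\<dots> \<le> CN / cmod x ^ (d - 1)" using CN(1) Yx x1 by (intro divide_left_mono power_mono mult_pos_pos zero_less_power) auto
      finally show ?thesis .
    qed
    ultimately have "cmod (P.T (x, y) + a * N.T (Yc (x, y), y)) \<le> (CP + CN) / cmod x ^ (d - 1)"
      using norm_triangle_ineq[of "P.T (x, y)" "a * N.T (Yc (x, y), y)"] by (simp add: add_divide_distrib)
    then show "good (x, y) \<and> cmod (W (x, y) - poly (pderiv p) y) \<le> (CP + CN) / cmod x ^ (d - 1)" using x1 y2 by (simp add: good_def W_def)
  qed (use CP CN M in auto)
qed

text \<open>Near \<open>(\<infinity>, c)\<close> the critical locus is the graph of a holomorphic function of \<open>x\<close>: the
  Newton map \<open>y \<mapsto> y - W (x, y) / p'' c\<close> is a contraction of a disc around \<open>c\<close>.\<close>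
lemma critical_graph:
  assumes c: "poly (pderiv p) c = 0" and simple: "poly (pderiv (pderiv p)) c \<noteq> 0"
  obtains y M \<rho> C where "0 < \<rho>" "\<rho> \<le> 1 / 2" "M > 1" "C \<ge> 0" "y holomorphic_on {x. cmod x > M}"
    "\<And>x y'. cmod x > M \<Longrightarrow> y' \<in> cball c \<rho> \<Longrightarrow> good (x, y')"
    "\<And>x. cmod x > M \<Longrightarrow> y x \<in> ball c \<rho> \<and> W (x, y x) = 0 \<and> cmod (y x - c) \<le> C / cmod x ^ (d - 1)"
    "\<And>x y'. cmod x > M \<Longrightarrow> y' \<in> cball c \<rho> \<Longrightarrow> W (x, y') = 0 \<Longrightarrow> y' = y x"
proof -
  define \<kappa> where "\<kappa> = poly (pderiv (pderiv p)) c"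
  have \<kappa>: "cmod \<kappa> > 0" "\<kappa> \<noteq> 0" using simple by (auto simp: \<kappa>_def)
  obtain C M0 where CM: "C \<ge> 0" "M0 > 1" "\<And>x y. cmod x > M0 \<Longrightarrow> y \<in> cball c 1 \<Longrightarrow> good (x, y) \<and> cmod (W (x, y) - poly (pderiv p) y) \<le> C / cmod x ^ (d - 1)"
    using W_bound[of c] by blast
  have "isCont (poly (pderiv (pderiv p))) c" by simp
  then obtain \<rho>0 where \<rho>0: "\<rho>0 > 0" "\<And>y. dist y c < \<rho>0 \<Longrightarrow> dist (poly (pderiv (pderiv p)) y) \<kappa> < cmod \<kappa> / 8"
    using \<kappa>(1) unfolding continuous_at_eps_delta \<kappa>_def by (metis divide_pos_pos zero_less_numeral)
  define \<rho> where "\<rho> = min (1 / 2) (\<rho>0 / 2)"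
  have \<rho>: "\<rho> > 0" "\<rho> \<le> 1 / 2" "\<rho> < \<rho>0" using \<rho>0(1) by (auto simp: \<rho>_def)
  define M where "M = max M0 (max (16 * C / cmod \<kappa>) (2 * C / (cmod \<kappa> * \<rho>)))"
  have M: "M \<ge> M0" "M \<ge> 16 * C / cmod \<kappa>" "M \<ge> 2 * C / (cmod \<kappa> * \<rho>)" by (auto simp: M_def)
  have sub1: "cball c \<rho> \<subseteq> cball c 1" using \<rho> by auto
  have gd: "good (x, y')" if "cmod x > M" "y' \<in> cball c 1" for x y' using CM(3)[of x y'] M(1) that by auto
  have xpow: "C / cmod x ^ (d - 1) \<le> C / cmod x" if "cmod x > M" for x
  proof -
    have x1: "cmod x \<ge> 1" using that M(1) CM(2) by linarith
    have "cmod x ^ 1 \<le> cmod x ^ (d - 1)" using x1 deg by (intro power_increasing) auto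
    then show ?thesis using x1 CM(1) by (intro divide_left_mono mult_pos_pos) auto
  qed
  define K where "K = (\<lambda>x y. y - W (x, y) / \<kappa>)"
  have dW: "((\<lambda>t. W (x, t)) has_field_derivative D2 W (x, t)) (at t)" if "cmod x > M" "t \<in> cball c 1" for x t
    using holomorphic2_on_slice2[OF holomorphic2_W, of x t] gd[OF that] by simp
  have D2W: "cmod (D2 W (x, t) - \<kappa>) \<le> cmod \<kappa> / 4" if x: "cmod x > M" and t: "t \<in> cball c \<rho>" for x t
  proof -
    have x0: "cmod x > 0" using x M(1) CM(2) by linarith
    have tb: "cball t (1 / 2) \<subseteq> cball c 1"
    proof
      fix w assume "w \<in> cball t (1 / 2)"
      then show "w \<in> cball c 1" using t \<rho>(2) dist_triangle[of c w t] by simp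
    qed
    have t1: "t \<in> cball c 1" using t sub1 by blast
    have "cmod (deriv (\<lambda>w. W (x, w) - poly (pderiv p) w) t) \<le> (C / cmod x ^ (d - 1)) / (1 / 2)"
    proof (rule deriv_bound_from_cball)
      have "(\<lambda>w. W (x, w)) holomorphic_on cball t (1 / 2)"
        by (rule holomorphic2_on_slice2_holomorphic[OF holomorphic2_W]) (use gd[OF x] tb in auto)
      then show "(\<lambda>w. W (x, w) - poly (pderiv p) w) holomorphic_on cball t (1 / 2)" by (intro holomorphic_intros)
      show "cmod (W (x, w) - poly (pderiv p) w) \<le> C / cmod x ^ (d - 1)" if "w \<in> cball t (1 / 2)" for w
        using CM(3)[of x w] x M(1) tb that by (meson le_less_trans subsetD)
    qed simp
    moreover have "deriv (\<lambda>w. W (x, w) - poly (pderiv p) w) t = D2 W (x, t) - poly (pderiv (pderiv p)) t"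
      by (rule DERIV_imp_deriv) (intro DERIV_diff dW[OF x t1] poly_DERIV)
    ultimately have "cmod (D2 W (x, t) - poly (pderiv (pderiv p)) t) \<le> C / cmod x ^ (d - 1) / (1 / 2)" by (simp only:)
    then have "cmod (D2 W (x, t) - poly (pderiv (pderiv p)) t) \<le> 2 * (C / cmod x ^ (d - 1))" by (simp add: mult.commute)
    also have "\<dots> \<le> 2 * (C / cmod x)" using xpow[OF x] by simp
    also have "\<dots> \<le> cmod \<kappa> / 8"
    proof -
      have "16 * C / cmod \<kappa> \<le> cmod x" using M(2) x by linarith
      then show ?thesis using \<kappa>(1) x0 by (simp add: field_simps)
    qed
    finally have 1: "cmod (D2 W (x, t) - poly (pderiv (pderiv p)) t) \<le> cmod \<kappa> / 8" .
    have "dist t c < \<rho>0" using t \<rho>(3) by (simp add: dist_commute)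
    then have 2: "cmod (poly (pderiv (pderiv p)) t - \<kappa>) < cmod \<kappa> / 8" using \<rho>0(2) by (simp add: dist_norm)
    have "cmod (D2 W (x, t) - \<kappa>) \<le> cmod (D2 W (x, t) - poly (pderiv (pderiv p)) t) + cmod (poly (pderiv (pderiv p)) t - \<kappa>)"
      using norm_triangle_ineq[of "D2 W (x, t) - poly (pderiv (pderiv p)) t" "poly (pderiv (pderiv p)) t - \<kappa>"] by simp
    then show ?thesis using 1 2 by argo
  qed
  have Klip: "cmod (K x y1 - K x y2) \<le> 1 / 4 * cmod (y1 - y2)" if x: "cmod x > M" and y: "y1 \<in> cball c \<rho>" "y2 \<in> cball c \<rho>" for x y1 y2
  proof (rule field_differentiable_bound[where S = "cball c \<rho>" and f' = "\<lambda>t. 1 - D2 W (x, t) / \<kappa>"])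
    fix t assume t: "t \<in> cball c \<rho>"
    have "((\<lambda>t. t - W (x, t) / \<kappa>) has_field_derivative 1 - D2 W (x, t) / \<kappa>) (at t)"
      by (intro DERIV_diff DERIV_ident DERIV_cdivide dW[OF x]) (use t sub1 in blast)
    then show "(K x has_field_derivative 1 - D2 W (x, t) / \<kappa>) (at t within cball c \<rho>)"
      unfolding K_def by (rule has_field_derivative_at_within)
    have "cmod (1 - D2 W (x, t) / \<kappa>) = cmod (D2 W (x, t) - \<kappa>) / cmod \<kappa>"
      using \<kappa> by (simp add: norm_minus_commute diff_divide_distrib flip: norm_divide)
    also have "\<dots> \<le> (cmod \<kappa> / 4) / cmod \<kappa>" using D2W[OF x t] by (intro divide_right_mono) auto
    finally show "cmod (1 - D2 W (x, t) / \<kappa>) \<le> 1 / 4" using \<kappa> by simp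
  qed (use y in auto)
  have cc: "c \<in> cball c \<rho>" using \<rho> by simp
  have Kc: "cmod (K x c - c) \<le> C / cmod x ^ (d - 1) / cmod \<kappa>" "cmod (K x c - c) \<le> \<rho> / 2" if x: "cmod x > M" for x
  proof -
    have x0: "cmod x > 0" using x M(1) CM(2) by linarith
    have "cmod (W (x, c)) \<le> C / cmod x ^ (d - 1)" using CM(3)[of x c] x M(1) c by simp
    then show 1: "cmod (K x c - c) \<le> C / cmod x ^ (d - 1) / cmod \<kappa>"
      using \<kappa> divide_right_mono[of "cmod (W (x, c))" _ "cmod \<kappa>"] by (simp add: K_def norm_divide del: divide_divide_eq_left)
    also have "\<dots> \<le> C / cmod x / cmod \<kappa>" using xpow[OF x] \<kappa> by (intro divide_right_mono) auto
    also have "\<dots> \<le> \<rho> / 2"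
    proof -
      have "2 * C / (cmod \<kappa> * \<rho>) \<le> cmod x" using M(3) x by linarith
      then show ?thesis using \<kappa>(1) x0 \<rho>(1) by (simp add: field_simps)
    qed
    finally show "cmod (K x c - c) \<le> \<rho> / 2" .
  qed
  have fix_ex: "\<exists>!t\<in>cball c \<rho>. K x t = t" if x: "cmod x > M" for x
  proof (rule Banach_fix[where c = "1 / 4"])
    show "K x ` cball c \<rho> \<subseteq> cball c \<rho>"
    proof
      fix k assume "k \<in> K x ` cball c \<rho>"
      then obtain t where t: "t \<in> cball c \<rho>" "k = K x t" by blast
      have "cmod (K x t - c) \<le> cmod (K x t - K x c) + cmod (K x c - c)" using norm_triangle_ineq[of "K x t - K x c" "K x c - c"] by simp
      also have "\<dots> \<le> 1 / 4 * cmod (t - c) + \<rho> / 2" using Klip[OF x t(1) cc] Kc(2)[OF x] by linarith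
      also have "\<dots> \<le> \<rho>" using t(1) \<rho>(1) by (simp add: dist_norm norm_minus_commute)
      finally show "k \<in> cball c \<rho>" using t(2) by (simp add: dist_norm norm_minus_commute)
    qed
    show "dist (K x y1) (K x y2) \<le> 1 / 4 * dist y1 y2" if "y1 \<in> cball c \<rho>" "y2 \<in> cball c \<rho>" for y1 y2
      using Klip[OF x that] by (simp add: dist_norm)
  qed (use cc in \<open>auto simp: complete_eq_closed\<close>)
  have KW: "K x t = t \<longleftrightarrow> W (x, t) = 0" for x t using \<kappa> by (simp add: K_def)
  define y where "y = (\<lambda>x. THE t. t \<in> cball c \<rho> \<and> K x t = t)"
  have y: "y x \<in> cball c \<rho>" "W (x, y x) = 0" if "cmod x > M" for x
  proof -
    have "y x \<in> cball c \<rho> \<and> K x (y x) = y x" using theI'[OF fix_ex[OF that]] by (simp only: y_def)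
    then show "y x \<in> cball c \<rho>" "W (x, y x) = 0" using KW by blast+
  qed
  have yu: "t = y x" if "cmod x > M" "t \<in> cball c \<rho>" "W (x, t) = 0" for x t
    using fix_ex[OF that(1)] y[OF that(1)] that(2,3) unfolding KW by blast
  have yc: "cmod (y x - c) \<le> 4 / 3 * cmod (K x c - c)" if x: "cmod x > M" for x
  proof -
    have "K x (y x) = y x" using y(2)[OF x] KW by blast
    then have "cmod (y x - c) \<le> cmod (K x (y x) - K x c) + cmod (K x c - c)"
      using norm_triangle_ineq[of "K x (y x) - K x c" "K x c - c"] by simp
    then show ?thesis using Klip[OF x y(1)[OF x] cc] by linarith
  qed
  have opM: "open {x::complex. cmod x > M}" by (intro open_Collect_less continuous_intros)
  have ycont: "isCont y x" if x: "cmod x > M" for x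
  proof -
    have "isCont (\<lambda>x'. W (x', y x)) x"
    proof (rule isCont_o2[of _ "\<lambda>x'. (x', y x)"])
      show "isCont W (x, y x)" using holomorphic2_on_isCont[OF holomorphic2_W] gd[OF x] y(1)[OF x] sub1 by blast
    qed (intro continuous_intros)
    then have l: "((\<lambda>x'. W (x', y x)) \<longlongrightarrow> 0) (at x)" using y(2)[OF x] by (simp add: isCont_def)
    have "((\<lambda>x'. 4 / 3 * (cmod (W (x', y x)) / cmod \<kappa>)) \<longlongrightarrow> 4 / 3 * (cmod 0 / cmod \<kappa>)) (at x)" using \<kappa> by (intro tendsto_intros l) auto
    then have l0: "((\<lambda>x'. 4 / 3 * (cmod (W (x', y x)) / cmod \<kappa>)) \<longlongrightarrow> 0) (at x)" by simp
    have "((\<lambda>x'. y x' - y x) \<longlongrightarrow> 0) (at x)"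
    proof (rule Lim_null_comparison[OF _ l0])
      have "\<forall>\<^sub>F x' in at x. x' \<in> {x. cmod x > M}" using opM x by (intro eventually_at_in_open') auto
      then show "\<forall>\<^sub>F x' in at x. norm (y x' - y x) \<le> 4 / 3 * (cmod (W (x', y x)) / cmod \<kappa>)"
      proof eventually_elim
        case (elim x')
        then have x': "cmod x' > M" by simp
        have "y x' - y x = (K x' (y x') - K x' (y x)) - W (x', y x) / \<kappa>" using y(2)[OF x'] by (simp add: K_def)
        then have "cmod (y x' - y x) \<le> cmod (K x' (y x') - K x' (y x)) + cmod (W (x', y x) / \<kappa>)" by (metis norm_triangle_ineq4)
        then have "cmod (y x' - y x) \<le> 1 / 4 * cmod (y x' - y x) + cmod (W (x', y x)) / cmod \<kappa>"
          using Klip[OF x' y(1)[OF x'] y(1)[OF x]] by (simp add: norm_divide)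
        then show ?case by linarith
      qed
    qed
    then show ?thesis by (simp add: isCont_def LIM_zero_iff)
  qed
  have yhol: "y holomorphic_on {x. cmod x > M}" unfolding holomorphic_on_def
  proof
    fix x assume "x \<in> {x. cmod x > M}"
    then have x: "cmod x > M" by simp
    have "y field_differentiable at x"
    proof (rule implicit_field_differentiable[where A = "\<lambda>x. x" and N = W and T = "{z. good z}"])
      show "(x, y x) \<in> {z. good z}" using gd[OF x] y(1)[OF x] sub1 by blast
      have "cmod (D2 W (x, y x) - \<kappa>) \<le> cmod \<kappa> / 4" by (rule D2W[OF x y(1)[OF x]])
      then show "D2 W (x, y x) \<noteq> 0" using \<kappa> by auto
      have "((\<lambda>x'. W (x', y x')) has_field_derivative 0) (at x)"
        by (rule has_field_derivative_transform_within_open[OF _ opM, of "\<lambda>_. 0"]) (use x y(2) in auto)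
      then show "(\<lambda>x'. W (x', y x')) field_differentiable at x" by (auto simp: field_differentiable_def)
    qed (use x ycont holomorphic2_W in auto)
    then show "y field_differentiable at x within {x. cmod x > M}" by (rule field_differentiable_at_within)
  qed
  show ?thesis
  proof (rule that[of \<rho> M "4 / 3 * (C / cmod \<kappa>)" y])
    fix x assume x: "cmod x > M"
    have "cmod (y x - c) \<le> 4 / 3 * (\<rho> / 2)" using yc[OF x] Kc(2)[OF x] by linarith
    also have "\<dots> < \<rho>" using \<rho>(1) by simp
    finally have 1: "y x \<in> ball c \<rho>" by (simp add: dist_norm norm_minus_commute)
    have "cmod (y x - c) \<le> 4 / 3 * (C / cmod x ^ (d - 1) / cmod \<kappa>)" using yc[OF x] Kc(1)[OF x] by linarith
    then have 2: "cmod (y x - c) \<le> 4 / 3 * (C / cmod \<kappa>) / cmod x ^ (d - 1)" by (simp add: mult_ac)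
    show "y x \<in> ball c \<rho> \<and> W (x, y x) = 0 \<and> cmod (y x - c) \<le> 4 / 3 * (C / cmod \<kappa>) / cmod x ^ (d - 1)" using 1 2 y(2)[OF x] by blast
  qed (use \<rho> CM M \<kappa> yhol yu gd sub1 in auto)
qed

definition Gf :: "complex \<Rightarrow> complex \<Rightarrow> complex" where
  "Gf x y = P.E (x, y) - N.E (Yc (x, y), y) - Ln (1 - poly p y / x)"

definition nondegenerate :: "complex \<Rightarrow> bool" where
  "nondegenerate c \<longleftrightarrow> (coeff p (d - 1) \<noteq> 0 \<longrightarrow> poly p c + (1 + a) * coeff p (d - 1) / of_nat d \<noteq> 0)"

context
  fixes Y :: "complex \<Rightarrow> complex" and c :: complex and C :: real
  assumes Yev: "\<forall>\<^sub>F u in at 0. good (inverse u, Y u) \<and> W (inverse u, Y u) = 0 \<and> cmod (Y u - c) \<le> C * cmod u ^ (d - 1)"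
begin

abbreviation (input) "ZY u \<equiv> Yc (inverse u, Y u)"
abbreviation (input) "EP u \<equiv> P.E (inverse u, Y u)"
abbreviation (input) "EN u \<equiv> N.E (ZY u, Y u)"
abbreviation (input) "TP u \<equiv> P.T (inverse u, Y u)"
abbreviation (input) "TN u \<equiv> N.T (ZY u, Y u)"
abbreviation (input) "QY u \<equiv> poly p (Y u) / inverse u"

lemma inv_inf: "filterlim inverse at_infinity (at (0::complex))" by (rule filterlim_inverse_at_infinity)

lemma tendsto_Y: "(Y \<longlongrightarrow> c) (at 0)"
proof -
  have "((\<lambda>u. C * cmod u ^ (d - 1)) \<longlongrightarrow> C * cmod 0 ^ (d - 1)) (at 0)" by (intro tendsto_intros)
  moreover have "C * cmod 0 ^ (d - 1) = 0" using deg by (simp add: power_0_left)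
  ultimately have l: "((\<lambda>u. C * cmod u ^ (d - 1)) \<longlongrightarrow> 0) (at 0)" by (simp only:)
  have "((\<lambda>u. Y u - c) \<longlongrightarrow> 0) (at 0)" by (rule Lim_null_comparison[OF _ l]) (use Yev in \<open>auto elim: eventually_mono\<close>)
  then show ?thesis by (rule LIM_zero_cancel)
qed

lemma tendsto_pY: "((\<lambda>u. poly p (Y u)) \<longlongrightarrow> poly p c) (at 0)" by (rule isCont_tendsto_compose[OF _ tendsto_Y]) simp

lemma tendsto_upY: "((\<lambda>u. u * poly p (Y u)) \<longlongrightarrow> 0) (at 0)" using tendsto_mult[OF tendsto_ident_at tendsto_pY] by simp

lemma Yc_inverse: "u \<noteq> 0 \<Longrightarrow> ZY u = ((u * poly p (Y u) - 1) / a) * inverse u" by (simp add: Yc_def field_simps)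

lemma ev_nz: "\<forall>\<^sub>F u in at (0::complex). u \<noteq> 0" by (auto simp: eventually_at_filter)

lemma Yc_inf: "filterlim (\<lambda>u. ZY u) at_infinity (at 0)"
proof -
  have "((\<lambda>u. (u * poly p (Y u) - 1) / a) \<longlongrightarrow> (0 - 1) / a) (at 0)" using a0 by (intro tendsto_intros tendsto_upY) auto
  then have "filterlim (\<lambda>u. ((u * poly p (Y u) - 1) / a) * inverse u) at_infinity (at 0)"
    by (rule tendsto_mult_filterlim_at_infinity) (use a0 inv_inf in auto)
  moreover have "\<forall>\<^sub>F u in at 0. ((u * poly p (Y u) - 1) / a) * inverse u = ZY u" using ev_nz by eventually_elim (simp add: Yc_inverse)
  ultimately show ?thesis by (rule filterlim_cong[OF refl refl, THEN iffD1, rotated])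
qed

lemma tendsto_ratio: "((\<lambda>u. inverse u / ZY u) \<longlongrightarrow> - a) (at 0)"
proof -
  have "((\<lambda>u. a / (u * poly p (Y u) - 1)) \<longlongrightarrow> a / (0 - 1)) (at 0)" by (intro tendsto_intros tendsto_upY) auto
  moreover have "\<forall>\<^sub>F u in at 0. a / (u * poly p (Y u) - 1) = inverse u / ZY u" using ev_nz by eventually_elim (simp add: Yc_inverse)
  ultimately show ?thesis using Lim_transform_eventually by fastforce
qed

lemma ev_Yc_nz: "\<forall>\<^sub>F u in at 0. ZY u \<noteq> 0" using Yev
proof eventually_elim
  case (elim u)
  then have "(ZY u, Y u) \<in> V" using good_reg(4)[of "(inverse u, Y u)"] by simp
  then show ?case using N.V_D(4) by fastforce
qed

lemma not_eventually_Gf_zero_if_leading: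
  assumes j: "1 \<le> j" "j < d" "\<And>i. d - j < i \<Longrightarrow> i < d \<Longrightarrow> coeff p i = 0"
    and L: "((\<lambda>u. inverse u ^ j * - QY u) \<longlongrightarrow> L) (at 0)"
    and nz: "coeff p (d - j) / of_nat d * (1 - (- a) ^ j) - L \<noteq> 0"
  shows "\<not> (\<forall>\<^sub>F u in at 0. Gf (inverse u) (Y u) = 0)"
proof
  assume z: "\<forall>\<^sub>F u in at 0. Gf (inverse u) (Y u) = 0"
  have l1: "((\<lambda>u. inverse u ^ j * EP u) \<longlongrightarrow> coeff p (d - j) / of_nat d) (at 0)" by (rule P.tendsto_E_leading[OF inv_inf tendsto_Y j])
  have "((\<lambda>u. (inverse u / ZY u) ^ j * (ZY u ^ j * EN u)) \<longlongrightarrow> (- a) ^ j * (coeff p (d - j) / of_nat d)) (at 0)"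
    by (intro tendsto_mult tendsto_power tendsto_ratio N.tendsto_E_leading[OF Yc_inf tendsto_Y j])
  moreover have "\<forall>\<^sub>F u in at 0. (inverse u / ZY u) ^ j * (ZY u ^ j * EN u) = inverse u ^ j * EN u"
    using ev_Yc_nz by eventually_elim (simp add: power_divide)
  ultimately have l2: "((\<lambda>u. inverse u ^ j * EN u) \<longlongrightarrow> (- a) ^ j * (coeff p (d - j) / of_nat d)) (at 0)" by (rule Lim_transform_eventually)
  have "((\<lambda>u. - (u * poly p (Y u))) \<longlongrightarrow> - 0) (at 0)" by (intro tendsto_intros tendsto_upY)
  then have q0: "((\<lambda>u. - QY u) \<longlongrightarrow> 0) (at 0)" by (simp add: divide_inverse mult.commute)
  have l3: "((\<lambda>u. inverse u ^ j * Ln (1 + - QY u)) \<longlongrightarrow> L) (at 0)" by (rule tendsto_mult_Ln_one_plus[OF q0 L])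
  have "((\<lambda>u. inverse u ^ j * EP u - inverse u ^ j * EN u - inverse u ^ j * Ln (1 + - QY u))
    \<longlongrightarrow> coeff p (d - j) / of_nat d - (- a) ^ j * (coeff p (d - j) / of_nat d) - L) (at 0)" by (intro tendsto_diff l1 l2 l3)
  moreover have "\<forall>\<^sub>F u in at 0. inverse u ^ j * EP u - inverse u ^ j * EN u - inverse u ^ j * Ln (1 + - QY u) = 0" using z
  proof eventually_elim
    case (elim u)
    have "inverse u ^ j * Gf (inverse u) (Y u) = 0" using elim by simp
    then show ?case by (simp add: Gf_def right_diff_distrib)
  qed
  ultimately have "((\<lambda>u. 0) \<longlongrightarrow> coeff p (d - j) / of_nat d - (- a) ^ j * (coeff p (d - j) / of_nat d) - L) (at (0::complex))"
    by (rule Lim_transform_eventually)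
  then have "0 = coeff p (d - j) / of_nat d - (- a) ^ j * (coeff p (d - j) / of_nat d) - L"
    by (rule tendsto_unique[OF trivial_limit_at tendsto_const])
  moreover have "X * (1 - A) - L = X - A * X - L" for X A :: complex by (simp add: right_diff_distrib mult.commute)
  ultimately show False using nz by metis
qed

lemma not_eventually_Gf_zero_square:
  assumes p: "p = monom 1 2" and c0: "c = 0"
  shows "\<not> (\<forall>\<^sub>F u in at 0. Gf (inverse u) (Y u) = 0)"
proof
  assume z: "\<forall>\<^sub>F u in at 0. Gf (inverse u) (Y u) = 0"
  have d2: "d = 2" using p by (simp add: degree_monom_eq)
  have pp: "poly p x = x\<^sup>2" "poly (pderiv p) x = 2 * x" for x by (simp_all add: p poly_monom pderiv_monom)
  define y1 where "y1 = (a - a\<^sup>2) / 4"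
  have t1: "((\<lambda>u. inverse u * TP u) \<longlongrightarrow> - a / 2) (at 0)" using P.tendsto_T[OF inv_inf tendsto_Y] d2 by simp
  have t2: "((\<lambda>u. ZY u * TN u) \<longlongrightarrow> - 1 / 2) (at 0)" using N.tendsto_T[OF Yc_inf tendsto_Y] d2 by simp
  have "((\<lambda>u. - (inverse u * TP u + a * (inverse u / ZY u) * (ZY u * TN u)) / 2)
     \<longlongrightarrow> - (- a / 2 + a * (- a) * (- 1 / 2)) / 2) (at 0)" by (intro tendsto_intros t1 t2 tendsto_ratio) auto
  moreover have "- (- a / 2 + a * (- a) * (- 1 / 2)) / 2 = y1" by (simp add: y1_def power2_eq_square field_simps)
  ultimately have "((\<lambda>u. - (inverse u * TP u + a * (inverse u / ZY u) * (ZY u * TN u)) / 2)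
     \<longlongrightarrow> y1) (at 0)" by simp
  moreover have "\<forall>\<^sub>F u in at 0. - (inverse u * TP u + a * (inverse u / ZY u) * (ZY u * TN u)) / 2
     = inverse u * Y u" using Yev ev_Yc_nz
  proof eventually_elim
    case (elim u)
    then have "2 * Y u = - (TP u + a * TN u)" by (simp add: W_def pp add_eq_0_iff)
    moreover have "v * y = - (v * t + v * s) / 2" if "2 * y = - (t + s)" for v y t s :: complex
    proof -
      have "v * (2 * y) = v * - (t + s)" by (simp only: that)
      then show ?thesis by (simp add: algebra_simps)
    qed
    ultimately have "inverse u * Y u = - (inverse u * TP u + inverse u * (a * TN u)) / 2" by blast
    moreover have "a * (inverse u / ZY u) * (ZY u * TN u) = inverse u * (a * TN u)" using elim by simp
    ultimately show ?case by simp
  qed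
  ultimately have XY: "((\<lambda>u. inverse u * Y u) \<longlongrightarrow> y1) (at 0)" by (rule Lim_transform_eventually)
  have l1: "((\<lambda>u. inverse u ^ 3 * EP u) \<longlongrightarrow> - a * y1 / 2 - a * 1\<^sup>2 / 4) (at 0)" by (rule P.tendsto_E_square[OF inv_inf XY p])
  have "((\<lambda>u. (inverse u * Y u) / (inverse u / ZY u)) \<longlongrightarrow> y1 / (- a)) (at 0)" using a0 by (intro tendsto_intros XY tendsto_ratio) auto
  moreover have "\<forall>\<^sub>F u in at 0. (inverse u * Y u) / (inverse u / ZY u) = ZY u * Y u" using ev_nz by eventually_elim simp
  ultimately have YY: "((\<lambda>u. ZY u * Y u) \<longlongrightarrow> y1 / (- a)) (at 0)" by (rule Lim_transform_eventually)
  have "((\<lambda>u. (inverse u / ZY u) ^ 3 * (ZY u ^ 3 * EN u)) \<longlongrightarrow> (- a) ^ 3 * (- 1 * (y1 / (- a)) / 2 - 1 * a\<^sup>2 / 4)) (at 0)"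
    by (intro tendsto_mult tendsto_power tendsto_ratio N.tendsto_E_square[OF Yc_inf YY p])
  moreover have "\<forall>\<^sub>F u in at 0. (inverse u / ZY u) ^ 3 * (ZY u ^ 3 * EN u) = inverse u ^ 3 * EN u"
    using ev_Yc_nz by eventually_elim (simp add: power_divide)
  ultimately have l2: "((\<lambda>u. inverse u ^ 3 * EN u) \<longlongrightarrow> (- a) ^ 3 * (- 1 * (y1 / (- a)) / 2 - 1 * a\<^sup>2 / 4)) (at 0)"
    by (rule Lim_transform_eventually)
  have "((\<lambda>u. - (u * poly p (Y u))) \<longlongrightarrow> - 0) (at 0)" by (intro tendsto_intros tendsto_upY)
  then have q0: "((\<lambda>u. - QY u) \<longlongrightarrow> 0) (at 0)" by (simp add: divide_inverse mult.commute)
  have "((\<lambda>u. - (inverse u * Y u)\<^sup>2) \<longlongrightarrow> - y1\<^sup>2) (at 0)" by (intro tendsto_intros XY)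
  moreover have "\<forall>\<^sub>F u in at 0. - (inverse u * Y u)\<^sup>2 = inverse u ^ 3 * - QY u"
    using ev_nz by eventually_elim (simp add: pp field_simps eval_nat_numeral)
  ultimately have lw: "((\<lambda>u. inverse u ^ 3 * - QY u) \<longlongrightarrow> - y1\<^sup>2) (at 0)" by (rule Lim_transform_eventually)
  have l3: "((\<lambda>u. inverse u ^ 3 * Ln (1 + - QY u)) \<longlongrightarrow> - y1\<^sup>2) (at 0)" by (rule tendsto_mult_Ln_one_plus[OF q0 lw])
  define Lt where "Lt = (- a * y1 / 2 - a * 1\<^sup>2 / 4) - (- a) ^ 3 * (- 1 * (y1 / (- a)) / 2 - 1 * a\<^sup>2 / 4) - (- y1\<^sup>2)"
  have "((\<lambda>u. inverse u ^ 3 * EP u - inverse u ^ 3 * EN u - inverse u ^ 3 * Ln (1 + - QY u))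
    \<longlongrightarrow> Lt) (at 0)" unfolding Lt_def by (intro tendsto_diff l1 l2 l3)
  moreover have "\<forall>\<^sub>F u in at 0. inverse u ^ 3 * EP u - inverse u ^ 3 * EN u - inverse u ^ 3 * Ln (1 + - QY u) = 0" using z
  proof eventually_elim
    case (elim u)
    have "inverse u ^ 3 * Gf (inverse u) (Y u) = 0" using elim by simp
    then show ?case by (simp add: Gf_def right_diff_distrib)
  qed
  ultimately have "((\<lambda>u. 0) \<longlongrightarrow> Lt) (at (0::complex))" by (rule Lim_transform_eventually)
  then have "0 = Lt" by (rule tendsto_unique[OF trivial_limit_at tendsto_const])
  moreover have "Lt = - y1\<^sup>2 - (a + a ^ 5) / 4" using a0 by (simp add: Lt_def y1_def field_simps eval_nat_numeral)
  moreover have y1sq: "y1\<^sup>2 = a\<^sup>2 * (1 - a)\<^sup>2 / 16" by (simp add: y1_def power2_eq_square field_simps)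
  have "a * (a * (1 - a)\<^sup>2 + 4 + 4 * a ^ 4) = - 16 * (- y1\<^sup>2 - (a + a ^ 5) / 4)" unfolding y1sq by (simp add: field_simps eval_nat_numeral)
  ultimately have "a * (a * (1 - a)\<^sup>2 + 4 + 4 * a ^ 4) = 0" by (simp only: mult_zero_right)
  then have "a * (1 - a)\<^sup>2 + 4 + 4 * a ^ 4 = 0" using a0 by (simp only: mult_eq_0_iff simp_thms)
  then have e4: "a * (1 - a)\<^sup>2 + 4 * a ^ 4 = - 4" by (metis (no_types) add.assoc add.commute add_eq_0_iff)
  have "cmod (1 - a) \<le> 1 + cmod a" using norm_triangle_ineq4[of 1 a] by simp
  then have "cmod (1 - a) \<le> 3 / 2" using a_half by linarith
  then have "cmod a * cmod (1 - a) ^ 2 \<le> 1 / 2 * (3 / 2) ^ 2" using a_half by (intro mult_mono power_mono) auto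
  moreover have "cmod a ^ 4 \<le> (1 / 2) ^ 4" using a_half by (intro power_mono) auto
  moreover have "cmod (a * (1 - a)\<^sup>2 + 4 * a ^ 4) \<le> cmod a * cmod (1 - a) ^ 2 + 4 * cmod a ^ 4"
    using norm_triangle_ineq[of "a * (1 - a)\<^sup>2" "4 * a ^ 4"] by (simp add: norm_mult norm_power)
  ultimately have "cmod (a * (1 - a)\<^sup>2 + 4 * a ^ 4) < 4" by (simp add: eval_nat_numeral)
  then show False unfolding e4 by simp
qed

lemma coeffs_below_leading_zero:
  assumes "\<And>i. 1 \<le> i \<Longrightarrow> i < d \<Longrightarrow> coeff p i = 0"
  shows "p = monom 1 d + [:coeff p 0:]"
proof (rule poly_eqI)
  fix i
  consider "i = 0" | "1 \<le> i" "i < d" | "i = d" | "i > d" by linarith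
  then show "coeff p i = coeff (monom 1 d + [:coeff p 0:]) i"
    by cases (use assms monic deg in \<open>auto simp: coeff_eq_0 coeff_pCons split: nat.splits\<close>)
qed

lemma not_eventually_Gf_zero:
  assumes crit: "poly (pderiv p) c = 0" and simple: "poly (pderiv (pderiv p)) c \<noteq> 0" and nd: "nondegenerate c"
  shows "\<not> (\<forall>\<^sub>F u in at 0. Gf (inverse u) (Y u) = 0)"
proof (cases "coeff p (d - 1) \<noteq> 0 \<or> poly p c \<noteq> 0")
  case True
  have "((\<lambda>u. - poly p (Y u)) \<longlongrightarrow> - poly p c) (at 0)" by (intro tendsto_intros tendsto_pY)
  moreover have "\<forall>\<^sub>F u in at 0. - poly p (Y u) = inverse u ^ 1 * - QY u" using ev_nz by eventually_elim simp
  ultimately have L: "((\<lambda>u. inverse u ^ 1 * - QY u) \<longlongrightarrow> - poly p c) (at 0)" by (rule Lim_transform_eventually)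
  show ?thesis
  proof (rule not_eventually_Gf_zero_if_leading[OF _ _ _ L])
    have "poly p c + (1 + a) * coeff p (d - 1) / of_nat d \<noteq> 0"
      using nd True unfolding nondegenerate_def by (cases "coeff p (d - 1) = 0") auto
    then show "coeff p (d - 1) / of_nat d * (1 - (- a) ^ 1) - - poly p c \<noteq> 0" by (simp add: field_simps)
  qed (use deg in auto)
next
  case False
  then have c1: "coeff p (d - 1) = 0" and pc: "poly p c = 0" by auto
  show ?thesis
  proof (cases "\<forall>i. 1 \<le> i \<longrightarrow> i < d \<longrightarrow> coeff p i = 0")
    case True
    then have pe: "p = monom 1 d + [:coeff p 0:]" by (intro coeffs_below_leading_zero) auto
    have pd: "pderiv p = monom (of_nat d) (d - 1)" by (subst pe) (simp add: pderiv_add pderiv_monom pderiv_pCons)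
    have c0: "c = 0" using crit deg by (auto simp: pd poly_monom)
    have "d = 2"
    proof (rule ccontr)
      assume "d \<noteq> 2"
      then have "d - 1 - 1 > 0" using deg by simp
      moreover have "pderiv (pderiv p) = monom (of_nat (d - 1) * of_nat d) (d - 1 - 1)" by (simp add: pd pderiv_monom)
      ultimately have "poly (pderiv (pderiv p)) c = 0" by (simp add: c0 poly_monom)
      with simple show False by simp
    qed
    moreover have "coeff p 0 = 0" using pc c0 by (simp add: poly_0_coeff_0)
    ultimately have "p = monom 1 2" using pe by simp
    then show ?thesis by (rule not_eventually_Gf_zero_square[OF _ c0])
  next
    case False
    define S where "S = {i. 1 \<le> i \<and> i < d \<and> coeff p i \<noteq> 0}"
    have S: "finite S" "S \<noteq> {}" using False by (auto simp: S_def)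
    define m where "m = Max S"
    have mS: "m \<in> S" using Max_in[OF S] by (simp add: m_def)
    have m: "1 \<le> m" "m < d" "coeff p m \<noteq> 0" using mS by (auto simp: S_def)
    define j where "j = d - m"
    have j: "1 \<le> j" "j < d" "d - j = m" using m by (auto simp: j_def)
    have low: "coeff p i = 0" if "d - j < i" "i < d" for i
    proof (rule ccontr)
      assume "coeff p i \<noteq> 0"
      then have "i \<in> S" using that by (auto simp: S_def)
      then have "i \<le> m" using S(1) by (simp add: m_def)
      then show False using that j by simp
    qed
    obtain q where q: "p = [:- c, 1:] * q" using pc poly_eq_0_iff_dvd by (metis dvdE)
    have ql: "((\<lambda>u. cmod (poly q (Y u))) \<longlongrightarrow> cmod (poly q c)) (at 0)" by (intro tendsto_norm isCont_tendsto_compose[OF _ tendsto_Y]) simp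
    have "((\<lambda>u. C * cmod u ^ m * cmod (poly q (Y u))) \<longlongrightarrow> C * cmod 0 ^ m * cmod (poly q c)) (at 0)" by (intro tendsto_intros ql)
    then have l0: "((\<lambda>u. C * cmod u ^ m * cmod (poly q (Y u))) \<longlongrightarrow> 0) (at 0)" using m by (simp add: power_0_left)
    have L: "((\<lambda>u. inverse u ^ j * - QY u) \<longlongrightarrow> 0) (at 0)"
    proof (rule Lim_null_comparison[OF _ l0])
      show "\<forall>\<^sub>F u in at 0. norm (inverse u ^ j * - QY u) \<le> C * cmod u ^ m * cmod (poly q (Y u))" using Yev ev_nz
      proof eventually_elim
        case (elim u)
        have u: "cmod u > 0" using elim by simp
        have pu: "cmod u ^ (d - 1) = cmod u ^ m * cmod u ^ (j - 1)"
        proof -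
          have "d - 1 = m + (j - 1)" using j by linarith
          then show ?thesis by (simp only: power_add)
        qed
        have ju: "cmod u ^ j = cmod u * cmod u ^ (j - 1)" using j by (metis Suc_diff_le diff_Suc_1 power_Suc Suc_pred' less_eq_Suc_le One_nat_def)
        have "cmod (poly p (Y u)) = cmod (Y u - c) * cmod (poly q (Y u))" by (subst q) (simp add: norm_mult flip: left_diff_distrib)
        then have "cmod (poly p (Y u)) \<le> (C * cmod u ^ (d - 1)) * cmod (poly q (Y u))" using elim by (simp add: mult_right_mono)
        then have "cmod (poly p (Y u)) * (cmod u / cmod u ^ j) \<le> (C * cmod u ^ (d - 1)) * cmod (poly q (Y u)) * (cmod u / cmod u ^ j)"
          by (intro mult_right_mono) auto
        also have "\<dots> = C * cmod u ^ m * cmod (poly q (Y u))" unfolding pu ju using u by simp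
        finally show ?case by (simp add: norm_mult norm_divide norm_inverse norm_power power_inverse divide_inverse mult_ac)
      qed
    qed
    show ?thesis
    proof (rule not_eventually_Gf_zero_if_leading[OF j(1,2) low L])
      have "cmod ((- a) ^ j) < 1"
      proof -
        have "cmod a ^ j \<le> (1 / 2) ^ j" using a_half by (intro power_mono) auto
        also have "\<dots> \<le> (1 / 2) ^ 1" using j by (intro power_decreasing) auto
        finally show ?thesis by (simp add: norm_power)
      qed
      then have "1 - (- a) ^ j \<noteq> 0" by auto
      then show "coeff p (d - j) / of_nat d * (1 - (- a) ^ j) - 0 \<noteq> 0" using m deg j by simp
    qed auto
  qed
qed

end

end


text \<open>Away from the zeros of \<open>D2 N\<close> this is the implicit function theorem; along a slice these zeros
  are isolated because \<open>Y\<close> is injective there, and Cauchy's formula over a circle avoiding them gives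
  holomorphy in the other variable.\<close>
lemma implicit_continuous_holomorphic2:
  fixes Y N :: "complex \<times> complex \<Rightarrow> complex" and A :: "complex \<Rightarrow> complex"
  assumes Yc: "continuous_on (ball s0 r \<times> ball y0 r) Y"
    and inj: "\<And>s. s \<in> ball s0 r \<Longrightarrow> inj_on (\<lambda>y. Y (s, y)) (ball y0 r)"
    and A: "A holomorphic_on ball s0 r" and T: "open T" and N: "holomorphic2_on N T"
    and AT: "\<And>s y. s \<in> ball s0 r \<Longrightarrow> y \<in> ball y0 r \<Longrightarrow> (A s, Y (s, y)) \<in> T"
    and M: "holomorphic2_on (\<lambda>z. N (A (fst z), Y z)) (ball s0 r \<times> ball y0 r)"
    and nc: "\<And>s y \<delta>. s \<in> ball s0 r \<Longrightarrow> y \<in> ball y0 r \<Longrightarrow> \<delta> > 0 \<Longrightarrow>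
      \<exists>t\<in>ball (Y (s, y)) \<delta>. (A s, t) \<in> T \<and> N (A s, t) \<noteq> N (A s, Y (s, y))"
  shows "holomorphic2_on Y (ball s0 r \<times> ball y0 r)"
proof -
  let ?B = "ball s0 r \<times> ball y0 r"
  have oB: "open ?B" by (intro open_Times) auto
  have cY: "isCont (\<lambda>y. Y (s, y)) y" "isCont (\<lambda>s. Y (s, y)) s" if "s \<in> ball s0 r" "y \<in> ball y0 r" for s y
  proof -
    have "isCont Y (s, y)" using Yc oB that by (simp add: continuous_on_eq_continuous_at)
    then show "isCont (\<lambda>y. Y (s, y)) y" "isCont (\<lambda>s. Y (s, y)) s"
      by (auto intro!: isCont_o2[of _ "\<lambda>y. (s, y)" Y] isCont_o2[of _ "\<lambda>s. (s, y)" Y] continuous_intros)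
  qed
  have isol: "\<forall>\<^sub>F y' in at y. D2 N (A s, Y (s, y')) \<noteq> 0" if s: "s \<in> ball s0 r" and y: "y \<in> ball y0 r" for s y
  proof -
    let ?t = "Y (s, y)"
    have oT: "open ((\<lambda>t. (A s, t)) -` T)" by (intro open_vimage T continuous_intros)
    moreover have "?t \<in> (\<lambda>t. (A s, t)) -` T" using AT[OF s y] by simp
    ultimately obtain e where e: "e > 0" "ball ?t e \<subseteq> (\<lambda>t. (A s, t)) -` T" using openE by blast
    have eT: "(A s, t) \<in> T" if "t \<in> ball ?t e" for t using e(2) that by blast
    have g: "(\<lambda>t. D2 N (A s, t)) holomorphic_on ball ?t e" by (rule holomorphic2_on_slice2_holomorphic[OF holomorphic2_on_D2[OF T N] eT])
    have "\<exists>t0\<in>ball ?t e. D2 N (A s, t0) \<noteq> 0"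
    proof (rule ccontr)
      assume "\<not> ?thesis"
      then have z: "D2 N (A s, t) = 0" if "t \<in> ball ?t e" for t using that by blast
      have "\<exists>c. \<forall>t\<in>ball ?t e. N (A s, t) = c"
      proof (rule has_field_derivative_zero_constant)
        fix t assume t: "t \<in> ball ?t e"
        have "((\<lambda>t. N (A s, t)) has_field_derivative 0) (at t)" using holomorphic2_on_slice2[OF N eT[OF t]] z[OF t] by simp
        then show "((\<lambda>t. N (A s, t)) has_field_derivative 0) (at t within ball ?t e)" by (rule has_field_derivative_at_within)
      qed auto
      then obtain c where "\<And>t. t \<in> ball ?t e \<Longrightarrow> N (A s, t) = c" by blast
      then show False using nc[OF s y e(1)] e(1) by (metis centre_in_ball)
    qed
    then obtain t0 where "t0 \<in> ball ?t e" "D2 N (A s, t0) \<noteq> 0" by blast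
    then have "\<forall>\<^sub>F t in at ?t. D2 N (A s, t) \<noteq> 0 \<and> t \<in> ball ?t e" using e(1) by (intro non_zero_neighbour_alt[OF g]) auto
    then have 1: "\<forall>\<^sub>F t in at ?t. D2 N (A s, t) \<noteq> 0" by eventually_elim simp
    have "filterlim (\<lambda>y'. Y (s, y')) (at ?t) (at y)"
    proof (rule filterlim_atI)
      show "((\<lambda>y'. Y (s, y')) \<longlongrightarrow> ?t) (at y)" using cY(1)[OF s y] by (simp add: isCont_def)
      have "\<forall>\<^sub>F y' in at y. y' \<in> ball y0 r - {y}" by (rule eventually_at_in_open[OF open_ball y])
      then show "\<forall>\<^sub>F y' in at y. Y (s, y') \<noteq> ?t" by eventually_elim (use inj[OF s] y in \<open>auto simp: inj_on_def\<close>)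
    qed
    then show ?thesis using 1 by (auto simp: filterlim_iff)
  qed
  have diff2: "(\<lambda>y. Y (s, y)) field_differentiable (at y)"
    if s: "s \<in> ball s0 r" and y: "y \<in> ball y0 r" and nz: "D2 N (A s, Y (s, y)) \<noteq> 0" for s y
  proof (rule implicit_field_differentiable[where A = "\<lambda>_. A s" and N = N and T = T])
    show "(A s, Y (s, y)) \<in> T" by (rule AT[OF s y])
    show "(\<lambda>w. N (A s, Y (s, w))) field_differentiable at y"
      using holomorphic2_on_slice2[OF M, of s y] s y by (auto simp: field_differentiable_def)
  qed (use N nz cY[OF s y] in auto)
  have diff1: "(\<lambda>s. Y (s, y)) field_differentiable (at s)"
    if s: "s \<in> ball s0 r" and y: "y \<in> ball y0 r" and nz: "D2 N (A s, Y (s, y)) \<noteq> 0" for s y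
  proof (rule implicit_field_differentiable[where A = A and N = N and T = T])
    show "(A s, Y (s, y)) \<in> T" by (rule AT[OF s y])
    show "(\<lambda>w. N (A w, Y (w, y))) field_differentiable at s"
      using holomorphic2_on_slice1[OF M, of s y] s y by (auto simp: field_differentiable_def)
    show "A field_differentiable at s" using A s holomorphic_on_imp_differentiable_at open_ball by blast
  qed (use N nz cY[OF s y] in auto)
  have slice2: "(\<lambda>y. Y (s, y)) holomorphic_on ball y0 r" if s: "s \<in> ball s0 r" for s unfolding holomorphic_on_def
  proof
    fix y assume y: "y \<in> ball y0 r"
    have "\<forall>\<^sub>F y' in at y. D2 N (A s, Y (s, y')) \<noteq> 0 \<and> y' \<in> ball y0 r - {y}"
      by (rule eventually_conj[OF isol[OF s y] eventually_at_in_open[OF open_ball y]])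
    then obtain e where e: "e > 0" "\<And>y'. y' \<noteq> y \<Longrightarrow> dist y' y < e \<Longrightarrow> D2 N (A s, Y (s, y')) \<noteq> 0 \<and> y' \<in> ball y0 r"
      unfolding eventually_at by auto
    have "(\<lambda>y. Y (s, y)) holomorphic_on ball y e"
    proof (rule no_isolated_singularity'[where K = "{y}"])
      show "((\<lambda>y. Y (s, y)) \<longlongrightarrow> Y (s, z)) (at z within ball y e)" if "z \<in> {y}" for z
        using cY(1)[OF s y] that by (auto simp: isCont_def intro: tendsto_within_subset)
      show "(\<lambda>y. Y (s, y)) holomorphic_on ball y e - {y}" unfolding holomorphic_on_def
      proof
        fix w assume "w \<in> ball y e - {y}"
        then have "D2 N (A s, Y (s, w)) \<noteq> 0 \<and> w \<in> ball y0 r" using e(2)[of w] by (simp add: dist_commute)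
        then have "(\<lambda>y. Y (s, y)) field_differentiable at w" using diff2[OF s] by blast
        then show "(\<lambda>y. Y (s, y)) field_differentiable at w within ball y e - {y}" by (rule field_differentiable_at_within)
      qed
    qed auto
    then have "(\<lambda>y. Y (s, y)) field_differentiable at y"
      using e(1) holomorphic_on_imp_differentiable_at[OF _ open_ball] by (metis centre_in_ball)
    then show "(\<lambda>y. Y (s, y)) field_differentiable at y within ball y0 r" by (rule field_differentiable_at_within)
  qed
  have slice1: "(\<lambda>s. Y (s, y)) field_differentiable (at s)" if s: "s \<in> ball s0 r" and y: "y \<in> ball y0 r" for s y
  proof -
    have "\<forall>\<^sub>F y' in at y. D2 N (A s, Y (s, y')) \<noteq> 0 \<and> y' \<in> ball y0 r - {y}"
      by (rule eventually_conj[OF isol[OF s y] eventually_at_in_open[OF open_ball y]])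
    then obtain e where e: "e > 0" "\<And>y'. y' \<noteq> y \<Longrightarrow> dist y' y < e \<Longrightarrow> D2 N (A s, Y (s, y')) \<noteq> 0 \<and> y' \<in> ball y0 r"
      unfolding eventually_at by auto
    define q where "q = e / 2"
    have q: "q > 0" using e by (simp add: q_def)
    have sph: "D2 N (A s, Y (s, u)) \<noteq> 0 \<and> u \<in> ball y0 r" if "u \<in> sphere y q" for u
      using e(2)[of u] that q e(1) by (auto simp: q_def dist_commute)
    have cb: "cball y q \<subseteq> ball y0 r"
    proof
      fix u assume "u \<in> cball y q"
      then show "u \<in> ball y0 r" using e(2)[of u] e(1) y by (cases "u = y") (auto simp: q_def dist_commute)
    qed
    define Wn where "Wn = ?B \<inter> (\<lambda>z. D2 N (A (fst z), Y z)) -` (- {0})"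
    have cphi: "continuous_on ?B (\<lambda>z. D2 N (A (fst z), Y z))"
    proof -
      have c1: "continuous_on T (D2 N)" using holomorphic2_on_imp_continuous_on[OF holomorphic2_on_D2[OF T N]] .
      have "continuous_on ?B (\<lambda>z. A (fst z))"
        by (rule continuous_on_compose2[OF holomorphic_on_imp_continuous_on[OF A]]) (auto intro!: continuous_intros)
      then have c2: "continuous_on ?B (\<lambda>z. (A (fst z), Y z))" by (intro continuous_on_Pair Yc)
      have i: "(\<lambda>z. (A (fst z), Y z)) ` ?B \<subseteq> T" using AT by force
      show ?thesis using continuous_on_compose2[OF c1 c2 i] .
    qed
    have oW: "open Wn" unfolding Wn_def by (rule continuous_open_preimage[OF cphi oB]) auto
    have "{s} \<times> sphere y q \<subseteq> Wn" using sph s by (auto simp: Wn_def)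
    moreover have "compact ({s} \<times> sphere y q)" by (intro compact_Times) auto
    ultimately obtain \<epsilon> where \<epsilon>: "\<epsilon> > 0" "(\<Union>x\<in>{s} \<times> sphere y q. ball x \<epsilon>) \<subseteq> Wn"
      using compact_subset_open_imp_ball_epsilon_subset[OF _ oW] by blast
    have eW: "(s', u) \<in> Wn" if "s' \<in> ball s \<epsilon>" "u \<in> sphere y q" for s' u
    proof -
      have "(s', u) \<in> ball (s, u) \<epsilon>" using that(1) by (simp add: dist_Pair_Pair)
      then show ?thesis using \<epsilon>(2) that(2) by blast
    qed
    have yq: "y + of_real q \<in> sphere y q" using q by (simp add: dist_norm)
    have sub: "s' \<in> ball s0 r" if "s' \<in> ball s \<epsilon>" for s' using eW[OF that yq] by (auto simp: Wn_def)
    have "(\<lambda>s'. contour_integral (circlepath y q) (\<lambda>u. Y (s', u) / (u - y))) holomorphic_on ball s \<epsilon>"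
    proof (rule holomorphic_on_circle_integral[OF open_ball q])
      have "continuous_on (ball s \<epsilon> \<times> sphere y q) Y" by (rule continuous_on_subset[OF Yc]) (use sub sph in auto)
      then have "continuous_on (ball s \<epsilon> \<times> sphere y q) (\<lambda>z. Y z / (snd z - y))" using q by (intro continuous_intros) auto
      then show "continuous_on (ball s \<epsilon> \<times> sphere y q) (\<lambda>(w, u). Y (w, u) / (u - y))" by (simp add: case_prod_unfold)
      fix u assume u: "u \<in> sphere y q"
      show "(\<lambda>w. Y (w, u) / (u - y)) holomorphic_on ball s \<epsilon>" unfolding holomorphic_on_def
      proof
        fix w assume w: "w \<in> ball s \<epsilon>"
        have "D2 N (A w, Y (w, u)) \<noteq> 0" using eW[OF w u] by (simp add: Wn_def)
        then have "(\<lambda>w. Y (w, u)) field_differentiable at w" using diff1[OF sub[OF w]] sph[OF u] by blast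
        then have "(\<lambda>w. Y (w, u) / (u - y)) field_differentiable at w" using u q by (intro field_differentiable_divide) auto
        then show "(\<lambda>w. Y (w, u) / (u - y)) field_differentiable at w within ball s \<epsilon>" by (rule field_differentiable_at_within)
      qed
    qed
    then have h: "(\<lambda>s'. contour_integral (circlepath y q) (\<lambda>u. Y (s', u) / (u - y)) / (2 * of_real pi * \<i>)) holomorphic_on ball s \<epsilon>"
      by (intro holomorphic_intros) auto
    have eq: "contour_integral (circlepath y q) (\<lambda>u. Y (s', u) / (u - y)) / (2 * of_real pi * \<i>) = Y (s', y)"
      if s': "s' \<in> ball s \<epsilon>" for s'
    proof -
      have "(\<lambda>u. Y (s', u)) holomorphic_on cball y q" using slice2[OF sub[OF s']] cb holomorphic_on_subset by blast
      then have "((\<lambda>u. Y (s', u) / (u - y)) has_contour_integral (2 * of_real pi * \<i> * Y (s', y))) (circlepath y q)"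
        by (rule Cauchy_integral_circlepath_simple) (use q in auto)
      then show ?thesis by (simp add: contour_integral_unique)
    qed
    have "(\<lambda>s'. Y (s', y)) holomorphic_on ball s \<epsilon>" by (rule holomorphic_transform[OF h]) (rule eq)
    then show ?thesis using \<epsilon>(1) holomorphic_on_imp_differentiable_at[OF _ open_ball] by (metis centre_in_ball)
  qed
  have "sep_holomorphic_on Y ?B" unfolding sep_holomorphic_on_def
  proof (intro conjI allI impI Yc)
    fix x y assume xy: "(x, y) \<in> ?B"
    then show "(\<lambda>s. Y (s, y)) field_differentiable at x" using slice1 by blast
    show "(\<lambda>t. Y (x, t)) field_differentiable at y" using slice2[of x] xy holomorphic_on_imp_differentiable_at[OF _ open_ball] by blast
  qed
  then show ?thesis using holomorphic2_on_iff[OF oB] by blast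
qed

context henon_map
begin

text \<open>The leaf of \<open>\<F>\<^sup>+\<close> through a point near infinity is not contained in a leaf of \<open>\<F>\<^sup>-\<close>, not even
  locally. Otherwise the coincidence spreads along the leaf up to a region where \<open>\<phi>\<^sub>- \<circ> f\<^sup>-\<^sup>1\<close> is
  close to \<open>p(y) - x\<close> over \<open>a\<close>, and \<open>p\<close> would be almost constant on large discs.\<close>
lemma leaves_not_locally_equal:
  obtains M where "M \<ge> P.M0" "\<And>s y0 \<delta>. cmod s > M \<Longrightarrow> cmod y0 < cmod s / 2 \<Longrightarrow> (y0, P.X s y0) \<in> N.U \<Longrightarrow> \<delta> > 0 \<Longrightarrow>
    \<exists>y\<in>ball y0 \<delta>. cmod y < cmod s / 2 \<and> \<not> N.eqv (y0, P.X s y0) (y, P.X s y)"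
proof -
  have d2: "degree p \<noteq> 0" using deg by simp
  obtain a1 q1 where q1: "p = pCons a1 q1" by (cases p) auto
  have q10: "q1 \<noteq> 0" using d2 q1 by auto
  obtain a2 q2 where q2: "q1 = pCons a2 q2" by (cases q1) auto
  have q20: "q2 \<noteq> 0" using deg q1 q2 by (auto split: if_splits)
  obtain r1 where r1: "\<And>z. r1 \<le> cmod z \<Longrightarrow> 17 \<le> cmod (poly q1 z)" using poly_infinity[OF q20, of 17 a2] q2 by blast
  obtain a3 q3 where q3: "pderiv p = pCons a3 q3" by (cases "pderiv p") auto
  have "degree (pderiv p) \<noteq> 0" using deg by (simp add: degree_pderiv)
  then have q30: "q3 \<noteq> 0" using q3 by auto
  obtain r2 where r2: "\<And>z. r2 \<le> cmod z \<Longrightarrow> 1 \<le> cmod (poly (pderiv p) z)" using poly_infinity[OF q30, of 1 a3] q3 by metis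
  have p16: "cmod (poly p y) \<ge> 16 * cmod y" if "r1 \<le> cmod y" "cmod a1 \<le> cmod y" for y
  proof -
    have "17 * cmod y \<le> cmod (poly q1 y) * cmod y" using r1[OF that(1)] by (intro mult_right_mono) auto
    also have "\<dots> = cmod (y * poly q1 y)" by (simp add: norm_mult)
    also have "\<dots> \<le> cmod (poly p y) + cmod a1" using norm_triangle_ineq4[of "poly p y" a1] by (simp add: q1)
    finally show ?thesis using that(2) by linarith
  qed
  define BB where "BB = 2 * N.C2 + 2 * P.C2"
  define M where "M = P.M0 + 8 * \<bar>r1\<bar> + 8 * \<bar>r2\<bar> + 8 * cmod a1 + 8 * P.C2 + 8 * \<alpha> + 64 * BB + 1"
  have nn: "P.M0 > 0" "P.C2 \<ge> 0" "N.C2 \<ge> 0" "\<alpha> > 0" "cmod a1 \<ge> 0" "BB \<ge> 0" using P.M0 P.C2_nonneg N.C2_nonneg P.Rr by (auto simp: BB_def)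
  have M: "M \<ge> P.M0" "M \<ge> 8 * r1" "M \<ge> 4 * r2" "M \<ge> 8 * cmod a1" "M \<ge> 8 * P.C2" "M \<ge> 8 * \<alpha>" "M > 64 * BB" "M \<ge> 0"
    unfolding M_def using nn abs_ge_zero[of r1] abs_ge_zero[of r2] abs_ge_self[of r1] abs_ge_self[of r2] by argo+
  show ?thesis
  proof (rule that[of M])
    fix s y0 :: complex and \<delta> :: real
    assume s: "cmod s > M" and y0: "cmod y0 < cmod s / 2" and y0U: "(y0, P.X s y0) \<in> N.U" and \<delta>: "\<delta> > 0"
    have s0: "cmod s > 0" "cmod s > P.M0" using s M by linarith+
    let ?D = "ball (0::complex) (cmod s / 2)"
    let ?c = "\<lambda>y. (y, P.X s y)"
    have Xhol: "P.X s holomorphic_on ?D" using holomorphic2_on_slice2_holomorphic[OF P.holomorphic2_X, of ?D s] s0 by (auto simp: P.box_def)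
    have Xc: "continuous_on ?D ?c" by (intro continuous_on_Pair continuous_on_id holomorphic_on_imp_continuous_on[OF Xhol])
    have Xd: "cmod (P.X s y - s) \<le> P.C2" if "y \<in> ?D" for y using P.X_diff[of s y] s0 that by simp
    have Xn: "cmod (P.X s y) \<le> cmod s + P.C2" if "y \<in> ?D" for y using Xd[OF that] norm_triangle_ineq[of "P.X s y - s" s] by simp
    define S0 where "S0 = ?D \<inter> ?c -` N.U"
    have oS: "open S0" unfolding S0_def by (rule continuous_open_preimage[OF Xc open_ball N.open_U])
    have yS: "y0 \<in> S0" using y0 y0U by (simp add: S0_def)
    define \<Omega> where "\<Omega> = connected_component_set S0 y0"
    have \<Omega>: "open \<Omega>" "connected \<Omega>" "\<Omega> \<subseteq> S0" "y0 \<in> \<Omega>" using oS yS by (auto simp: \<Omega>_def open_connected_component connected_component_subset)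
    have hFn: "(\<lambda>y. fst ((N.F ^^ n) (y, P.X s y))) holomorphic_on ?D" for n
      by (rule holomorphic2_on_compose_curve[OF N.holomorphic2_Fn(1)[of n UNIV] holomorphic_on_ident Xhol open_ball]) simp
    show "\<exists>y\<in>ball y0 \<delta>. cmod y < cmod s / 2 \<and> \<not> N.eqv (?c y0) (?c y)"
    proof (rule ccontr)
      assume "\<not> ?thesis"
      then have eq0: "\<And>y. y \<in> ball y0 \<delta> \<Longrightarrow> cmod y < cmod s / 2 \<Longrightarrow> N.eqv (?c y0) (?c y)" by blast
      have loc: "\<exists>T. openin (top_of_set \<Omega>) T \<and> y1 \<in> T \<and>
          (\<forall>x\<in>T. \<forall>y\<in>T. (\<exists>e>0. \<forall>y'\<in>ball x e. N.eqv (?c y0) (?c y')) \<longrightarrow> (\<exists>e>0. \<forall>y'\<in>ball y e. N.eqv (?c y0) (?c y')))"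
        if y1: "y1 \<in> \<Omega>" for y1
      proof -
        have "?c y1 \<in> N.U" using y1 \<Omega>(3) by (auto simp: S0_def)
        then obtain n where n: "(N.F ^^ n) (?c y1) \<in> V" by (auto simp: N.U_def)
        have cF: "continuous_on ?D (\<lambda>y. (N.F ^^ n) (?c y))" using continuous_on_compose2[OF N.continuous_Fn[of UNIV n] Xc] by simp
        have o: "open (\<Omega> \<inter> (\<lambda>y. (N.F ^^ n) (?c y)) -` V)"
          by (rule continuous_open_preimage[OF continuous_on_subset[OF cF] \<Omega>(1) N.open_V]) (use \<Omega>(3) in \<open>auto simp: S0_def\<close>)
        have m: "y1 \<in> \<Omega> \<inter> (\<lambda>y. (N.F ^^ n) (?c y)) -` V" using y1 n by simp
        obtain e where e: "e > 0" "ball y1 e \<subseteq> \<Omega> \<inter> (\<lambda>y. (N.F ^^ n) (?c y)) -` V" using openE[OF o m] by blast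
        have eV: "(N.F ^^ n) (?c y) \<in> V" if "y \<in> ball y1 e" for y using e(2) that by blast
        have eD: "ball y1 e \<subseteq> ?D" using e(2) \<Omega>(3) by (auto simp: S0_def)
        define \<theta> where "\<theta> = (\<lambda>y. N.\<psi> ((N.F ^^ n) (?c y)))"
        have \<theta>h: "\<theta> holomorphic_on ball y1 e" unfolding \<theta>_def
          by (rule holomorphic2_on_compose_curve[OF N.holomorphic2_compose_Fn[OF N.holomorphic2_psi, where S = "{z. (N.F ^^ n) z \<in> V}"]
              holomorphic_on_ident holomorphic_on_subset[OF Xhol eD] open_ball]) (use eV in auto)
        have \<theta>0: "\<theta> y \<noteq> 0" if "y \<in> ball y1 e" for y unfolding \<theta>_def by (rule N.psi_nonzero[OF eV[OF that]])
        have rr: "N.eqv (?c x) (?c y) \<longleftrightarrow> \<theta> y / \<theta> x \<in> root_group d" if "x \<in> ball y1 e" "y \<in> ball y1 e" for x y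
          using N.eqv_V_iff[OF eV[OF that(1)] eV[OF that(2)]] N.eqv_Fn_iff by (simp add: \<theta>_def)
        show ?thesis
        proof (intro exI[of _ "ball y1 e"] conjI ballI impI)
          show "openin (top_of_set \<Omega>) (ball y1 e)" using e(2) by (intro open_openin_trans \<Omega>(1)) auto
          show "y1 \<in> ball y1 e" using e by simp
          fix x y assume x: "x \<in> ball y1 e" and y: "y \<in> ball y1 e" and "\<exists>e>0. \<forall>y'\<in>ball x e. N.eqv (?c y0) (?c y')"
          then obtain e' where e': "e' > 0" "\<And>y'. y' \<in> ball x e' \<Longrightarrow> N.eqv (?c y0) (?c y')" by blast
          have ex: "N.eqv (?c y0) (?c x)" using e' by simp
          have const: "\<theta> w = \<theta> x" if w: "w \<in> ball y1 e" for w
          proof (rule constant_if_root_group_ratio[OF open_ball _ \<theta>h x \<theta>0[OF x] e'(1) _ _ w])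
            fix v assume v: "v \<in> ball x e'" "v \<in> ball y1 e"
            have "N.eqv (?c x) (?c v)" using N.eqv_trans[OF N.eqv_sym[OF ex] e'(2)[OF v(1)]] .
            then show "\<theta> v / \<theta> x \<in> root_group d" using rr[OF x v(2)] by simp
          qed (use P.d_pos in auto)
          obtain e2 where e2: "e2 > 0" "ball y e2 \<subseteq> ball y1 e" using y open_ball openE by blast
          have "N.eqv (?c y0) (?c y')" if y': "y' \<in> ball y e2" for y'
          proof -
            have y'': "y' \<in> ball y1 e" using y' e2 by blast
            have "\<theta> y' / \<theta> x \<in> root_group d" using const[OF y''] \<theta>0[OF x] by simp
            then show ?thesis using rr[OF x y''] N.eqv_trans[OF ex] by blast
          qed
          then show "\<exists>e>0. \<forall>y'\<in>ball y e. N.eqv (?c y0) (?c y')" using e2(1) by blast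
        qed
      qed
      have init: "\<exists>e>0. \<forall>y'\<in>ball y0 e. N.eqv (?c y0) (?c y')"
      proof -
        have "y0 \<in> ball y0 \<delta> \<inter> ?D" "open (ball y0 \<delta> \<inter> ?D)" using \<delta> y0 by auto
        then obtain e where "e > 0" "ball y0 e \<subseteq> ball y0 \<delta> \<inter> ?D" using openE by blast
        then have "N.eqv (?c y0) (?c y')" if "y' \<in> ball y0 e" for y' using eq0[of y'] that by (simp add: subset_iff)
        then show ?thesis using \<open>e > 0\<close> by blast
      qed
      have all: "N.eqv (?c y0) (?c y)" if y: "y \<in> \<Omega>" for y
      proof -
        have "\<exists>e>0. \<forall>y'\<in>ball y e. N.eqv (?c y0) (?c y')" by (rule connected_induction_simple[OF \<Omega>(2) \<Omega>(4) y init loc])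
        then show ?thesis by auto
      qed
      define An where "An = {y::complex. cmod s / 8 < cmod (y - 0) \<and> cmod (y - 0) < cmod s / 2}"
      have An: "connected An" unfolding An_def by (rule connected_annulus) simp
      have AV: "(Yc (P.X s y, y), y) \<in> V" if y: "y \<in> An" for y
      proof -
        have yD: "y \<in> ?D" "cmod y > cmod s / 8" using y by (auto simp: An_def)
        have "cmod (poly p y) \<ge> 16 * cmod y" using yD s M by (intro p16) linarith+
        moreover have "cmod (poly p y) - cmod (P.X s y) \<le> cmod (poly p y - P.X s y)" by (rule norm_triangle_ineq2)
        moreover have "P.C2 \<le> cmod y" "\<alpha> < cmod y" using yD s M by linarith+
        ultimately have 1: "cmod (poly p y - P.X s y) \<ge> 7 * cmod y" using Xn[OF yD(1)] yD(2) by linarith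
        have "cmod (poly p y - P.X s y) = cmod a * cmod (Yc (P.X s y, y))" using a0 by (simp add: Yc_def norm_divide)
        moreover have "cmod a * cmod (Yc (P.X s y, y)) \<le> 1 / 2 * cmod (Yc (P.X s y, y))" using a_half by (intro mult_right_mono) auto
        ultimately have "cmod (Yc (P.X s y, y)) \<ge> 14 * cmod y" using 1 by linarith
        then show ?thesis using \<open>\<alpha> < cmod y\<close> nn by (intro N.V_I) linarith+
      qed
      have NFc: "N.F (?c y) = (Yc (P.X s y, y), y)" for y using N_F_sw_eq[of "(P.X s y, y)"] by simp
      have AS: "An \<subseteq> S0"
      proof
        fix y assume y: "y \<in> An"
        have "N.F (?c y) \<in> N.U" using AV[OF y] N.V_subset_U NFc by auto
        then show "y \<in> S0" using y by (auto simp: S0_def An_def N.U_F)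
      qed
      have meet: "\<Omega> \<inter> An \<noteq> {}"
      proof
        assume dis: "\<Omega> \<inter> An = {}"
        have sm: "\<Omega> \<subseteq> cball 0 (cmod s / 8)"
        proof
          fix y assume "y \<in> \<Omega>"
          then have "y \<notin> An" "y \<in> ?D" using dis \<Omega>(3) by (auto simp: S0_def)
          then show "y \<in> cball 0 (cmod s / 8)" by (auto simp: An_def)
        qed
        have cl: "closure \<Omega> \<subseteq> cball 0 (cmod s / 8)" using closure_minimal[OF sm] by simp
        then have clD: "closure \<Omega> \<subseteq> ?D"
        proof (rule subset_trans)
          show "cball 0 (cmod s / 8) \<subseteq> ?D" using s0 by (simp add: cball_subset_ball_iff)
        qed
        define Bd where "Bd = max (cmod s + P.C2) \<alpha>"
        have "cmod (fst ((N.F ^^ n) (?c y0))) \<le> Bd" for n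
        proof (rule maximum_modulus_frontier[where S = \<Omega> and f = "\<lambda>y. fst ((N.F ^^ n) (?c y))"])
          show "(\<lambda>y. fst ((N.F ^^ n) (?c y))) holomorphic_on interior \<Omega>"
            using holomorphic_on_subset[OF hFn] clD closure_subset interior_subset by (metis subset_trans)
          show "continuous_on (closure \<Omega>) (\<lambda>y. fst ((N.F ^^ n) (?c y)))"
            using holomorphic_on_imp_continuous_on[OF hFn] clD continuous_on_subset by blast
          show "bounded \<Omega>" using sm bounded_cball bounded_subset by blast
          fix y assume y: "y \<in> frontier \<Omega>"
          have "y \<in> frontier S0" using y frontier_of_connected_component_subset unfolding \<Omega>_def by blast
          then have yn: "y \<notin> S0" using oS by (simp add: frontier_def interior_open)
          have yD: "y \<in> ?D" using y clD by (auto simp: frontier_def)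
          have "?c y \<notin> N.U" using yn yD by (auto simp: S0_def)
          then have "cmod (fst ((N.F ^^ n) (?c y))) \<le> max (cmod (P.X s y)) \<alpha>" using N.not_U_bound[of "?c y" n] by simp
          also have "\<dots> \<le> Bd" unfolding Bd_def by (intro max.mono Xn[OF yD]) simp
          finally show "cmod (fst ((N.F ^^ n) (?c y))) \<le> Bd" .
        qed (rule \<Omega>(4))
        moreover have "\<exists>n. N.deep Bd ((N.F ^^ n) (?c y0))" using N.eventually_deep[OF y0U, of Bd] unfolding eventually_sequentially by blast
        ultimately show False unfolding N.deep_def by (meson not_less)
      qed
      have A\<Omega>: "An \<subseteq> \<Omega>"
      proof -
        have "\<Omega> \<in> components S0" using yS by (auto simp: \<Omega>_def components_def)
        then show ?thesis using components_maximal[OF _ An AS] meet by blast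
      qed
      define y1 where "y1 = complex_of_real (cmod s / 4)"
      have y1n: "cmod y1 = cmod s / 4" using s0 by (simp add: y1_def)
      define t where "t = cmod s / 64"
      have t: "t > 0" using s0 by (simp add: t_def)
      have bA: "cball y1 t \<subseteq> An"
      proof
        fix y assume "y \<in> cball y1 t"
        then have "cmod (y - y1) \<le> cmod s / 64" by (simp add: t_def dist_norm norm_minus_commute)
        moreover have "cmod y \<le> cmod y1 + cmod (y - y1)" "cmod y1 \<le> cmod y + cmod (y - y1)"
          using norm_triangle_ineq[of y1 "y - y1"] norm_triangle_ineq4[of y "y - y1"] by simp_all
        ultimately have "cmod s / 8 < cmod y" "cmod y < cmod s / 2" using y1n s0 by linarith+
        then show "y \<in> An" by (simp add: An_def)
      qed
      have y1A: "y1 \<in> An" using bA t by auto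
      define \<theta> where "\<theta> = (\<lambda>y. N.\<psi> (Yc (P.X s y, y), y))"
      have \<theta>r: "\<theta> y / \<theta> y1 \<in> root_group d" if y: "y \<in> cball y1 t" for y
      proof -
        have yA: "y \<in> An" using y bA by blast
        have "N.eqv (?c y1) (?c y)" using N.eqv_trans[OF N.eqv_sym[OF all] all] A\<Omega> y1A yA by blast
        then have "N.eqv (N.F (?c y1)) (N.F (?c y))" by (rule N.eqv_F)
        then show ?thesis using N.eqv_V_iff[OF AV[OF y1A] AV[OF yA]] by (simp only: NFc \<theta>_def)
      qed
      have \<theta>c: "\<theta> y = \<theta> y1" if y: "y \<in> cball y1 t" for y
      proof -
        have "continuous_on (cball y1 t) \<theta>"
        proof -
          have c1: "continuous_on (cball y1 t) (\<lambda>y. (Yc (P.X s y, y), y))"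
          proof -
            have "cball y1 t \<subseteq> ?D" using bA by (auto simp: An_def)
            then have "continuous_on (cball y1 t) (\<lambda>y. N.F (?c y))"
              using continuous_on_compose2[OF N.continuous_Fn[of UNIV 1] continuous_on_subset[OF Xc]] by simp
            then show ?thesis by (simp only: NFc)
          qed
          have i: "(\<lambda>y. (Yc (P.X s y, y), y)) ` cball y1 t \<subseteq> V" using AV bA by blast
          show ?thesis unfolding \<theta>_def using continuous_on_compose2[OF holomorphic2_on_imp_continuous_on[OF N.holomorphic2_psi] c1 i] .
        qed
        then have c: "continuous_on (cball y1 t) (\<lambda>y. \<theta> y / \<theta> y1)"
          using N.psi_nonzero[OF AV[OF y1A]] by (intro continuous_intros) (auto simp: \<theta>_def)
        have "\<theta> y / \<theta> y1 = \<theta> y1 / \<theta> y1"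
          by (rule constant_if_countable_range[where A = "cball y1 t" and f = "\<lambda>y. \<theta> y / \<theta> y1", OF _ c countable_root_group[OF P.d_pos(3)] \<theta>r])
            (use y t in auto)
        then show ?thesis using N.psi_nonzero[OF AV[OF y1A]] by (simp add: \<theta>_def)
      qed
      have small: "cmod (poly p y - poly p y1) \<le> BB" if y: "y \<in> cball y1 t" for y
      proof -
        have yA: "y \<in> An" using y bA by blast
        let ?u = "Yc (P.X s y, y)" and ?u1 = "Yc (P.X s y1, y1)"
        have "N.\<Phi> (?u, y) = N.\<Phi> (?u1, y1)" using \<theta>c[OF y] N.psi_eq_iff by (simp only: \<theta>_def)
        moreover have "cmod (N.\<Phi> (?u, y) - ?u) \<le> N.C2" "cmod (N.\<Phi> (?u1, y1) - ?u1) \<le> N.C2"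
          using N.Phi_diff[OF AV[OF yA]] N.Phi_diff[OF AV[OF y1A]] by simp_all
        ultimately have "cmod (?u - ?u1) \<le> 2 * N.C2" using norm_triangle_ineq4[of "N.\<Phi> (?u1, y1) - ?u1" "N.\<Phi> (?u1, y1) - ?u"] by simp
        moreover have "cmod (a * (?u - ?u1)) \<le> 1 * cmod (?u - ?u1)" unfolding norm_mult using a_half by (intro mult_right_mono) auto
        ultimately have 1: "cmod (a * (?u - ?u1)) \<le> 2 * N.C2" by linarith
        have yD: "y \<in> ?D" "y1 \<in> ?D" using yA y1A by (auto simp: An_def)
        have "cmod (P.X s y - P.X s y1) \<le> 2 * P.C2"
          using norm_triangle_ineq4[of "P.X s y - s" "P.X s y1 - s"] Xd[OF yD(1)] Xd[OF yD(2)] by simp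
        moreover have "cmod (poly p y - poly p y1) \<le> cmod (a * (?u - ?u1)) + cmod (P.X s y - P.X s y1)"
        proof -
          have "poly p y - poly p y1 = a * (?u - ?u1) + (P.X s y - P.X s y1)" using a0 by (simp add: Yc_def field_simps)
          then show ?thesis using norm_triangle_ineq by metis
        qed
        ultimately show ?thesis using 1 unfolding BB_def by argo
      qed
      have "cmod (deriv (\<lambda>y. poly p y - poly p y1) y1) \<le> BB / t" by (rule deriv_bound_from_cball[OF _ t small]) (intro holomorphic_intros)
      moreover have "deriv (\<lambda>y. poly p y - poly p y1) y1 = poly (pderiv p) y1" by (rule DERIV_imp_deriv) (auto intro!: derivative_eq_intros)
      moreover have "BB / t < 1" using s M s0 by (simp add: t_def field_simps)
      moreover have "1 \<le> cmod (poly (pderiv p) y1)" using y1n s M by (intro r2) linarith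
      ultimately show False by simp
    qed
  qed (use M in auto)
qed

end


lemma norm_inverse_greater_iff:
  fixes u :: complex
  assumes "u \<noteq> 0" "0 < r"
  shows "1 / r < cmod (inverse u) \<longleftrightarrow> cmod u < r" unfolding norm_inverse using assms by (simp add: field_simps)

locale henon_end_chart = henon_map +
  fixes c :: complex and \<rho> :: real
    and \<Gamma> :: "complex \<Rightarrow> complex \<times> complex" and G :: "complex \<Rightarrow> complex"
  assumes rho: "0 < \<rho>" "\<rho> \<le> 1"
    and Gamma_holomorphic: "(\<lambda>v. fst (\<Gamma> v)) holomorphic_on pdisc \<rho>" "(\<lambda>v. snd (\<Gamma> v)) holomorphic_on pdisc \<rho>"
    and G_holomorphic: "G holomorphic_on ball 0 \<rho>" and G_0: "G 0 = 0" and G_nontrivial: "\<And>t. t > 0 \<Longrightarrow> \<exists>v\<in>ball 0 t. G v \<noteq> 0"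
    and Gamma: "\<And>v. v \<in> pdisc \<rho> \<Longrightarrow> good (\<Gamma> v) \<and> \<Gamma> v \<in> critical_locus p a \<alpha> \<and> P.\<psi> (\<Gamma> v) = 1 / v \<and>
       N.\<psi> (N.F (sw (\<Gamma> v))) = 1 / (- a / \<eta> * v * exp (G v))"
    and Gamma_image: "\<And>t. 0 < t \<Longrightarrow> t \<le> \<rho> \<Longrightarrow> \<exists>A. open A \<and> \<Gamma> ` (pdisc t) = critical_locus p a \<alpha> \<inter> A \<and>
       (\<exists>B \<delta>. \<delta> > 0 \<and> {z. cmod (fst z) > B \<and> cmod (snd z - c) < \<delta>} \<subseteq> A)"
    and Gamma_end: "\<And>B \<delta>. \<delta> > 0 \<Longrightarrow> \<exists>t. 0 < t \<and> t \<le> \<rho> \<and>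
       (\<forall>v\<in>pdisc t. cmod (fst (\<Gamma> v)) > B \<and> cmod (snd (\<Gamma> v) - c) < \<delta>)"

context henon_map
begin

lemma end_chart:
  assumes c: "poly (pderiv p) c = 0" and simple: "poly (pderiv (pderiv p)) c \<noteq> 0" and nd: "nondegenerate c"
  shows "\<exists>\<rho> \<Gamma> G. henon_end_chart p a \<eta> R r \<alpha> c \<rho> \<Gamma> G"
proof -
  obtain y M \<rho>c C where cg: "0 < \<rho>c" "\<rho>c \<le> 1 / 2" "M > 1" "C \<ge> 0" "y holomorphic_on {x. cmod x > M}"
    "\<And>x y'. cmod x > M \<Longrightarrow> y' \<in> cball c \<rho>c \<Longrightarrow> good (x, y')"
    "\<And>x. cmod x > M \<Longrightarrow> y x \<in> ball c \<rho>c \<and> W (x, y x) = 0 \<and> cmod (y x - c) \<le> C / cmod x ^ (d - 1)"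
    "\<And>x y'. cmod x > M \<Longrightarrow> y' \<in> cball c \<rho>c \<Longrightarrow> W (x, y') = 0 \<Longrightarrow> y' = y x" by (rule critical_graph[OF c simple]) (rule that)
  define Y where "Y = (\<lambda>u. y (inverse u))"
  have inv: "cmod (inverse u) > M" if "u \<in> pdisc (1 / M)" for u using that cg(3) norm_inverse_greater_iff[of u "1 / M"] by simp
  have Yp: "good (inverse u, Y u) \<and> W (inverse u, Y u) = 0 \<and> cmod (Y u - c) \<le> C * cmod u ^ (d - 1) \<and> Y u \<in> ball c \<rho>c"
    if u: "u \<in> pdisc (1 / M)" for u
  proof -
    have "C / cmod (inverse u) ^ (d - 1) = C * cmod u ^ (d - 1)" by (simp add: norm_inverse power_inverse divide_inverse)
    then show ?thesis using cg(7)[OF inv[OF u]] cg(6)[OF inv[OF u], of "Y u"] by (auto simp: Y_def)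
  qed
  have Yev: "\<forall>\<^sub>F u in at 0. good (inverse u, Y u) \<and> W (inverse u, Y u) = 0 \<and> cmod (Y u - c) \<le> C * cmod u ^ (d - 1)"
    unfolding eventually_at using Yp cg(3) by (intro exI[of _ "1 / M"]) auto
  define D0 where "D0 = ball (0::complex) (1 / M) - {0}"
  have oD0: "open D0" by (auto simp: D0_def)
  have hinv: "inverse holomorphic_on D0" by (auto simp: D0_def intro!: holomorphic_on_inverse holomorphic_on_ident)
  have hY: "Y holomorphic_on D0" unfolding Y_def
  proof (rule holomorphic_on_compose_gen[OF hinv cg(5), unfolded o_def])
    show "inverse ` D0 \<subseteq> {x. cmod x > M}" using inv unfolding D0_def by blast
  qed
  define e1 where "e1 = (\<lambda>u. P.E (inverse u, Y u))"
  define e2 where "e2 = (\<lambda>u. N.E (Yc (inverse u, Y u), Y u))"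
  define wz where "wz = (\<lambda>u. u * poly p (Y u))"
  have l: "(e1 \<longlongrightarrow> 0) (at 0)" "(e2 \<longlongrightarrow> 0) (at 0)" "(wz \<longlongrightarrow> 0) (at 0)" unfolding e1_def e2_def wz_def
    using P.tendsto_E_0[OF filterlim_inverse_at_infinity tendsto_Y[OF Yev]]
      N.tendsto_E_0[OF Yc_inf[OF Yev] tendsto_Y[OF Yev]] tendsto_upY[OF Yev] by blast+
  have he1: "e1 holomorphic_on D0" unfolding e1_def
    by (rule holomorphic2_on_compose_curve[OF P.holomorphic2_E hinv hY oD0]) (use good_reg(3) Yp in \<open>auto simp: D0_def\<close>)
  have hE2: "holomorphic2_on (\<lambda>z. N.E (Yc z, snd z)) {z. good z}"
    by (rule holomorphic2_on_compose[OF N.holomorphic2_E holomorphic2_Yc holomorphic2_on_snd]) (use good_reg(4) in auto)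
  have he2: "e2 holomorphic_on D0" unfolding e2_def using holomorphic2_on_compose_curve[OF hE2 hinv hY oD0] Yp by (auto simp: D0_def)
  have hw: "wz holomorphic_on D0" unfolding wz_def by (intro holomorphic_intros hY)
  have "\<forall>\<^sub>F u in at 0. dist (wz u) 0 < 1 / 2" using l(3) by (rule tendstoD) simp
  then obtain \<delta>1 where \<delta>1: "\<delta>1 > 0" "\<And>u. u \<noteq> 0 \<Longrightarrow> cmod u < \<delta>1 \<Longrightarrow> cmod (wz u) < 1 / 2" unfolding eventually_at by (auto simp: dist_norm)
  define \<rho>1 where "\<rho>1 = min \<delta>1 (1 / M)"
  have \<rho>1: "\<rho>1 > 0" "\<rho>1 \<le> \<delta>1" "\<rho>1 \<le> 1 / M" using \<delta>1 cg(3) by (auto simp: \<rho>1_def)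
  have sub1: "pdisc \<rho>1 \<subseteq> D0" using \<rho>1 by (auto simp: D0_def)
  define E1 where "E1 = (\<lambda>u. if u = 0 then 0 else e1 u)"
  define E2 where "E2 = (\<lambda>u. if u = 0 then 0 else e2 u)"
  define wx where "wx = (\<lambda>u. if u = 0 then 0 else wz u)"
  have hE: "E1 holomorphic_on ball 0 \<rho>1" "E2 holomorphic_on ball 0 \<rho>1" "wx holomorphic_on ball 0 \<rho>1" unfolding E1_def E2_def wx_def
    by (rule holomorphic_extend_by_0[OF holomorphic_on_subset[OF he1 sub1] l(1)]
        holomorphic_extend_by_0[OF holomorphic_on_subset[OF he2 sub1] l(2)]
        holomorphic_extend_by_0[OF holomorphic_on_subset[OF hw sub1] l(3)])+
  have wx2: "cmod (wx u) < 1 / 2" if "u \<in> ball 0 \<rho>1" for u using \<delta>1(2)[of u] that \<rho>1 by (auto simp: wx_def)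
  define vv where "vv = (\<lambda>u. u * exp (- E1 u))"
  have hv: "vv holomorphic_on ball 0 \<rho>1" unfolding vv_def by (intro holomorphic_intros hE)
  have v0: "vv 0 = 0" by (simp add: vv_def)
  have vnz: "vv u \<noteq> 0 \<longleftrightarrow> u \<noteq> 0" for u by (simp add: vv_def)
  have "deriv vv 0 = 1"
  proof (rule DERIV_imp_deriv)
    obtain D where D: "(E1 has_field_derivative D) (at 0)"
      using hE(1) \<rho>1(1) holomorphic_on_imp_differentiable_at[OF _ open_ball] unfolding field_differentiable_def by (metis centre_in_ball)
    show "(vv has_field_derivative 1) (at 0)" unfolding vv_def by (rule derivative_eq_intros D refl)+ (simp add: E1_def)
  qed
  then obtain r s ui where li: "0 < r" "r \<le> \<rho>1" "0 < s" "inj_on vv (ball 0 r)" "ui holomorphic_on ball 0 s" "ui 0 = 0"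
    "\<And>w. w \<in> ball 0 s \<Longrightarrow> ui w \<in> ball 0 r \<and> vv (ui w) = w" using local_inverse_at_0[OF hv \<rho>1(1) v0] by auto
  define g where "g = (\<lambda>u. E1 u - E2 u - Ln (1 - wx u))"
  have hg: "g holomorphic_on ball 0 \<rho>1" unfolding g_def
  proof (intro holomorphic_intros hE)
    fix u :: complex assume u: "u \<in> ball 0 \<rho>1"
    have "Re (wx u) < 1" using wx2[OF u] complex_Re_le_cmod[of "wx u"] by linarith
    then show "1 - wx u \<notin> \<real>\<^sub>\<le>\<^sub>0" by (auto simp: complex_nonpos_Reals_iff)
  qed
  define \<rho> where "\<rho> = min s 1"
  have \<rho>: "0 < \<rho>" "\<rho> \<le> 1" "\<rho> \<le> s" using li by (auto simp: \<rho>_def)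
  define \<Gamma> where "\<Gamma> = (\<lambda>w. (inverse (ui w), Y (ui w)))"
  define G where "G = (\<lambda>w. g (ui w))"
  have rM: "pdisc r \<subseteq> pdisc (1 / M)"
  proof -
    have "r \<le> 1 / M" using li(2) \<rho>1(3) by linarith
    then show ?thesis by auto
  qed
  have uiD: "ui w \<in> pdisc r" "vv (ui w) = w" "ui w \<in> D0" "ui w \<in> pdisc (1 / M)" if "w \<in> pdisc \<rho>" for w
  proof -
    have "w \<in> ball 0 s" using that \<rho> by auto
    then have 1: "ui w \<in> ball 0 r" "vv (ui w) = w" using li(7) by auto
    then have "ui w \<noteq> 0" using that v0 by auto
    then show "ui w \<in> pdisc r" "vv (ui w) = w" "ui w \<in> D0" "ui w \<in> pdisc (1 / M)" using 1 rM unfolding D0_def by blast+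
  qed
  have rD0: "u \<in> pdisc r \<Longrightarrow> u \<in> pdisc (1 / M)" for u :: complex using rM by blast
  have hui: "ui holomorphic_on pdisc \<rho>" by (rule holomorphic_on_subset[OF li(5)]) (use \<rho> in auto)
  have uiv: "ui (vv u) = u" if "u \<in> ball 0 r" "vv u \<in> ball 0 s" for u using li(7)[OF that(2)] li(4) that(1) by (auto simp: inj_on_def)
  have uic: "isCont ui 0" using holomorphic_on_imp_continuous_on[OF li(5)] li(3) by (auto simp: continuous_on_eq_continuous_at)
  show ?thesis
  proof (rule exI[of _ \<rho>], rule exI[of _ \<Gamma>], rule exI[of _ G], intro henon_end_chart.intro henon_map_axioms henon_end_chart_axioms.intro)
    show "(\<lambda>v. fst (\<Gamma> v)) holomorphic_on pdisc \<rho>" unfolding \<Gamma>_def fst_conv using uiD(1) by (intro holomorphic_on_inverse hui) auto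
    show "(\<lambda>v. snd (\<Gamma> v)) holomorphic_on pdisc \<rho>" unfolding \<Gamma>_def snd_conv
    proof (rule holomorphic_on_compose_gen[OF hui hY, unfolded o_def])
      show "ui ` (pdisc \<rho>) \<subseteq> D0" using uiD(3) by blast
    qed
    have hus: "ui holomorphic_on ball 0 \<rho>" by (rule holomorphic_on_subset[OF li(5)]) (use \<rho> in auto)
    have "ui ` ball 0 \<rho> \<subseteq> ball 0 \<rho>1"
    proof (rule image_subsetI)
      fix w :: complex assume "w \<in> ball 0 \<rho>"
      then have "ui w \<in> ball 0 r" using li(7)[of w] \<rho>(3) by simp
      then show "ui w \<in> ball 0 \<rho>1" using li(2) by simp
    qed
    then show "G holomorphic_on ball 0 \<rho>" unfolding G_def using holomorphic_on_compose_gen[OF hus hg, unfolded o_def] by blast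
    show "G 0 = 0" by (simp add: G_def g_def li(6) E1_def E2_def wx_def)
    show "\<exists>v\<in>ball 0 t. G v \<noteq> 0" if t: "t > 0" for t
    proof (rule ccontr)
      assume "\<not> ?thesis"
      then have G0: "\<And>v. v \<in> ball 0 t \<Longrightarrow> G v = 0" by blast
      have "isCont vv 0" using holomorphic_on_imp_continuous_on[OF hv] \<rho>1 by (auto simp: continuous_on_eq_continuous_at)
      then have "\<forall>\<^sub>F u in at 0. dist (vv u) 0 < min t s" using v0 t li(3) by (intro tendstoD) (auto simp: isCont_def)
      moreover have "\<forall>\<^sub>F u in at 0. u \<in> pdisc r" using li(1) by (intro eventually_at_in_open) auto
      ultimately have "\<forall>\<^sub>F u in at 0. Gf (inverse u) (Y u) = 0"
      proof eventually_elim
        case (elim u)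
        then have "G (vv u) = 0" by (intro G0) (simp add: dist_commute)
        moreover have "ui (vv u) = u" using elim by (intro uiv) (auto simp: dist_commute)
        ultimately have "g u = 0" by (simp add: G_def)
        then show ?case using elim by (simp add: g_def Gf_def E1_def E2_def wx_def e1_def e2_def wz_def divide_inverse mult.commute)
      qed
      with not_eventually_Gf_zero[OF Yev c simple nd] show False by blast
    qed
    show "good (\<Gamma> v) \<and> \<Gamma> v \<in> critical_locus p a \<alpha> \<and> P.\<psi> (\<Gamma> v) = 1 / v \<and>
       N.\<psi> (N.F (sw (\<Gamma> v))) = 1 / (- a / \<eta> * v * exp (G v))" if v: "v \<in> pdisc \<rho>" for v
    proof -
      define u where "u = ui v"
      have u: "u \<in> pdisc r" "vv u = v" "u \<in> pdisc (1 / M)" using uiD[OF v] by (auto simp: u_def)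
      have u0: "u \<noteq> 0" using u by simp
      have \<Gamma>u: "\<Gamma> v = (inverse u, Y u)" by (simp add: \<Gamma>_def u_def)
      have gd: "good (\<Gamma> v)" "W (\<Gamma> v) = 0" using Yp[OF u(3)] by (auto simp: \<Gamma>u)
      have E1u: "E1 u = P.E (inverse u, Y u)" "E2 u = N.E (Yc (inverse u, Y u), Y u)" "wx u = u * poly p (Y u)"
        using u0 by (simp_all add: E1_def E2_def wx_def e1_def e2_def wz_def)
      have veq: "v = u * exp (- E1 u)" using u(2) by (simp add: vv_def)
      have "P.\<psi> (\<Gamma> v) = inverse u * exp (E1 u)" by (simp add: P.\<psi>_def P.\<Phi>_def \<Gamma>u E1u)
      also have "\<dots> = 1 / v" by (simp add: veq exp_minus divide_inverse)
      finally have 1: "P.\<psi> (\<Gamma> v) = 1 / v" .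
      have w1: "1 - wx u \<noteq> 0" using wx2[of u] u(1) li(2) by auto
      have Ycu: "Yc (inverse u, Y u) = - (1 - wx u) / (a * u)" using u0 a0 by (simp add: Yc_def E1u field_simps)
      have Gv: "G v = g u" by (simp add: G_def u_def)
      have "exp (- E1 u) * exp (g u) = exp (- E2 u - Ln (1 - wx u))" by (simp add: g_def flip: exp_add)
      also have "\<dots> = exp (- E2 u) / (1 - wx u)" using w1 by (simp add: exp_diff exp_Ln)
      finally have eq: "v * exp (G v) = u * (exp (- E2 u) / (1 - wx u))" unfolding Gv by (subst veq) (simp only: mult.assoc)
      have "1 / (- a / \<eta> * v * exp (G v)) = 1 / (- a / \<eta> * (u * (exp (- E2 u) / (1 - wx u))))" by (simp only: eq mult.assoc)
      also have "\<dots> = \<eta> * (- (1 - wx u) / (a * u)) * exp (E2 u)"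
        using u0 a0 N.eta0 w1 by (simp add: exp_minus divide_simps) (simp add: algebra_simps)
      also have "\<dots> = N.\<psi> (N.F (sw (\<Gamma> v)))" unfolding N_F_sw_eq by (simp add: N.\<psi>_def N.\<Phi>_def \<Gamma>u E1u(2) Ycu)
      finally show ?thesis using gd 1 critical_locus_good_iff[OF gd(1)] by simp
    qed
    show "\<exists>A. open A \<and> \<Gamma> ` (pdisc t) = critical_locus p a \<alpha> \<inter> A \<and>
       (\<exists>B \<delta>. \<delta> > 0 \<and> {z. cmod (fst z) > B \<and> cmod (snd z - c) < \<delta>} \<subseteq> A)" if t: "0 < t" "t \<le> \<rho>" for t
    proof -
      define A0 where "A0 = {z::complex \<times> complex. cmod (fst z) > 1 / r \<and> cmod (snd z - c) < \<rho>c}"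
      have oA0: "open A0" unfolding A0_def by (intro open_Collect_conj open_Collect_less continuous_intros)
      have iA: "inverse (fst z) \<in> pdisc r" if "z \<in> A0" for z
      proof -
        have 1: "1 / r < cmod (fst z)" using that by (simp add: A0_def)
        moreover have "0 < 1 / r" using li(1) by simp
        ultimately have "0 < cmod (fst z)" by linarith
        then show ?thesis using norm_inverse_greater_iff[of "inverse (fst z)" r] 1 li(1) by simp
      qed
      have "continuous_on A0 (\<lambda>z. inverse (fst z))" using iA by (intro continuous_intros) auto
      moreover have "(\<lambda>z. inverse (fst z)) ` A0 \<subseteq> ball 0 \<rho>1"
      proof (rule image_subsetI)
        show "inverse (fst z) \<in> ball 0 \<rho>1" if "z \<in> A0" for z using iA[OF that] li(2) by simp
      qed
      ultimately have cA: "continuous_on A0 (\<lambda>z. vv (inverse (fst z)))"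
        using continuous_on_compose2[OF holomorphic_on_imp_continuous_on[OF hv]] by blast
      define A where "A = A0 \<inter> (\<lambda>z. vv (inverse (fst z))) -` ball 0 t"
      have oA: "open A" unfolding A_def by (rule continuous_open_preimage[OF cA oA0]) auto
      have "\<Gamma> ` (pdisc t) \<subseteq> critical_locus p a \<alpha> \<inter> A"
      proof (rule image_subsetI)
        fix v :: complex assume "v \<in> pdisc t"
        then have v: "v \<in> pdisc \<rho>" "v \<in> ball 0 t" using t by auto
        have u: "ui v \<in> pdisc r" "vv (ui v) = v" "ui v \<in> pdisc (1 / M)" using uiD[OF v(1)] by auto
        have gd: "good (\<Gamma> v)" "W (\<Gamma> v) = 0" "snd (\<Gamma> v) \<in> ball c \<rho>c" using Yp[OF u(3)] by (auto simp: \<Gamma>_def)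
        have "cmod (inverse (ui v)) > 1 / r" using u(1) li(1) norm_inverse_greater_iff[of "ui v" r] by simp
        then have "\<Gamma> v \<in> A" using u v(2) gd(3) by (simp add: A_def A0_def \<Gamma>_def dist_norm norm_minus_commute)
        then show "\<Gamma> v \<in> critical_locus p a \<alpha> \<inter> A" using gd critical_locus_good_iff by blast
      qed
      moreover have "critical_locus p a \<alpha> \<inter> A \<subseteq> \<Gamma> ` (pdisc t)"
      proof
        fix z assume z: "z \<in> critical_locus p a \<alpha> \<inter> A"
        define u where "u = inverse (fst z)"
        have u: "u \<in> pdisc r" using iA z by (auto simp: A_def u_def)
        have fz: "fst z = inverse u" by (simp add: u_def)
        have M: "cmod (fst z) > M" using inv[OF rD0[OF u]] by (simp add: fz)
        have s: "snd z \<in> cball c \<rho>c" using z by (simp add: A_def A0_def dist_norm norm_minus_commute)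
        have gd: "good z" using cg(6)[OF M s] by simp
        have "W z = 0" using z critical_locus_good_iff[OF gd] by blast
        then have "snd z = y (fst z)" using cg(8)[OF M s] by simp
        then have "snd z = Y u" by (simp only: Y_def fz)
        moreover have vt: "vv u \<in> ball 0 t" using z by (simp add: A_def u_def)
        moreover have "ui (vv u) = u" using u vt t \<rho> by (intro uiv) auto
        ultimately have "z = \<Gamma> (vv u)" using fz by (simp add: \<Gamma>_def prod_eq_iff)
        then show "z \<in> \<Gamma> ` (pdisc t)" using vt vnz u by auto
      qed
      moreover have "\<exists>B \<delta>. \<delta> > 0 \<and> {z. cmod (fst z) > B \<and> cmod (snd z - c) < \<delta>} \<subseteq> A"
      proof -
        have "isCont vv 0" using holomorphic_on_imp_continuous_on[OF hv] \<rho>1 by (auto simp: continuous_on_eq_continuous_at)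
        then obtain e where e: "e > 0" "\<And>u. cmod u < e \<Longrightarrow> cmod (vv u) < t"
          using t(1) v0 unfolding continuous_at_eps_delta by (auto simp: dist_norm)
        have "z \<in> A" if z: "cmod (fst z) > max (1 / r) (1 / e)" "cmod (snd z - c) < \<rho>c" for z
        proof -
          have zA: "z \<in> A0" using z by (simp add: A0_def)
          have 1: "1 / e < cmod (fst z)" using z(1) by simp
          moreover have "0 < 1 / e" using e(1) by simp
          ultimately have "0 < cmod (fst z)" by linarith
          then have "cmod (inverse (fst z)) < e" using norm_inverse_greater_iff[of "inverse (fst z)" e] 1 e(1) by simp
          then show ?thesis using zA e(2) by (simp add: A_def)
        qed
        then show ?thesis using cg(1) by (intro exI[of _ "max (1 / r) (1 / e)"] exI[of _ \<rho>c]) blast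
      qed
      ultimately show ?thesis using oA by blast
    qed
    show "\<exists>t. 0 < t \<and> t \<le> \<rho> \<and>
       (\<forall>v\<in>pdisc t. cmod (fst (\<Gamma> v)) > B \<and> cmod (snd (\<Gamma> v) - c) < \<delta>)" if \<delta>: "\<delta> > 0" for B \<delta>
    proof -
      have "\<forall>\<^sub>F u in at 0. dist (Y u) c < \<delta>" using tendsto_Y[OF Yev] \<delta> by (rule tendstoD)
      then obtain e1 where e1: "e1 > 0" "\<And>u. u \<noteq> 0 \<Longrightarrow> cmod u < e1 \<Longrightarrow> cmod (Y u - c) < \<delta>" unfolding eventually_at by (auto simp: dist_norm)
      define e where "e = min e1 (1 / (\<bar>B\<bar> + 1))"
      have e: "e > 0" "e \<le> e1" "e \<le> 1 / (\<bar>B\<bar> + 1)" using e1 by (auto simp: e_def)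
      obtain t0 where t0: "t0 > 0" "\<And>v. cmod v < t0 \<Longrightarrow> cmod (ui v) < e"
        using uic e(1) li(6) unfolding continuous_at_eps_delta by (auto simp: dist_norm)
      show ?thesis
      proof (intro exI[of _ "min t0 \<rho>"] conjI ballI)
        fix v :: complex assume v: "v \<in> pdisc (min t0 \<rho>)"
        have u: "cmod (ui v) < e" "ui v \<noteq> 0" using t0(2)[of v] uiD(1)[of v] v by auto
        show "cmod (snd (\<Gamma> v) - c) < \<delta>" using e1(2) u e by (simp add: \<Gamma>_def)
        have "cmod (ui v) < 1 / (\<bar>B\<bar> + 1)" using u(1) e(3) by linarith
        then have "\<bar>B\<bar> + 1 < cmod (inverse (ui v))" using norm_inverse_greater_iff[OF u(2), of "1 / (\<bar>B\<bar> + 1)"] by simp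
        then show "B < cmod (fst (\<Gamma> v))" by (simp add: \<Gamma>_def)
      qed (use t0 \<rho> in auto)
    qed
  qed (use \<rho> in auto)
qed

end

locale henon_end = henon_end_chart p a \<eta> R r \<alpha> c \<rho> \<Gamma> G
  for p a \<eta> R r \<alpha> c and H :: "(complex \<times> complex) set" and \<rho> \<Gamma> G +
  assumes component: "primary_component p a \<alpha> c H"
begin

definition m :: "complex \<Rightarrow> complex" where
  "m v = - a / \<eta> * v * exp (G v)"

abbreviation disc :: "complex set" where "disc \<equiv> pdisc \<rho>"

lemma continuous_Gamma: "continuous_on disc \<Gamma>" using continuous_on_Pair[OF holomorphic_on_imp_continuous_on[OF Gamma_holomorphic(1)]
      holomorphic_on_imp_continuous_on[OF Gamma_holomorphic(2)]] by simp

lemma Gamma_D: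
  assumes "v \<in> disc"
  shows "\<Gamma> v \<in> V" "N.F (sw (\<Gamma> v)) \<in> V" "\<Gamma> v \<in> P.U" "sw (\<Gamma> v) \<in> N.U" "P.\<psi> (\<Gamma> v) = 1 / v" "N.\<psi> (N.F (sw (\<Gamma> v))) = 1 / m v"
proof -
  have g: "good (\<Gamma> v)" using Gamma[OF assms] by blast
  show "\<Gamma> v \<in> V" "N.F (sw (\<Gamma> v)) \<in> V" using good_reg[OF g] by (simp_all add: N_F_sw_eq)
  show "\<Gamma> v \<in> P.U" "sw (\<Gamma> v) \<in> N.U" using good_U[OF g] by (simp_all add: U_plus_eq U_minus_iff)
  show "P.\<psi> (\<Gamma> v) = 1 / v" "N.\<psi> (N.F (sw (\<Gamma> v))) = 1 / m v" using Gamma[OF assms] by (simp_all add: m_def)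
qed

lemma m_nonzero: "v \<noteq> 0 \<Longrightarrow> m v \<noteq> 0" using a0 N.eta0 by (simp add: m_def)

lemma Gamma_inj: "v \<in> disc \<Longrightarrow> w \<in> disc \<Longrightarrow> \<Gamma> v = \<Gamma> w \<Longrightarrow> v = w" by (metis Gamma_D(5) inverse_eq_divide inverse_inverse_eq)

lemma component_subset: "H \<subseteq> critical_locus p a \<alpha>" "H \<subseteq> P.U" "z \<in> H \<Longrightarrow> sw z \<in> N.U"
proof -
  show 1: "H \<subseteq> critical_locus p a \<alpha>" using component in_components_subset by (auto simp: primary_component_def)
  then show "H \<subseteq> P.U" "z \<in> H \<Longrightarrow> sw z \<in> N.U" by (auto simp: critical_locus_def U_plus_eq U_minus_iff)
qed

lemma Gamma_subset_component: "\<Gamma> ` disc \<subseteq> H"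
proof (rule components_maximal)
  show "H \<in> components (critical_locus p a \<alpha>)" using component by (simp add: primary_component_def)
  have "connected disc" by (rule connected_punctured_ball) simp
  then show "connected (\<Gamma> ` disc)" by (rule connected_continuous_image[OF continuous_Gamma])
  show "\<Gamma> ` disc \<subseteq> critical_locus p a \<alpha>" using Gamma by blast
  obtain A B \<delta> where A: "\<Gamma> ` disc = critical_locus p a \<alpha> \<inter> A" "\<delta> > 0" "{z. cmod (fst z) > B \<and> cmod (snd z - c) < \<delta>} \<subseteq> A"
    using Gamma_image[of \<rho>] rho by blast
  have "\<not> eventually (\<lambda>_. False) (puncture_filter H c)" using component by (simp add: primary_component_def eventually_False)
  then obtain z where "z \<in> H" "cmod (fst z) > B" "cmod (snd z - c) < \<delta>" unfolding eventually_puncture_filter using A(2) by blast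
  then show "H \<inter> \<Gamma> ` disc \<noteq> {}" using A component_subset by blast
qed

lemma puncture_filter_iff:
  "eventually Q (puncture_filter H c) \<longleftrightarrow> (\<exists>t. 0 < t \<and> t \<le> \<rho> \<and> (\<forall>v\<in>pdisc t. Q (\<Gamma> v)))"
proof
  assume "eventually Q (puncture_filter H c)"
  then obtain B \<delta> where B: "\<delta> > 0" "\<And>z. z \<in> H \<Longrightarrow> cmod (fst z) > B \<Longrightarrow> cmod (snd z - c) < \<delta> \<Longrightarrow> Q z" unfolding eventually_puncture_filter by blast
  obtain t where t: "0 < t" "t \<le> \<rho>" "\<And>v. v \<in> pdisc t \<Longrightarrow> cmod (fst (\<Gamma> v)) > B \<and> cmod (snd (\<Gamma> v) - c) < \<delta>"
    using Gamma_end[OF B(1), of B] by blast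
  have "Q (\<Gamma> v)" if v: "v \<in> pdisc t" for v
  proof -
    have "v \<in> disc" using v t by auto
    then show ?thesis using B(2) t(3)[OF v] Gamma_subset_component by blast
  qed
  then show "\<exists>t. 0 < t \<and> t \<le> \<rho> \<and> (\<forall>v\<in>pdisc t. Q (\<Gamma> v))" using t by blast
next
  assume "\<exists>t. 0 < t \<and> t \<le> \<rho> \<and> (\<forall>v\<in>pdisc t. Q (\<Gamma> v))"
  then obtain t where t: "0 < t" "t \<le> \<rho>" "\<And>v. v \<in> pdisc t \<Longrightarrow> Q (\<Gamma> v)" by blast
  obtain A B \<delta> where A: "\<Gamma> ` (pdisc t) = critical_locus p a \<alpha> \<inter> A" "\<delta> > 0" "{z. cmod (fst z) > B \<and> cmod (snd z - c) < \<delta>} \<subseteq> A"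
    using Gamma_image[OF t(1,2)] by blast
  show "eventually Q (puncture_filter H c)" unfolding eventually_puncture_filter
  proof (rule exI[of _ B], rule exI[of _ \<delta>], intro conjI ballI impI A(2))
    fix z assume "z \<in> H" "cmod (fst z) > B" "cmod (snd z - c) < \<delta>"
    then have "z \<in> \<Gamma> ` (pdisc t)" using A(1,3) component_subset(1) by blast
    then show "Q z" using t(3) by blast
  qed
qed

lemma open_Gamma_image:
  assumes D: "open D" "D \<subseteq> disc"
  shows "openin (top_of_set H) (\<Gamma> ` D)" "homeomorphism D (\<Gamma> ` D) \<Gamma> (\<lambda>z. 1 / P.\<psi> z)"
proof -
  obtain A where A: "open A" "\<Gamma> ` disc = critical_locus p a \<alpha> \<inter> A" using Gamma_image[of \<rho>] rho by blast
  have cV: "continuous_on V (\<lambda>z. 1 / P.\<psi> z)"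
    using P.psi_nonzero by (intro continuous_intros holomorphic2_on_imp_continuous_on[OF P.holomorphic2_psi]) auto
  have inv: "1 / P.\<psi> (\<Gamma> v) = v" if "v \<in> D" for v
  proof -
    have "v \<in> disc" using that D by blast
    then show ?thesis by (simp add: Gamma_D(5) del: Diff_iff)
  qed
  have "\<Gamma> ` D = H \<inter> (A \<inter> (V \<inter> (\<lambda>z. 1 / P.\<psi> z) -` D))"
  proof (intro equalityI subsetI)
    fix z assume "z \<in> \<Gamma> ` D"
    then obtain v where v: "v \<in> D" "z = \<Gamma> v" by blast
    have vd: "v \<in> disc" using v D by blast
    then have "z \<in> H" "z \<in> A" "z \<in> V" using Gamma_subset_component A(2) Gamma_D(1)[OF vd] v(2) by blast+
    then show "z \<in> H \<inter> (A \<inter> (V \<inter> (\<lambda>z. 1 / P.\<psi> z) -` D))" using inv[OF v(1)] v by simp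
  next
    fix z assume z: "z \<in> H \<inter> (A \<inter> (V \<inter> (\<lambda>z. 1 / P.\<psi> z) -` D))"
    then have "z \<in> \<Gamma> ` disc" using A(2) component_subset(1) by blast
    then obtain v where v: "v \<in> disc" "z = \<Gamma> v" by blast
    then have "v \<in> D" using z Gamma_D(5)[OF v(1)] by simp
    then show "z \<in> \<Gamma> ` D" using v by blast
  qed
  moreover have "open (A \<inter> (V \<inter> (\<lambda>z. 1 / P.\<psi> z) -` D))" by (intro open_Int A(1) continuous_open_preimage[OF cV P.open_V D(1)])
  ultimately show "openin (top_of_set H) (\<Gamma> ` D)" by (metis openin_open)
  show "homeomorphism D (\<Gamma> ` D) \<Gamma> (\<lambda>z. 1 / P.\<psi> z)"
  proof (rule homeomorphismI)
    show "continuous_on D \<Gamma>" using continuous_on_subset[OF continuous_Gamma D(2)] .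
    show "continuous_on (\<Gamma> ` D) (\<lambda>z. 1 / P.\<psi> z)" by (rule continuous_on_subset[OF cV]) (use Gamma_D(1) D in blast)
  qed (use inv in auto)
qed

end


lemma root_group_power: "\<omega> \<in> root_group d \<Longrightarrow> \<omega> ^ n \<in> root_group d" by (induction n) (auto intro: root_group_mult)

lemma root_group_divide: "\<omega> \<in> root_group d \<Longrightarrow> \<theta> \<in> root_group d \<Longrightarrow> \<omega> / \<theta> \<in> root_group d"
  using root_group_mult[OF _ root_group_inverse] by (simp add: divide_inverse)

lemma root_group_if_power:
  assumes "\<omega> ^ (d ^ n) \<in> root_group d"
  shows "\<omega> \<in> root_group d"
proof -
  obtain m where "(\<omega> ^ (d ^ n)) ^ (d ^ m) = 1" using assms by (auto simp: root_group_def)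
  then have "\<omega> ^ (d ^ (n + m)) = 1" by (simp add: power_add power_mult)
  then show ?thesis by (rule root_groupI)
qed

lemma power_divide_self_root_group:
  assumes "C \<noteq> 0" "C ^ d / C \<in> root_group d"
  shows "C ^ (d ^ n) / C \<in> root_group d"
proof (induction n)
  case (Suc n)
  have "C ^ (d ^ Suc n) / C = (C ^ (d ^ n) / C) ^ d * (C ^ d / C)"
    using assms(1) by (simp add: power_divide power_mult[symmetric] mult.commute)
  then show ?case using root_group_mult[OF root_group_power[OF Suc.IH] assms(2)] by (simp only:)
qed (use assms in simp)

lemma (in bott) eventually_psi_large:
  assumes "z \<in> U"
  shows "\<forall>\<^sub>F n in sequentially. (F ^^ n) z \<in> V \<and> cmod (\<psi> ((F ^^ n) z)) > B" using eventually_deep[OF assms, of "B / cmod \<eta> + C2"]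
proof eventually_elim
  case (elim n)
  let ?w = "(F ^^ n) z"
  have w: "?w \<in> V" "cmod (fst ?w) > B / cmod \<eta> + C2" using elim by (auto simp: deep_def)
  have "cmod (fst ?w) - cmod (\<Phi> ?w) \<le> cmod (\<Phi> ?w - fst ?w)" using norm_triangle_ineq2[of "fst ?w" "\<Phi> ?w"] by (simp add: norm_minus_commute)
  then have "cmod (\<Phi> ?w) > B / cmod \<eta>" using w(2) Phi_diff[OF w(1)] by linarith
  then have "cmod (\<psi> ?w) > B" using eta0 by (simp add: \<psi>_def norm_mult field_simps)
  then show ?case using w by simp
qed

locale side_conjugacy =
  f: bott pf bf ef \<eta>f Rf rf \<alpha>f + g: bott pg bg eg \<eta>g Rg rg \<alpha>g
  for pf bf ef \<eta>f Rf rf \<alpha>f pg bg eg \<eta>g Rg rg \<alpha>g +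
  fixes h :: "complex \<times> complex \<Rightarrow> complex \<times> complex" and S :: "(complex \<times> complex) set"
  assumes degree_eq: "degree pg = degree pf"
    and U_S: "f.U \<subseteq> S" and F_S: "\<And>z. z \<in> S \<Longrightarrow> f.F z \<in> S" and inj: "inj_on h S"
    and h_F: "\<And>z. z \<in> S \<Longrightarrow> h (f.F z) = g.F (h z)"
    and h_leaf: "\<And>z. z \<in> f.U \<Longrightarrow> \<exists>z'\<in>g.U. h ` {w. f.eqv z w} = {w. g.eqv z' w}"
begin

lemma h_eqv_class: "z \<in> f.U \<Longrightarrow> h z \<in> g.U \<and> h ` {w. f.eqv z w} = {w. g.eqv (h z) w}"
proof -
  assume z: "z \<in> f.U"
  obtain z' where z': "z' \<in> g.U" "h ` {w. f.eqv z w} = {w. g.eqv z' w}" using h_leaf[OF z] by blast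
  have e: "g.eqv z' (h z)" using z'(2) f.eqv_refl[OF z] by blast
  then have "{w. g.eqv z' w} = {w. g.eqv (h z) w}" using g.eqv_trans g.eqv_sym by blast
  then show ?thesis using z'(2) g.eqv_U[OF e] by simp
qed

lemma h_eqv_lift: "z \<in> f.U \<Longrightarrow> g.eqv (h z) w \<Longrightarrow> \<exists>w'\<in>f.U. h w' = w \<and> f.eqv z w'"
proof -
  assume "z \<in> f.U" "g.eqv (h z) w"
  then have "w \<in> h ` {w. f.eqv z w}" using h_eqv_class by blast
  then show ?thesis using f.eqv_U by blast
qed

lemma h_eqv_iff:
  assumes "z \<in> f.U" "w \<in> f.U"
  shows "g.eqv (h z) (h w) \<longleftrightarrow> f.eqv z w"
proof
  assume "g.eqv (h z) (h w)"
  then obtain w' where "w' \<in> f.U" "h w' = h w" "f.eqv z w'" using h_eqv_lift[OF assms(1)] by blast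
  then show "f.eqv z w" using inj U_S assms(2) by (metis inj_onD subsetD)
qed (use h_eqv_class[OF assms(1)] in blast)

lemma Fn_S: "z \<in> S \<Longrightarrow> (f.F ^^ n) z \<in> S" by (induction n) (auto intro: F_S)

lemma h_Fn: "z \<in> S \<Longrightarrow> h ((f.F ^^ n) z) = (g.F ^^ n) (h z)" by (induction n) (auto simp: h_F Fn_S)

lemma coordinate_ratio:
  assumes V: "x \<in> V_plus \<alpha>f" "x' \<in> V_plus \<alpha>f" "h x \<in> V_plus \<alpha>g" "h x' \<in> V_plus \<alpha>g"
    and u: "f.\<psi> x = 1 / u" "f.\<psi> x' = 1 / u'" and v: "g.\<psi> (h x) = 1 / v" "g.\<psi> (h x') = 1 / v'"
  shows "v' / v \<in> root_group (degree pf) \<Longrightarrow> u' / u \<in> root_group (degree pf)"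
    and "v' = v ^ degree pf \<Longrightarrow> u' / u ^ degree pf \<in> root_group (degree pf)"
proof -
  have U: "x \<in> f.U" "x' \<in> f.U" using V f.V_subset_U by auto
  assume "v' / v \<in> root_group (degree pf)"
  then have "g.eqv (h x) (h x')" using g.eqv_V_iff[OF V(3,4)] root_group_inverse[of "v' / v"] degree_eq by (simp add: v)
  then have "f.\<psi> x' / f.\<psi> x \<in> root_group (degree pf)" using h_eqv_iff[OF U] f.eqv_V_iff[OF V(1,2)] by blast
  from root_group_inverse[OF this] show "u' / u \<in> root_group (degree pf)" by (simp add: u)
next
  have U: "x \<in> f.U" "x' \<in> f.U" "f.F x \<in> f.U" "x \<in> S" using V f.V_subset_U f.U_F U_S by auto
  have FV: "f.F x \<in> V_plus \<alpha>f" "g.F (h x) \<in> V_plus \<alpha>g" using f.F_V g.F_V V by auto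
  assume "v' = v ^ degree pf"
  then have "g.\<psi> (h x') = g.\<psi> (g.F (h x))" using g.psi_F[OF V(3)] degree_eq by (simp add: v power_one_over)
  then have "g.eqv (g.F (h x)) (h x')" using g.eqv_V_iff[OF FV(2) V(4)] g.psi_nonzero[OF FV(2)] by simp
  then have "f.eqv (f.F x) x'" using h_eqv_iff[OF U(3,2)] h_F[OF U(4)] by simp
  then have "f.\<psi> x' / f.\<psi> x ^ degree pf \<in> root_group (degree pf)" using f.eqv_V_iff[OF FV(1) V(2)] f.psi_F[OF V(1)] by simp
  from root_group_inverse[OF this] show "u' / u ^ degree pf \<in> root_group (degree pf)" by (simp add: u power_one_over)
qed

context
  fixes B :: real and C :: complex
  assumes C: "C \<noteq> 0" "C ^ degree pf / C \<in> root_group (degree pf)"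
    and end_points: "\<And>s. cmod s > B \<Longrightarrow> \<exists>x\<in>V_plus \<alpha>f. h x \<in> V_plus \<alpha>g \<and> f.\<psi> x = s \<and> g.\<psi> (h x) = cnj (C * s)"
begin

lemma psi_conjugacy:
  assumes z: "z \<in> V_plus \<alpha>f" "h z \<in> V_plus \<alpha>g"
  shows "g.\<psi> (h z) / cnj (C * f.\<psi> z) \<in> root_group (degree pf)"
proof -
  have zU: "z \<in> f.U" "z \<in> S" using z f.V_subset_U U_S by auto
  obtain n where n: "(f.F ^^ n) z \<in> V_plus \<alpha>f" "cmod (f.\<psi> ((f.F ^^ n) z)) > B"
    using f.eventually_psi_large[OF zU(1), of B] unfolding eventually_sequentially by blast
  obtain x where x: "x \<in> V_plus \<alpha>f" "h x \<in> V_plus \<alpha>g" "f.\<psi> x = f.\<psi> ((f.F ^^ n) z)" "g.\<psi> (h x) = cnj (C * f.\<psi> ((f.F ^^ n) z))"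
    using end_points[OF n(2)] by blast
  have gV: "(g.F ^^ n) (h z) \<in> V_plus \<alpha>g" using g.Fn_V[OF z(2)] by blast
  have "f.eqv ((f.F ^^ n) z) x" using f.eqv_V_iff[OF n(1) x(1)] x(3) f.psi_nonzero[OF n(1)] by simp
  then have "g.eqv ((g.F ^^ n) (h z)) (h x)" using h_eqv_iff[of "(f.F ^^ n) z" x] n(1) x(1) f.V_subset_U h_Fn[OF zU(2)] by auto
  then have r: "cnj (C * f.\<psi> ((f.F ^^ n) z)) / g.\<psi> ((g.F ^^ n) (h z)) \<in> root_group (degree pf)"
    using g.eqv_V_iff[OF gV x(2)] x(4) degree_eq by simp
  let ?D = "degree pf ^ n"
  let ?w = "g.\<psi> (h z) / cnj (C * f.\<psi> z)"
  have nz: "f.\<psi> z \<noteq> 0" "g.\<psi> (h z) \<noteq> 0" using f.psi_nonzero g.psi_nonzero z by auto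
  have "?w ^ ?D = inverse (cnj (C * f.\<psi> ((f.F ^^ n) z)) / g.\<psi> ((g.F ^^ n) (h z))) / cnj (C ^ ?D / C)"
    using nz C(1) by (simp add: f.psi_Fn[OF z(1)] g.psi_Fn[OF z(2)] degree_eq power_divide power_mult_distrib)
  also have "\<dots> \<in> root_group (degree pf)" by (intro root_group_divide root_group_inverse[OF r] root_group_cnj power_divide_self_root_group C)
  finally show ?thesis by (rule root_group_if_power)
qed

lemma h_U_iff:
  assumes z: "z \<in> S"
  shows "h z \<in> g.U \<longleftrightarrow> z \<in> f.U"
proof
  assume "h z \<in> g.U"
  then obtain n where n: "(g.F ^^ n) (h z) \<in> V_plus \<alpha>g" "cmod (g.\<psi> ((g.F ^^ n) (h z))) > B * cmod C"
    using g.eventually_psi_large[of "h z" "B * cmod C"] unfolding eventually_sequentially by blast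
  define s where "s = cnj (g.\<psi> ((g.F ^^ n) (h z))) / C"
  have "cmod s > B" using n(2) C(1) by (simp add: s_def norm_divide field_simps)
  then obtain x where x: "x \<in> V_plus \<alpha>f" "h x \<in> V_plus \<alpha>g" "g.\<psi> (h x) = cnj (C * s)" using end_points by blast
  have "g.\<psi> (h x) = g.\<psi> ((g.F ^^ n) (h z))" using x(3) C(1) by (simp add: s_def)
  then have "g.eqv (h x) ((g.F ^^ n) (h z))" using g.eqv_V_iff[OF x(2) n(1)] g.psi_nonzero[OF n(1)] by simp
  moreover have "x \<in> f.U" using x(1) f.V_subset_U by blast
  ultimately obtain w where "w \<in> f.U" "h w = h ((f.F ^^ n) z)" using h_eqv_lift[of x] unfolding h_Fn[OF z, of n] by blast
  then have "(f.F ^^ n) z \<in> f.U" using inj Fn_S[OF z] U_S by (metis inj_onD subsetD)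
  then show "z \<in> f.U" by (simp add: f.U_Fn)
qed (use h_eqv_class in blast)

end

end

context henon_map
begin

lemma U_minus_P_F: "sw (P.F z) \<in> N.U \<longleftrightarrow> sw z \<in> N.U" using N.U_F[of "sw (P.F z)"] by (simp add: N_F_sw)

lemma U_plus_P_Fi: "P.Fi z \<in> P.U \<longleftrightarrow> z \<in> P.U" using P.U_F[of "P.Fi z"] by simp

lemma multiplier: "- a / \<eta> \<noteq> 0" "cmod (- a / \<eta>) < 1"
proof -
  show "- a / \<eta> \<noteq> 0" using a0 N.eta0 by simp
  have "cmod \<eta> > 1"
  proof (rule ccontr)
    assume "\<not> ?thesis"
    then have "cmod \<eta> ^ (degree p - 1) \<le> 1" by (intro power_le_one) auto
    moreover have "cmod \<eta> ^ (degree p - 1) = 1 / cmod a" using eta by (metis norm_divide norm_one norm_power)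
    moreover have "cmod a * cmod \<eta> ^ (degree p - 1) \<le> cmod a * 1" by (intro mult_left_mono calculation(1)) simp
    ultimately have "1 \<le> cmod a" using a0 by simp
    then show False using a_half by simp
  qed
  moreover from this have "cmod a * 1 \<le> 1 / 2 * cmod \<eta>" using a_half by (intro mult_mono) auto
  ultimately have "cmod a < cmod \<eta>" by linarith
  then show "cmod (- a / \<eta>) < 1" by (simp add: norm_divide divide_less_eq_1)
qed

end

context henon_end
begin

lemma m_holomorphic: "m holomorphic_on ball 0 \<rho>" unfolding m_def[abs_def] by (intro holomorphic_intros G_holomorphic)  (use N.eta0 in auto)

lemma m_local_inverse:
  assumes t: "0 < t" "t \<le> \<rho>"
  obtains q s n where "0 < q" "q \<le> t" "0 < s" "inj_on m (ball 0 q)" "n holomorphic_on ball 0 s" "n 0 = 0"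
    "\<And>w. w \<in> ball 0 s \<Longrightarrow> n w \<in> ball 0 q \<and> m (n w) = w"
proof -
  have h: "m holomorphic_on ball 0 t" by (rule holomorphic_on_subset[OF m_holomorphic]) (use t in auto)
  obtain D where D: "(G has_field_derivative D) (at 0)"
    using G_holomorphic rho(1) holomorphic_on_imp_differentiable_at[OF _ open_ball] unfolding field_differentiable_def by (metis centre_in_ball)
  have "(m has_field_derivative - a / \<eta>) (at 0)" unfolding m_def[abs_def] by (rule derivative_eq_intros D refl)+ (simp add: G_0)
  then have "deriv m 0 \<noteq> 0" using multiplier(1) by (simp add: DERIV_imp_deriv)
  moreover have "m 0 = 0" by (simp add: m_def)
  ultimately show ?thesis using local_inverse_at_0[OF h t(1)] that by metis
qed

end

locale henon_conjugacy =
  f: henon_map pf af \<eta>f Rf rf \<alpha>f + g: henon_map pg ag \<eta>g Rg rg \<alpha>g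
  for pf af \<eta>f Rf rf \<alpha>f pg ag \<eta>g Rg rg \<alpha>g +
  fixes h k :: "complex \<times> complex \<Rightarrow> complex \<times> complex"
  assumes degree_eq: "degree pg = degree pf"
    and homeo: "homeomorphism (U_plus pf af \<union> U_minus pf af) (U_plus pg ag \<union> U_minus pg ag) h k"
    and h_henon: "\<And>z. z \<in> U_plus pf af \<union> U_minus pf af \<Longrightarrow> h (henon pf af z) = henon pg ag (h z)"
begin

abbreviation "sw \<equiv> prod.swap :: complex \<times> complex \<Rightarrow> complex \<times> complex"
abbreviation "Uf \<equiv> U_plus pf af \<union> U_minus pf af"
abbreviation "Ug \<equiv> U_plus pg ag \<union> U_minus pg ag"

lemma k_h: "z \<in> Uf \<Longrightarrow> k (h z) = z" and inj_h: "inj_on h Uf"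
  and h_k: "w \<in> Ug \<Longrightarrow> h (k w) = w" and k_Ug: "w \<in> Ug \<Longrightarrow> k w \<in> Uf" using homeo by (auto simp: homeomorphism_def intro: inj_on_inverseI)

lemma Uf_F: "z \<in> Uf \<Longrightarrow> f.P.F z \<in> Uf" "z \<in> Uf \<Longrightarrow> f.P.Fi z \<in> Uf"
proof -
  show "z \<in> Uf \<Longrightarrow> f.P.F z \<in> Uf" for z by (auto simp: f.U_plus_eq f.U_minus_iff f.P.U_F f.U_minus_P_F)
  have "sw (f.P.Fi z) \<in> f.N.U \<longleftrightarrow> sw z \<in> f.N.U" for z using f.U_minus_P_F[of "f.P.Fi z"] by simp
  then show "z \<in> Uf \<Longrightarrow> f.P.Fi z \<in> Uf" by (auto simp: f.U_plus_eq f.U_minus_iff f.U_plus_P_Fi)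
qed

lemma h_F: "z \<in> Uf \<Longrightarrow> h (f.P.F z) = g.P.F (h z)" using h_henon by (simp add: f.henon_eq g.henon_eq)

lemma h_Fi: "z \<in> Uf \<Longrightarrow> h (f.P.Fi z) = g.P.Fi (h z)" using h_F[OF Uf_F(2)[of z]] by simp

lemma h_Fn: "z \<in> Uf \<Longrightarrow> (f.P.F ^^ n) z \<in> Uf \<and> h ((f.P.F ^^ n) z) = (g.P.F ^^ n) (h z)" by (induction n) (auto simp: h_F Uf_F simp del: Un_iff)

lemma h_Fin: "z \<in> Uf \<Longrightarrow> (f.P.Fi ^^ n) z \<in> Uf \<and> h ((f.P.Fi ^^ n) z) = (g.P.Fi ^^ n) (h z)"
  by (induction n) (auto simp: h_Fi Uf_F simp del: Un_iff)

end

locale end_conjugacy =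
  f: henon_end pf af \<eta>f Rf rf \<alpha>f cf Hf \<rho>f \<Gamma>f Gf + g: henon_end pg ag \<eta>g Rg rg \<alpha>g cg Hg \<rho>g \<Gamma>g Gg +
  henon_conjugacy pf af \<eta>f Rf rf \<alpha>f pg ag \<eta>g Rg rg \<alpha>g h k
  for pf af \<eta>f Rf rf \<alpha>f cf Hf \<rho>f \<Gamma>f Gf pg ag \<eta>g Rg rg \<alpha>g cg Hg \<rho>g \<Gamma>g Gg h k +
  assumes h_leaves: "\<And>L. L \<in> leaves_plus pf af \<alpha>f \<Longrightarrow> h ` L \<in> leaves_plus pg ag \<alpha>g"
      "\<And>L. L \<in> leaves_minus pf af \<alpha>f \<Longrightarrow> h ` L \<in> leaves_minus pg ag \<alpha>g"
    and orientation: "orientation_reversing h Hf Hg"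
    and puncture: "\<exists>N0. puncture_nhd Hf cf N0 \<and>
          (\<forall>N \<subseteq> N0. puncture_nhd Hf cf N \<longrightarrow> puncture_nhd Hg cg (h ` N))"
begin

lemma side_plus: "side_conjugacy pf af 1 1 Rf rf \<alpha>f pg ag 1 1 Rg rg \<alpha>g h Uf"
proof (intro side_conjugacy.intro side_conjugacy_axioms.intro f.P.bott_axioms g.P.bott_axioms degree_eq inj_h Uf_F h_F)
  show "f.P.U \<subseteq> Uf" by (simp add: f.U_plus_eq)
  fix z assume "z \<in> f.P.U"
  then have "{w. f.P.eqv z w} \<in> leaves_plus pf af \<alpha>f" by (auto simp: f.leaves_plus_eq)
  from h_leaves(1)[OF this] show "\<exists>z'\<in>g.P.U. h ` {w. f.P.eqv z w} = {w. g.P.eqv z' w}" by (auto simp: g.leaves_plus_eq)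
qed

lemma side_minus:
  "side_conjugacy pf 1 af \<eta>f Rf rf \<alpha>f pg 1 ag \<eta>g Rg rg \<alpha>g (\<lambda>z. prod.swap (h (prod.swap z))) {z. prod.swap z \<in> Uf}"
proof (intro side_conjugacy.intro side_conjugacy_axioms.intro f.N.bott_axioms g.N.bott_axioms degree_eq)
  show "f.N.U \<subseteq> {z. sw z \<in> Uf}" by (auto simp: f.U_minus_iff)
  have sF: "sw (f.N.F z) = f.P.Fi (sw z)" for z using f.N_F_sw[of "sw z"] by simp
  show "f.N.F z \<in> {z. sw z \<in> Uf}" if "z \<in> {z. sw z \<in> Uf}" for z using Uf_F(2) that unfolding mem_Collect_eq sF by blast
  show "inj_on (\<lambda>z. sw (h (sw z))) {z. sw z \<in> Uf}"
  proof (rule inj_onI)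
    fix x y assume xy: "x \<in> {z. sw z \<in> Uf}" "y \<in> {z. sw z \<in> Uf}" "sw (h (sw x)) = sw (h (sw y))"
    then have "h (sw x) = h (sw y)" by (metis swap_swap)
    then have "sw x = sw y" using inj_onD[OF inj_h] xy(1,2) by blast
    then show "x = y" by (metis swap_swap)
  qed
  show "sw (h (sw (f.N.F z))) = g.N.F (sw (h (sw z)))" if "z \<in> {z. sw z \<in> Uf}" for z
    using h_Fi[of "sw z"] that unfolding sF g.N_F_sw by simp
  fix z assume z: "z \<in> f.N.U"
  then have "{w. f.N.eqv z (sw w)} \<in> leaves_minus pf af \<alpha>f"
    unfolding f.leaves_minus_eq by (intro image_eqI[of _ _ "sw z"]) (auto simp: f.U_minus_iff)
  from h_leaves(2)[OF this] obtain z' where z': "sw z' \<in> g.N.U" "h ` {w. f.N.eqv z (sw w)} = {w. g.N.eqv (sw z') (sw w)}"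
    by (auto simp: g.leaves_minus_eq g.U_minus_iff)
  have "(\<lambda>z. sw (h (sw z))) ` {w. f.N.eqv z w} = sw ` (h ` {w. f.N.eqv z (sw w)})"
  proof -
    have e: "sw ` {w. f.N.eqv z w} = {w. f.N.eqv z (sw w)}" by (simp add: f.sw_image)
    show ?thesis unfolding e[symmetric] by (simp add: image_image)
  qed
  also have "\<dots> = {w. g.N.eqv (sw z') w}" unfolding z'(2) g.sw_image by simp
  finally show "\<exists>z'\<in>g.N.U. (\<lambda>z. sw (h (sw z))) ` {w. f.N.eqv z w} = {w. g.N.eqv z' w}" using z'(1) by blast
qed

sublocale SP: side_conjugacy pf af 1 1 Rf rf \<alpha>f pg ag 1 1 Rg rg \<alpha>g h Uf by (rule side_plus)

sublocale SN: side_conjugacy pf 1 af \<eta>f Rf rf \<alpha>f pg 1 ag \<eta>g Rg rg \<alpha>g "\<lambda>z. prod.swap (h (prod.swap z))" "{z. prod.swap z \<in> Uf}"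
  by (rule side_minus)

lemma Gamma_Uf: "u \<in> f.disc \<Longrightarrow> \<Gamma>f u \<in> Uf" using f.Gamma_D(3) by (simp add: f.U_plus_eq)

lemma Gamma_Ug: "v \<in> g.disc \<Longrightarrow> \<Gamma>g v \<in> Ug" using g.Gamma_D(3) by (simp add: g.U_plus_eq)

lemma Gamma_pullback:
  assumes t: "0 < t" "t \<le> \<rho>f"
  obtains t' where "0 < t'" "t' \<le> \<rho>g" "\<And>v. v \<in> pdisc t' \<Longrightarrow> \<exists>u\<in>pdisc t. h (\<Gamma>f u) = \<Gamma>g v"
proof -
  obtain N0 where N0: "puncture_nhd Hf cf N0" "\<And>N. N \<subseteq> N0 \<Longrightarrow> puncture_nhd Hf cf N \<Longrightarrow> puncture_nhd Hg cg (h ` N)" using puncture by blast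
  define N where "N = \<Gamma>f ` (pdisc t) \<inter> N0"
  have "\<forall>\<^sub>F z in puncture_filter Hf cf. z \<in> \<Gamma>f ` (pdisc t)" unfolding f.puncture_filter_iff using t by blast
  moreover have "\<forall>\<^sub>F z in puncture_filter Hf cf. z \<in> N0" using N0(1) by (simp add: puncture_nhd_def)
  ultimately have "\<forall>\<^sub>F z in puncture_filter Hf cf. z \<in> N" by eventually_elim (simp add: N_def)
  then have "puncture_nhd Hf cf N" using N0(1) by (auto simp: puncture_nhd_def N_def)
  then have "puncture_nhd Hg cg (h ` N)" by (intro N0(2)) (auto simp: N_def)
  then obtain t' where t': "0 < t'" "t' \<le> \<rho>g" "\<And>v. v \<in> pdisc t' \<Longrightarrow> \<Gamma>g v \<in> h ` N" unfolding puncture_nhd_def g.puncture_filter_iff by blast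
  show ?thesis
  proof (rule that[OF t'(1,2)])
    fix v :: complex assume "v \<in> pdisc t'"
    from t'(3)[OF this] show "\<exists>u\<in>pdisc t. h (\<Gamma>f u) = \<Gamma>g v" by (auto simp: N_def)
  qed
qed

text \<open>A holomorphic coordinate change between the two ends would have local degree \<open>1\<close>.\<close>
lemma not_linear_end:
  assumes r: "0 < r" "r \<le> \<rho>g" and C: "C \<noteq> 0"
    and eq: "\<And>v. v \<in> pdisc r \<Longrightarrow> C * v \<in> f.disc \<and> h (\<Gamma>f (C * v)) = \<Gamma>g v"
  shows False
proof -
  define v0 where "v0 = complex_of_real (r / 2)"
  define E where "E = ball v0 (r / 4)"
  have nv0: "cmod v0 = r / 2" using r by (simp add: v0_def)
  have Er: "E \<subseteq> pdisc r"
  proof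
    fix v assume "v \<in> E"
    then have v: "cmod (v - v0) < r / 4" by (simp add: E_def dist_norm norm_minus_commute)
    have "cmod v \<le> cmod v0 + cmod (v - v0)" "cmod v0 \<le> cmod v + cmod (v - v0)"
      using norm_triangle_ineq[of v0 "v - v0"] norm_triangle_ineq4[of v "v - v0"] by simp_all
    then have "cmod v < r" "cmod v > 0" using v nv0 r by linarith+
    then show "v \<in> pdisc r" by simp
  qed
  then have Eg: "E \<subseteq> g.disc" using r by auto
  have oE: "open E" by (simp add: E_def)
  define \<sigma> where "\<sigma> = (\<lambda>v. \<Gamma>f (C * v))"
  have CE: "(*) C ` E \<subseteq> f.disc"
  proof (rule image_subsetI)
    show "C * v \<in> f.disc" if "v \<in> E" for v using eq[of v] Er that by blast
  qed
  have "(*) C ` E = (\<lambda>v. v / C) -` E" using C by (auto simp: image_iff) (metis nonzero_mult_div_cancel_left times_divide_eq_right)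
  then have oCE: "open ((*) C ` E)" using C by (simp add: open_vimage[OF oE] continuous_intros)
  have hol: "(\<lambda>v. fst (\<Gamma>f (C * v))) holomorphic_on E" "(\<lambda>v. snd (\<Gamma>f (C * v))) holomorphic_on E"
    using holomorphic_on_compose_gen[OF _ f.Gamma_holomorphic(1) CE] holomorphic_on_compose_gen[OF _ f.Gamma_holomorphic(2) CE]
    by (auto simp: o_def intro!: holomorphic_intros)
  have cpf: "curve_param Hf E \<sigma>" unfolding curve_param_def
  proof (intro conjI oE)
    show "(fst \<circ> \<sigma>) holomorphic_on E" "(snd \<circ> \<sigma>) holomorphic_on E" using hol by (simp_all add: \<sigma>_def o_def)
    have im: "\<sigma> ` E = \<Gamma>f ` (*) C ` E" by (auto simp: \<sigma>_def)
    show "openin (top_of_set Hf) (\<sigma> ` E)" unfolding im by (rule f.open_Gamma_image[OF oCE CE])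
    have "homeomorphism E ((*) C ` E) ((*) C) (\<lambda>v. v / C)" by (rule homeomorphismI) (use C in \<open>auto intro!: continuous_intros\<close>)
    then have "homeomorphism E (\<Gamma>f ` (*) C ` E) (\<Gamma>f \<circ> (*) C) ((\<lambda>v. v / C) \<circ> (\<lambda>z. 1 / f.P.\<psi> z))"
      using f.open_Gamma_image(2)[OF oCE CE] by (rule homeomorphism_compose)
    moreover have "\<Gamma>f \<circ> (*) C = \<sigma>" by (auto simp: \<sigma>_def)
    ultimately show "\<exists>\<kappa>. homeomorphism E (\<sigma> ` E) \<sigma> \<kappa>" unfolding im by metis
  qed
  have cpg: "curve_param Hg E \<Gamma>g" unfolding curve_param_def
  proof (intro conjI oE)
    show "(fst \<circ> \<Gamma>g) holomorphic_on E" "(snd \<circ> \<Gamma>g) holomorphic_on E"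
      using holomorphic_on_subset[OF g.Gamma_holomorphic(1) Eg] holomorphic_on_subset[OF g.Gamma_holomorphic(2) Eg] by (simp_all add: o_def)
    show "openin (top_of_set Hg) (\<Gamma>g ` E)" by (rule g.open_Gamma_image[OF oE Eg])
    show "\<exists>\<kappa>. homeomorphism E (\<Gamma>g ` E) \<Gamma>g \<kappa>" using g.open_Gamma_image(2)[OF oE Eg] by blast
  qed
  have h\<sigma>: "h (\<sigma> v) = \<Gamma>g v" if "v \<in> E" for v
  proof -
    have "v \<in> pdisc r" using Er that by blast
    then show ?thesis using eq[of v] unfolding \<sigma>_def by blast
  qed
  have inj: "inj_on \<Gamma>g E" using g.Gamma_inj Eg unfolding inj_on_def by blast
  have id: "inv_into E \<Gamma>g (h (\<sigma> v)) = v" if "v \<in> E" for v using h\<sigma>[OF that] inj that by simp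
  have cb: "cball v0 (r / 8) \<subseteq> E" using r by (auto simp: E_def)
  have "h ` \<sigma> ` E \<subseteq> \<Gamma>g ` E" using h\<sigma> by auto
  then have "winding_number ((inv_into E \<Gamma>g \<circ> h \<circ> \<sigma>) \<circ> circlepath v0 (r / 8)) ((inv_into E \<Gamma>g \<circ> h \<circ> \<sigma>) v0) = -1"
    using orientation cpf cpg cb r unfolding orientation_reversing_def by auto
  moreover have "(inv_into E \<Gamma>g \<circ> h \<circ> \<sigma>) \<circ> circlepath v0 (r / 8) = circlepath v0 (r / 8)"
  proof
    fix x :: real
    have "circlepath v0 (r / 8) x \<in> cball v0 (r / 8)" using r by (simp add: circlepath dist_norm norm_mult)
    then show "((inv_into E \<Gamma>g \<circ> h \<circ> \<sigma>) \<circ> circlepath v0 (r / 8)) x = circlepath v0 (r / 8) x" using id cb by auto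
  qed
  moreover have "(inv_into E \<Gamma>g \<circ> h \<circ> \<sigma>) v0 = v0" using id[of v0] r by (simp add: E_def)
  moreover have "winding_number (circlepath v0 (r / 8)) v0 = 1" using r by (intro winding_number_circlepath_centre) simp
  ultimately show False by simp
qed

end


context end_conjugacy
begin

lemma rigid_end:
  obtains C D :: complex and q :: real
  where "C \<noteq> 0" "D \<noteq> 0" "0 < q" "C ^ degree pf / C \<in> root_group (degree pf)" "D ^ degree pf / D \<in> root_group (degree pf)"
    "\<And>v. v \<in> pdisc q \<Longrightarrow> v \<in> g.disc \<and> C * cnj v \<in> f.disc \<and> h (\<Gamma>f (C * cnj v)) = \<Gamma>g v \<and> f.m (C * cnj v) = D * cnj (g.m v)"
proof -
  let ?d = "degree pf"
  obtain rf' where mf: "0 < rf'" "rf' \<le> \<rho>f" "inj_on f.m (ball 0 rf')" by (rule f.m_local_inverse[OF f.rho(1) order_refl]) (rule that)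
  obtain t1 where t1: "0 < t1" "t1 \<le> \<rho>g" "\<And>v. v \<in> pdisc t1 \<Longrightarrow> \<exists>u\<in>pdisc rf'. h (\<Gamma>f u) = \<Gamma>g v" using Gamma_pullback[OF mf(1,2)] by blast
  obtain rg' sg' ng where mg: "0 < rg'" "rg' \<le> t1" "0 < sg'" "inj_on g.m (ball 0 rg')" "ng holomorphic_on ball 0 sg'" "ng 0 = 0"
    "\<And>w. w \<in> ball 0 sg' \<Longrightarrow> ng w \<in> ball 0 rg' \<and> g.m (ng w) = w" by (rule g.m_local_inverse[OF t1(1,2)]) (rule that)
  define q0 where "q0 = min rg' sg'"
  have q0: "0 < q0" "q0 \<le> 1" "q0 \<le> \<rho>g" "q0 \<le> t1" "q0 \<le> rg'" "q0 \<le> sg'" using mg t1 g.rho by (auto simp: q0_def)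
  define kk where "kk = (\<lambda>v. 1 / f.P.\<psi> (k (\<Gamma>g v)))"
  define ll where "ll = (\<lambda>w. f.m (kk (ng w)))"
  have kk_eq: "kk v = u" if "u \<in> f.disc" "h (\<Gamma>f u) = \<Gamma>g v" for u v
  proof -
    have "k (\<Gamma>g v) = \<Gamma>f u" using k_h[OF Gamma_Uf[OF that(1)]] that(2) by simp
    then show ?thesis using f.Gamma_D(5)[OF that(1)] by (simp add: kk_def)
  qed
  have kk: "kk v \<in> pdisc rf'" "kk v \<in> f.disc" "h (\<Gamma>f (kk v)) = \<Gamma>g v" "v \<in> g.disc" if v: "v \<in> pdisc t1" for v :: complex
  proof -
    obtain u where u: "u \<in> pdisc rf'" "h (\<Gamma>f u) = \<Gamma>g v" using t1(3)[OF v] by blast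
    have ud: "u \<in> f.disc" using u(1) mf(2) by auto
    then show "kk v \<in> pdisc rf'" "kk v \<in> f.disc" "h (\<Gamma>f (kk v)) = \<Gamma>g v" using kk_eq[OF ud u(2)] u by auto
    show "v \<in> g.disc" using v t1(2) by auto
  qed
  have ng0: "ng w \<in> pdisc rg'" "g.m (ng w) = w" "ng w \<in> pdisc t1" if "w \<in> pdisc q0" for w :: complex
  proof -
    have "w \<in> ball 0 sg'" using that q0(6) by auto
    then have 1: "ng w \<in> ball 0 rg'" "g.m (ng w) = w" using mg(7) by blast+
    have "g.m 0 = 0" by (simp add: g.m_def)
    then have "ng w \<noteq> 0" using 1(2) that by auto
    then show "ng w \<in> pdisc rg'" "g.m (ng w) = w" "ng w \<in> pdisc t1" using 1 mg(2) by auto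
  qed
  have sub: "v \<in> pdisc t1" if "v \<in> pdisc q0" for v :: complex using that q0 by auto
  have kk_cont: "continuous_on (pdisc t1) kk"
  proof -
    have c1: "continuous_on (pdisc t1) \<Gamma>g" using continuous_on_subset[OF g.continuous_Gamma] kk(4) by blast
    have c2: "continuous_on Ug k" using homeo by (simp add: homeomorphism_def)
    have i1: "\<Gamma>g ` (pdisc t1) \<subseteq> Ug" using Gamma_Ug kk(4) by blast
    have c3: "continuous_on (pdisc t1) (\<lambda>v. k (\<Gamma>g v))" using continuous_on_compose2[OF c2 c1 i1] .
    have kG: "k (\<Gamma>g v) = \<Gamma>f (kk v)" if "v \<in> pdisc t1" for v :: complex using k_h[OF Gamma_Uf[OF kk(2)[OF that]]] kk(3)[OF that] by simp
    have kV: "k (\<Gamma>g v) \<in> f.V" if "v \<in> pdisc t1" for v :: complex unfolding kG[OF that] by (rule f.Gamma_D(1)[OF kk(2)[OF that]])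
    have c4: "continuous_on (pdisc t1) (\<lambda>v. f.P.\<psi> (k (\<Gamma>g v)))"
      by (rule continuous_on_compose2[OF holomorphic2_on_imp_continuous_on[OF f.P.holomorphic2_psi] c3]) (use kV in blast)
    show ?thesis unfolding kk_def by (intro continuous_intros c4 ballI) (rule f.P.psi_nonzero[OF kV])
  qed
  have kk_inj: "v = w" if "v \<in> pdisc t1" "w \<in> pdisc t1" "kk v = kk w" for v w
    using kk(3)[OF that(1)] kk(3)[OF that(2)] that(3) g.Gamma_inj[OF kk(4)[OF that(1)] kk(4)[OF that(2)]] by simp
  have rootn: "0 < ?d" by (rule f.P.d_pos(3))
  have rot_ball: "\<omega> * v \<in> pdisc q0" if "v \<in> pdisc q0" "\<omega> \<in> root_group ?d" for \<omega> v :: complex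
  proof -
    have "cmod \<omega> = 1" by (rule root_group_norm[OF rootn that(2)])
    then show ?thesis using that(1) by (auto simp: norm_mult)
  qed
  have pow_ball: "v ^ ?d \<in> pdisc q0" if "v \<in> pdisc q0" for v :: complex
  proof -
    have "cmod v ^ ?d \<le> cmod v ^ 1" using that q0(2) rootn by (intro power_decreasing) auto
    then show ?thesis using that by (auto simp: norm_power)
  qed
  have P_ratio: "v / w \<in> root_group ?d \<Longrightarrow> kk v / kk w \<in> root_group ?d" "v = w ^ ?d \<Longrightarrow> kk v / kk w ^ ?d \<in> root_group ?d"
    if vw: "v \<in> pdisc q0" "w \<in> pdisc q0" for v w :: complex
  proof -
    note v = kk(2-4)[OF sub[OF vw(1)]] and w = kk(2-4)[OF sub[OF vw(2)]]
    show "v / w \<in> root_group ?d \<Longrightarrow> kk v / kk w \<in> root_group ?d" "v = w ^ ?d \<Longrightarrow> kk v / kk w ^ ?d \<in> root_group ?d"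
      using SP.coordinate_ratio[of "\<Gamma>f (kk w)" "\<Gamma>f (kk v)" "kk w" "kk v" w v, unfolded v(2) w(2)]
        f.Gamma_D[OF v(1)] f.Gamma_D[OF w(1)] g.Gamma_D[OF v(3)] g.Gamma_D[OF w(3)] by blast+
  qed
  have hF: "prod.swap (h (prod.swap (f.N.F (sw z)))) = g.N.F (sw (h z))" if "z \<in> Uf" for z using SN.h_F[of "sw z"] that by simp
  have Nside: "f.N.F (sw (\<Gamma>f (kk v))) \<in> f.V" "prod.swap (h (prod.swap (f.N.F (sw (\<Gamma>f (kk v)))))) = g.N.F (sw (\<Gamma>g v))"
    "g.N.F (sw (\<Gamma>g v)) \<in> g.V" "f.N.\<psi> (f.N.F (sw (\<Gamma>f (kk v)))) = 1 / f.m (kk v)" "g.N.\<psi> (g.N.F (sw (\<Gamma>g v))) = 1 / g.m v"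
    if "v \<in> pdisc t1" for v :: complex
  proof -
    note v = kk(2-4)[OF that]
    show "prod.swap (h (prod.swap (f.N.F (sw (\<Gamma>f (kk v)))))) = g.N.F (sw (\<Gamma>g v))" using hF[OF Gamma_Uf[OF v(1)]] v(2) by simp
  qed (use f.Gamma_D[OF kk(2)[OF that]] g.Gamma_D[OF kk(4)[OF that]] in auto)
  have N_ratio: "v / w \<in> root_group ?d \<Longrightarrow> ll v / ll w \<in> root_group ?d" "v = w ^ ?d \<Longrightarrow> ll v / ll w ^ ?d \<in> root_group ?d"
    if vw: "v \<in> pdisc q0" "w \<in> pdisc q0" for v w :: complex
  proof -
    note v = Nside[OF ng0(3)[OF vw(1)]] ng0(2)[OF vw(1)] and w = Nside[OF ng0(3)[OF vw(2)]] ng0(2)[OF vw(2)]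
    show "v / w \<in> root_group ?d \<Longrightarrow> ll v / ll w \<in> root_group ?d" "v = w ^ ?d \<Longrightarrow> ll v / ll w ^ ?d \<in> root_group ?d"
      using SN.coordinate_ratio[of "f.N.F (sw (\<Gamma>f (kk (ng w))))" "f.N.F (sw (\<Gamma>f (kk (ng v))))" "ll w" "ll v" w v, unfolded v(2) w(2)]
        v w unfolding ll_def by metis+
  qed
  have ll_nz: "ll w \<noteq> 0" if "w \<in> pdisc q0" for w :: complex unfolding ll_def using f.m_nonzero kk(1)[OF ng0(3)[OF that]] by simp
  have "(kk \<longlongrightarrow> 0) (at 0)"
  proof (rule tendstoI)
    fix e :: real assume e: "e > 0"
    obtain t' where t': "0 < t'" "\<And>v. v \<in> pdisc t' \<Longrightarrow> \<exists>u\<in>pdisc (min e \<rho>f). h (\<Gamma>f u) = \<Gamma>g v"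
    proof (rule Gamma_pullback[of "min e \<rho>f"])
      show "0 < min e \<rho>f" "min e \<rho>f \<le> \<rho>f" using e f.rho(1) by auto
    qed (rule that)
    have "\<forall>\<^sub>F v in at (0::complex). v \<in> pdisc t'" using t'(1) by (intro eventually_at_in_open) auto
    then show "\<forall>\<^sub>F v in at 0. dist (kk v) 0 < e"
    proof eventually_elim
      case (elim v)
      obtain u where u: "u \<in> pdisc (min e \<rho>f)" "h (\<Gamma>f u) = \<Gamma>g v" using t'(2)[OF elim] by blast
      have "kk v = u" using u(1) by (intro kk_eq u(2)) auto
      then show ?case using u(1) by simp
    qed
  qed
  have rel: "\<forall>\<^sub>F v in at 0. ll (- ag / \<eta>g * v * exp (Gg v)) = - af / \<eta>f * kk v * exp (Gf (kk v))"
  proof -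
    have "isCont g.m 0" using holomorphic_on_imp_continuous_on[OF g.m_holomorphic] g.rho by (auto simp: continuous_on_eq_continuous_at)
    then have "(g.m \<longlongrightarrow> 0) (at 0)" by (simp add: isCont_def g.m_def)
    then have "\<forall>\<^sub>F v in at 0. dist (g.m v) 0 < sg'" using mg(3) by (rule tendstoD)
    moreover have "\<forall>\<^sub>F v in at 0. v \<in> pdisc rg'" using mg(1) by (intro eventually_at_in_open) auto
    ultimately show ?thesis
    proof eventually_elim
      case (elim v)
      then have 1: "g.m v \<in> ball 0 sg'" by (simp add: dist_commute)
      have "ng (g.m v) = v" using mg(4) mg(7)[OF 1] elim(2) by (auto dest: inj_onD)
      then have "ll (g.m v) = f.m (kk v)" by (simp add: ll_def)
      then show ?case by (simp add: g.m_def f.m_def)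
    qed
  qed
  have ll_cont: "continuous_on (pdisc q0) ll"
  proof -
    have c1: "continuous_on (pdisc q0) ng" by (rule continuous_on_subset[OF holomorphic_on_imp_continuous_on[OF mg(5)]]) (use q0 in auto)
    have c2: "continuous_on (pdisc q0) (\<lambda>w. kk (ng w))" by (rule continuous_on_compose2[OF kk_cont c1]) (rule image_subsetI, rule ng0(3))
    show ?thesis unfolding ll_def
    proof (rule continuous_on_compose2[OF holomorphic_on_imp_continuous_on[OF f.m_holomorphic] c2])
      show "(\<lambda>w. kk (ng w)) ` (pdisc q0) \<subseteq> ball 0 \<rho>f" using kk(2) ng0(3) by blast
    qed
  qed
  have ll_inj: "inj_on ll (pdisc q0)"
  proof (rule inj_onI)
    fix v w assume v: "v \<in> pdisc q0" and w: "w \<in> pdisc q0" and eq: "ll v = ll w"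
    have "kk (ng v) = kk (ng w)" using inj_onD[OF mf(3) eq[unfolded ll_def]] kk(1)[OF ng0(3)[OF v]] kk(1)[OF ng0(3)[OF w]] by blast
    then have "ng v = ng w" by (rule kk_inj[OF ng0(3)[OF v] ng0(3)[OF w]])
    then show "v = w" using ng0(2)[OF v] ng0(2)[OF w] by metis
  qed
  obtain C D where CD: "C \<noteq> 0" "D \<noteq> 0"
    "(\<forall>v \<in> pdisc q0. kk v = C * v \<and> ll v = D * v) \<or> (\<forall>v \<in> pdisc q0. kk v = C * cnj v \<and> ll v = D * cnj v)"
  proof (rule two_coordinate_rigidity[of ?d q0 kk ll Gg Gf \<rho>f "- ag / \<eta>g" "- af / \<eta>f"])
    show "continuous_on (pdisc q0) kk" by (rule continuous_on_subset[OF kk_cont]) (use sub in blast)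
    show "inj_on kk (pdisc q0)" by (rule inj_onI) (rule kk_inj[OF sub sub])
    show "kk v \<noteq> 0" if "v \<in> pdisc q0" for v :: complex using kk(1)[OF sub[OF that]] by simp
    show "kk (\<omega> * v) / kk v \<in> root_group ?d" if "v \<in> pdisc q0" "\<omega> \<in> root_group ?d" for v \<omega>
      using P_ratio(1)[OF rot_ball[OF that] that(1)] that by simp
    show "kk (v ^ ?d) / kk v ^ ?d \<in> root_group ?d" if "v \<in> pdisc q0" for v :: complex using P_ratio(2)[OF pow_ball[OF that] that refl] .
    show "ll (\<omega> * v) / ll v \<in> root_group ?d" if "v \<in> pdisc q0" "\<omega> \<in> root_group ?d" for v \<omega>
      using N_ratio(1)[OF rot_ball[OF that] that(1)] that by simp
    show "ll (v ^ ?d) / ll v ^ ?d \<in> root_group ?d" if "v \<in> pdisc q0" for v :: complex using N_ratio(2)[OF pow_ball[OF that] that refl] .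
    show "Gg holomorphic_on ball 0 q0" by (rule holomorphic_on_subset[OF g.G_holomorphic]) (use q0 in auto)
  qed (use f.deg q0 ll_cont ll_inj ll_nz \<open>(kk \<longlongrightarrow> 0) (at 0)\<close> g.G_0 f.G_holomorphic f.G_0 f.rho g.multiplier f.multiplier rel g.G_nontrivial in blast)+
  have not_lin: "\<not> (\<forall>v \<in> pdisc q0. kk v = C * v \<and> ll v = D * v)"
  proof
    assume lin: "\<forall>v \<in> pdisc q0. kk v = C * v \<and> ll v = D * v"
    show False
    proof (rule not_linear_end[OF q0(1,3) CD(1)])
      fix v :: complex assume v: "v \<in> pdisc q0"
      have "kk v = C * v" using lin v by blast
      then show "C * v \<in> f.disc \<and> h (\<Gamma>f (C * v)) = \<Gamma>g v" using kk(2,3)[OF sub[OF v]] by simp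
    qed
  qed
  then have conjk: "kk v = C * cnj v" "ll v = D * cnj v" if "v \<in> pdisc q0" for v :: complex using CD(3) that by blast+
  have half: "complex_of_real (q0 / 2) \<in> pdisc q0" using q0(1) by simp
  have CC: "X ^ ?d / X \<in> root_group ?d" if "X \<noteq> 0" "x \<noteq> 0" "X * cnj (x ^ ?d) / (X * cnj x) ^ ?d \<in> root_group ?d" for X x :: complex
  proof -
    have "inverse (X * cnj (x ^ ?d) / (X * cnj x) ^ ?d) = X ^ ?d / X" using that by (simp add: power_mult_distrib)
    then show ?thesis using root_group_inverse[OF that(3)] by simp
  qed
  have Croot: "C ^ ?d / C \<in> root_group ?d"
  proof (rule CC[OF CD(1)])
    show "complex_of_real (q0 / 2) \<noteq> 0" using half by simp
    show "C * cnj (complex_of_real (q0 / 2) ^ ?d) / (C * cnj (complex_of_real (q0 / 2))) ^ ?d \<in> root_group ?d"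
      using P_ratio(2)[OF pow_ball[OF half] half refl] unfolding conjk(1)[OF half] conjk(1)[OF pow_ball[OF half]] .
  qed
  have Droot: "D ^ ?d / D \<in> root_group ?d"
  proof (rule CC[OF CD(2)])
    show "complex_of_real (q0 / 2) \<noteq> 0" using half by simp
    show "D * cnj (complex_of_real (q0 / 2) ^ ?d) / (D * cnj (complex_of_real (q0 / 2))) ^ ?d \<in> root_group ?d"
      using N_ratio(2)[OF pow_ball[OF half] half refl] unfolding conjk(2)[OF half] conjk(2)[OF pow_ball[OF half]] .
  qed
  have "isCont g.m 0" using holomorphic_on_imp_continuous_on[OF g.m_holomorphic] g.rho by (auto simp: continuous_on_eq_continuous_at)
  moreover have gm0: "g.m 0 = 0" by (simp add: g.m_def)
  ultimately obtain e where e: "e > 0" "\<And>v. cmod v < e \<Longrightarrow> cmod (g.m v) < q0"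
    using q0(1) unfolding continuous_at_eps_delta by (auto simp: dist_norm)
  define q where "q = min e q0"
  show ?thesis
  proof (rule that[OF CD(1,2) _ Croot Droot, of q])
    show "0 < q" using e q0 by (simp add: q_def)
    fix v :: complex assume v: "v \<in> pdisc q"
    have v0: "v \<in> pdisc q0" using v by (auto simp: q_def)
    have mv: "g.m v \<in> pdisc q0" using e(2)[of v] v g.m_nonzero by (auto simp: q_def)
    have ms: "g.m v \<in> ball 0 sg'" using mv q0 by auto
    have "ng (g.m v) = v" using mg(4) mg(7)[OF ms] v0 q0 by (auto dest: inj_onD)
    then have "f.m (kk v) = D * cnj (g.m v)" using conjk(2)[OF mv] by (simp add: ll_def)
    then show "v \<in> g.disc \<and> C * cnj v \<in> f.disc \<and> h (\<Gamma>f (C * cnj v)) = \<Gamma>g v \<and> f.m (C * cnj v) = D * cnj (g.m v)"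
      using kk(2-4)[OF sub[OF v0]] conjk(1)[OF v0] by simp
  qed
qed

end


lemma conj2_conj2 [simp]: "conj2 (conj2 z) = z" by (simp add: conj2_def)

lemma conj2_image: "conj2 ` S = {z. conj2 z \<in> S}" by (force simp: image_iff)

lemma continuous_on_conj2: "continuous_on S conj2" unfolding conj2_def[abs_def] by (intro continuous_intros)

lemma open_conj2_image: "open S \<Longrightarrow> open (conj2 ` S)"
  unfolding conj2_image using open_vimage[OF _ continuous_on_conj2] by (simp add: vimage_def)

lemma holomorphic2_on_conj2:
  assumes "holomorphic2_on \<phi> S"
  shows "holomorphic2_on (\<lambda>z. cnj (\<phi> (conj2 z))) (conj2 ` S)" unfolding holomorphic2_on_def
proof
  fix z assume "z \<in> conj2 ` S"
  then have "conj2 z \<in> S" by (simp add: conj2_image)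
  then obtain A B where AB: "(\<phi> has_derivative (\<lambda>v. A * fst v + B * snd v)) (at (conj2 z))"
    using assms unfolding holomorphic2_on_def by blast
  have "bounded_linear (\<lambda>z::complex \<times> complex. cnj (fst z))" "bounded_linear (\<lambda>z::complex \<times> complex. cnj (snd z))"
    by (intro bounded_linear_compose[OF bounded_linear_cnj] bounded_linear_fst bounded_linear_snd)+
  then have "(conj2 has_derivative conj2) (at z)"
    unfolding conj2_def[abs_def] by (intro has_derivative_Pair bounded_linear_imp_has_derivative)
  from diff_chain_at[OF diff_chain_at[OF this AB] bounded_linear_imp_has_derivative[OF bounded_linear_cnj]]
  have "((\<lambda>z. cnj (\<phi> (conj2 z))) has_derivative (\<lambda>v. cnj A * fst v + cnj B * snd v)) (at z)" by (simp add: o_def conj2_def)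
  then show "\<exists>A B. ((\<lambda>z. cnj (\<phi> (conj2 z))) has_derivative (\<lambda>v. A * fst v + B * snd v)) (at z)" by blast
qed

lemma holomorphic2_on_localI:
  assumes "\<And>z. z \<in> S \<Longrightarrow> \<exists>A. z \<in> A \<and> holomorphic2_on \<phi> A"
  shows "holomorphic2_on \<phi> S" using assms unfolding holomorphic2_on_def by blast

context bott
begin

lemma open_deep: "open {z. deep M z}" unfolding deep_def
  by (intro open_Collect_conj open_Collect_less continuous_intros) (simp_all add: open_V)

lemma deep_mono: "deep M z \<Longrightarrow> M' \<le> M \<Longrightarrow> deep M' z" by (auto simp: deep_def)

lemma deep_Phi: "deep (M + C2) z \<Longrightarrow> cmod (\<Phi> z) > M"
  using Phi_diff[of z] norm_triangle_ineq2[of "fst z" "\<Phi> z"] by (auto simp: deep_def norm_minus_commute)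

lemma continuous_level: "continuous_on box (\<lambda>z. (X (fst z) (snd z), snd z))"
  by (intro continuous_on_Pair holomorphic2_on_imp_continuous_on[OF holomorphic2_X] continuous_intros)

end

context henon_map
begin

lemma Fin_sw: "(P.Fi ^^ n) z = sw ((N.F ^^ n) (sw z))" using henon_inv_funpow[of n z] by (simp add: henon_inv_Fi)

lemma open_U_minus: "open (U_minus p a)"
proof -
  have "U_minus p a = sw ` N.U" by (auto simp: U_minus_iff sw_image)
  then show ?thesis using open_swap_image[OF N.open_U] by simp
qed

lemma open_U_plus: "open (U_plus p a)" by (simp add: U_plus_eq P.open_U)

end

locale leaf_conjugacy = henon_conjugacy pf af \<eta>f Rf rf \<alpha>f pg ag \<eta>g Rg rg \<alpha>g h k
  for pf af \<eta>f Rf rf \<alpha>f pg ag \<eta>g Rg rg \<alpha>g h k +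
  fixes C D :: complex
  assumes CD: "C \<noteq> 0" "D \<noteq> 0"
    and U_P: "\<And>z. z \<in> Uf \<Longrightarrow> h z \<in> U_plus pg ag \<longleftrightarrow> z \<in> U_plus pf af"
    and U_N: "\<And>z. z \<in> Uf \<Longrightarrow> h z \<in> U_minus pg ag \<longleftrightarrow> z \<in> U_minus pf af"
    and psi_P: "\<And>z. z \<in> V_plus \<alpha>f \<Longrightarrow> h z \<in> V_plus \<alpha>g \<Longrightarrow> g.P.\<psi> (h z) / cnj (C * f.P.\<psi> z) \<in> root_group (degree pf)"
    and psi_N: "\<And>z. z \<in> Uf \<Longrightarrow> sw z \<in> V_plus \<alpha>f \<Longrightarrow> sw (h z) \<in> V_plus \<alpha>g \<Longrightarrow>
      g.N.\<psi> (sw (h z)) / cnj (D * f.N.\<psi> (sw z)) \<in> root_group (degree pf)"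
begin

text \<open>In the coordinates \<open>(\<phi>\<^sub>+, y)\<close> near infinity the conjugate of \<open>h\<close> is multiplication by a constant
  in the first coordinate, and the second one is determined by \<open>\<phi>\<^sub>-\<close>.\<close>
lemma holomorphic_near_infinity:
  assumes Mg: "\<And>s y0 \<delta>. cmod s > Mg \<Longrightarrow> cmod y0 < cmod s / 2 \<Longrightarrow> (y0, g.P.X s y0) \<in> g.N.U \<Longrightarrow> \<delta> > 0 \<Longrightarrow>
      \<exists>y\<in>ball y0 \<delta>. cmod y < cmod s / 2 \<and> \<not> g.N.eqv (y0, g.P.X s y0) (y, g.P.X s y)"
    and z0: "z0 \<in> U_minus pf af" "f.P.deep (2 * f.P.M0) z0" "g.P.deep Mh (h z0)" and Mh: "Mh \<ge> 2 * g.P.M0" "Mh \<ge> Mg + g.P.C2"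
  obtains A where "z0 \<in> A" "open A" "holomorphic2_on (\<lambda>z. cnj (fst (h z))) A" "holomorphic2_on (\<lambda>z. cnj (snd (h z))) A"
proof -
  let ?d = "degree pf"
  define lev where "lev = (\<lambda>z. (f.P.X (fst z) (snd z), snd z))"
  have c_lev: "continuous_on f.P.box lev" unfolding lev_def by (rule f.P.continuous_level)
  note db0 = f.P.deep_box[OF z0(2)]
  have lev0: "lev (f.P.\<Phi> z0, snd z0) = z0" using db0(3) by (simp add: lev_def)
  have zU: "z0 \<in> U_plus pf af" using z0(2) f.P.V_subset_U by (auto simp: f.P.deep_def f.U_plus_eq)
  have swz: "sw z0 \<in> f.N.U" using z0(1) by (simp add: f.U_minus_iff)
  have "h z0 \<in> U_minus pg ag" using U_N[of z0] z0(1) by simp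
  then have swh: "sw (h z0) \<in> g.N.U" by (simp add: g.U_minus_iff)
  obtain n1 n2 where n12: "(f.N.F ^^ n1) (sw z0) \<in> f.V" "(g.N.F ^^ n2) (sw (h z0)) \<in> g.V"
    using swz swh unfolding f.N.U_def g.N.U_def by blast
  define m where "m = max n1 n2"
  have m: "(f.N.F ^^ m) (sw z0) \<in> f.V" "(g.N.F ^^ m) (sw (h z0)) \<in> g.V"
    using f.N.Fn_V_mono[OF n12(1), of m] g.N.Fn_V_mono[OF n12(2), of m] by (simp_all add: m_def)
  have csw: "continuous_on S sw" for S by (auto simp: prod.swap_def intro!: continuous_intros)
  have cNf: "continuous_on S (\<lambda>z. (f.N.F ^^ m) (sw z))" for S
    using continuous_on_compose2[OF f.N.continuous_Fn[of UNIV m] csw[of S]] by simp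
  have cNg: "continuous_on S (\<lambda>z. (g.N.F ^^ m) (sw z))" for S
    using continuous_on_compose2[OF g.N.continuous_Fn[of UNIV m] csw[of S]] by simp
  define O1 where "O1 = {w. g.P.deep Mh w} \<inter> (\<lambda>z. (g.N.F ^^ m) (sw z)) -` g.V"
  have oO1: "open O1" unfolding O1_def by (intro open_Int g.P.open_deep open_vimage[OF g.N.open_V cNg])
  define O2 where "O2 = (Uf \<inter> h -` O1) \<inter> (U_minus pf af \<inter> (\<lambda>z. (f.N.F ^^ m) (sw z)) -` f.V)"
  have oUf: "open Uf" using f.open_U_plus f.open_U_minus by blast
  have ch: "continuous_on Uf h" using homeo by (simp add: homeomorphism_def)
  have oO2: "open O2" unfolding O2_def
    by (intro open_Int f.open_U_minus open_vimage[OF f.N.open_V cNf] continuous_open_preimage[OF ch oUf oO1])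
  have zO2: "z0 \<in> O2" using zU z0 m by (simp add: O2_def O1_def)
  define O3 where "O3 = f.P.box \<inter> lev -` O2"
  have oO3: "open O3" unfolding O3_def by (rule continuous_open_preimage[OF c_lev f.P.open_box oO2])
  have "(f.P.\<Phi> z0, snd z0) \<in> O3" using db0(4) lev0 zO2 by (simp add: O3_def)
  then obtain r where r: "r > 0" "cball (f.P.\<Phi> z0) r \<times> cball (snd z0) r \<subseteq> O3" using sep_holomorphic_box[OF oO3] by blast
  define B where "B = ball (f.P.\<Phi> z0) r \<times> ball (snd z0) r"
  have B3: "B \<subseteq> O3" using r(2) ball_subset_cball unfolding B_def by blast
  have oB: "open B" unfolding B_def by (intro open_Times) auto
  have conB: "connected B" unfolding B_def by (intro connected_Times) auto
  have zB: "(f.P.\<Phi> z0, snd z0) \<in> B" using r(1) by (simp add: B_def)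
  define T where "T = (\<lambda>z. h (lev z))"
  have Bp: "z \<in> f.P.box" "lev z \<in> Uf" "lev z \<in> U_minus pf af" "g.P.deep Mh (T z)" "(g.N.F ^^ m) (sw (T z)) \<in> g.V"
    "(f.N.F ^^ m) (sw (lev z)) \<in> f.V" if "z \<in> B" for z using that B3 by (auto simp: O3_def O2_def O1_def T_def)
  have Bf: "lev z \<in> f.V" "f.P.\<Phi> (lev z) = fst z" "snd (lev z) = snd z" if "z \<in> B" for z
    using f.P.X[of "fst z" "snd z"] Bp(1)[OF that] by (auto simp: f.P.box_def lev_def)
  have Tdeep: "g.P.deep (2 * g.P.M0) (T z)" if "z \<in> B" for z using g.P.deep_mono[OF Bp(4)[OF that] Mh(1)] .
  note Tb = g.P.deep_box[OF Tdeep]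
  have TV: "T z \<in> g.V" if "z \<in> B" for z using Bp(4)[OF that] by (simp add: g.P.deep_def)
  have cB_lev: "continuous_on B lev" by (rule continuous_on_subset[OF c_lev]) (use Bp(1) in blast)
  have cT: "continuous_on B T" unfolding T_def by (rule continuous_on_compose2[OF ch cB_lev]) (use Bp(2) in blast)
  have s0: "fst z \<noteq> 0" if "z \<in> B" for z using f.P.Phi_nonzero[OF Bf(1)[OF that]] Bf(2)[OF that] by simp
  obtain \<omega> where \<omega>: "\<And>z. z \<in> B \<Longrightarrow> g.P.\<Phi> (T z) / cnj (C * fst z) = \<omega>"
  proof
    fix z assume z: "z \<in> B"
    show "g.P.\<Phi> (T z) / cnj (C * fst z) = g.P.\<Phi> (T (f.P.\<Phi> z0, snd z0)) / cnj (C * fst (f.P.\<Phi> z0, snd z0))"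
    proof (rule constant_if_countable_range[OF conB _ countable_root_group[OF f.P.d_pos(3)] _ z zB])
      have "continuous_on B (\<lambda>z. g.P.\<Phi> (T z))"
        by (rule continuous_on_compose2[OF holomorphic2_on_imp_continuous_on[OF g.P.holomorphic2_Phi] cT]) (use TV in blast)
      then show "continuous_on B (\<lambda>z. g.P.\<Phi> (T z) / cnj (C * fst z))" using s0 CD by (intro continuous_intros) auto
      show "g.P.\<Phi> (T z) / cnj (C * fst z) \<in> root_group ?d" if "z \<in> B" for z
        using psi_P[OF Bf(1)[OF that] TV[OF that, unfolded T_def]] Bf(2)[OF that] by (simp add: g.P.\<psi>_def f.P.\<psi>_def T_def)
    qed
  qed
  define C' where "C' = cnj \<omega> * C"
  have PhiT: "g.P.\<Phi> (T z) = cnj (C' * fst z)" if "z \<in> B" for z using \<omega>[OF that] s0[OF that] CD by (auto simp: C'_def field_simps)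
  have Teq: "T z = (g.P.X (cnj (C' * fst z)) (snd (T z)), snd (T z))" if "z \<in> B" for z
    using Tb(3)[OF that] PhiT[OF that] by (simp add: prod_eq_iff)
  define \<theta> where "\<theta> = (\<lambda>z. f.N.\<psi> ((f.N.F ^^ m) (sw (lev z))))"
  have h_lev: "holomorphic2_on (\<lambda>z. f.P.X (fst z) (snd z)) B" by (rule holomorphic2_on_subset[OF f.P.holomorphic2_X]) (use Bp(1) in blast)
  have h\<theta>: "holomorphic2_on \<theta> B"
  proof -
    have "holomorphic2_on (\<lambda>z. f.N.\<psi> ((f.N.F ^^ m) z)) {z. (f.N.F ^^ m) z \<in> f.V}"
      by (rule f.N.holomorphic2_compose_Fn[OF f.N.holomorphic2_psi]) simp
    then have "holomorphic2_on (\<lambda>z. f.N.\<psi> ((f.N.F ^^ m) (snd z, f.P.X (fst z) (snd z)))) B"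
      by (rule holomorphic2_on_compose[OF _ holomorphic2_on_snd h_lev]) (use Bp(6) in \<open>simp add: lev_def\<close>)
    then show ?thesis by (simp add: \<theta>_def lev_def)
  qed
  have \<theta>0: "\<theta> z \<noteq> 0" if "z \<in> B" for z unfolding \<theta>_def by (rule f.N.psi_nonzero[OF Bp(6)[OF that]])
  obtain \<omega>' where \<omega>': "\<And>z. z \<in> B \<Longrightarrow> g.N.\<psi> ((g.N.F ^^ m) (sw (T z))) / cnj (D * \<theta> z) = \<omega>'"
  proof
    fix z assume z: "z \<in> B"
    show "g.N.\<psi> ((g.N.F ^^ m) (sw (T z))) / cnj (D * \<theta> z) = g.N.\<psi> ((g.N.F ^^ m) (sw (T (f.P.\<Phi> z0, snd z0)))) / cnj (D * \<theta> (f.P.\<Phi> z0, snd z0))"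
    proof (rule constant_if_countable_range[OF conB _ countable_root_group[OF f.P.d_pos(3)] _ z zB])
      have c1: "continuous_on B (\<lambda>z. (g.N.F ^^ m) (sw (T z)))" using continuous_on_compose2[OF cNg[of UNIV] cT] by simp
      have "continuous_on B (\<lambda>z. g.N.\<psi> ((g.N.F ^^ m) (sw (T z))))"
        by (rule continuous_on_compose2[OF holomorphic2_on_imp_continuous_on[OF g.N.holomorphic2_psi] c1]) (use Bp(5) in blast)
      then show "continuous_on B (\<lambda>z. g.N.\<psi> ((g.N.F ^^ m) (sw (T z))) / cnj (D * \<theta> z))"
        using \<theta>0 CD by (intro continuous_intros holomorphic2_on_imp_continuous_on[OF h\<theta>]) auto
      fix z assume z: "z \<in> B"
      let ?w = "(f.P.Fi ^^ m) (lev z)"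
      have hw: "?w \<in> Uf" "h ?w = (g.P.Fi ^^ m) (T z)" using h_Fin[OF Bp(2)[OF z], of m] by (simp_all add: T_def)
      have e: "sw ?w = (f.N.F ^^ m) (sw (lev z))" by (simp add: f.Fin_sw)
      have e': "sw (h ?w) = (g.N.F ^^ m) (sw (T z))" unfolding hw(2) by (simp add: g.Fin_sw)
      have "g.N.\<psi> (sw (h ?w)) / cnj (D * f.N.\<psi> (sw ?w)) \<in> root_group ?d" using psi_N[OF hw(1)] Bp(5,6)[OF z] unfolding e e' by blast
      then show "g.N.\<psi> ((g.N.F ^^ m) (sw (T z))) / cnj (D * \<theta> z) \<in> root_group ?d" unfolding e e' \<theta>_def .
    qed
  qed
  have psiT: "g.N.\<psi> ((g.N.F ^^ m) (sw (T z))) = cnj (cnj \<omega>' * D * \<theta> z)" if "z \<in> B" for z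
    using \<omega>'[OF that] \<theta>0[OF that] CD by (auto simp: field_simps)
  define Tg where "Tg = g.P.box \<inter> (\<lambda>z. (g.N.F ^^ m) (sw (g.P.X (fst z) (snd z), snd z))) -` g.V"
  have oTg: "open Tg" unfolding Tg_def by (rule continuous_open_preimage[OF _ g.P.open_box g.N.open_V])
      (use continuous_on_compose2[OF cNg[of UNIV] g.P.continuous_level] in simp)
  define \<phi> where "\<phi> = (\<lambda>z. g.N.\<psi> ((g.N.F ^^ m) (snd z, g.P.X (fst z) (snd z))))"
  have h\<phi>: "holomorphic2_on \<phi> Tg"
  proof -
    have "holomorphic2_on (\<lambda>z. g.N.\<psi> ((g.N.F ^^ m) z)) {z. (g.N.F ^^ m) z \<in> g.V}"
      by (rule g.N.holomorphic2_compose_Fn[OF g.N.holomorphic2_psi]) simp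
    moreover have "holomorphic2_on (\<lambda>z. g.P.X (fst z) (snd z)) Tg"
      by (rule holomorphic2_on_subset[OF g.P.holomorphic2_X]) (auto simp: Tg_def)
    ultimately show ?thesis unfolding \<phi>_def
      by (intro holomorphic2_on_compose[where T = "{z. (g.N.F ^^ m) z \<in> g.V}"] holomorphic2_on_snd) (auto simp: Tg_def)
  qed
  define Y where "Y = (\<lambda>z. cnj (snd (T z)))"
  have hY: "holomorphic2_on Y B" unfolding B_def
  proof (rule implicit_continuous_holomorphic2[where A = "\<lambda>s. C' * s" and N = "\<lambda>z. cnj (\<phi> (conj2 z))" and T = "conj2 ` Tg"])
    show "continuous_on (ball (f.P.\<Phi> z0) r \<times> ball (snd z0) r) Y" unfolding Y_def using cT unfolding B_def by (intro continuous_intros)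
    show "inj_on (\<lambda>y. Y (s, y)) (ball (snd z0) r)" if s: "s \<in> ball (f.P.\<Phi> z0) r" for s
    proof (rule inj_onI)
      fix y y' assume y: "y \<in> ball (snd z0) r" "y' \<in> ball (snd z0) r" and eq: "Y (s, y) = Y (s, y')"
      have B: "(s, y) \<in> B" "(s, y') \<in> B" using s y by (auto simp: B_def)
      have "snd (T (s, y)) = snd (T (s, y'))" using eq by (simp add: Y_def)
      then have "T (s, y) = T (s, y')" using Teq[OF B(1)] Teq[OF B(2)] by (metis fst_conv)
      then have "lev (s, y) = lev (s, y')" using inj_onD[OF inj_h] Bp(2)[OF B(1)] Bp(2)[OF B(2)] unfolding T_def by blast
      then show "y = y'" by (simp add: lev_def)
    qed
    show "(\<lambda>s. C' * s) holomorphic_on ball (f.P.\<Phi> z0) r" by (intro holomorphic_intros)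
    show "open (conj2 ` Tg)" by (rule open_conj2_image[OF oTg])
    show "holomorphic2_on (\<lambda>z. cnj (\<phi> (conj2 z))) (conj2 ` Tg)" by (rule holomorphic2_on_conj2[OF h\<phi>])
    have inT: "(cnj (C' * fst z), snd (T z)) \<in> Tg" if z: "z \<in> B" for z
    proof -
      have "(cnj (C' * fst z), snd (T z)) \<in> g.P.box" using Tb(4)[OF z] PhiT[OF z] by simp
      moreover have e: "sw (T z) = (snd (T z), g.P.X (cnj (C' * fst z)) (snd (T z)))"
        using arg_cong[OF Teq[OF z], of sw] by (simp only: swap_simp)
      have "(g.N.F ^^ m) (snd (T z), g.P.X (cnj (C' * fst z)) (snd (T z))) \<in> g.V" using Bp(5)[OF z] by (simp only: e)
      ultimately show ?thesis by (simp add: Tg_def)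
    qed
    show AT: "(C' * s, Y (s, y)) \<in> conj2 ` Tg" if "s \<in> ball (f.P.\<Phi> z0) r" "y \<in> ball (snd z0) r" for s y
      unfolding conj2_image mem_Collect_eq using inT[of "(s, y)"] that by (simp add: conj2_def Y_def B_def)
    have rel: "cnj (\<phi> (conj2 (C' * fst z, Y z))) = cnj \<omega>' * D * \<theta> z" if z: "z \<in> B" for z
    proof -
      have "\<phi> (conj2 (C' * fst z, Y z)) = g.N.\<psi> ((g.N.F ^^ m) (sw (T z)))"
        using arg_cong[OF Teq[OF z], of "\<lambda>w. g.N.\<psi> ((g.N.F ^^ m) (sw w))"] by (simp add: \<phi>_def conj2_def Y_def)
      then show ?thesis using psiT[OF z] by simp
    qed
    have "holomorphic2_on (\<lambda>z. cnj \<omega>' * D * \<theta> z) B" by (intro holomorphic2_intros h\<theta>)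
    then have "holomorphic2_on (\<lambda>z. cnj (\<phi> (conj2 (C' * fst z, Y z)))) B" by (subst holomorphic2_on_cong[OF oB rel])
    then show "holomorphic2_on (\<lambda>z. cnj (\<phi> (conj2 (C' * fst z, Y z)))) (ball (f.P.\<Phi> z0) r \<times> ball (snd z0) r)" by (simp only: B_def)
    show "\<exists>t\<in>ball (Y (s, y)) \<delta>. (C' * s, t) \<in> conj2 ` Tg \<and> cnj (\<phi> (conj2 (C' * s, t))) \<noteq> cnj (\<phi> (conj2 (C' * s, Y (s, y))))"
      if sy: "s \<in> ball (f.P.\<Phi> z0) r" "y \<in> ball (snd z0) r" and \<delta>: "\<delta> > 0" for s y \<delta>
    proof -
      have z: "(s, y) \<in> B" using sy by (simp add: B_def)
      define s' where "s' = cnj (C' * s)"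
      define y' where "y' = snd (T (s, y))"
      have s'eq: "g.P.\<Phi> (T (s, y)) = s'" using PhiT[OF z] by (simp add: s'_def)
      have sT: "sw (T (s, y)) = (y', g.P.X s' y')" using arg_cong[OF Teq[OF z], of sw] by (simp add: s'_def y'_def)
      have "g.P.deep (Mg + g.P.C2) (T (s, y))" using g.P.deep_mono[OF Bp(4)[OF z] Mh(2)] .
      then have s'M: "cmod s' > Mg" using g.P.deep_Phi s'eq by metis
      have y's: "cmod y' < cmod s' / 2" using Tb(2)[OF z] s'eq by (simp add: y'_def)
      have y'U: "(y', g.P.X s' y') \<in> g.N.U" using Bp(5)[OF z] unfolding sT by (auto simp: g.N.U_def)
      have "open ((\<lambda>t. (s', t)) -` Tg)" by (intro open_vimage oTg continuous_intros)
      moreover have "y' \<in> (\<lambda>t. (s', t)) -` Tg" using inT[OF z] by (simp add: s'_def y'_def)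
      ultimately obtain e where e: "e > 0" "ball y' e \<subseteq> (\<lambda>t. (s', t)) -` Tg" using openE by blast
      obtain y'' where y'': "y'' \<in> ball y' (min e \<delta>)" "\<not> g.N.eqv (y', g.P.X s' y') (y'', g.P.X s' y'')"
        using Mg[OF s'M y's y'U, of "min e \<delta>"] e(1) \<delta> by auto
      have "y' \<in> ball y' e" "y'' \<in> ball y' e" using e(1) y''(1) by auto
      then have yT: "(s', y'') \<in> Tg" "(s', y') \<in> Tg" using e(2) by blast+
      show ?thesis
      proof (rule bexI[of _ "cnj y''"], intro conjI)
        have "dist (cnj y') (cnj y'') = dist y' y''" by (simp add: dist_norm flip: complex_cnj_diff)
        then show "cnj y'' \<in> ball (Y (s, y)) \<delta>" using y''(1) by (simp add: Y_def y'_def)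
        show "(C' * s, cnj y'') \<in> conj2 ` Tg" unfolding conj2_image mem_Collect_eq using yT(1) by (simp add: conj2_def s'_def)
        show "cnj (\<phi> (conj2 (C' * s, cnj y''))) \<noteq> cnj (\<phi> (conj2 (C' * s, Y (s, y))))"
        proof
          assume "cnj (\<phi> (conj2 (C' * s, cnj y''))) = cnj (\<phi> (conj2 (C' * s, Y (s, y))))"
          then have "\<phi> (s', y'') = \<phi> (s', y')" by (simp add: conj2_def s'_def Y_def y'_def)
          then have "g.N.eqv (y', g.P.X s' y') (y'', g.P.X s' y'')" using yT unfolding g.N.eqv_def \<phi>_def Tg_def by (intro exI[of _ m]) auto
          with y''(2) show False by blast
        qed
      qed
    qed
  qed
  have hPhi: "holomorphic2_on f.P.\<Phi> f.V" by (rule f.P.holomorphic2_Phi)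
  define A where "A = {z. f.P.deep (2 * f.P.M0) z} \<inter> (\<lambda>z. (f.P.\<Phi> z, snd z)) -` B"
  have dV: "f.P.deep M z \<Longrightarrow> z \<in> f.V" for M z by (simp add: f.P.deep_def)
  have oA: "open A" unfolding A_def
  proof (rule continuous_open_preimage[OF _ f.P.open_deep oB])
    show "continuous_on {z. f.P.deep (2 * f.P.M0) z} (\<lambda>z. (f.P.\<Phi> z, snd z))"
      by (intro continuous_on_Pair continuous_on_subset[OF holomorphic2_on_imp_continuous_on[OF hPhi]] continuous_intros) (use dV in blast)
  qed
  have hPA: "holomorphic2_on f.P.\<Phi> A" by (rule holomorphic2_on_subset[OF hPhi]) (use dV in \<open>auto simp: A_def\<close>)
  have hYA: "holomorphic2_on (\<lambda>z. Y (f.P.\<Phi> z, snd z)) A" by (rule holomorphic2_on_compose[OF hY hPA holomorphic2_on_snd]) (simp add: A_def)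
  have TA: "T (f.P.\<Phi> z, snd z) = h z" "(f.P.\<Phi> z, snd z) \<in> B" if "z \<in> A" for z
    using that f.P.deep_box(3)[of z] by (auto simp: T_def lev_def A_def)
  show ?thesis
  proof (rule that[of A])
    show "z0 \<in> A" using z0(2) zB by (simp add: A_def)
    show "open A" by (rule oA)
    have "cnj (snd (h z)) = Y (f.P.\<Phi> z, snd z)" if "z \<in> A" for z using TA(1)[OF that] by (simp add: Y_def)
    from holomorphic2_on_cong[OF oA this] show "holomorphic2_on (\<lambda>z. cnj (snd (h z))) A" using hYA by simp
    have hX: "holomorphic2_on (\<lambda>z. cnj (g.P.X (fst (conj2 z)) (snd (conj2 z)))) (conj2 ` g.P.box)"
      by (rule holomorphic2_on_conj2[OF g.P.holomorphic2_X])
    have inb: "(C' * f.P.\<Phi> z, Y (f.P.\<Phi> z, snd z)) \<in> conj2 ` g.P.box" if "z \<in> A" for z unfolding conj2_image mem_Collect_eq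
      using Tb(4)[OF TA(2)[OF that]] PhiT[OF TA(2)[OF that]] by (simp add: conj2_def Y_def)
    have "holomorphic2_on (\<lambda>z. C' * f.P.\<Phi> z) A" by (intro holomorphic2_intros hPA)
    from holomorphic2_on_compose[OF hX this hYA inb]
    have "holomorphic2_on (\<lambda>z. cnj (g.P.X (fst (conj2 (C' * f.P.\<Phi> z, Y (f.P.\<Phi> z, snd z)))) (snd (conj2 (C' * f.P.\<Phi> z, Y (f.P.\<Phi> z, snd z)))))) A" .
    note hX2 = this
    have "cnj (fst (h z)) = cnj (g.P.X (fst (conj2 (C' * f.P.\<Phi> z, Y (f.P.\<Phi> z, snd z)))) (snd (conj2 (C' * f.P.\<Phi> z, Y (f.P.\<Phi> z, snd z)))))"
      if "z \<in> A" for z using arg_cong[OF Teq[OF TA(2)[OF that]], of fst] TA(1)[OF that] by (simp add: conj2_def Y_def)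
    from holomorphic2_on_cong[OF oA this] show "holomorphic2_on (\<lambda>z. cnj (fst (h z))) A" using hX2 by (simp only:)
  qed
qed

lemma antiholomorphic:
  "holomorphic2_on (\<lambda>z. cnj (fst (h z))) (U_plus pf af \<inter> U_minus pf af)"
  "holomorphic2_on (\<lambda>z. cnj (snd (h z))) (U_plus pf af \<inter> U_minus pf af)"
proof -
  obtain Mg where Mg: "Mg \<ge> g.P.M0" "\<And>s y0 \<delta>. cmod s > Mg \<Longrightarrow> cmod y0 < cmod s / 2 \<Longrightarrow> (y0, g.P.X s y0) \<in> g.N.U \<Longrightarrow> \<delta> > 0 \<Longrightarrow>
      \<exists>y\<in>ball y0 \<delta>. cmod y < cmod s / 2 \<and> \<not> g.N.eqv (y0, g.P.X s y0) (y, g.P.X s y)" using g.leaves_not_locally_equal by blast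
  define Mh where "Mh = max (2 * g.P.M0) (Mg + g.P.C2)"
  have loc: "\<exists>A. z \<in> A \<and> holomorphic2_on (\<lambda>z. cnj (fst (h z))) A \<and> holomorphic2_on (\<lambda>z. cnj (snd (h z))) A"
    if z: "z \<in> U_plus pf af \<inter> U_minus pf af" for z
  proof -
    have zUf: "z \<in> Uf" using z by blast
    have zP: "z \<in> f.P.U" "h z \<in> g.P.U" using z U_P[OF zUf] by (auto simp: f.U_plus_eq g.U_plus_eq)
    have "\<forall>\<^sub>F n in sequentially. f.P.deep (2 * f.P.M0) ((f.P.F ^^ n) z) \<and> g.P.deep Mh ((g.P.F ^^ n) (h z))"
      by (rule eventually_conj[OF f.P.eventually_deep[OF zP(1)] g.P.eventually_deep[OF zP(2)]])
    then obtain n where n: "f.P.deep (2 * f.P.M0) ((f.P.F ^^ n) z)" "g.P.deep Mh (h ((f.P.F ^^ n) z))"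
      using h_Fn[OF zUf] unfolding eventually_sequentially by auto
    have um: "(f.P.F ^^ n) z \<in> U_minus pf af"
    proof (induction n)
      case (Suc n)
      then show ?case by (simp add: f.U_minus_iff f.U_minus_P_F)
    qed (use z in simp)
    obtain A where A: "(f.P.F ^^ n) z \<in> A" "open A" "holomorphic2_on (\<lambda>z. cnj (fst (h z))) A" "holomorphic2_on (\<lambda>z. cnj (snd (h z))) A"
      by (rule holomorphic_near_infinity[OF Mg(2) um n]) (auto simp: Mh_def)
    define A' where "A' = Uf \<inter> (f.P.F ^^ n) -` A"
    have oA': "open A'" unfolding A'_def using f.open_U_plus f.open_U_minus open_vimage[OF A(2) f.P.continuous_Fn] by blast
    have hz: "h w = (g.P.Fi ^^ n) (h ((f.P.F ^^ n) w))" if "w \<in> A'" for w using h_Fn[of w n] that by (simp add: A'_def)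
    have hol: "holomorphic2_on (\<lambda>w. \<phi> (cnj (fst (h ((f.P.F ^^ n) w))), cnj (snd (h ((f.P.F ^^ n) w))))) A'"
      if \<phi>: "holomorphic2_on \<phi> UNIV" for \<phi>
    proof (rule holomorphic2_on_compose[OF \<phi>])
      show "holomorphic2_on (\<lambda>w. cnj (fst (h ((f.P.F ^^ n) w)))) A'" "holomorphic2_on (\<lambda>w. cnj (snd (h ((f.P.F ^^ n) w)))) A'"
        using f.P.holomorphic2_compose_Fn[OF A(3), of A'] f.P.holomorphic2_compose_Fn[OF A(4), of A'] by (auto simp: A'_def)
    qed simp
    have u: "conj2 ` UNIV = (UNIV :: (complex \<times> complex) set)" by (simp add: conj2_image)
    have h1: "holomorphic2_on (\<lambda>w. cnj (fst ((g.P.Fi ^^ n) (conj2 w)))) UNIV"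
      using holomorphic2_on_conj2[OF g.P.holomorphic2_Fin(1)[of n UNIV]] by (simp add: u)
    have h2: "holomorphic2_on (\<lambda>w. cnj (snd ((g.P.Fi ^^ n) (conj2 w)))) UNIV"
      using holomorphic2_on_conj2[OF g.P.holomorphic2_Fin(2)[of n UNIV]] by (simp add: u)
    have c: "conj2 (cnj (fst w), cnj (snd w)) = w" for w by (simp add: conj2_def)
    have "holomorphic2_on (\<lambda>w. cnj (fst ((g.P.Fi ^^ n) (h ((f.P.F ^^ n) w))))) A'"
      "holomorphic2_on (\<lambda>w. cnj (snd ((g.P.Fi ^^ n) (h ((f.P.F ^^ n) w))))) A'" using hol[OF h1] hol[OF h2] unfolding c .
    then have "holomorphic2_on (\<lambda>w. cnj (fst (h w))) A'" "holomorphic2_on (\<lambda>w. cnj (snd (h w))) A'"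
      using holomorphic2_on_cong[OF oA', of "\<lambda>w. cnj (fst (h w))" "\<lambda>w. cnj (fst ((g.P.Fi ^^ n) (h ((f.P.F ^^ n) w))))"]
        holomorphic2_on_cong[OF oA', of "\<lambda>w. cnj (snd (h w))" "\<lambda>w. cnj (snd ((g.P.Fi ^^ n) (h ((f.P.F ^^ n) w))))"] hz by auto
    moreover have "z \<in> A'" using zUf A(1) by (simp add: A'_def)
    ultimately show ?thesis by blast
  qed
  show "holomorphic2_on (\<lambda>z. cnj (fst (h z))) (U_plus pf af \<inter> U_minus pf af)"
    "holomorphic2_on (\<lambda>z. cnj (snd (h z))) (U_plus pf af \<inter> U_minus pf af)" by (rule holomorphic2_on_localI, use loc in blast)+
qed

lemma inverse_leaf_conjugacy:
  "leaf_conjugacy pg ag \<eta>g Rg rg \<alpha>g pf af \<eta>f Rf rf \<alpha>f k h (1 / cnj C) (1 / cnj D)"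
proof (intro leaf_conjugacy.intro henon_conjugacy.intro henon_conjugacy_axioms.intro leaf_conjugacy_axioms.intro f.henon_map_axioms g.henon_map_axioms)
  have inv: "v / cnj (1 / cnj K * u) = cnj (inverse (u / cnj (K * v)))" if "K \<noteq> 0" for u v K :: complex
    using that by (simp add: field_simps)
  show "degree pf = degree pg" using degree_eq by simp
  show "homeomorphism Ug Uf k h" using homeo by (rule homeomorphism_symD)
  show "k (henon pg ag z) = henon pf af (k z)" if "z \<in> Ug" for z
  proof -
    have "g.P.F z = h (f.P.F (k z))" using h_F[OF k_Ug[OF that]] h_k[OF that] by simp
    then show ?thesis using k_h[OF Uf_F(1)[OF k_Ug[OF that]]] by (simp add: f.henon_eq g.henon_eq)
  qed
  show "k z \<in> U_plus pf af \<longleftrightarrow> z \<in> U_plus pg ag" "k z \<in> U_minus pf af \<longleftrightarrow> z \<in> U_minus pg ag" if "z \<in> Ug" for z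
    using U_P[OF k_Ug[OF that]] U_N[OF k_Ug[OF that]] h_k[OF that] by simp_all
  show "f.P.\<psi> (k z) / cnj (1 / cnj C * g.P.\<psi> z) \<in> root_group (degree pg)" if "z \<in> g.V" "k z \<in> f.V" for z
  proof -
    have "z \<in> Ug" using that(1) g.P.V_subset_U by (auto simp: g.U_plus_eq)
    then have "g.P.\<psi> z / cnj (C * f.P.\<psi> (k z)) \<in> root_group (degree pf)" using psi_P[OF that(2)] that(1) h_k by simp
    then show ?thesis unfolding inv[OF CD(1)] degree_eq by (intro root_group_cnj root_group_inverse)
  qed
  show "f.N.\<psi> (sw (k z)) / cnj (1 / cnj D * g.N.\<psi> (sw z)) \<in> root_group (degree pg)"
    if "z \<in> Ug" "sw z \<in> g.V" "sw (k z) \<in> f.V" for z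
  proof -
    have "g.N.\<psi> (sw z) / cnj (D * f.N.\<psi> (sw (k z))) \<in> root_group (degree pf)"
      using psi_N[OF k_Ug[OF that(1)] that(3)] that(2) h_k[OF that(1)] by simp
    then show ?thesis unfolding inv[OF CD(2)] degree_eq by (intro root_group_cnj root_group_inverse)
  qed
qed (use CD in auto)

lemma biholomorphism_conj2_h:
  "biholomorphism (conj2 \<circ> h) (U_plus pf af \<inter> U_minus pf af) (conj2 ` (U_plus pg ag \<inter> U_minus pg ag))"
proof -
  let ?S = "U_plus pf af \<inter> U_minus pf af" and ?S' = "U_plus pg ag \<inter> U_minus pg ag"
  interpret inv: leaf_conjugacy pg ag \<eta>g Rg rg \<alpha>g pf af \<eta>f Rf rf \<alpha>f k h "1 / cnj C" "1 / cnj D" by (rule inverse_leaf_conjugacy)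
  have oS: "open ?S" and oS': "open ?S'" using f.open_U_plus f.open_U_minus g.open_U_plus g.open_U_minus by auto
  have oT: "open (conj2 ` ?S')" by (rule open_conj2_image[OF oS'])
  have hS: "h z \<in> ?S'" if "z \<in> ?S" for z using that U_P[of z] U_N[of z] by simp
  have kS: "k w \<in> ?S" "h (k w) = w" if "w \<in> ?S'" for w using that inv.U_P[of w] inv.U_N[of w] h_k[of w] by simp_all
  have kh: "k (h z) = z" if "z \<in> ?S" for z using that k_h[of z] by simp
  have bij: "bij_betw (conj2 \<circ> h) ?S (conj2 ` ?S')"
  proof (rule bij_betw_byWitness[where f' = "\<lambda>w. k (conj2 w)"])
    show "(conj2 \<circ> h) ` ?S \<subseteq> conj2 ` ?S'" using hS by auto
    show "(\<lambda>w. k (conj2 w)) ` conj2 ` ?S' \<subseteq> ?S" using kS(1) by auto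
  qed (use kh kS in \<open>auto simp: conj2_image\<close>)
  have inj: "inj_on (conj2 \<circ> h) ?S" using bij by (rule bij_betw_imp_inj_on)
  have ii: "inv_into ?S (conj2 \<circ> h) w = k (conj2 w)" if "w \<in> conj2 ` ?S'" for w
  proof (rule inv_into_f_eq[OF inj])
    have "conj2 w \<in> ?S'" using that by (simp add: conj2_image)
    then show "k (conj2 w) \<in> ?S" "(conj2 \<circ> h) (k (conj2 w)) = w" using kS by auto
  qed
  have a: "(fst \<circ> (conj2 \<circ> h)) = (\<lambda>z. cnj (fst (h z)))" "(snd \<circ> (conj2 \<circ> h)) = (\<lambda>z. cnj (snd (h z)))"
    by (simp_all add: fun_eq_iff conj2_def)
  have b: "holomorphic2_on (\<lambda>w. fst (k (conj2 w))) (conj2 ` ?S')" "holomorphic2_on (\<lambda>w. snd (k (conj2 w))) (conj2 ` ?S')"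
    using holomorphic2_on_conj2[OF inv.antiholomorphic(1)] holomorphic2_on_conj2[OF inv.antiholomorphic(2)] by simp_all
  have "holomorphic2_on (fst \<circ> inv_into ?S (conj2 \<circ> h)) (conj2 ` ?S')" "holomorphic2_on (snd \<circ> inv_into ?S (conj2 \<circ> h)) (conj2 ` ?S')"
    using holomorphic2_on_cong[OF oT, of "fst \<circ> inv_into ?S (conj2 \<circ> h)" "\<lambda>w. fst (k (conj2 w))"]
      holomorphic2_on_cong[OF oT, of "snd \<circ> inv_into ?S (conj2 \<circ> h)" "\<lambda>w. snd (k (conj2 w))"] b ii by auto
  then show ?thesis unfolding biholomorphism_def a using oS oT bij antiholomorphic by blast
qed

end


context end_conjugacy
begin

theorem biholomorphism_and_constants:
  "biholomorphism (conj2 \<circ> h) (U_plus pf af \<inter> U_minus pf af) (conj2 ` (U_plus pg ag \<inter> U_minus pg ag)) \<and>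
   (\<exists>\<beta> \<gamma>. \<beta> \<noteq> 0 \<and> \<gamma> \<noteq> 0 \<and>
      (\<forall>\<^sub>F z in puncture_filter Hf cf. cnj (psi_plus pg ag (h z)) = 1 / \<beta> * psi_plus pf af z) \<and>
      (\<forall>\<^sub>F z in puncture_filter Hf cf. cnj (psi_minus pg ag \<eta>g (h z)) = 1 / \<gamma> * psi_minus pf af \<eta>f z) \<and>
      \<beta> ^ (degree pf - 1) \<in> root_group (degree pf) \<and> \<gamma> ^ (degree pf - 1) \<in> root_group (degree pf))"
proof -
  obtain C D :: complex and q :: real where CD: "C \<noteq> 0" "D \<noteq> 0" and q: "0 < q"
    and roots: "C ^ degree pf / C \<in> root_group (degree pf)" "D ^ degree pf / D \<in> root_group (degree pf)"
    and E: "\<And>v. v \<in> pdisc q \<Longrightarrow> v \<in> g.disc \<and> C * cnj v \<in> f.disc \<and> h (\<Gamma>f (C * cnj v)) = \<Gamma>g v \<and> f.m (C * cnj v) = D * cnj (g.m v)"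
    by (rule rigid_end) (rule that)
  have ends: "u \<in> f.disc \<and> cnj (u / C) \<in> g.disc \<and> h (\<Gamma>f u) = \<Gamma>g (cnj (u / C)) \<and> f.m u = D * cnj (g.m (cnj (u / C)))"
    if u: "u \<in> pdisc (cmod C * q)" for u
  proof -
    have "cmod (u / C) < q" using u CD by (simp add: norm_divide field_simps)
    then have v: "cnj (u / C) \<in> pdisc q" using u CD by (simp del: complex_cnj_divide)
    have "C * cnj (cnj (u / C)) = u" using CD by simp
    then show ?thesis using E[OF v] by simp
  qed
  have end_P: "\<exists>x\<in>f.V. h x \<in> g.V \<and> f.P.\<psi> x = s \<and> g.P.\<psi> (h x) = cnj (C * s)" if s: "cmod s > 1 / (cmod C * q)" for s
  proof -
    have Cq: "cmod C * q > 0" using CD q by simp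
    then have s0: "cmod s > 0" using s by (meson less_trans zero_less_divide_1_iff)
    have "cmod (1 / s) < cmod C * q" using s Cq s0 by (simp add: norm_divide field_simps)
    then have u: "1 / s \<in> pdisc (cmod C * q)" using s0 by simp
    note e = ends[OF u]
    show ?thesis
    proof (intro bexI[of _ "\<Gamma>f (1 / s)"] conjI)
      show "\<Gamma>f (1 / s) \<in> f.V" using f.Gamma_D(1) e by blast
      show "h (\<Gamma>f (1 / s)) \<in> g.V" using g.Gamma_D(1) e by metis
      show "f.P.\<psi> (\<Gamma>f (1 / s)) = s" using f.Gamma_D(5)[of "1 / s"] e s0 by simp
      show "g.P.\<psi> (h (\<Gamma>f (1 / s))) = cnj (C * s)" using g.Gamma_D(5)[of "cnj (1 / s / C)"] e by simp
    qed
  qed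
  obtain B where end_N: "\<And>s. cmod s > B \<Longrightarrow> \<exists>x\<in>f.V. sw (h (sw x)) \<in> g.V \<and> f.N.\<psi> x = s \<and> g.N.\<psi> (sw (h (sw x))) = cnj (D * s)"
  proof -
    have t: "0 < min \<rho>f (cmod C * q)" "min \<rho>f (cmod C * q) \<le> \<rho>f" using f.rho CD q by auto
    obtain q2 s2 n where n: "0 < q2" "q2 \<le> min \<rho>f (cmod C * q)" "0 < s2"
      "\<And>w. w \<in> ball 0 s2 \<Longrightarrow> n w \<in> ball 0 q2 \<and> f.m (n w) = w" by (rule f.m_local_inverse[OF t]) (rule that)
    show ?thesis
    proof (rule that[of "1 / s2"])
      fix s :: complex assume s: "cmod s > 1 / s2"
      then have s0: "cmod s > 0" using n(3) by (meson less_trans zero_less_divide_1_iff)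
      have "cmod (1 / s) < s2" using s n(3) s0 by (simp add: norm_divide field_simps)
      then have w: "1 / s \<in> ball 0 s2" by simp
      define u where "u = n (1 / s)"
      have u: "u \<in> ball 0 q2" "f.m u = 1 / s" using n(4)[OF w] by (auto simp: u_def)
      have "f.m 0 = 0" by (simp add: f.m_def)
      then have "u \<noteq> 0" using u(2) s0 by auto
      then have "u \<in> pdisc (cmod C * q)" using u(1) n(2) by auto
      note e = ends[OF this]
      let ?v = "cnj (u / C)"
      have ud: "u \<in> f.disc" and vd: "?v \<in> g.disc" using e by blast+
      have hx: "sw (h (sw (f.N.F (sw (\<Gamma>f u))))) = g.N.F (sw (\<Gamma>g ?v))" using SN.h_F[of "sw (\<Gamma>f u)"] Gamma_Uf[OF ud] e by simp
      have gm: "g.m ?v = cnj (1 / (s * D))"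
      proof -
        have "cnj (g.m ?v) = 1 / (s * D)" using e u(2) CD s0 by (simp add: field_simps)
        then show ?thesis by (metis complex_cnj_cnj)
      qed
      show "\<exists>x\<in>f.V. sw (h (sw x)) \<in> g.V \<and> f.N.\<psi> x = s \<and> g.N.\<psi> (sw (h (sw x))) = cnj (D * s)"
      proof (intro bexI[of _ "f.N.F (sw (\<Gamma>f u))"] conjI)
        show "f.N.F (sw (\<Gamma>f u)) \<in> f.V" by (rule f.Gamma_D(2)[OF ud])
        show "sw (h (sw (f.N.F (sw (\<Gamma>f u))))) \<in> g.V" unfolding hx by (rule g.Gamma_D(2)[OF vd])
        show "f.N.\<psi> (f.N.F (sw (\<Gamma>f u))) = s" unfolding f.Gamma_D(6)[OF ud] u(2) by simp
        show "g.N.\<psi> (sw (h (sw (f.N.F (sw (\<Gamma>f u)))))) = cnj (D * s)" unfolding hx g.Gamma_D(6)[OF vd] gm by (simp add: mult.commute)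
      qed
    qed
  qed
  interpret LC: leaf_conjugacy pf af \<eta>f Rf rf \<alpha>f pg ag \<eta>g Rg rg \<alpha>g h k C D
  proof (intro leaf_conjugacy.intro leaf_conjugacy_axioms.intro henon_conjugacy_axioms CD)
    show "h z \<in> U_plus pg ag \<longleftrightarrow> z \<in> U_plus pf af" if "z \<in> Uf" for z
      using SP.h_U_iff[OF CD(1) roots(1) end_P that] by (simp add: f.U_plus_eq g.U_plus_eq)
    show "h z \<in> U_minus pg ag \<longleftrightarrow> z \<in> U_minus pf af" if "z \<in> Uf" for z
      using SN.h_U_iff[OF CD(2) roots(2) end_N, where z = "sw z"] that by (simp add: f.U_minus_iff g.U_minus_iff)
    show "g.P.\<psi> (h z) / cnj (C * f.P.\<psi> z) \<in> root_group (degree pf)" if "z \<in> f.V" "h z \<in> g.V" for z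
      by (rule SP.psi_conjugacy[OF CD(1) roots(1) end_P that])
    show "g.N.\<psi> (sw (h z)) / cnj (D * f.N.\<psi> (sw z)) \<in> root_group (degree pf)" if "z \<in> Uf" "sw z \<in> f.V" "sw (h z) \<in> g.V" for z
      using SN.psi_conjugacy[OF CD(2) roots(2) end_N, where z = "sw z"] that by simp
  qed
  define t where "t = min \<rho>f (cmod C * q)"
  have t: "0 < t" "t \<le> \<rho>f" using f.rho CD q by (auto simp: t_def)
  have tu: "u \<in> pdisc (cmod C * q)" if "u \<in> pdisc t" for u :: complex using that by (auto simp: t_def)
  have 1: "\<forall>\<^sub>F z in puncture_filter Hf cf. cnj (psi_plus pg ag (h z)) = 1 / (1 / C) * psi_plus pf af z" unfolding f.puncture_filter_iff
  proof (intro exI[of _ t] conjI t ballI)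
    fix u :: complex assume u: "u \<in> pdisc t"
    note e = ends[OF tu[OF u]]
    show "cnj (psi_plus pg ag (h (\<Gamma>f u))) = 1 / (1 / C) * psi_plus pf af (\<Gamma>f u)"
      using f.Gamma_D(5)[of u] g.Gamma_D(5)[of "cnj (u / C)"] e by (simp add: f.psi_plus_eq g.psi_plus_eq)
  qed
  have 2: "\<forall>\<^sub>F z in puncture_filter Hf cf. cnj (psi_minus pg ag \<eta>g (h z)) = 1 / (1 / D) * psi_minus pf af \<eta>f z"
    unfolding f.puncture_filter_iff
  proof (intro exI[of _ t] conjI t ballI)
    fix u :: complex assume u: "u \<in> pdisc t"
    note e = ends[OF tu[OF u]]
    have "g.m (cnj (u / C)) \<noteq> 0" using g.m_nonzero e by simp
    then show "cnj (psi_minus pg ag \<eta>g (h (\<Gamma>f u))) = 1 / (1 / D) * psi_minus pf af \<eta>f (\<Gamma>f u)"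
      using f.Gamma_D(6)[of u] g.Gamma_D(6)[of "cnj (u / C)"] e CD by (simp add: f.psi_minus_eq g.psi_minus_eq)
  qed
  have r: "(1 / X) ^ (degree pf - 1) \<in> root_group (degree pf)" if "X \<noteq> 0" "X ^ degree pf / X \<in> root_group (degree pf)" for X :: complex
  proof -
    have "X ^ degree pf = X * X ^ (degree pf - 1)" using f.P.d_pos(3) by (metis Suc_diff_1 power_Suc)
    then have "inverse (X ^ degree pf / X) = (1 / X) ^ (degree pf - 1)" using that(1) by (simp add: power_one_over field_simps)
    then show ?thesis using root_group_inverse[OF that(2)] by simp
  qed
  show ?thesis using LC.biholomorphism_conj2_h 1 2 CD r[OF CD(1) roots(1)] r[OF CD(2) roots(2)]
    by (intro conjI exI[of _ "1 / C"] exI[of _ "1 / D"]) auto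
qed

end

text \<open>The ends of the critical locus are nondegenerate if \<open>a\<close> avoids the numbers
  \<open>- (1 + d * p(c) / p\<^sub>d\<^sub>-\<^sub>1)\<close>, where \<open>c\<close> runs over the critical points.\<close>
definition end_threshold :: "complex poly \<Rightarrow> real" where
  "end_threshold p = Min (insert (1 / 2) ((\<lambda>c. cmod (1 + of_nat (degree p) * poly p c / coeff p (degree p - 1))) `
     {c. poly (pderiv p) c = 0 \<and> 1 + of_nat (degree p) * poly p c / coeff p (degree p - 1) \<noteq> 0}))"

context
  fixes p :: "complex poly"
  assumes deg: "degree p \<ge> 2"
begin

lemma finite_critical: "finite {c. poly (pderiv p) c = 0 \<and> Q c}"
proof -
  have "pderiv p \<noteq> 0" using deg by (auto simp: pderiv_eq_0_iff)
  then have "finite {c. poly (pderiv p) c = 0}" by (rule poly_roots_finite)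
  then show ?thesis by (rule rev_finite_subset) auto
qed

lemma end_threshold: "0 < end_threshold p" "end_threshold p \<le> 1 / 2"
proof -
  show "0 < end_threshold p" unfolding end_threshold_def using finite_critical by (auto simp: Min_gr_iff)
  show "end_threshold p \<le> 1 / 2" unfolding end_threshold_def by (intro Min_le finite.insertI finite_imageI finite_critical) simp
qed

lemma end_threshold_le:
  assumes "poly (pderiv p) c = 0" "1 + of_nat (degree p) * poly p c / coeff p (degree p - 1) \<noteq> 0"
  shows "end_threshold p \<le> cmod (1 + of_nat (degree p) * poly p c / coeff p (degree p - 1))"
  unfolding end_threshold_def using assms by (intro Min_le finite.insertI finite_imageI finite_critical) auto

end

lemma admissible_henon_end:
  assumes p: "admissible_poly p" and esc: "escape_constants p R r \<alpha>"
    and a: "0 < cmod a" "cmod a < R" "cmod a < end_threshold p" and \<eta>: "\<eta> ^ (degree p - 1) = 1 / a"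
    and H: "primary_component p a \<alpha> c H"
  shows "\<exists>\<rho> \<Gamma> G. henon_end p a \<eta> R r \<alpha> c H \<rho> \<Gamma> G"
proof -
  have deg: "degree p \<ge> 2" and monic: "lead_coeff p = 1" and sc: "simple_critical_points p" using p by (auto simp: admissible_poly_def)
  interpret henon_map p a \<eta> R r \<alpha> by unfold_locales (use deg monic esc a \<eta> end_threshold[OF deg] in auto)
  have c: "poly (pderiv p) c = 0" using H by (simp add: primary_component_def)
  have simple: "poly (pderiv (pderiv p)) c \<noteq> 0"
  proof -
    have o: "order c (pderiv p) = 1" using sc c by (simp add: simple_critical_points_def)
    have nz: "pderiv p \<noteq> 0" using deg by (auto simp: pderiv_eq_0_iff)
    have "pderiv (pderiv p) \<noteq> 0"
    proof
      assume "pderiv (pderiv p) = 0"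
      then have "degree (pderiv p) = 0" by (simp add: pderiv_eq_0_iff)
      then obtain b where "pderiv p = [:b:]" by (metis degree_eq_zeroE)
      then show False using c nz by auto
    qed
    moreover have "order c (pderiv (pderiv p)) = 0" using order_pderiv[OF nz c] o by simp
    ultimately show ?thesis by (simp add: order_root)
  qed
  have nd: "nondegenerate c" unfolding nondegenerate_def
  proof
    assume b: "coeff p (degree p - 1) \<noteq> 0"
    define b where "b = coeff p (degree p - 1)"
    define v where "v = 1 + of_nat (degree p) * poly p c / b"
    have "v + a \<noteq> 0"
    proof (cases "v = 0")
      case False
      then have "cmod a < cmod v" using end_threshold_le[OF deg c] a(3) by (simp add: v_def b_def)
      then show ?thesis by (metis add_eq_0_iff less_irrefl norm_minus_cancel)
    qed (use a in auto)
    moreover have "v + a = (poly p c + (1 + a) * b / of_nat (degree p)) * (of_nat (degree p) / b)"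
      using b P.d_pos(4) by (simp add: v_def b_def field_simps)
    ultimately show "poly p c + (1 + a) * coeff p (degree p - 1) / of_nat (degree p) \<noteq> 0" unfolding b_def by auto
  qed
  show ?thesis using end_chart[OF c simple nd] henon_end.intro[OF _ henon_end_axioms.intro[OF H]] by blast
qed

theorem corollary6p15:
  fixes R r \<alpha> :: "complex poly \<Rightarrow> real"
  assumes constants: "\<And>p. admissible_poly p \<Longrightarrow> escape_constants p (R p) (r p) (\<alpha> p)"
  shows "\<exists>\<epsilon> :: complex poly \<Rightarrow> real.
    (\<forall>p. admissible_poly p \<longrightarrow> 0 < \<epsilon> p \<and> \<epsilon> p \<le> R p) \<and>
    (\<forall>(d::nat) (pf :: complex poly) (pg :: complex poly) (af :: complex) (ag :: complex)
       (\<eta>f :: complex) (\<eta>g :: complex) (h :: complex \<times> complex \<Rightarrow> complex \<times> complex)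
       (cf :: complex) (cg :: complex) (Hf :: (complex \<times> complex) set) (Hg :: (complex \<times> complex) set).
       admissible_poly pf \<and> admissible_poly pg \<and> degree pf = d \<and> degree pg = d \<and>
       0 < cmod af \<and> cmod af < \<epsilon> pf \<and> 0 < cmod ag \<and> cmod ag < \<epsilon> pg \<and>
       \<eta>f ^ (d - 1) = 1 / af \<and> \<eta>g ^ (d - 1) = 1 / ag \<and>
       (\<exists>k. homeomorphism (U_plus pf af \<union> U_minus pf af) (U_plus pg ag \<union> U_minus pg ag) h k) \<and>
       (\<forall>z \<in> U_plus pf af \<union> U_minus pf af. h (henon pf af z) = henon pg ag (h z)) \<and>
       (\<forall>L \<in> leaves_plus pf af (\<alpha> pf). h ` L \<in> leaves_plus pg ag (\<alpha> pg)) \<and>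
       (\<forall>L \<in> leaves_minus pf af (\<alpha> pf). h ` L \<in> leaves_minus pg ag (\<alpha> pg)) \<and>
       primary_component pf af (\<alpha> pf) cf Hf \<and> primary_component pg ag (\<alpha> pg) cg Hg \<and>
       h ` Hf = Hg \<and> orientation_reversing h Hf Hg \<and>
       (\<exists>N0. puncture_nhd Hf cf N0 \<and>
          (\<forall>N \<subseteq> N0. puncture_nhd Hf cf N \<longrightarrow> puncture_nhd Hg cg (h ` N)))
       \<longrightarrow>
       biholomorphism (conj2 \<circ> h) (U_plus pf af \<inter> U_minus pf af)
         (conj2 ` (U_plus pg ag \<inter> U_minus pg ag)) \<and>
       (\<exists>\<beta> \<gamma>. \<beta> \<noteq> 0 \<and> \<gamma> \<noteq> 0 \<and>
          (\<forall>\<^sub>F z in puncture_filter Hf cf. cnj (psi_plus pg ag (h z)) = 1 / \<beta> * psi_plus pf af z) \<and>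
          (\<forall>\<^sub>F z in puncture_filter Hf cf. cnj (psi_minus pg ag \<eta>g (h z)) = 1 / \<gamma> * psi_minus pf af \<eta>f z) \<and>
          \<beta> ^ (d - 1) \<in> {\<omega>. \<exists>n. \<omega> ^ (d ^ n) = 1} \<and>
          \<gamma> ^ (d - 1) \<in> {\<omega>. \<exists>n. \<omega> ^ (d ^ n) = 1}))"
proof (rule exI[of _ "\<lambda>p. min (R p) (end_threshold p)"], (rule conjI; intro allI impI), goal_cases)
  case (1 p)
  then have "degree p \<ge> 2" by (simp add: admissible_poly_def)
  moreover have "0 < R p" using constants[OF 1] by (simp add: escape_constants_def)
  ultimately show ?case using end_threshold(1) by simp
next
  case (2 d pf pg af ag \<eta>f \<eta>g h cf cg Hf Hg)
  then have deg: "degree pf = d" "degree pg = d" by blast+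
  obtain k where k: "homeomorphism (U_plus pf af \<union> U_minus pf af) (U_plus pg ag \<union> U_minus pg ag) h k"
    using 2 by blast
  obtain \<rho>f \<Gamma>f Gf where f: "henon_end pf af \<eta>f (R pf) (r pf) (\<alpha> pf) cf Hf \<rho>f \<Gamma>f Gf"
    using admissible_henon_end[OF _ constants[of pf]] 2 deg by (metis min_less_iff_conj)
  obtain \<rho>g \<Gamma>g Gg where g: "henon_end pg ag \<eta>g (R pg) (r pg) (\<alpha> pg) cg Hg \<rho>g \<Gamma>g Gg"
    using admissible_henon_end[OF _ constants[of pg]] 2 deg by (metis min_less_iff_conj)
  note fg = henon_end_chart.axioms(1)[OF henon_end.axioms(1)[OF f]] henon_end_chart.axioms(1)[OF henon_end.axioms(1)[OF g]]
  have "end_conjugacy pf af \<eta>f (R pf) (r pf) (\<alpha> pf) cf Hf \<rho>f \<Gamma>f Gf pg ag \<eta>g (R pg) (r pg) (\<alpha> pg) cg Hg \<rho>g \<Gamma>g Gg h k"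
    by (intro end_conjugacy.intro henon_conjugacy.intro henon_conjugacy_axioms.intro end_conjugacy_axioms.intro f g k fg)
      (use 2 deg in blast)+
  from end_conjugacy.biholomorphism_and_constants[OF this] show ?case unfolding root_group_def deg .
qed

end
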